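(* Let $\mathbb C$ be a pretopos. The functor $\Sigma \colon \mathsf{PreOrd}(\mathbb C) \to \mathsf{Stab}(\mathbb C)$ is universal among all finite coproduct preserving torsion theory functors $G \colon \mathsf{PreOrd}(\mathbb C) \to \mathbb X$, where $\mathsf{PreOrd}(\mathbb C)$ is equipped with the pretorsion theory $(\mathsf{Eq}(\mathbb C), \mathsf{ParOrd}(\mathbb C))$ and $\mathbb X$ is a pointed category with finite coproducts and with a torsion theory $(\mathcal T,\mathcal F)$. This means that for any such $\mathbb X$, $(\mathcal T,\mathcal F)$ and any finite coproduct preserving torsion theory functor $G \colon \mathsf{PreOrd}(\mathbb C) \to \mathbb X$ there is a unique functor $\overline G \colon \mathsf{Stab}(\mathbb C) \to \mathbb X$ such that $\overline G \circ \Sigma = G$. Moreover, the induced functor $\overline G$ preserves finite coproducts, and is a torsion theory functor (with respect to the torsion theory on $\mathsf{Stab}(\mathbb C)$ given by equivalence relations and partial orders, and $(\mathcal T,\mathcal F)$ on $\mathbb X$).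
   Context: **Pretopos.** A pretopos is a (Barr-)exact category $\mathbb C$ with finite coproducts which is extensive (equivalently, finite coproducts are disjoint and universal). It has a strict initial object $0$. **Preorders.** $\mathsf{PreOrd}(\mathbb C)$ has as objects the internal preorders $(A,\rho)$: $\langle r_1,r_2\rangle\colon\rho\to A\times A$ is a subobject that is reflexive (contains the diagonal $\Delta_A$) and transitive. A morphism $(A,\rho)\to(B,\sigma)$ is a morphism $f\colon A\to B$ in $\mathbb C$ for which there is a (necessarily unique) $\hat f\colon \rho\to\sigma$ with $f r_i=s_i\hat f$, $i=1,2$. One often writes $A$ for $(A,\rho)$. $\mathsf{Eq}(\mathbb C)$ and $\mathsf{ParOrd}(\mathbb C)$ are the full subcategories of equivalence relations ($\rho^\circ=\rho$) and of partial orders ($\rho\cap\rho^\circ=\Delta_A$). $\mathcal Z=\mathsf{Eq}(\mathbb C)\cap\mathsf{ParOrd}(\mathbb C)$ consists of the discrete preorders $(A,\Delta_A)$ (trivial objects); a morphism is trivial if it factors through an object of $\mathcal Z$. **Complemented subobjects.** A subobject $\alpha\colon(A',\rho')\to(A,\rho)$ in $\mathsf{PreOrd}(\mathbb C)$ is complemented if there is a subobject $\alpha^c\colon(A'^c,\rho'^c)\to(A,\rho)$ (its complement) with intersection $0$ and union $(A,\rho)$; equivalently, $\alpha,\alpha^c$ exhibit $A=A'\coprod A'^c$ in $\mathbb C$, $\rho'$ and $\rho'^c$ are the inverse images of $\rho$ along $\alpha$ and $\alpha^c$, and for $i=1,2$ the squares formed by the $i$-th projections of $\rho',\rho,\rho'^c$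 and $\alpha,\alpha^c$ are pullbacks (so $\rho=\rho'\coprod\rho'^c$). These are exactly the coproduct decompositions of $(A,\rho)$ in $\mathsf{PreOrd}(\mathbb C)$. **Stable category.** $\mathsf{PaPreOrd}(\mathbb C)$ has the same objects as $\mathsf{PreOrd}(\mathbb C)$; a morphism $A\to B$ is a pair $(\alpha,f)$ with $\alpha\colon A'\to A$ a complemented subobject (taken up to isomorphism) and $f\colon A'\to B$ a morphism in $\mathsf{PreOrd}(\mathbb C)$. Composition: $(\beta,g)\circ(\alpha,f)=(\alpha\alpha',gf')$, where $\alpha',f'$ are the projections of the pullback of $f$ and $\beta$, with $\alpha'$ the pullback of $\beta$ along $f$ and $f'$ the pullback of $f$ along $\beta$. Two parallel morphisms $(\alpha_1,f_1),(\alpha_2,f_2)\colon A\to B$, with $\alpha_i\colon A_i\to A$, are equivalent, $(\alpha_1,f_1)\sim(\alpha_2,f_2)$, if there are an object $A_0$ and complemented subobjects $\alpha_0\colon A_0\to A$ and $\alpha_0^i\colon A_0\to A_i$ ($i=1,2$) with $\alpha_i\alpha_0^i=\alpha_0$, $f_1\alpha_0^1=f_2\alpha_0^2$, and such that each $f_i$ restricted to the complement of $A_0$ in $A_i$ is a trivial morphism. This is a congruence on $\mathsf{PaPreOrd}(\mathbb C)$, and the stable category $\mathsf{Stab}(\mathbb C)$ is the quotient category. $\langle\alpha,f\rangle$ denotes the class of $(\alpha,f)$. $\Sigma\colon\mathsf{PreOrd}(\mathbb C)\to\mathsf{Stab}(\mathbb C)$ is the identity on objects and sends $f\colon A\to B$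 to $\langle 1_A,f\rangle$. $\mathsf{Stab}(\mathbb C)$ is pointed with zero object $\Sigma(0)$. **(Pre)torsion theories.** Let $(\mathcal T,\mathcal F)$ be a pair of full replete subcategories of a category, $\mathcal Z=\mathcal T\cap\mathcal F$; $\mathcal Z$-trivial morphisms are those factoring through an object of $\mathcal Z$. $\mathcal Z$-kernels, $\mathcal Z$-cokernels and short $\mathcal Z$-exact sequences ($f$ is a $\mathcal Z$-kernel of $g$ and $g$ is a $\mathcal Z$-cokernel of $f$) are defined as usual kernels, cokernels and short exact sequences with zero morphisms replaced by $\mathcal Z$-trivial ones. $(\mathcal T,\mathcal F)$ is a pretorsion theory if every morphism from an object of $\mathcal T$ to an object of $\mathcal F$ is $\mathcal Z$-trivial and every object $X$ has a short $\mathcal Z$-exact sequence $T(X)\to X\to F(X)$ with $T(X)\in\mathcal T$, $F(X)\in\mathcal F$ (the canonical sequence). A torsion theory in a pointed category is a pretorsion theory for which $\mathcal Z$ is the class of zero objects. $(\mathsf{Eq}(\mathbb C),\mathsf{ParOrd}(\mathbb C))$ is a pretorsion theory in $\mathsf{PreOrd}(\mathbb C)$, with canonical sequences $(A,\sim_\rho)\to(A,\rho)\to(A/{\sim_\rho},\pi(\rho))$, where ${\sim_\rho}=\rho\cap\rho^\circ$, the first morphism is the identity on $A$, $\pi\colon A\to A/{\sim_\rho}$ is the quotient and $\pi(\rho)$ the induced partial order. $\mathsf{Stab}(\mathbb C)$ is equipped with the torsion theory given by its full subcategories on the equivalence relations and on the partial orders. **Torsion theory functor.** Given a category $\mathbb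 A$ with a pretorsion theory $(\mathcal T,\mathcal F)$ and a pointed category $\mathbb B$ with a torsion theory $(\mathcal T',\mathcal F')$, a functor $G\colon\mathbb A\to\mathbb B$ is a torsion theory functor if (1) $G(\mathcal T)\subseteq\mathcal T'$ and $G(\mathcal F)\subseteq\mathcal F'$ on objects; (2) for each object $A$ with canonical short $\mathcal Z$-exact sequence $T(A)\to A\to F(A)$, the sequence $0\to G(T(A))\to G(A)\to G(F(A))\to0$ is short exact in $\mathbb B$. *)

theory Defs
  imports Main
begin

section \<open>Categories and functors\<close>

record ('o, 'm) cat =
  Ob :: "'o set"
  Ar :: "'m set"
  Dom :: "'m \<Rightarrow> 'o"
  Cod :: "'m \<Rightarrow> 'o"
  Ident :: "'o \<Rightarrow> 'm"
  Comp :: "'m \<Rightarrow> 'm \<Rightarrow> 'm" (infixl "\<cdot>\<index>" 70)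

text \<open>Composition is in the classical order: \<open>g \<cdot>\<^bsub>C\<^esub> f\<close> is first \<open>f\<close>, then \<open>g\<close>.  The operations
  are only meaningful on objects, arrows and composable pairs.\<close>

definition hom :: "('o, 'm) cat \<Rightarrow> 'o \<Rightarrow> 'o \<Rightarrow> 'm set" where
  "hom C A B = {f \<in> Ar C. Dom C f = A \<and> Cod C f = B}"

locale category =
  fixes C :: "('o, 'm) cat" (structure)
  assumes Dom_Ob: "f \<in> Ar C \<Longrightarrow> Dom C f \<in> Ob C"
    and Cod_Ob: "f \<in> Ar C \<Longrightarrow> Cod C f \<in> Ob C"
    and Ident_hom: "A \<in> Ob C \<Longrightarrow> Ident C A \<in> hom C A A"
    and Comp_hom: "f \<in> hom C X Y \<Longrightarrow> g \<in> hom C Y Z \<Longrightarrow> g \<cdot> f \<in> hom C X Z"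
    and Comp_Ident: "f \<in> hom C X Y \<Longrightarrow> f \<cdot> Ident C X = f"
    and Ident_Comp: "f \<in> hom C X Y \<Longrightarrow> Ident C Y \<cdot> f = f"
    and Comp_assoc: "f \<in> hom C W X \<Longrightarrow> g \<in> hom C X Y \<Longrightarrow> h \<in> hom C Y Z \<Longrightarrow>
                      (h \<cdot> g) \<cdot> f = h \<cdot> (g \<cdot> f)"

record ('o, 'm, 'p, 'n) funct =
  omap :: "'o \<Rightarrow> 'p"
  amap :: "'m \<Rightarrow> 'n"

definition is_functor :: "('o, 'm) cat \<Rightarrow> ('p, 'n) cat \<Rightarrow> ('o, 'm, 'p, 'n) funct \<Rightarrow> bool" where
  "is_functor C D F \<longleftrightarrow> category C \<and> category D \<and>
     (\<forall>A \<in> Ob C. omap F A \<in> Ob D) \<and>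
     (\<forall>f \<in> Ar C. amap F f \<in> hom D (omap F (Dom C f)) (omap F (Cod C f))) \<and>
     (\<forall>A \<in> Ob C. amap F (Ident C A) = Ident D (omap F A)) \<and>
     (\<forall>f \<in> Ar C. \<forall>g \<in> Ar C. Cod C f = Dom C g \<longrightarrow>
        amap F (g \<cdot>\<^bsub>C\<^esub> f) = amap F g \<cdot>\<^bsub>D\<^esub> amap F f)"

definition funct_comp :: "('p, 'n, 'q, 'k) funct \<Rightarrow> ('o, 'm, 'p, 'n) funct \<Rightarrow> ('o, 'm, 'q, 'k) funct" where
  "funct_comp G F = \<lparr>omap = omap G \<circ> omap F, amap = amap G \<circ> amap F\<rparr>"

text \<open>Equality of functors with domain \<open>C\<close>; the values of the underlying HOL functions outside
  \<open>Ob C\<close> and \<open>Ar C\<close> are irrelevant.\<close>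

definition functor_eq :: "('o, 'm) cat \<Rightarrow> ('o, 'm, 'p, 'n) funct \<Rightarrow> ('o, 'm, 'p, 'n) funct \<Rightarrow> bool" where
  "functor_eq C F G \<longleftrightarrow>
     (\<forall>A \<in> Ob C. omap F A = omap G A) \<and> (\<forall>f \<in> Ar C. amap F f = amap G f)"


section \<open>Limits and colimits\<close>

definition is_iso :: "('o, 'm) cat \<Rightarrow> 'm \<Rightarrow> bool" where
  "is_iso C f \<longleftrightarrow> f \<in> Ar C \<and> (\<exists>g \<in> hom C (Cod C f) (Dom C f).
     g \<cdot>\<^bsub>C\<^esub> f = Ident C (Dom C f) \<and> f \<cdot>\<^bsub>C\<^esub> g = Ident C (Cod C f))"

definition is_mono :: "('o, 'm) cat \<Rightarrow> 'm \<Rightarrow> bool" where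
  "is_mono C m \<longleftrightarrow> m \<in> Ar C \<and> (\<forall>X. \<forall>u \<in> hom C X (Dom C m). \<forall>v \<in> hom C X (Dom C m).
     m \<cdot>\<^bsub>C\<^esub> u = m \<cdot>\<^bsub>C\<^esub> v \<longrightarrow> u = v)"

definition is_terminal :: "('o, 'm) cat \<Rightarrow> 'o \<Rightarrow> bool" where
  "is_terminal C T \<longleftrightarrow> T \<in> Ob C \<and> (\<forall>X \<in> Ob C. \<exists>!f. f \<in> hom C X T)"

definition is_initial :: "('o, 'm) cat \<Rightarrow> 'o \<Rightarrow> bool" where
  "is_initial C I \<longleftrightarrow> I \<in> Ob C \<and> (\<forall>X \<in> Ob C. \<exists>!f. f \<in> hom C I X)"

definition zero_objects :: "('o, 'm) cat \<Rightarrow> 'o set" where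
  "zero_objects C = {Z. is_initial C Z \<and> is_terminal C Z}"

definition pointed :: "('o, 'm) cat \<Rightarrow> bool" where
  "pointed C \<longleftrightarrow> zero_objects C \<noteq> {}"

text \<open>\<open>is_pullback C p q f g\<close>: the square with \<open>f \<cdot> p = g \<cdot> q\<close> is a pullback, so \<open>p\<close> is the
  pullback of \<open>g\<close> along \<open>f\<close>.\<close>

definition is_pullback :: "('o, 'm) cat \<Rightarrow> 'm \<Rightarrow> 'm \<Rightarrow> 'm \<Rightarrow> 'm \<Rightarrow> bool" where
  "is_pullback C p q f g \<longleftrightarrow>
     f \<in> Ar C \<and> g \<in> Ar C \<and> Cod C f = Cod C g \<and>
     p \<in> hom C (Dom C p) (Dom C f) \<and> q \<in> hom C (Dom C p) (Dom C g) \<and>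
     f \<cdot>\<^bsub>C\<^esub> p = g \<cdot>\<^bsub>C\<^esub> q \<and>
     (\<forall>X. \<forall>u \<in> hom C X (Dom C f). \<forall>v \<in> hom C X (Dom C g). f \<cdot>\<^bsub>C\<^esub> u = g \<cdot>\<^bsub>C\<^esub> v \<longrightarrow>
        (\<exists>!w. w \<in> hom C X (Dom C p) \<and> p \<cdot>\<^bsub>C\<^esub> w = u \<and> q \<cdot>\<^bsub>C\<^esub> w = v))"

definition is_coproduct :: "('o, 'm) cat \<Rightarrow> 'm \<Rightarrow> 'm \<Rightarrow> bool" where
  "is_coproduct C i j \<longleftrightarrow>
     i \<in> Ar C \<and> j \<in> Ar C \<and> Cod C i = Cod C j \<and>
     (\<forall>Y. \<forall>u \<in> hom C (Dom C i) Y. \<forall>v \<in> hom C (Dom C j) Y.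
        \<exists>!w. w \<in> hom C (Cod C i) Y \<and> w \<cdot>\<^bsub>C\<^esub> i = u \<and> w \<cdot>\<^bsub>C\<^esub> j = v)"

definition is_coequalizer :: "('o, 'm) cat \<Rightarrow> 'm \<Rightarrow> 'm \<Rightarrow> 'm \<Rightarrow> bool" where
  "is_coequalizer C q f g \<longleftrightarrow>
     f \<in> Ar C \<and> g \<in> hom C (Dom C f) (Cod C f) \<and> q \<in> hom C (Cod C f) (Cod C q) \<and>
     q \<cdot>\<^bsub>C\<^esub> f = q \<cdot>\<^bsub>C\<^esub> g \<and>
     (\<forall>Y. \<forall>u \<in> hom C (Cod C f) Y. u \<cdot>\<^bsub>C\<^esub> f = u \<cdot>\<^bsub>C\<^esub> g \<longrightarrow>
        (\<exists>!w. w \<in> hom C (Cod C q) Y \<and> w \<cdot>\<^bsub>C\<^esub> q = u))"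

definition has_finite_limits :: "('o, 'm) cat \<Rightarrow> bool" where
  "has_finite_limits C \<longleftrightarrow> (\<exists>T. is_terminal C T) \<and>
     (\<forall>f \<in> Ar C. \<forall>g \<in> Ar C. Cod C f = Cod C g \<longrightarrow> (\<exists>p q. is_pullback C p q f g))"

definition has_finite_coproducts :: "('o, 'm) cat \<Rightarrow> bool" where
  "has_finite_coproducts C \<longleftrightarrow> (\<exists>I. is_initial C I) \<and>
     (\<forall>A \<in> Ob C. \<forall>B \<in> Ob C. \<exists>i j. is_coproduct C i j \<and> Dom C i = A \<and> Dom C j = B)"

definition preserves_finite_coproducts ::
    "('o, 'm) cat \<Rightarrow> ('p, 'n) cat \<Rightarrow> ('o, 'm, 'p, 'n) funct \<Rightarrow> bool" where
  "preserves_finite_coproducts C D F \<longleftrightarrow>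
     (\<forall>I. is_initial C I \<longrightarrow> is_initial D (omap F I)) \<and>
     (\<forall>i j. is_coproduct C i j \<longrightarrow> is_coproduct D (amap F i) (amap F j))"


section \<open>Internal relations\<close>

text \<open>The relation \<open>\<langle>r\<^sub>1, r\<^sub>2\<rangle> : \<rho> \<rightarrow> A \<times> A\<close> is given by its two jointly monic projections; the
  object \<open>\<rho>\<close> is their common domain.  A subobject of \<open>A \<times> A\<close> is handled through a representative,
  and comparison of subobjects is \<open>rel_le\<close>.\<close>

record ('o, 'm) irel =
  base :: 'o
  pr1 :: 'm
  pr2 :: 'm

definition is_relation :: "('o, 'm) cat \<Rightarrow> ('o, 'm) irel \<Rightarrow> bool" where
  "is_relation C R \<longleftrightarrow> base R \<in> Ob C \<and>
     pr1 R \<in> hom C (Dom C (pr1 R)) (base R) \<and> pr2 R \<in> hom C (Dom C (pr1 R)) (base R) \<and>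
     (\<forall>X. \<forall>u \<in> hom C X (Dom C (pr1 R)). \<forall>v \<in> hom C X (Dom C (pr1 R)).
        pr1 R \<cdot>\<^bsub>C\<^esub> u = pr1 R \<cdot>\<^bsub>C\<^esub> v \<and> pr2 R \<cdot>\<^bsub>C\<^esub> u = pr2 R \<cdot>\<^bsub>C\<^esub> v \<longrightarrow> u = v)"

definition rel_le :: "('o, 'm) cat \<Rightarrow> ('o, 'm) irel \<Rightarrow> ('o, 'm) irel \<Rightarrow> bool" where
  "rel_le C R S \<longleftrightarrow> base R = base S \<and>
     (\<exists>t \<in> hom C (Dom C (pr1 R)) (Dom C (pr1 S)).
        pr1 S \<cdot>\<^bsub>C\<^esub> t = pr1 R \<and> pr2 S \<cdot>\<^bsub>C\<^esub> t = pr2 R)"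

definition rel_diag :: "('o, 'm) cat \<Rightarrow> 'o \<Rightarrow> ('o, 'm) irel" where
  "rel_diag C A = \<lparr>base = A, pr1 = Ident C A, pr2 = Ident C A\<rparr>"

definition rel_conv :: "('o, 'm) irel \<Rightarrow> ('o, 'm) irel" where
  "rel_conv R = \<lparr>base = base R, pr1 = pr2 R, pr2 = pr1 R\<rparr>"

definition rel_reflexive :: "('o, 'm) cat \<Rightarrow> ('o, 'm) irel \<Rightarrow> bool" where
  "rel_reflexive C R \<longleftrightarrow> rel_le C (rel_diag C (base R)) R"

definition rel_symmetric :: "('o, 'm) cat \<Rightarrow> ('o, 'm) irel \<Rightarrow> bool" where
  "rel_symmetric C R \<longleftrightarrow> rel_le C (rel_conv R) R \<and> rel_le C R (rel_conv R)"

definition rel_transitive :: "('o, 'm) cat \<Rightarrow> ('o, 'm) irel \<Rightarrow> bool" where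
  "rel_transitive C R \<longleftrightarrow> (\<forall>p q. is_pullback C p q (pr2 R) (pr1 R) \<longrightarrow>
     (\<exists>t \<in> hom C (Dom C p) (Dom C (pr1 R)).
        pr1 R \<cdot>\<^bsub>C\<^esub> t = pr1 R \<cdot>\<^bsub>C\<^esub> p \<and> pr2 R \<cdot>\<^bsub>C\<^esub> t = pr2 R \<cdot>\<^bsub>C\<^esub> q))"

text \<open>\<open>\<rho> \<inter> \<rho>\<degree> = \<Delta>\<close>, the intersection being the greatest lower bound among subobjects of
  \<open>A \<times> A\<close>.\<close>

definition rel_antisymmetric :: "('o, 'm) cat \<Rightarrow> ('o, 'm) irel \<Rightarrow> bool" where
  "rel_antisymmetric C R \<longleftrightarrow> (\<forall>S. is_relation C S \<longrightarrow>
     (rel_le C S R \<and> rel_le C S (rel_conv R) \<longleftrightarrow> rel_le C S (rel_diag C (base R))))"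

definition is_preorder :: "('o, 'm) cat \<Rightarrow> ('o, 'm) irel \<Rightarrow> bool" where
  "is_preorder C R \<longleftrightarrow> is_relation C R \<and> rel_reflexive C R \<and> rel_transitive C R"

definition Eq_objs :: "('o, 'm) cat \<Rightarrow> ('o, 'm) irel set" where
  "Eq_objs C = {R. is_preorder C R \<and> rel_symmetric C R}"

definition ParOrd_objs :: "('o, 'm) cat \<Rightarrow> ('o, 'm) irel set" where
  "ParOrd_objs C = {R. is_preorder C R \<and> rel_antisymmetric C R}"


section \<open>Pretoposes\<close>

definition is_regular_epi :: "('o, 'm) cat \<Rightarrow> 'm \<Rightarrow> bool" where
  "is_regular_epi C q \<longleftrightarrow> (\<exists>f g. is_coequalizer C q f g)"

definition is_regular_category :: "('o, 'm) cat \<Rightarrow> bool" where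
  "is_regular_category C \<longleftrightarrow> category C \<and> has_finite_limits C \<and>
     (\<forall>f p q. is_pullback C p q f f \<longrightarrow> (\<exists>e. is_coequalizer C e p q)) \<and>
     (\<forall>p q f e. is_pullback C p q f e \<and> is_regular_epi C e \<longrightarrow> is_regular_epi C p)"

definition is_exact_category :: "('o, 'm) cat \<Rightarrow> bool" where
  "is_exact_category C \<longleftrightarrow> is_regular_category C \<and>
     (\<forall>R \<in> Eq_objs C. \<exists>f. is_pullback C (pr1 R) (pr2 R) f f)"

definition is_extensive :: "('o, 'm) cat \<Rightarrow> bool" where
  "is_extensive C \<longleftrightarrow> has_finite_coproducts C \<and>
     (\<forall>i1 i2 x1 x2 f g1 g2. is_coproduct C i1 i2 \<and>
        f \<in> hom C (Dom C f) (Cod C i1) \<and>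
        x1 \<in> hom C (Dom C g1) (Dom C f) \<and> x2 \<in> hom C (Dom C g2) (Dom C f) \<and>
        g1 \<in> hom C (Dom C g1) (Dom C i1) \<and> g2 \<in> hom C (Dom C g2) (Dom C i2) \<and>
        f \<cdot>\<^bsub>C\<^esub> x1 = i1 \<cdot>\<^bsub>C\<^esub> g1 \<and> f \<cdot>\<^bsub>C\<^esub> x2 = i2 \<cdot>\<^bsub>C\<^esub> g2 \<longrightarrow>
        (is_coproduct C x1 x2 \<longleftrightarrow> is_pullback C x1 g1 f i1 \<and> is_pullback C x2 g2 f i2))"

definition pretopos :: "('o, 'm) cat \<Rightarrow> bool" where
  "pretopos C \<longleftrightarrow> is_exact_category C \<and> is_extensive C"


section \<open>Pretorsion theories\<close>

text \<open>A full subcategory is given by its set of objects.\<close>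

definition full_replete :: "('o, 'm) cat \<Rightarrow> 'o set \<Rightarrow> bool" where
  "full_replete C \<T> \<longleftrightarrow> \<T> \<subseteq> Ob C \<and> (\<forall>f. is_iso C f \<and> Dom C f \<in> \<T> \<longrightarrow> Cod C f \<in> \<T>)"

definition is_trivial :: "('o, 'm) cat \<Rightarrow> 'o set \<Rightarrow> 'm \<Rightarrow> bool" where
  "is_trivial C \<Z> f \<longleftrightarrow> f \<in> Ar C \<and>
     (\<exists>Z \<in> \<Z>. \<exists>g \<in> hom C (Dom C f) Z. \<exists>h \<in> hom C Z (Cod C f). f = h \<cdot>\<^bsub>C\<^esub> g)"

definition is_Z_kernel :: "('o, 'm) cat \<Rightarrow> 'o set \<Rightarrow> 'm \<Rightarrow> 'm \<Rightarrow> bool" where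
  "is_Z_kernel C \<Z> k f \<longleftrightarrow>
     f \<in> Ar C \<and> k \<in> hom C (Dom C k) (Dom C f) \<and> is_trivial C \<Z> (f \<cdot>\<^bsub>C\<^esub> k) \<and>
     (\<forall>X. \<forall>u \<in> hom C X (Dom C f). is_trivial C \<Z> (f \<cdot>\<^bsub>C\<^esub> u) \<longrightarrow>
        (\<exists>!w. w \<in> hom C X (Dom C k) \<and> k \<cdot>\<^bsub>C\<^esub> w = u))"

definition is_Z_cokernel :: "('o, 'm) cat \<Rightarrow> 'o set \<Rightarrow> 'm \<Rightarrow> 'm \<Rightarrow> bool" where
  "is_Z_cokernel C \<Z> c f \<longleftrightarrow>
     f \<in> Ar C \<and> c \<in> hom C (Cod C f) (Cod C c) \<and> is_trivial C \<Z> (c \<cdot>\<^bsub>C\<^esub> f) \<and>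
     (\<forall>Y. \<forall>u \<in> hom C (Cod C f) Y. is_trivial C \<Z> (u \<cdot>\<^bsub>C\<^esub> f) \<longrightarrow>
        (\<exists>!w. w \<in> hom C (Cod C c) Y \<and> w \<cdot>\<^bsub>C\<^esub> c = u))"

definition short_Z_exact :: "('o, 'm) cat \<Rightarrow> 'o set \<Rightarrow> 'm \<Rightarrow> 'm \<Rightarrow> bool" where
  "short_Z_exact C \<Z> f g \<longleftrightarrow> is_Z_kernel C \<Z> f g \<and> is_Z_cokernel C \<Z> g f"

text \<open>The short \<open>\<Z>\<close>-exact sequences \<open>T(A) \<rightarrow> A \<rightarrow> F(A)\<close> with \<open>\<Z> = \<T> \<inter> \<F>\<close>; they are determined by
  \<open>A\<close> up to unique isomorphism.\<close>

definition canonical_seq :: "('o, 'm) cat \<Rightarrow> 'o set \<Rightarrow> 'o set \<Rightarrow> 'o \<Rightarrow> 'm \<Rightarrow> 'm \<Rightarrow> bool" where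
  "canonical_seq C \<T> \<F> A k c \<longleftrightarrow>
     short_Z_exact C (\<T> \<inter> \<F>) k c \<and> Cod C k = A \<and> Dom C k \<in> \<T> \<and> Cod C c \<in> \<F>"

definition pretorsion_theory :: "('o, 'm) cat \<Rightarrow> 'o set \<Rightarrow> 'o set \<Rightarrow> bool" where
  "pretorsion_theory C \<T> \<F> \<longleftrightarrow> category C \<and> full_replete C \<T> \<and> full_replete C \<F> \<and>
     (\<forall>T \<in> \<T>. \<forall>F \<in> \<F>. \<forall>f \<in> hom C T F. is_trivial C (\<T> \<inter> \<F>) f) \<and>
     (\<forall>A \<in> Ob C. \<exists>k c. canonical_seq C \<T> \<F> A k c)"

definition torsion_theory :: "('o, 'm) cat \<Rightarrow> 'o set \<Rightarrow> 'o set \<Rightarrow> bool" where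
  "torsion_theory C \<T> \<F> \<longleftrightarrow> pointed C \<and> pretorsion_theory C \<T> \<F> \<and> \<T> \<inter> \<F> = zero_objects C"

definition torsion_theory_functor ::
    "('o, 'm) cat \<Rightarrow> 'o set \<Rightarrow> 'o set \<Rightarrow> ('p, 'n) cat \<Rightarrow> 'p set \<Rightarrow> 'p set \<Rightarrow>
     ('o, 'm, 'p, 'n) funct \<Rightarrow> bool" where
  "torsion_theory_functor \<A> \<T> \<F> \<B> \<T>' \<F>' G \<longleftrightarrow> is_functor \<A> \<B> G \<and>
     omap G ` \<T> \<subseteq> \<T>' \<and> omap G ` \<F> \<subseteq> \<F>' \<and>
     (\<forall>A \<in> Ob \<A>. \<forall>k c. canonical_seq \<A> \<T> \<F> A k c \<longrightarrow>
        short_Z_exact \<B> (zero_objects \<B>) (amap G k) (amap G c))"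


section \<open>Internal preorders\<close>

text \<open>An arrow carries its domain and codomain.\<close>

type_synonym ('o, 'm) preord_arr = "('o, 'm) irel \<times> 'm \<times> ('o, 'm) irel"

definition is_monotone :: "('o, 'm) cat \<Rightarrow> ('o, 'm) irel \<Rightarrow> ('o, 'm) irel \<Rightarrow> 'm \<Rightarrow> bool" where
  "is_monotone C R S f \<longleftrightarrow> f \<in> hom C (base R) (base S) \<and>
     (\<exists>f' \<in> hom C (Dom C (pr1 R)) (Dom C (pr1 S)).
        f \<cdot>\<^bsub>C\<^esub> pr1 R = pr1 S \<cdot>\<^bsub>C\<^esub> f' \<and> f \<cdot>\<^bsub>C\<^esub> pr2 R = pr2 S \<cdot>\<^bsub>C\<^esub> f')"

definition PreOrd :: "('o, 'm) cat \<Rightarrow> (('o, 'm) irel, ('o, 'm) preord_arr) cat" where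
  "PreOrd C = \<lparr>
     Ob = {R. is_preorder C R},
     Ar = {(R, f, S). is_preorder C R \<and> is_preorder C S \<and> is_monotone C R S f},
     Dom = (\<lambda>(R, f, S). R),
     Cod = (\<lambda>(R, f, S). S),
     Ident = (\<lambda>R. (R, Ident C (base R), R)),
     Comp = (\<lambda>(S', g, T) (R, f, S). (R, g \<cdot>\<^bsub>C\<^esub> f, T))\<rparr>"


section \<open>The stable category\<close>

text \<open>\<open>a\<close> and \<open>b\<close> are complementary subobjects: their intersection is \<open>0\<close>, and their union is the
  whole object, i.e. the only subobject containing both is the greatest one.\<close>

definition is_complement :: "('o, 'm) cat \<Rightarrow> 'm \<Rightarrow> 'm \<Rightarrow> bool" where
  "is_complement D a b \<longleftrightarrow> is_mono D a \<and> is_mono D b \<and> Cod D a = Cod D b \<and>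
     (\<exists>p q. is_pullback D p q a b \<and> is_initial D (Dom D p)) \<and>
     (\<forall>m. is_mono D m \<and> Cod D m = Cod D a \<and>
        (\<exists>u \<in> hom D (Dom D a) (Dom D m). m \<cdot>\<^bsub>D\<^esub> u = a) \<and>
        (\<exists>v \<in> hom D (Dom D b) (Dom D m). m \<cdot>\<^bsub>D\<^esub> v = b) \<longrightarrow> is_iso D m)"

definition is_complemented :: "('o, 'm) cat \<Rightarrow> 'm \<Rightarrow> bool" where
  "is_complemented D a \<longleftrightarrow> (\<exists>b. is_complement D a b)"

definition partial_pairs :: "('o, 'm) cat \<Rightarrow> ('m \<times> 'm) set" where
  "partial_pairs D = {(a, f). is_complemented D a \<and> f \<in> Ar D \<and> Dom D a = Dom D f}"

definition partial_iso :: "('o, 'm) cat \<Rightarrow> (('m \<times> 'm) \<times> ('m \<times> 'm)) set" where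
  "partial_iso D = {((a, f), (b, g)). (a, f) \<in> partial_pairs D \<and> (b, g) \<in> partial_pairs D \<and>
     (\<exists>i \<in> hom D (Dom D a) (Dom D b). is_iso D i \<and> b \<cdot>\<^bsub>D\<^esub> i = a \<and> g \<cdot>\<^bsub>D\<^esub> i = f)}"

text \<open>An arrow of the category of partial morphisms is an isomorphism class of pairs.  The
  composition collects the composites of all representatives over all choices of the pullback,
  which together make up one isomorphism class.\<close>

definition Partial :: "('o, 'm) cat \<Rightarrow> ('o, ('m \<times> 'm) set) cat" where
  "Partial D = \<lparr>
     Ob = Ob D,
     Ar = partial_pairs D // partial_iso D,
     Dom = (\<lambda>P. the_elem ((\<lambda>(a, f). Cod D a) ` P)),
     Cod = (\<lambda>P. the_elem ((\<lambda>(a, f). Cod D f) ` P)),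
     Ident = (\<lambda>A. partial_iso D `` {(Ident D A, Ident D A)}),
     Comp = (\<lambda>Q P. {(a \<cdot>\<^bsub>D\<^esub> a', g \<cdot>\<^bsub>D\<^esub> f') | a f b g a' f'.
               (a, f) \<in> P \<and> (b, g) \<in> Q \<and> is_pullback D a' f' f b})\<rparr>"

definition PaPreOrd ::
    "('o, 'm) cat \<Rightarrow> (('o, 'm) irel, (('o, 'm) preord_arr \<times> ('o, 'm) preord_arr) set) cat" where
  "PaPreOrd C = Partial (PreOrd C)"

definition pair_sim :: "('o, 'm) cat \<Rightarrow> 'o set \<Rightarrow> 'm \<times> 'm \<Rightarrow> 'm \<times> 'm \<Rightarrow> bool" where
  "pair_sim D \<Z> = (\<lambda>(a1, f1) (a2, f2). \<exists>a0 b1 b2 c1 c2.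
     is_complemented D a0 \<and>
     b1 \<in> hom D (Dom D a0) (Dom D a1) \<and> b2 \<in> hom D (Dom D a0) (Dom D a2) \<and>
     a1 \<cdot>\<^bsub>D\<^esub> b1 = a0 \<and> a2 \<cdot>\<^bsub>D\<^esub> b2 = a0 \<and> f1 \<cdot>\<^bsub>D\<^esub> b1 = f2 \<cdot>\<^bsub>D\<^esub> b2 \<and>
     is_complement D b1 c1 \<and> is_trivial D \<Z> (f1 \<cdot>\<^bsub>D\<^esub> c1) \<and>
     is_complement D b2 c2 \<and> is_trivial D \<Z> (f2 \<cdot>\<^bsub>D\<^esub> c2))"

definition stab_cong ::
    "('o, 'm) cat \<Rightarrow>
     ((('o, 'm) preord_arr \<times> ('o, 'm) preord_arr) set \<times>
      (('o, 'm) preord_arr \<times> ('o, 'm) preord_arr) set) set" where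
  "stab_cong C = {(P, Q). P \<in> Ar (PaPreOrd C) \<and> Q \<in> Ar (PaPreOrd C) \<and>
     Dom (PaPreOrd C) P = Dom (PaPreOrd C) Q \<and> Cod (PaPreOrd C) P = Cod (PaPreOrd C) Q \<and>
     (\<exists>p \<in> P. \<exists>q \<in> Q. pair_sim (PreOrd C) (Eq_objs C \<inter> ParOrd_objs C) p q)}"

definition quotient_cat :: "('o, 'm) cat \<Rightarrow> ('m \<times> 'm) set \<Rightarrow> ('o, 'm set) cat" where
  "quotient_cat C r = \<lparr>
     Ob = Ob C,
     Ar = Ar C // r,
     Dom = (\<lambda>K. the_elem (Dom C ` K)),
     Cod = (\<lambda>K. the_elem (Cod C ` K)),
     Ident = (\<lambda>A. r `` {Ident C A}),
     Comp = (\<lambda>L K. r `` {g \<cdot>\<^bsub>C\<^esub> f | f g. f \<in> K \<and> g \<in> L})\<rparr>"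

type_synonym ('o, 'm) stab_arr = "(('o, 'm) preord_arr \<times> ('o, 'm) preord_arr) set set"

definition Stab :: "('o, 'm) cat \<Rightarrow> (('o, 'm) irel, ('o, 'm) stab_arr) cat" where
  "Stab C = quotient_cat (PaPreOrd C) (stab_cong C)"

definition stab_class ::
    "('o, 'm) cat \<Rightarrow> ('o, 'm) preord_arr \<Rightarrow> ('o, 'm) preord_arr \<Rightarrow> ('o, 'm) stab_arr" where
  "stab_class C a f = stab_cong C `` {partial_iso (PreOrd C) `` {(a, f)}}"

definition stab_functor ::
    "('o, 'm) cat \<Rightarrow>
     (('o, 'm) irel, ('o, 'm) preord_arr, ('o, 'm) irel, ('o, 'm) stab_arr) funct" where
  "stab_functor C = \<lparr>
     omap = (\<lambda>A. A),
     amap = (\<lambda>f. stab_class C (Ident (PreOrd C) (Dom (PreOrd C) f)) f)\<rparr>"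

end

theory Submission
  imports Defs
begin

text \<open>
  The category \<open>\<D>\<close> of internal preorders is itself extensive with pullbacks, so its complemented
  subobjects are exactly its coproduct injections, and the stable category can be built from \<open>\<D>\<close> and the
  ideal of trivial morphisms alone.  Two partial morphisms out of \<open>A\<close> are equivalent iff \<open>A\<close> is a coproduct of
  two pieces such that both are defined and equal on the first piece and both are trivial wherever they are defined
  on the second; in this form transitivity, compatibility with composition and the uniqueness statements are
  arguments by cutting \<open>A\<close> into pieces.

  The short exact sequences of \<open>\<D>\<close> stay exact in the stable category because canonical sequences are
  compatible with coproduct decompositions.  For a functor \<open>G\<close> into \<open>X\<close> the value of the induced functor at
  the class of \<open>(a, f)\<close> is forced: on the coproduct \<open>G A\<close> it is \<open>G f\<close> on the domain of \<open>a\<close> and zero on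
  its complement.
\<close>

section \<open>Categories\<close>

text \<open>An equation in the quotient category says nothing about single representatives: it only
  yields a cutting of the source on which they agree or vanish. So the real difficulty is to move
  cuttings along arrows. Backwards along an arrow this is extensivity. Forwards, from A to its
  torsion-free reflection F(A), it works because the sum of the canonical sequences of the pieces is
  again a canonical sequence of A; this is where closure of both classes under coproducts comes in,
  while complemented subobjects and retracts enter because an arrow of the stable category lives on
  a piece of its source only. For internal preorders everything is phrased with generalised
  elements. Ordinary arguments on elements then survive with two translations: a case distinction
  becomes a cutting of the domain of the element, and the choice of a preimage becomes passage to a
  regular epimorphism, undone at the end because relations descend along those. Exactness enters in
  the quotient of a preorder by its symmetric part, the source of the canonical sequences.\<close>

lemma in_hom [simp]: "f \<in> hom C A B \<longleftrightarrow> f \<in> Ar C \<and> Dom C f = A \<and> Cod C f = B"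
  by (auto simp: hom_def)

context category
begin

lemma comp_arr [simp]:
  assumes "f \<in> Ar C" "g \<in> Ar C" "Cod C f = Dom C g"
  shows "g \<cdot> f \<in> Ar C" "Dom C (g \<cdot> f) = Dom C f" "Cod C (g \<cdot> f) = Cod C g"
  using Comp_hom[of f "Dom C f" "Dom C g" g "Cod C g"] assms by auto

lemma ident_arr [simp]:
  assumes "A \<in> Ob C"
  shows "Ident C A \<in> Ar C" "Dom C (Ident C A) = A" "Cod C (Ident C A) = A"
  using Ident_hom[OF assms] by auto

lemma dom_cod_Ob [simp]: "f \<in> Ar C \<Longrightarrow> Dom C f \<in> Ob C" "f \<in> Ar C \<Longrightarrow> Cod C f \<in> Ob C"
  by (auto intro: Dom_Ob Cod_Ob)

lemma comp_ident [simp]: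
  "f \<in> Ar C \<Longrightarrow> Dom C f = A \<Longrightarrow> f \<cdot> Ident C A = f"
  "f \<in> Ar C \<Longrightarrow> Cod C f = A \<Longrightarrow> Ident C A \<cdot> f = f"
  using Comp_Ident[of f "Dom C f" "Cod C f"] Ident_Comp[of f "Dom C f" "Cod C f"] by auto

lemma comp_assoc [simp]:
  assumes "f \<in> Ar C" "g \<in> Ar C" "h \<in> Ar C" "Cod C f = Dom C g" "Cod C g = Dom C h"
  shows "(h \<cdot> g) \<cdot> f = h \<cdot> (g \<cdot> f)"
  using Comp_assoc[of f "Dom C f" "Dom C g" g "Dom C h" h "Cod C h"] assms by auto

text \<open>Composites are kept bracketed to the right; the next two rules turn an equation between composites into one
  that also applies inside a longer composite.\<close>

lemma comp_tri:
  assumes "g \<cdot> f = k" "f \<in> Ar C" "g \<in> Ar C" "x \<in> Ar C" "Cod C f = Dom C g" "Cod C x = Dom C f"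
  shows "g \<cdot> (f \<cdot> x) = k \<cdot> x"
  using comp_assoc[of x f g] assms by auto

lemma comp_square:
  assumes "g \<cdot> f = g' \<cdot> f'" "f \<in> Ar C" "g \<in> Ar C" "f' \<in> Ar C" "g' \<in> Ar C" "x \<in> Ar C"
    "Cod C f = Dom C g" "Cod C f' = Dom C g'" "Cod C x = Dom C f" "Cod C x = Dom C f'"
  shows "g \<cdot> (f \<cdot> x) = g' \<cdot> (f' \<cdot> x)"
  using comp_assoc[of x f g] comp_assoc[of x f' g'] assms by auto

section \<open>Monomorphisms and isomorphisms\<close>

lemma monoD:
  assumes "is_mono C m" "u \<in> Ar C" "v \<in> Ar C" "Cod C u = Dom C m" "Cod C v = Dom C m"
    "Dom C u = Dom C v" "m \<cdot> u = m \<cdot> v"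
  shows "u = v"
  using assms unfolding is_mono_def by auto

lemma mono_arr: "is_mono C m \<Longrightarrow> m \<in> Ar C"
  by (simp add: is_mono_def)

lemma monoI:
  assumes "m \<in> Ar C"
    and "\<And>u v. u \<in> Ar C \<Longrightarrow> v \<in> Ar C \<Longrightarrow> Cod C u = Dom C m \<Longrightarrow> Cod C v = Dom C m \<Longrightarrow>
      Dom C u = Dom C v \<Longrightarrow> m \<cdot> u = m \<cdot> v \<Longrightarrow> u = v"
  shows "is_mono C m"
  using assms unfolding is_mono_def by auto

lemma isoI:
  assumes "f \<in> Ar C" "g \<in> Ar C" "Dom C g = Cod C f" "Cod C g = Dom C f"
    "g \<cdot> f = Ident C (Dom C f)" "f \<cdot> g = Ident C (Cod C f)"
  shows "is_iso C f"
  using assms unfolding is_iso_def by auto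

lemma isoE:
  assumes "is_iso C f"
  obtains g where "f \<in> Ar C" "g \<in> Ar C" "Dom C g = Cod C f" "Cod C g = Dom C f"
    "g \<cdot> f = Ident C (Dom C f)" "f \<cdot> g = Ident C (Cod C f)" "is_iso C g"
proof -
  obtain g where g: "f \<in> Ar C" "g \<in> Ar C" "Dom C g = Cod C f" "Cod C g = Dom C f"
    "g \<cdot> f = Ident C (Dom C f)" "f \<cdot> g = Ident C (Cod C f)"
    using assms unfolding is_iso_def by auto
  then have "is_iso C g" by (intro isoI[of g f]) auto
  with g that show thesis by blast
qed

lemma iso_arr: "is_iso C f \<Longrightarrow> f \<in> Ar C"
  by (simp add: is_iso_def)

lemma iso_ident [simp]: "A \<in> Ob C \<Longrightarrow> is_iso C (Ident C A)"
  by (rule isoI[where g = "Ident C A"]) auto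

lemma iso_comp:
  assumes "is_iso C f" "is_iso C g" "Cod C f = Dom C g"
  shows "is_iso C (g \<cdot> f)"
proof -
  obtain f' where f' [simp]: "f \<in> Ar C" "f' \<in> Ar C" "Dom C f' = Cod C f" "Cod C f' = Dom C f"
    "f' \<cdot> f = Ident C (Dom C f)" "f \<cdot> f' = Ident C (Cod C f)" by (rule isoE[OF assms(1)])
  obtain g' where g' [simp]: "g \<in> Ar C" "g' \<in> Ar C" "Dom C g' = Cod C g" "Cod C g' = Dom C g"
    "g' \<cdot> g = Ident C (Dom C g)" "g \<cdot> g' = Ident C (Cod C g)" by (rule isoE[OF assms(2)])
  note [simp] = assms(3) comp_tri[OF f'(5)] comp_tri[OF f'(6)] comp_tri[OF g'(5)] comp_tri[OF g'(6)]
  show ?thesis by (rule isoI[where g = "f' \<cdot> g'"]) auto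
qed

lemma iso_mono:
  assumes "is_iso C f"
  shows "is_mono C f"
proof -
  obtain f' where f' [simp]: "f \<in> Ar C" "f' \<in> Ar C" "Dom C f' = Cod C f" "Cod C f' = Dom C f"
    "f' \<cdot> f = Ident C (Dom C f)" "f \<cdot> f' = Ident C (Cod C f)" by (rule isoE[OF assms])
  show ?thesis
  proof (rule monoI)
    fix u v assume uv: "u \<in> Ar C" "v \<in> Ar C" "Cod C u = Dom C f" "Cod C v = Dom C f"
      "Dom C u = Dom C v" "f \<cdot> u = f \<cdot> v"
    have "u = f' \<cdot> (f \<cdot> u)" using uv(1-5) by (simp add: comp_tri[OF f'(5)])
    also have "\<dots> = f' \<cdot> (f \<cdot> v)" using uv(6) by simp
    also have "\<dots> = v" using uv(1-5) by (simp add: comp_tri[OF f'(5)])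
    finally show "u = v" .
  qed simp
qed

text \<open>Cancelling \<open>m\<close> on the left of \<open>m \<cdot> (s \<cdot> m) = m\<close>
  makes the section a two-sided inverse. Serves to turn the union condition on complements into an
  isomorphism.\<close>

lemma mono_iso_section:
  assumes "is_mono C m" "s \<in> Ar C" "Dom C s = Cod C m" "Cod C s = Dom C m" "m \<cdot> s = Ident C (Cod C m)"
  shows "is_iso C m"
proof -
  note [simp] = mono_arr[OF assms(1)] assms(2-4)
  have "s \<cdot> m = Ident C (Dom C m)"
    by (rule monoD[OF assms(1)]) (simp_all add: comp_tri[OF assms(5)])
  then show ?thesis by (rule isoI[OF mono_arr[OF assms(1)] assms(2-4) _ assms(5)])
qed

section \<open>Initial objects\<close>

lemma initialI:
  assumes "I \<in> Ob C"
    and "\<And>X. X \<in> Ob C \<Longrightarrow> \<exists>f \<in> Ar C. Dom C f = I \<and> Cod C f = X"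
    and uniq: "\<And>f g. f \<in> Ar C \<Longrightarrow> g \<in> Ar C \<Longrightarrow> Dom C f = I \<Longrightarrow> Dom C g = I \<Longrightarrow> Cod C f = Cod C g \<Longrightarrow> f = g"
  shows "is_initial C I"
  unfolding is_initial_def
proof (intro conjI ballI)
  fix X assume "X \<in> Ob C"
  then obtain f where f: "f \<in> Ar C" "Dom C f = I" "Cod C f = X" using assms(2) by blast
  show "\<exists>!f. f \<in> hom C I X"
  proof (rule ex1I[of _ f])
    fix g assume "g \<in> hom C I X"
    then show "g = f" using uniq[of g f] f by simp
  qed (use f in simp)
qed (rule assms(1))

lemma initialE:
  assumes "is_initial C I" "X \<in> Ob C"
  obtains f where "f \<in> Ar C" "Dom C f = I" "Cod C f = X"
  using assms unfolding is_initial_def by auto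

lemma initial_unique:
  assumes "is_initial C I" "f \<in> Ar C" "g \<in> Ar C" "Dom C f = I" "Dom C g = I" "Cod C f = Cod C g"
  shows "f = g"
proof -
  have "\<exists>!h. h \<in> hom C I (Cod C f)" using assms unfolding is_initial_def by auto
  moreover have "f \<in> hom C I (Cod C f)" "g \<in> hom C I (Cod C f)" using assms by auto
  ultimately show ?thesis by blast
qed

lemma initial_iso:
  assumes "is_initial C I" "is_iso C f" "Dom C f = I"
  shows "is_initial C (Cod C f)"
proof -
  obtain f' where f' [simp]: "f \<in> Ar C" "f' \<in> Ar C" "Dom C f' = Cod C f" "Cod C f' = Dom C f"
    "f' \<cdot> f = Ident C (Dom C f)" "f \<cdot> f' = Ident C (Cod C f)" by (rule isoE[OF assms(2)])
  show ?thesis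
  proof (rule initialI)
    fix X assume X: "X \<in> Ob C"
    obtain u where u: "u \<in> Ar C" "Dom C u = I" "Cod C u = X"
      using initialE[OF assms(1) X] .
    show "\<exists>h \<in> Ar C. Dom C h = Cod C f \<and> Cod C h = X"
      by (rule bexI[of _ "u \<cdot> f'"]) (simp_all add: u assms(3))
  next
    fix g h assume gh: "g \<in> Ar C" "h \<in> Ar C" "Dom C g = Cod C f" "Dom C h = Cod C f" "Cod C g = Cod C h"
    have "g \<cdot> f = h \<cdot> f"
      by (rule initial_unique[OF assms(1)]) (simp_all add: assms(3) gh)
    then have "(g \<cdot> f) \<cdot> f' = (h \<cdot> f) \<cdot> f'" by simp
    then show "g = h" using gh by simp
  qed simp
qed

lemma initial_isomorphic:
  assumes "is_initial C I" "is_initial C J"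
  obtains f where "is_iso C f" "Dom C f = I" "Cod C f = J"
proof -
  have [simp]: "I \<in> Ob C" "J \<in> Ob C" using assms by (auto simp: is_initial_def)
  obtain f where f: "f \<in> Ar C" "Dom C f = I" "Cod C f = J"
    by (rule initialE[OF assms(1), of J]) auto
  obtain g where g: "g \<in> Ar C" "Dom C g = J" "Cod C g = I"
    by (rule initialE[OF assms(2), of I]) auto
  have "g \<cdot> f = Ident C I" by (rule initial_unique[OF assms(1)]) (simp_all add: f g)
  moreover have "f \<cdot> g = Ident C J" by (rule initial_unique[OF assms(2)]) (simp_all add: f g)
  ultimately have "is_iso C f" using f g by (auto intro!: isoI[of f g])
  with that f show thesis by blast
qed

section \<open>Binary coproducts, given by their two injections\<close>

lemma coproductD:
  assumes "is_coproduct C i j"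
  shows "i \<in> Ar C" "j \<in> Ar C" "Cod C j = Cod C i"
  using assms unfolding is_coproduct_def by (elim conjE; simp)+

lemma copair_ex1:
  assumes "is_coproduct C i j" "u \<in> Ar C" "v \<in> Ar C" "Dom C u = Dom C i" "Dom C v = Dom C j"
    "Cod C v = Cod C u"
  shows "\<exists>!w. w \<in> hom C (Cod C i) (Cod C u) \<and> w \<cdot> i = u \<and> w \<cdot> j = v"
proof -
  have A: "\<forall>Y. \<forall>u \<in> hom C (Dom C i) Y. \<forall>v \<in> hom C (Dom C j) Y.
        \<exists>!w. w \<in> hom C (Cod C i) Y \<and> w \<cdot> i = u \<and> w \<cdot> j = v"
    using assms(1) unfolding is_coproduct_def by (elim conjE) assumption
  have "u \<in> hom C (Dom C i) (Cod C u)" "v \<in> hom C (Dom C j) (Cod C u)"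
    using assms(2-6) by auto
  from A[rule_format, OF this] show ?thesis .
qed

lemma copairE:
  assumes "is_coproduct C i j" "u \<in> Ar C" "v \<in> Ar C" "Dom C u = Dom C i" "Dom C v = Dom C j"
    "Cod C v = Cod C u"
  obtains w where "w \<in> Ar C" "Dom C w = Cod C i" "Cod C w = Cod C u" "w \<cdot> i = u" "w \<cdot> j = v"
  using ex1_implies_ex[OF copair_ex1[OF assms]] that by auto

lemma coproduct_eqI:
  assumes "is_coproduct C i j" "f \<in> Ar C" "g \<in> Ar C" "Dom C f = Cod C i" "Dom C g = Cod C i"
    "Cod C f = Cod C g" "f \<cdot> i = g \<cdot> i" "f \<cdot> j = g \<cdot> j"
  shows "f = g"
proof -
  note [simp] = coproductD[OF assms(1)] assms(2-6)
  have "\<exists>!w. w \<in> hom C (Cod C i) (Cod C (g \<cdot> i)) \<and> w \<cdot> i = g \<cdot> i \<and> w \<cdot> j = g \<cdot> j"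
    by (rule copair_ex1[OF assms(1)]) simp_all
  moreover have "f \<in> hom C (Cod C i) (Cod C (g \<cdot> i))" "g \<in> hom C (Cod C i) (Cod C (g \<cdot> i))"
    by simp_all
  ultimately show ?thesis using assms(7,8) by blast
qed

lemma coproductI:
  assumes "i \<in> Ar C" "j \<in> Ar C" "Cod C j = Cod C i"
    and ex: "\<And>u v. u \<in> Ar C \<Longrightarrow> v \<in> Ar C \<Longrightarrow> Dom C u = Dom C i \<Longrightarrow> Dom C v = Dom C j \<Longrightarrow>
      Cod C v = Cod C u \<Longrightarrow> \<exists>w \<in> Ar C. Dom C w = Cod C i \<and> Cod C w = Cod C u \<and> w \<cdot> i = u \<and> w \<cdot> j = v"
    and uniq: "\<And>f g. f \<in> Ar C \<Longrightarrow> g \<in> Ar C \<Longrightarrow> Dom C f = Cod C i \<Longrightarrow> Dom C g = Cod C i \<Longrightarrow>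
      Cod C f = Cod C g \<Longrightarrow> f \<cdot> i = g \<cdot> i \<Longrightarrow> f \<cdot> j = g \<cdot> j \<Longrightarrow> f = g"
  shows "is_coproduct C i j"
  unfolding is_coproduct_def
proof (intro conjI allI ballI)
  fix Y u v assume uv: "u \<in> hom C (Dom C i) Y" "v \<in> hom C (Dom C j) Y"
  then obtain w where w: "w \<in> Ar C" "Dom C w = Cod C i" "Cod C w = Cod C u" "w \<cdot> i = u" "w \<cdot> j = v"
    using ex[of u v] by auto
  show "\<exists>!w. w \<in> hom C (Cod C i) Y \<and> w \<cdot> i = u \<and> w \<cdot> j = v"
  proof (rule ex1I[of _ w])
    fix w' assume "w' \<in> hom C (Cod C i) Y \<and> w' \<cdot> i = u \<and> w' \<cdot> j = v"
    then have w': "w' \<in> Ar C" "Dom C w' = Cod C i" "Cod C w' = Y" "w' \<cdot> i = u" "w' \<cdot> j = v"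
      by simp_all
    show "w' = w" by (rule uniq) (use w w' uv in simp_all)
  qed (use w uv in auto)
qed (use assms in auto)

lemma coproduct_sym: "is_coproduct C i j \<Longrightarrow> is_coproduct C j i"
proof (rule coproductI)
  assume *: "is_coproduct C i j"
  note [simp] = coproductD[OF *]
  show "j \<in> Ar C" "i \<in> Ar C" "Cod C i = Cod C j" by auto
  show "\<exists>w\<in>Ar C. Dom C w = Cod C j \<and> Cod C w = Cod C u \<and> w \<cdot> j = u \<and> w \<cdot> i = v"
    if "u \<in> Ar C" "v \<in> Ar C" "Dom C u = Dom C j" "Dom C v = Dom C i" "Cod C v = Cod C u" for u v
    using copairE[OF * that(2) that(1)] that by (metis coproductD(3)[OF *])
  show "f = g" if "f \<in> Ar C" "g \<in> Ar C" "Dom C f = Cod C j" "Dom C g = Cod C j"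
      "Cod C f = Cod C g" "f \<cdot> j = g \<cdot> j" "f \<cdot> i = g \<cdot> i" for f g
    by (rule coproduct_eqI[OF *]) (use that in auto)
qed

lemma coproduct_iso:
  assumes cop: "is_coproduct C i j" and k: "is_iso C k" "Dom C k = Cod C i"
  shows "is_coproduct C (k \<cdot> i) (k \<cdot> j)"
proof -
  obtain k' where k' [simp]: "k \<in> Ar C" "k' \<in> Ar C" "Dom C k' = Cod C k" "Cod C k' = Dom C k"
    "k' \<cdot> k = Ident C (Dom C k)" "k \<cdot> k' = Ident C (Cod C k)" by (rule isoE[OF k(1)])
  note [simp] = coproductD[OF cop] k(2) comp_tri[OF k'(5)]
  show ?thesis
  proof (rule coproductI)
    fix u v assume uv: "u \<in> Ar C" "v \<in> Ar C" "Dom C u = Dom C (k \<cdot> i)" "Dom C v = Dom C (k \<cdot> j)"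
      "Cod C v = Cod C u"
    obtain w where w: "w \<in> Ar C" "Dom C w = Cod C i" "Cod C w = Cod C u" "w \<cdot> i = u" "w \<cdot> j = v"
      using copairE[OF cop, of u v] uv by auto
    then show "\<exists>w\<in>Ar C. Dom C w = Cod C (k \<cdot> i) \<and> Cod C w = Cod C u \<and> w \<cdot> (k \<cdot> i) = u \<and> w \<cdot> (k \<cdot> j) = v"
      by (intro bexI[of _ "w \<cdot> k'"]) auto
  next
    fix f g assume fg: "f \<in> Ar C" "g \<in> Ar C" "Dom C f = Cod C (k \<cdot> i)" "Dom C g = Cod C (k \<cdot> i)"
      "Cod C f = Cod C g" "f \<cdot> (k \<cdot> i) = g \<cdot> (k \<cdot> i)" "f \<cdot> (k \<cdot> j) = g \<cdot> (k \<cdot> j)"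
    have "f \<cdot> k = g \<cdot> k" by (rule coproduct_eqI[OF cop]) (use fg in auto)
    then have "(f \<cdot> k) \<cdot> k' = (g \<cdot> k) \<cdot> k'" by simp
    then show "f = g" using fg by simp
  qed auto
qed

lemma coproduct_unique:
  assumes c1: "is_coproduct C i j" and c2: "is_coproduct C i' j'"
    and eq: "Dom C i = Dom C i'" "Dom C j = Dom C j'"
  obtains k where "is_iso C k" "Dom C k = Cod C i" "Cod C k = Cod C i'" "k \<cdot> i = i'" "k \<cdot> j = j'"
proof -
  note [simp] = coproductD[OF c1] coproductD[OF c2] eq
  obtain k where k [simp]: "k \<in> Ar C" "Dom C k = Cod C i" "Cod C k = Cod C i'" "k \<cdot> i = i'" "k \<cdot> j = j'"
    by (rule copairE[OF c1, of i' j']) auto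
  obtain l where l [simp]: "l \<in> Ar C" "Dom C l = Cod C i'" "Cod C l = Cod C i" "l \<cdot> i' = i" "l \<cdot> j' = j"
    by (rule copairE[OF c2, of i j]) auto
  have "l \<cdot> k = Ident C (Dom C k)" by (rule coproduct_eqI[OF c1]) auto
  moreover have "k \<cdot> l = Ident C (Cod C k)" by (rule coproduct_eqI[OF c2]) auto
  ultimately have "is_iso C k" by (intro isoI[of k l]) auto
  then show thesis using that k by auto
qed

section \<open>Pullback squares\<close>

lemma pullbackD:
  assumes "is_pullback C p q f g"
  shows "f \<in> Ar C" "g \<in> Ar C" "p \<in> Ar C" "q \<in> Ar C" "Cod C g = Cod C f" "Cod C p = Dom C f"
    "Cod C q = Dom C g" "Dom C q = Dom C p" "f \<cdot> p = g \<cdot> q"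
  using assms unfolding is_pullback_def by (elim conjE; simp)+

lemma pullback_ex1:
  assumes "is_pullback C p q f g" "u \<in> Ar C" "v \<in> Ar C" "Cod C u = Dom C f" "Cod C v = Dom C g"
    "Dom C v = Dom C u" "f \<cdot> u = g \<cdot> v"
  shows "\<exists>!w. w \<in> hom C (Dom C u) (Dom C p) \<and> p \<cdot> w = u \<and> q \<cdot> w = v"
proof -
  have A: "\<forall>X. \<forall>u \<in> hom C X (Dom C f). \<forall>v \<in> hom C X (Dom C g). f \<cdot> u = g \<cdot> v \<longrightarrow>
        (\<exists>!w. w \<in> hom C X (Dom C p) \<and> p \<cdot> w = u \<and> q \<cdot> w = v)"
    using assms(1) unfolding is_pullback_def by (elim conjE) assumption
  have "u \<in> hom C (Dom C u) (Dom C f)" "v \<in> hom C (Dom C u) (Dom C g)"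
    using assms(2-6) by auto
  from A[rule_format, OF this assms(7)] show ?thesis .
qed

lemma pullbackE:
  assumes "is_pullback C p q f g" "u \<in> Ar C" "v \<in> Ar C" "Cod C u = Dom C f" "Cod C v = Dom C g"
    "Dom C v = Dom C u" "f \<cdot> u = g \<cdot> v"
  obtains w where "w \<in> Ar C" "Dom C w = Dom C u" "Cod C w = Dom C p" "p \<cdot> w = u" "q \<cdot> w = v"
  using ex1_implies_ex[OF pullback_ex1[OF assms]] that by auto

lemma pullback_eqI:
  assumes "is_pullback C p q f g" "u \<in> Ar C" "v \<in> Ar C" "Cod C u = Dom C p" "Cod C v = Dom C p"
    "Dom C u = Dom C v" "p \<cdot> u = p \<cdot> v" "q \<cdot> u = q \<cdot> v"
  shows "u = v"
proof -
  note pb = pullbackD[OF assms(1)]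
  have "f \<cdot> (p \<cdot> v) = g \<cdot> (q \<cdot> v)" by (rule comp_square[OF pb(9)]) (simp_all add: pb(1-8) assms(2-6))
  then have "\<exists>!w. w \<in> hom C (Dom C (p \<cdot> v)) (Dom C p) \<and> p \<cdot> w = p \<cdot> v \<and> q \<cdot> w = q \<cdot> v"
    by (intro pullback_ex1[OF assms(1)]) (simp_all add: pb(1-8) assms(2-6))
  moreover have "u \<in> hom C (Dom C (p \<cdot> v)) (Dom C p)" "v \<in> hom C (Dom C (p \<cdot> v)) (Dom C p)"
    by (simp_all add: pb(1-8) assms(2-6))
  ultimately show ?thesis using assms(7,8) by blast
qed

lemma pullbackI:
  assumes "f \<in> Ar C" "g \<in> Ar C" "p \<in> Ar C" "q \<in> Ar C" "Cod C g = Cod C f" "Cod C p = Dom C f"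
    "Cod C q = Dom C g" "Dom C q = Dom C p" "f \<cdot> p = g \<cdot> q"
    and ex: "\<And>u v. u \<in> Ar C \<Longrightarrow> v \<in> Ar C \<Longrightarrow> Cod C u = Dom C f \<Longrightarrow> Cod C v = Dom C g \<Longrightarrow>
      Dom C v = Dom C u \<Longrightarrow> f \<cdot> u = g \<cdot> v \<Longrightarrow>
      \<exists>w \<in> Ar C. Dom C w = Dom C u \<and> Cod C w = Dom C p \<and> p \<cdot> w = u \<and> q \<cdot> w = v"
    and uniq: "\<And>u v. u \<in> Ar C \<Longrightarrow> v \<in> Ar C \<Longrightarrow> Cod C u = Dom C p \<Longrightarrow> Cod C v = Dom C p \<Longrightarrow>
      Dom C u = Dom C v \<Longrightarrow> p \<cdot> u = p \<cdot> v \<Longrightarrow> q \<cdot> u = q \<cdot> v \<Longrightarrow> u = v"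
  shows "is_pullback C p q f g"
  unfolding is_pullback_def
proof (intro conjI allI ballI impI)
  fix X u v assume uv: "u \<in> hom C X (Dom C f)" "v \<in> hom C X (Dom C g)" "f \<cdot> u = g \<cdot> v"
  then obtain w where w: "w \<in> Ar C" "Dom C w = X" "Cod C w = Dom C p" "p \<cdot> w = u" "q \<cdot> w = v"
    using ex[of u v] by auto
  show "\<exists>!w. w \<in> hom C X (Dom C p) \<and> p \<cdot> w = u \<and> q \<cdot> w = v"
  proof (rule ex1I[of _ w])
    fix w' assume "w' \<in> hom C X (Dom C p) \<and> p \<cdot> w' = u \<and> q \<cdot> w' = v"
    then have w': "w' \<in> Ar C" "Dom C w' = X" "Cod C w' = Dom C p" "p \<cdot> w' = u" "q \<cdot> w' = v"
      by simp_all
    show "w' = w" by (rule uniq) (use w w' uv in simp_all)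
  qed (use w in auto)
qed (use assms in auto)

lemma pullback_sym: "is_pullback C p q f g \<Longrightarrow> is_pullback C q p g f"
proof (rule pullbackI)
  assume *: "is_pullback C p q f g"
  note [simp] = pullbackD[OF *]
  show "\<exists>w\<in>Ar C. Dom C w = Dom C u \<and> Cod C w = Dom C q \<and> q \<cdot> w = u \<and> p \<cdot> w = v"
    if "u \<in> Ar C" "v \<in> Ar C" "Cod C u = Dom C g" "Cod C v = Dom C f" "Dom C v = Dom C u" "g \<cdot> u = f \<cdot> v" for u v
    using pullbackE[OF * that(2) that(1)] that by (metis pullbackD(8)[OF *])
  show "u = v" if "u \<in> Ar C" "v \<in> Ar C" "Cod C u = Dom C q" "Cod C v = Dom C q" "Dom C u = Dom C v"
      "q \<cdot> u = q \<cdot> v" "p \<cdot> u = p \<cdot> v" for u v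
    by (rule pullback_eqI[OF *]) (use that in auto)
  show "g \<cdot> q = f \<cdot> p" by (metis pullbackD(9)[OF *])
qed (auto simp: pullbackD)

lemma pullback_iso:
  assumes pb: "is_pullback C p q f g" and i: "is_iso C i" "Cod C i = Dom C p"
  shows "is_pullback C (p \<cdot> i) (q \<cdot> i) f g"
proof -
  obtain i' where i' [simp]: "i \<in> Ar C" "i' \<in> Ar C" "Dom C i' = Cod C i" "Cod C i' = Dom C i"
    "i' \<cdot> i = Ident C (Dom C i)" "i \<cdot> i' = Ident C (Cod C i)" by (rule isoE[OF i(1)])
  note [simp] = pullbackD[OF pb] i(2) comp_tri[OF i'(6)]
  show ?thesis
  proof (rule pullbackI)
    show "f \<cdot> (p \<cdot> i) = g \<cdot> (q \<cdot> i)" by (rule comp_square) auto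
  next
    fix u v assume uv: "u \<in> Ar C" "v \<in> Ar C" "Cod C u = Dom C f" "Cod C v = Dom C g"
      "Dom C v = Dom C u" "f \<cdot> u = g \<cdot> v"
    obtain w where w: "w \<in> Ar C" "Dom C w = Dom C u" "Cod C w = Dom C p" "p \<cdot> w = u" "q \<cdot> w = v"
      using pullbackE[OF pb uv] .
    then show "\<exists>w\<in>Ar C. Dom C w = Dom C u \<and> Cod C w = Dom C (p \<cdot> i) \<and> (p \<cdot> i) \<cdot> w = u \<and> (q \<cdot> i) \<cdot> w = v"
      by (intro bexI[of _ "i' \<cdot> w"]) auto
  next
    fix u v assume uv: "u \<in> Ar C" "v \<in> Ar C" "Cod C u = Dom C (p \<cdot> i)" "Cod C v = Dom C (p \<cdot> i)"
      "Dom C u = Dom C v" "(p \<cdot> i) \<cdot> u = (p \<cdot> i) \<cdot> v" "(q \<cdot> i) \<cdot> u = (q \<cdot> i) \<cdot> v"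
    have "i \<cdot> u = i \<cdot> v" by (rule pullback_eqI[OF pb]) (use uv in auto)
    then show "u = v" using monoD[OF iso_mono[OF i(1)], of u v] uv by auto
  qed auto
qed

lemma pullback_unique:
  assumes c1: "is_pullback C p q f g" and c2: "is_pullback C p' q' f g"
  obtains k where "is_iso C k" "Dom C k = Dom C p'" "Cod C k = Dom C p" "p \<cdot> k = p'" "q \<cdot> k = q'"
proof -
  note [simp] = pullbackD[OF c1] pullbackD[OF c2]
  have e: "f \<cdot> p = g \<cdot> q" "f \<cdot> p' = g \<cdot> q'" by auto
  obtain k where k [simp]: "k \<in> Ar C" "Dom C k = Dom C p'" "Cod C k = Dom C p" "p \<cdot> k = p'" "q \<cdot> k = q'"
    by (rule pullbackE[OF c1, of p' q']) auto
  obtain l where l [simp]: "l \<in> Ar C" "Dom C l = Dom C p" "Cod C l = Dom C p'" "p' \<cdot> l = p" "q' \<cdot> l = q"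
    by (rule pullbackE[OF c2, of p q]) auto
  have "l \<cdot> k = Ident C (Dom C k)"
    by (rule pullback_eqI[OF c2]) (auto simp: comp_tri[OF l(4)] comp_tri[OF l(5)])
  moreover have "k \<cdot> l = Ident C (Cod C k)"
    by (rule pullback_eqI[OF c1]) (auto simp: comp_tri[OF k(4)] comp_tri[OF k(5)])
  ultimately have "is_iso C k" by (intro isoI[of k l]) auto
  then show thesis using that k by auto
qed

end

section \<open>Degenerate and iterated coproducts\<close>

context category
begin

lemma mono_comp:
  assumes "is_mono C f" "is_mono C g" "Cod C f = Dom C g"
  shows "is_mono C (g \<cdot> f)"
proof (rule monoI)
  note [simp] = mono_arr[OF assms(1)] mono_arr[OF assms(2)] assms(3)
  show "g \<cdot> f \<in> Ar C" by simp
  fix u v assume uv: "u \<in> Ar C" "v \<in> Ar C" "Cod C u = Dom C (g \<cdot> f)" "Cod C v = Dom C (g \<cdot> f)"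
      "Dom C u = Dom C v" "(g \<cdot> f) \<cdot> u = (g \<cdot> f) \<cdot> v"
  have "f \<cdot> u = f \<cdot> v" by (rule monoD[OF assms(2)]) (use uv in simp_all)
  then show "u = v" by - (rule monoD[OF assms(1)]; use uv in simp)
qed

text \<open>The degenerate cutting with one empty piece; it is used whenever an identity needs a
  complement, or a partial morphism an empty domain.\<close>

lemma coproduct_initial:
  assumes "is_initial C I" "a \<in> Ar C" "Dom C a = I"
  shows "is_coproduct C (Ident C (Cod C a)) a"
proof (rule coproductI)
  note [simp] = assms(2,3)
  fix u v assume uv: "u \<in> Ar C" "v \<in> Ar C" "Dom C u = Dom C (Ident C (Cod C a))" "Dom C v = Dom C a"
      "Cod C v = Cod C u"
  then have "u \<cdot> a = v" by (intro initial_unique[OF assms(1)]) simp_all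
  with uv show "\<exists>w\<in>Ar C. Dom C w = Cod C (Ident C (Cod C a)) \<and> Cod C w = Cod C u \<and>
      w \<cdot> Ident C (Cod C a) = u \<and> w \<cdot> a = v"
    by (intro bexI[of _ u]) simp_all
qed (use assms in simp_all)

text \<open>Reassociation of a cutting in two stages: after cutting the piece \<open>x0\<close>
  again, the rest \<open>u1\<close> of that piece and the old piece \<open>x1\<close> are united to
  one complement \<open>z\<close>. The vertex of \<open>z\<close> is prescribed through
  \<open>k1\<close> and \<open>k2\<close>, so that \<open>z\<close> is their copairing.\<close>

lemma coproduct_assoc:
  assumes x: "is_coproduct C x0 x1" and u: "is_coproduct C u0 u1" "Cod C u0 = Dom C x0"
    and k: "is_coproduct C k1 k2" "Dom C k1 = Dom C u1" "Dom C k2 = Dom C x1"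
  obtains z where "is_coproduct C (x0 \<cdot> u0) z" "Dom C z = Cod C k1" "z \<cdot> k1 = x0 \<cdot> u1" "z \<cdot> k2 = x1"
proof -
  note [simp] = coproductD[OF x] coproductD[OF u(1)] coproductD[OF k(1)] u(2) k(2,3)
  obtain z where z [simp]: "z \<in> Ar C" "Dom C z = Cod C k1" "Cod C z = Cod C x0"
      and zk: "z \<cdot> k1 = x0 \<cdot> u1" "z \<cdot> k2 = x1"
    by (rule copairE[OF k(1), of "x0 \<cdot> u1" x1]) simp_all
  note [simp] = comp_square[OF zk(1)] comp_tri[OF zk(2)]
  have "is_coproduct C (x0 \<cdot> u0) z"
  proof (rule coproductI)
    fix v w assume vw: "v \<in> Ar C" "w \<in> Ar C" "Dom C v = Dom C (x0 \<cdot> u0)" "Dom C w = Dom C z"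
      "Cod C w = Cod C v"
    obtain s where s: "s \<in> Ar C" "Dom C s = Dom C x0" "Cod C s = Cod C v" "s \<cdot> u0 = v" "s \<cdot> u1 = w \<cdot> k1"
      by (rule copairE[OF u(1), of v "w \<cdot> k1"]) (use vw in simp_all)
    obtain t where t: "t \<in> Ar C" "Dom C t = Cod C x0" "Cod C t = Cod C v" "t \<cdot> x0 = s" "t \<cdot> x1 = w \<cdot> k2"
      by (rule copairE[OF x, of s "w \<cdot> k2"]) (use vw s in simp_all)
    have "t \<cdot> z = w"
      by (rule coproduct_eqI[OF k(1)]) (use vw s t zk in \<open>simp_all add: comp_tri[OF t(4)]\<close>)
    then show "\<exists>t\<in>Ar C. Dom C t = Cod C (x0 \<cdot> u0) \<and> Cod C t = Cod C v \<and> t \<cdot> (x0 \<cdot> u0) = v \<and> t \<cdot> z = w"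
      using s t by (intro bexI[of _ t]) (simp_all add: comp_tri[OF t(4)])
  next
    fix f g assume fg: "f \<in> Ar C" "g \<in> Ar C" "Dom C f = Cod C (x0 \<cdot> u0)" "Dom C g = Cod C (x0 \<cdot> u0)"
      "Cod C f = Cod C g" "f \<cdot> (x0 \<cdot> u0) = g \<cdot> (x0 \<cdot> u0)" "f \<cdot> z = g \<cdot> z"
    note sq = comp_square[OF fg(7)]
    have "f \<cdot> (z \<cdot> k2) = g \<cdot> (z \<cdot> k2)" by (rule sq) (simp_all add: fg(1-5))
    then have "f \<cdot> x1 = g \<cdot> x1" unfolding zk .
    moreover have "f \<cdot> (z \<cdot> k1) = g \<cdot> (z \<cdot> k1)" by (rule sq) (simp_all add: fg(1-5))
    then have "f \<cdot> (x0 \<cdot> u1) = g \<cdot> (x0 \<cdot> u1)" unfolding zk .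
    then have "f \<cdot> x0 = g \<cdot> x0"
      by - (rule coproduct_eqI[OF u(1)]; use fg in simp)
    ultimately show "f = g" by - (rule coproduct_eqI[OF x]; use fg in simp)
  qed simp_all
  with that zk show thesis by simp
qed

end

section \<open>Extensive categories\<close>

locale ext_cat = category C for C :: "('o, 'm) cat" (structure) +
  assumes ext: "is_extensive C"
    and pb: "f \<in> Ar C \<Longrightarrow> g \<in> Ar C \<Longrightarrow> Cod C f = Cod C g \<Longrightarrow> \<exists>p q. is_pullback C p q f g"
begin

lemma initial_ex: obtains I where "is_initial C I"
  using ext by (auto simp: is_extensive_def has_finite_coproducts_def)

lemma coproduct_ex:
  assumes "A \<in> Ob C" "B \<in> Ob C"
  obtains i j where "is_coproduct C i j" "Dom C i = A" "Dom C j = B"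
  using ext assms unfolding is_extensive_def has_finite_coproducts_def by blast

lemma pullback_ex:
  assumes "f \<in> Ar C" "g \<in> Ar C" "Cod C f = Cod C g"
  obtains p q where "is_pullback C p q f g"
  using pb[OF assms] by blast

lemma ext_iff:
  assumes "is_coproduct C i j" "f \<in> Ar C" "Cod C f = Cod C i"
    "x1 \<in> Ar C" "Cod C x1 = Dom C f" "x2 \<in> Ar C" "Cod C x2 = Dom C f"
    "g1 \<in> Ar C" "Dom C g1 = Dom C x1" "Cod C g1 = Dom C i"
    "g2 \<in> Ar C" "Dom C g2 = Dom C x2" "Cod C g2 = Dom C j"
    "f \<cdot> x1 = i \<cdot> g1" "f \<cdot> x2 = j \<cdot> g2"
  shows "is_coproduct C x1 x2 \<longleftrightarrow> is_pullback C x1 g1 f i \<and> is_pullback C x2 g2 f j"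
proof -
  have A: "\<forall>i1 i2 x1 x2 f g1 g2. is_coproduct C i1 i2 \<and>
        f \<in> hom C (Dom C f) (Cod C i1) \<and>
        x1 \<in> hom C (Dom C g1) (Dom C f) \<and> x2 \<in> hom C (Dom C g2) (Dom C f) \<and>
        g1 \<in> hom C (Dom C g1) (Dom C i1) \<and> g2 \<in> hom C (Dom C g2) (Dom C i2) \<and>
        f \<cdot> x1 = i1 \<cdot> g1 \<and> f \<cdot> x2 = i2 \<cdot> g2 \<longrightarrow>
        (is_coproduct C x1 x2 \<longleftrightarrow> is_pullback C x1 g1 f i1 \<and> is_pullback C x2 g2 f i2)"
    using ext unfolding is_extensive_def by (elim conjE) assumption
  show ?thesis
    by (rule A[rule_format]) (use assms in simp)
qed

lemma pullback_coproduct: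
  assumes "is_coproduct C i j" "is_pullback C x1 g1 f i" "is_pullback C x2 g2 f j"
  shows "is_coproduct C x1 x2"
  using assms
  by (subst ext_iff[OF assms(1), of f x1 x2 g1 g2])
    (simp_all add: coproductD[OF assms(1)] pullbackD[OF assms(2)] pullbackD[OF assms(3)])

text \<open>Universality of coproducts: a cutting of the codomain pulls back to a cutting of the
  domain. This is the case distinction of all later arguments, on whether an element lies in the
  first or the second piece.\<close>

lemma decompose:
  assumes "is_coproduct C i j" "f \<in> Ar C" "Cod C f = Cod C i"
  obtains x1 g1 x2 g2 where "is_coproduct C x1 x2" "is_pullback C x1 g1 f i" "is_pullback C x2 g2 f j"
proof -
  note [simp] = coproductD[OF assms(1)] assms(2,3)
  obtain x1 g1 where 1: "is_pullback C x1 g1 f i" by (rule pullback_ex[of f i]) simp_all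
  obtain x2 g2 where 2: "is_pullback C x2 g2 f j" by (rule pullback_ex[of f j]) simp_all
  from that[OF pullback_coproduct[OF assms(1) 1 2] 1 2] show thesis .
qed

text \<open>Extensivity is applied to the injection \<open>i\<close> itself, as an arrow into the
  coproduct, over the degenerate cutting of its domain into itself and an initial object. One square
  gives that \<open>i\<close> is monic, the other that the injections are disjoint.\<close>

lemma injection_pullbacks:
  assumes cop: "is_coproduct C i j" and I: "is_initial C I"
  obtains a b where "is_pullback C (Ident C (Dom C i)) (Ident C (Dom C i)) i i"
    and "is_pullback C a b i j" "Dom C a = I"
proof -
  note [simp] = coproductD[OF cop]
  obtain a where a [simp]: "a \<in> Ar C" "Dom C a = I" "Cod C a = Dom C i"
    by (rule initialE[OF I, of "Dom C i"]) simp_all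
  obtain b where b [simp]: "b \<in> Ar C" "Dom C b = I" "Cod C b = Dom C j"
    by (rule initialE[OF I, of "Dom C j"]) simp_all
  have ab: "i \<cdot> a = j \<cdot> b" by (rule initial_unique[OF I]) simp_all
  have "is_coproduct C (Ident C (Dom C i)) a" using coproduct_initial[OF I a(1)] by simp
  then have "is_pullback C (Ident C (Dom C i)) (Ident C (Dom C i)) i i \<and> is_pullback C a b i j"
    by (subst ext_iff[OF cop, symmetric]) (simp_all add: ab)
  with that[of a b] a(2) show thesis by blast
qed

lemma injection_mono:
  assumes cop: "is_coproduct C i j"
  shows "is_mono C i"
proof (rule monoI)
  obtain I where I: "is_initial C I" by (rule initial_ex)
  obtain a b where pb: "is_pullback C (Ident C (Dom C i)) (Ident C (Dom C i)) i i"
    by (rule injection_pullbacks[OF cop I])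
  note [simp] = coproductD[OF cop]
  fix u v assume uv: "u \<in> Ar C" "v \<in> Ar C" "Cod C u = Dom C i" "Cod C v = Dom C i"
    "Dom C u = Dom C v" "i \<cdot> u = i \<cdot> v"
  obtain w where "w \<in> Ar C" "Cod C w = Dom C i" "Ident C (Dom C i) \<cdot> w = u" "Ident C (Dom C i) \<cdot> w = v"
    by (rule pullbackE[OF pb, of u v]) (use uv in simp_all)
  then show "u = v" by simp
qed (rule coproductD[OF cop])

text \<open>An initial object is the coproduct of two copies of itself with identities as
  injections. Pulling this back along \<open>t\<close> makes the domain of \<open>t\<close> such a
  coproduct as well, so any two parallel arrows out of it are equal; existence comes from composing
  with \<open>t\<close>.\<close>

lemma strict_initial:
  assumes I: "is_initial C I" and t [simp]: "t \<in> Ar C" "Cod C t = I"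
  shows "is_initial C (Dom C t)"
proof -
  have IO [simp]: "I \<in> Ob C" using I by (simp add: is_initial_def)
  have cop: "is_coproduct C (Ident C I) (Ident C I)"
    using coproduct_initial[OF I, of "Ident C I"] by simp
  have pb: "is_pullback C (Ident C (Dom C t)) t t (Ident C I)"
  proof (rule pullbackI)
    fix u v assume uv: "u \<in> Ar C" "v \<in> Ar C" "Cod C u = Dom C t" "Cod C v = Dom C (Ident C I)"
      "Dom C v = Dom C u" "t \<cdot> u = Ident C I \<cdot> v"
    then show "\<exists>w\<in>Ar C. Dom C w = Dom C u \<and> Cod C w = Dom C (Ident C (Dom C t)) \<and>
        Ident C (Dom C t) \<cdot> w = u \<and> t \<cdot> w = v"
      by (intro bexI[of _ u]) simp_all
  qed simp_all
  have cT: "is_coproduct C (Ident C (Dom C t)) (Ident C (Dom C t))"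
    by (rule pullback_coproduct[OF cop pb pb])
  show ?thesis
  proof (rule initialI)
    fix X assume "X \<in> Ob C"
    then obtain x where "x \<in> Ar C" "Dom C x = I" "Cod C x = X" by (rule initialE[OF I])
    then show "\<exists>f\<in>Ar C. Dom C f = Dom C t \<and> Cod C f = X" by (intro bexI[of _ "x \<cdot> t"]) simp_all
  next
    fix f g assume fg: "f \<in> Ar C" "g \<in> Ar C" "Dom C f = Dom C t" "Dom C g = Dom C t" "Cod C f = Cod C g"
    obtain w where "w \<in> Ar C" "Dom C w = Dom C t" "w \<cdot> Ident C (Dom C t) = f" "w \<cdot> Ident C (Dom C t) = g"
      by (rule copairE[OF cT, of f g]) (use fg in simp_all)
    then show "f = g" by simp
  qed simp
qed

text \<open>The common element factors through the pullback of the two injections, which is initial,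
  and initial objects are strict.\<close>

lemma disjoint:
  assumes cop: "is_coproduct C i j" and uv: "u \<in> Ar C" "v \<in> Ar C" "Cod C u = Dom C i"
    "Cod C v = Dom C j" "Dom C u = Dom C v" "i \<cdot> u = j \<cdot> v"
  shows "is_initial C (Dom C v)"
proof -
  obtain I where I: "is_initial C I" by (rule initial_ex)
  obtain a b where pb: "is_pullback C a b i j" and a: "Dom C a = I"
    by (rule injection_pullbacks[OF cop I])
  obtain w where "w \<in> Ar C" "Dom C w = Dom C u" "Cod C w = Dom C a"
    by (rule pullbackE[OF pb, of u v]) (use uv in simp_all)
  with strict_initial[OF I, of w] a uv show ?thesis by simp
qed

text \<open>\<open>m\<close> is the copairing of \<open>a\<close> and \<open>b\<close>. Cut the
  domain of \<open>v\<close> by the summand in which \<open>v\<close> lands. On the part in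
  \<open>i\<close> the monomorphism \<open>a\<close> can be cancelled; the part in \<open>j\<close>
  is initial because it would be a common element of \<open>a\<close> and \<open>b\<close>.\<close>

lemma copair_mono_aux:
  assumes a: "is_mono C a" and [simp]: "b \<in> Ar C" "Cod C b = Cod C a"
    and cop: "is_coproduct C i j" and ij [simp]: "Dom C i = Dom C a" "Dom C j = Dom C b"
    and m [simp]: "m \<in> Ar C" "Dom C m = Cod C i" "Cod C m = Cod C a" and mi: "m \<cdot> i = a" and mj: "m \<cdot> j = b"
    and disj: "\<And>u v. u \<in> Ar C \<Longrightarrow> v \<in> Ar C \<Longrightarrow> Cod C u = Dom C a \<Longrightarrow> Cod C v = Dom C b \<Longrightarrow>
      Dom C u = Dom C v \<Longrightarrow> a \<cdot> u = b \<cdot> v \<Longrightarrow> is_initial C (Dom C v)"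
    and [simp]: "g \<in> Ar C" "Cod C g = Dom C a" "v \<in> Ar C" "Dom C v = Dom C g" "Cod C v = Cod C i"
    and eq: "m \<cdot> v = a \<cdot> g"
  shows "v = i \<cdot> g"
proof -
  note [simp] = coproductD[OF cop] mono_arr[OF a]
  obtain y1 h1 y2 h2 where y: "is_coproduct C y1 y2"
    and p1: "is_pullback C y1 h1 v i" and p2: "is_pullback C y2 h2 v j"
    by (rule decompose[OF cop, of v]) simp_all
  note q1 = pullbackD[OF p1] and q2 = pullbackD[OF p2]
  note [simp] = q1(1-4,6-8) q2(1-4,6-8)
  show ?thesis
  proof (rule coproduct_eqI[OF y])
    have "a \<cdot> (g \<cdot> y1) = m \<cdot> (v \<cdot> y1)" by (simp add: comp_square[OF eq])
    also have "\<dots> = a \<cdot> h1" by (simp only: q1(9)) (simp add: comp_tri[OF mi])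
    finally have "g \<cdot> y1 = h1" by - (rule monoD[OF a]; simp)
    then show "v \<cdot> y1 = (i \<cdot> g) \<cdot> y1" by (simp add: q1(9))
    have "a \<cdot> (g \<cdot> y2) = m \<cdot> (v \<cdot> y2)" by (simp add: comp_square[OF eq])
    also have "\<dots> = b \<cdot> h2" by (simp only: q2(9)) (simp add: comp_tri[OF mj])
    finally have "is_initial C (Dom C h2)" by - (rule disj[of "g \<cdot> y2"]; simp)
    then show "v \<cdot> y2 = (i \<cdot> g) \<cdot> y2" by (rule initial_unique) simp_all
  qed simp_all
qed

text \<open>Two elements identified by \<open>m\<close> are compared piecewise: where
  \<open>u\<close> lies in a summand, \<open>copair_mono_aux\<close> for that summand forces
  \<open>v\<close> to be the same element of it.\<close>

lemma copair_mono:
  assumes a: "is_mono C a" and b: "is_mono C b" and [simp]: "Cod C b = Cod C a"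
    and cop: "is_coproduct C i j" and ij [simp]: "Dom C i = Dom C a" "Dom C j = Dom C b"
    and m [simp]: "m \<in> Ar C" "Dom C m = Cod C i" "Cod C m = Cod C a" and mi: "m \<cdot> i = a" and mj: "m \<cdot> j = b"
    and disj: "\<And>u v. u \<in> Ar C \<Longrightarrow> v \<in> Ar C \<Longrightarrow> Cod C u = Dom C a \<Longrightarrow> Cod C v = Dom C b \<Longrightarrow>
      Dom C u = Dom C v \<Longrightarrow> a \<cdot> u = b \<cdot> v \<Longrightarrow> is_initial C (Dom C v)"
  shows "is_mono C m"
proof (rule monoI[OF m(1)])
  note [simp] = coproductD[OF cop] mono_arr[OF a] mono_arr[OF b]
  fix u v assume [simp]: "u \<in> Ar C" "v \<in> Ar C" "Cod C u = Dom C m" "Cod C v = Dom C m" "Dom C u = Dom C v"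
    and uv: "m \<cdot> u = m \<cdot> v"
  obtain y1 h1 y2 h2 where y: "is_coproduct C y1 y2"
    and p1: "is_pullback C y1 h1 u i" and p2: "is_pullback C y2 h2 u j"
    by (rule decompose[OF cop, of u]) simp_all
  note q1 = pullbackD[OF p1] and q2 = pullbackD[OF p2]
  note [simp] = q1(1-4,6-8) q2(1-4,6-8)
  show "u = v"
  proof (rule coproduct_eqI[OF y])
    have "m \<cdot> (v \<cdot> y1) = m \<cdot> (u \<cdot> y1)" by (simp add: comp_square[OF uv])
    also have "\<dots> = a \<cdot> h1" by (simp only: q1(9)) (simp add: comp_tri[OF mi])
    finally have "v \<cdot> y1 = i \<cdot> h1"
      by - (rule copair_mono_aux[OF a _ _ cop _ _ _ _ _ mi mj disj]; simp)
    then show "u \<cdot> y1 = v \<cdot> y1" by (simp add: q1(9))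
    have "m \<cdot> (v \<cdot> y2) = m \<cdot> (u \<cdot> y2)" by (simp add: comp_square[OF uv])
    also have "\<dots> = b \<cdot> h2" by (simp only: q2(9)) (simp add: comp_tri[OF mj])
    finally have eq: "m \<cdot> (v \<cdot> y2) = b \<cdot> h2" .
    have "v \<cdot> y2 = j \<cdot> h2"
    proof (rule copair_mono_aux[OF b _ _ coproduct_sym[OF cop] _ _ _ _ _ mj mi])
      fix s t assume *: "s \<in> Ar C" "t \<in> Ar C" "Cod C s = Dom C b" "Cod C t = Dom C a" "Dom C s = Dom C t"
        "b \<cdot> s = a \<cdot> t"
      then show "is_initial C (Dom C t)" using disj[of t s] by simp
    qed (simp_all add: eq)
    then show "u \<cdot> y2 = v \<cdot> y2" by (simp add: q2(9))
  qed simp_all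
qed

text \<open>Forwards, the copairing of two disjoint subobjects is monic and contains both, so the
  union condition makes it invertible. Backwards, extensivity supplies monic and disjoint
  injections, and a subobject that contains both of them has a section.\<close>

lemma complement_iff: "is_complement C a b \<longleftrightarrow> is_coproduct C a b"
proof
  assume cp: "is_complement C a b"
  have a: "is_mono C a" and b: "is_mono C b" and ab: "Cod C a = Cod C b"
    using cp by (simp_all only: is_complement_def)
  note [simp] = ab[symmetric]
  have un: "\<forall>m. is_mono C m \<and> Cod C m = Cod C a \<and>
        (\<exists>u \<in> hom C (Dom C a) (Dom C m). m \<cdot> u = a) \<and>
        (\<exists>v \<in> hom C (Dom C b) (Dom C m). m \<cdot> v = b) \<longrightarrow> is_iso C m"
    using cp unfolding is_complement_def by (elim conjE) assumption
  have "\<exists>p q. is_pullback C p q a b \<and> is_initial C (Dom C p)"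
    using cp unfolding is_complement_def by (elim conjE) assumption
  then obtain p q where pq: "is_pullback C p q a b" and p: "is_initial C (Dom C p)" by blast
  note [simp] = mono_arr[OF a] mono_arr[OF b]
  obtain i j where cop: "is_coproduct C i j" and [simp]: "Dom C i = Dom C a" "Dom C j = Dom C b"
    by (rule coproduct_ex[of "Dom C a" "Dom C b"]) simp_all
  note [simp] = coproductD[OF cop]
  obtain m where m [simp]: "m \<in> Ar C" "Dom C m = Cod C i" "Cod C m = Cod C a" and mi: "m \<cdot> i = a" "m \<cdot> j = b"
    by (rule copairE[OF cop, of a b]) simp_all
  have "is_mono C m"
  proof (rule copair_mono[OF a b _ cop _ _ m mi])
    fix u v assume uv: "u \<in> Ar C" "v \<in> Ar C" "Cod C u = Dom C a" "Cod C v = Dom C b" "Dom C u = Dom C v"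
      "a \<cdot> u = b \<cdot> v"
    obtain w where "w \<in> Ar C" "Dom C w = Dom C u" "Cod C w = Dom C p"
      by (rule pullbackE[OF pq, of u v]) (use uv in simp_all)
    with strict_initial[OF p, of w] uv show "is_initial C (Dom C v)" by simp
  qed simp_all
  \<comment> \<open>\<open>m\<close> is itself one of the subobjects tested by the union condition:
    \<open>a\<close> and \<open>b\<close> factor through it by \<open>i\<close> and
    \<open>j\<close>.\<close>
  then have "is_iso C m" 
    using un[THEN spec[of _ m]] mi
    by (simp del: in_hom) (metis (no_types, lifting) in_hom coproductD(1-3)[OF cop] m(2) \<open>Dom C i = Dom C a\<close> \<open>Dom C j = Dom C b\<close>)
  from coproduct_iso[OF cop this m(2)] show "is_coproduct C a b" by (simp add: mi)
next
  assume cop: "is_coproduct C a b"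
  note [simp] = coproductD[OF cop]
  obtain I where I: "is_initial C I" by (rule initial_ex)
  obtain p q where pq: "is_pullback C p q a b" "Dom C p = I" by (rule injection_pullbacks[OF cop I])
  show "is_complement C a b"
    unfolding is_complement_def
  proof (intro conjI allI impI)
    show "\<exists>p q. is_pullback C p q a b \<and> is_initial C (Dom C p)" using pq I by blast
    fix m assume "is_mono C m \<and> Cod C m = Cod C a \<and> (\<exists>u\<in>hom C (Dom C a) (Dom C m). m \<cdot> u = a) \<and>
      (\<exists>v\<in>hom C (Dom C b) (Dom C m). m \<cdot> v = b)"
    then obtain u v where m: "is_mono C m" "Cod C m = Cod C a"
      and uv: "u \<in> hom C (Dom C a) (Dom C m)" "m \<cdot> u = a" "v \<in> hom C (Dom C b) (Dom C m)" "m \<cdot> v = b"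
      by blast
    \<comment> \<open>The factorisations of \<open>a\<close> and \<open>b\<close> through
      \<open>m\<close>, put together on the coproduct, give a section of \<open>m\<close>.\<close>
    obtain s where s [simp]: "s \<in> Ar C" "Dom C s = Cod C a" "Cod C s = Dom C m" "s \<cdot> a = u" "s \<cdot> b = v"
      by (rule copairE[OF cop, of u v]) (use uv in simp_all)
    have "m \<cdot> s = Ident C (Cod C a)"
      by (rule coproduct_eqI[OF cop]) (use m uv in \<open>simp_all add: mono_arr\<close>)
    then show "is_iso C m" using m by (intro mono_iso_section[of m s]) simp_all
  qed (simp_all add: injection_mono[OF cop] injection_mono[OF coproduct_sym[OF cop]])
qed

section \<open>Complemented subobjects under pullback, composition and restriction\<close>

lemma complemented_iff: "is_complemented C a \<longleftrightarrow> (\<exists>b. is_coproduct C a b)"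
  by (simp add: is_complemented_def complement_iff)

lemma complementedE:
  assumes "is_complemented C a"
  obtains b where "is_coproduct C a b"
  using assms complemented_iff by auto

lemma complemented_mono: "is_complemented C a \<Longrightarrow> is_mono C a"
  using complemented_iff injection_mono by blast

lemma complemented_arr: "is_complemented C a \<Longrightarrow> a \<in> Ar C"
  using complemented_mono mono_arr by blast

lemma complemented_pullback:
  assumes "is_complemented C b" "is_pullback C p q f b"
  shows "is_complemented C p"
proof -
  obtain b' where b': "is_coproduct C b b'" using complementedE[OF assms(1)] .
  note [simp] = coproductD[OF b'] pullbackD(1-4,6-8)[OF assms(2)] pullbackD(5)[OF assms(2), symmetric]
  obtain x2 g2 where "is_pullback C x2 g2 f b'" by (rule pullback_ex[of f b']) simp_all
  from pullback_coproduct[OF b' assms(2) this] show ?thesis using complemented_iff by blast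
qed

lemma complemented_comp:
  assumes "is_complemented C a" "is_complemented C b" "Cod C b = Dom C a"
  shows "is_complemented C (a \<cdot> b)"
proof -
  obtain a' where a': "is_coproduct C a a'" using complementedE[OF assms(1)] .
  obtain b' where b': "is_coproduct C b b'" using complementedE[OF assms(2)] .
  obtain k1 k2 where k: "is_coproduct C k1 k2" "Dom C k1 = Dom C b'" "Dom C k2 = Dom C a'"
    by (rule coproduct_ex[of "Dom C b'" "Dom C a'"]) (simp_all add: coproductD[OF a'] coproductD[OF b'])
  obtain z where "is_coproduct C (a \<cdot> b) z" by (rule coproduct_assoc[OF a' b' assms(3) k])
  then show ?thesis using complemented_iff by blast
qed

lemma complemented_ident [simp]:
  assumes "A \<in> Ob C"
  shows "is_complemented C (Ident C A)"
proof -
  obtain I where I: "is_initial C I" by (rule initial_ex)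
  obtain a where "a \<in> Ar C" "Dom C a = I" "Cod C a = A" using initialE[OF I assms] .
  then show ?thesis using coproduct_initial[OF I, of a] complemented_iff by blast
qed

text \<open>Since \<open>a\<close> is monic and \<open>x0\<close> is \<open>a \<cdot> b\<close>, the
  pullback of \<open>x0\<close> along \<open>a\<close> is \<open>b\<close>. Pulling back the whole
  cutting along \<open>a\<close> therefore exhibits the preimage of \<open>x1\<close> as the
  complement of \<open>b\<close>.\<close>

lemma coproduct_restrict:
  assumes a: "is_mono C a" and x: "is_coproduct C x0 x1" and [simp]: "Cod C x0 = Cod C a"
    and b [simp]: "b \<in> Ar C" "Cod C b = Dom C a" and ab: "a \<cdot> b = x0"
  obtains c d where "is_coproduct C b c" "is_pullback C c d a x1"
proof -
  note [simp] = coproductD[OF x] mono_arr[OF a]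
  have [simp]: "Dom C b = Dom C x0" using comp_arr(2)[of b a] ab by simp
  obtain c d where cd: "is_pullback C c d a x1" by (rule pullback_ex[of a x1]) simp_all
  have "is_pullback C b (Ident C (Dom C x0)) a x0"
  proof (rule pullbackI)
    fix u v assume uv: "u \<in> Ar C" "v \<in> Ar C" "Cod C u = Dom C a" "Cod C v = Dom C x0"
      "Dom C v = Dom C u" "a \<cdot> u = x0 \<cdot> v"
    then have "u = b \<cdot> v"
      by - (rule monoD[OF a]; simp add: comp_tri[OF ab])
    with uv show "\<exists>w\<in>Ar C. Dom C w = Dom C u \<and> Cod C w = Dom C b \<and> b \<cdot> w = u \<and> Ident C (Dom C x0) \<cdot> w = v"
      by (intro bexI[of _ v]) simp_all
  qed (simp_all add: ab)
  from that[OF pullback_coproduct[OF x this cd] cd] show thesis .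
qed

end

section \<open>Pasting of pullbacks, and the ideal of trivial morphisms\<close>

context category
begin

lemma pullback_ident: "f \<in> Ar C \<Longrightarrow> is_pullback C (Ident C (Dom C f)) f f (Ident C (Cod C f))"
proof (rule pullbackI)
  fix u v assume f: "f \<in> Ar C" and uv: "u \<in> Ar C" "v \<in> Ar C" "Cod C u = Dom C f"
    "Cod C v = Dom C (Ident C (Cod C f))" "Dom C v = Dom C u" "f \<cdot> u = Ident C (Cod C f) \<cdot> v"
  then show "\<exists>w\<in>Ar C. Dom C w = Dom C u \<and> Cod C w = Dom C (Ident C (Dom C f)) \<and>
      Ident C (Dom C f) \<cdot> w = u \<and> f \<cdot> w = v"
    by (intro bexI[of _ u]) simp_all
qed simp_all

lemma pullback_paste:
  assumes 1: "is_pullback C a f' f b" and 2: "is_pullback C p q f' b'"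
  shows "is_pullback C (a \<cdot> p) q f (b \<cdot> b')"
proof -
  note q1 = pullbackD[OF 1] and q2 = pullbackD[OF 2]
  note [simp] = q1(1-4,6-8) q2(1-4,6-8)
  have [simp]: "Cod C b' = Dom C b" "Cod C b = Cod C f" using q2(5) q1(5) by simp_all
  show ?thesis
  proof (rule pullbackI)
    have "f \<cdot> (a \<cdot> p) = b \<cdot> (f' \<cdot> p)" by (simp add: comp_square[OF q1(9)])
    also have "\<dots> = b \<cdot> (b' \<cdot> q)" by (simp only: q2(9))
    finally show "f \<cdot> (a \<cdot> p) = (b \<cdot> b') \<cdot> q" by simp
  next
    fix u v assume uv: "u \<in> Ar C" "v \<in> Ar C" "Cod C u = Dom C f" "Cod C v = Dom C (b \<cdot> b')"
      "Dom C v = Dom C u" "f \<cdot> u = (b \<cdot> b') \<cdot> v"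
    obtain w where w: "w \<in> Ar C" "Dom C w = Dom C u" "Cod C w = Dom C a" "a \<cdot> w = u" "f' \<cdot> w = b' \<cdot> v"
      by (rule pullbackE[OF 1, of u "b' \<cdot> v"]) (use uv in simp_all)
    obtain z where z: "z \<in> Ar C" "Dom C z = Dom C u" "Cod C z = Dom C p" "p \<cdot> z = w" "q \<cdot> z = v"
      by (rule pullbackE[OF 2, of w v]) (use uv w in simp_all)
    show "\<exists>w\<in>Ar C. Dom C w = Dom C u \<and> Cod C w = Dom C (a \<cdot> p) \<and> (a \<cdot> p) \<cdot> w = u \<and> q \<cdot> w = v"
      by (rule bexI[of _ z]) (use w z in simp_all)
  next
    fix u v assume uv: "u \<in> Ar C" "v \<in> Ar C" "Cod C u = Dom C (a \<cdot> p)" "Cod C v = Dom C (a \<cdot> p)"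
      "Dom C u = Dom C v" "(a \<cdot> p) \<cdot> u = (a \<cdot> p) \<cdot> v" "q \<cdot> u = q \<cdot> v"
    have "p \<cdot> u = p \<cdot> v"
    proof (rule pullback_eqI[OF 1])
      have "f' \<cdot> (p \<cdot> u) = b' \<cdot> (q \<cdot> u)" by (rule comp_square[OF q2(9)]) (use uv in simp_all)
      also have "\<dots> = b' \<cdot> (q \<cdot> v)" by (simp only: uv(7))
      also have "\<dots> = f' \<cdot> (p \<cdot> v)" by (rule comp_square[OF q2(9)[symmetric]]) (use uv in simp_all)
      finally show "f' \<cdot> (p \<cdot> u) = f' \<cdot> (p \<cdot> v)" .
    qed (use uv in simp_all)
    then show "u = v" by - (rule pullback_eqI[OF 2]; use uv in simp)
  qed simp_all
qed

text \<open>Representatives of one class of partial morphisms differ by isomorphisms of their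
  domains; this carries a pullback over one choice of representatives to another choice.\<close>

lemma pullback_base_iso:
  assumes pb: "is_pullback C a f (d \<cdot> i) (e \<cdot> j)" and i: "is_iso C i" "d \<in> Ar C" "Cod C i = Dom C d"
    and j: "is_iso C j" "e \<in> Ar C" "Cod C j = Dom C e"
  shows "is_pullback C (i \<cdot> a) (j \<cdot> f) d e"
proof -
  obtain i' where i' [simp]: "i \<in> Ar C" "i' \<in> Ar C" "Dom C i' = Cod C i" "Cod C i' = Dom C i"
    "i' \<cdot> i = Ident C (Dom C i)" "i \<cdot> i' = Ident C (Cod C i)" by (rule isoE[OF i(1)])
  obtain j' where j' [simp]: "j \<in> Ar C" "j' \<in> Ar C" "Dom C j' = Cod C j" "Cod C j' = Dom C j"
    "j' \<cdot> j = Ident C (Dom C j)" "j \<cdot> j' = Ident C (Cod C j)" by (rule isoE[OF j(1)])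
  note [simp] = i(2,3) j(2,3) comp_tri[OF i'(5)] comp_tri[OF i'(6)] comp_tri[OF j'(5)] comp_tri[OF j'(6)]
  note q = pullbackD[OF pb]
  note [simp] = q(3,4,8)
  have [simp]: "Cod C a = Dom C i" "Cod C f = Dom C j" "Cod C e = Cod C d" using q(5,6,7) by simp_all
  show ?thesis
  proof (rule pullbackI)
    show "d \<cdot> (i \<cdot> a) = e \<cdot> (j \<cdot> f)" using q(9) by simp
  next
    fix u v assume uv: "u \<in> Ar C" "v \<in> Ar C" "Cod C u = Dom C d" "Cod C v = Dom C e"
      "Dom C v = Dom C u" "d \<cdot> u = e \<cdot> v"
    obtain w where w: "w \<in> Ar C" "Dom C w = Dom C (i' \<cdot> u)" "Cod C w = Dom C a" "a \<cdot> w = i' \<cdot> u" "f \<cdot> w = j' \<cdot> v"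
      by (rule pullbackE[OF pb, of "i' \<cdot> u" "j' \<cdot> v"]) (use uv in simp_all)
    show "\<exists>w\<in>Ar C. Dom C w = Dom C u \<and> Cod C w = Dom C (i \<cdot> a) \<and> (i \<cdot> a) \<cdot> w = u \<and> (j \<cdot> f) \<cdot> w = v"
      by (rule bexI[of _ w]) (use uv w in simp_all)
  next
    fix u v assume uv: "u \<in> Ar C" "v \<in> Ar C" "Cod C u = Dom C (i \<cdot> a)" "Cod C v = Dom C (i \<cdot> a)"
      "Dom C u = Dom C v" "(i \<cdot> a) \<cdot> u = (i \<cdot> a) \<cdot> v" "(j \<cdot> f) \<cdot> u = (j \<cdot> f) \<cdot> v"
    have "a \<cdot> u = a \<cdot> v" by (rule monoD[OF iso_mono[OF i(1)]]) (use uv in simp_all)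
    moreover have "f \<cdot> u = f \<cdot> v" by (rule monoD[OF iso_mono[OF j(1)]]) (use uv in simp_all)
    ultimately show "u = v" by - (rule pullback_eqI[OF pb]; use uv in simp)
  qed simp_all
qed

lemma trivialI:
  assumes "h \<in> Ar C" "g \<in> Ar C" "Cod C g = Dom C h" "Cod C g \<in> \<Z>"
  shows "is_trivial C \<Z> (h \<cdot> g)"
  unfolding is_trivial_def
  by (intro conjI bexI[of _ "Cod C g"] bexI[of _ g] bexI[of _ h]) (use assms in simp_all)

lemma trivialE:
  assumes "is_trivial C \<Z> f"
  obtains g h where "f \<in> Ar C" "h \<in> Ar C" "g \<in> Ar C" "Cod C g = Dom C h" "Cod C g \<in> \<Z>" "f = h \<cdot> g"
    "Dom C g = Dom C f" "Cod C h = Cod C f"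
  using assms unfolding is_trivial_def by auto

lemma trivial_arr: "is_trivial C \<Z> f \<Longrightarrow> f \<in> Ar C"
  by (simp add: is_trivial_def)

lemma trivial_comp:
  assumes "is_trivial C \<Z> f" "g \<in> Ar C" "Cod C f = Dom C g"
  shows "is_trivial C \<Z> (g \<cdot> f)"
proof -
  obtain p q where pq: "f \<in> Ar C" "q \<in> Ar C" "p \<in> Ar C" "Cod C p = Dom C q" "Cod C p \<in> \<Z>" "f = q \<cdot> p"
    "Dom C p = Dom C f" "Cod C q = Cod C f"
    by (rule trivialE[OF assms(1)])
  have "is_trivial C \<Z> ((g \<cdot> q) \<cdot> p)" by (rule trivialI) (use pq(2-5,8) assms(2,3) in simp_all)
  then show ?thesis using pq(2-4,8) assms(2,3) by (subst pq(6)) simp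
qed

lemma trivial_comp2:
  assumes "is_trivial C \<Z> f" "g \<in> Ar C" "Cod C g = Dom C f"
  shows "is_trivial C \<Z> (f \<cdot> g)"
proof -
  obtain p q where pq: "f \<in> Ar C" "q \<in> Ar C" "p \<in> Ar C" "Cod C p = Dom C q" "Cod C p \<in> \<Z>" "f = q \<cdot> p"
    "Dom C p = Dom C f" "Cod C q = Cod C f"
    by (rule trivialE[OF assms(1)])
  have "is_trivial C \<Z> (q \<cdot> (p \<cdot> g))" by (rule trivialI) (use pq(2-5,7) assms(2,3) in simp_all)
  then show ?thesis using pq(2-4,7) assms(2,3) by (subst pq(6)) simp
qed

end

section \<open>The equivalence of partial morphisms\<close>

text \<open>What the construction of the stable category requires of trivial morphisms. Gluing
  permits proofs by pieces; reflection along monomorphisms is needed because after restricting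
  \<open>f\<close> to a subobject \<open>b\<close> only the composite with \<open>b\<close> is known
  to be trivial; initial objects in \<open>\<Z>\<close> make whatever is defined on an empty piece
  trivial.\<close>

locale triv_cat = ext_cat C for C :: "('o, 'm) cat" (structure) +
  fixes \<Z> :: "'o set"
  assumes triv_glue: "is_coproduct C i j \<Longrightarrow> f \<in> Ar C \<Longrightarrow> Dom C f = Cod C i \<Longrightarrow>
      is_trivial C \<Z> (f \<cdot> i) \<Longrightarrow> is_trivial C \<Z> (f \<cdot> j) \<Longrightarrow> is_trivial C \<Z> f"
    and triv_reflect: "is_mono C m \<Longrightarrow> f \<in> Ar C \<Longrightarrow> Cod C f = Dom C m \<Longrightarrow>
      is_trivial C \<Z> (m \<cdot> f) \<Longrightarrow> is_trivial C \<Z> f"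
    and initial_Z: "is_initial C I \<Longrightarrow> I \<in> \<Z>"
begin

abbreviation triv :: "'m \<Rightarrow> bool" where "triv \<equiv> is_trivial C \<Z>"

lemma triv_from_initial:
  assumes "is_initial C (Dom C f)" "f \<in> Ar C"
  shows "triv f"
  using trivialI[of f "Ident C (Dom C f)"] initial_Z[OF assms(1)] assms by simp

text \<open>\<open>null a f x\<close>: the partial morphism \<open>(a, f)\<close> is trivial wherever it is defined along \<open>x\<close>, which includes
  the case that \<open>x\<close> does not meet \<open>a\<close>.  Quantifying over commuting squares avoids choosing a pullback.\<close>

definition null :: "'m \<Rightarrow> 'm \<Rightarrow> 'm \<Rightarrow> bool" where
  "null a f x \<longleftrightarrow> (\<forall>w \<in> Ar C. \<forall>u \<in> Ar C. Cod C w = Dom C a \<longrightarrow> Cod C u = Dom C x \<longrightarrow> Dom C w = Dom C u \<longrightarrow>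
     a \<cdot> w = x \<cdot> u \<longrightarrow> triv (f \<cdot> w))"

text \<open>Like \<open>null\<close>, stated for an arbitrary arrow \<open>x\<close> and without a
  chosen pullback. For partial morphisms the factorisations \<open>s\<close> and \<open>t\<close>
  are unique, as \<open>a\<close> and \<open>b\<close> are monic.\<close>

definition agree :: "'m \<Rightarrow> 'm \<Rightarrow> 'm \<Rightarrow> 'm \<Rightarrow> 'm \<Rightarrow> bool" where
  "agree a f b g x \<longleftrightarrow> (\<exists>s \<in> Ar C. \<exists>t \<in> Ar C. Cod C s = Dom C a \<and> Cod C t = Dom C b \<and>
     a \<cdot> s = x \<and> b \<cdot> t = x \<and> f \<cdot> s = g \<cdot> t)"

definition pair :: "'m \<Rightarrow> 'm \<Rightarrow> bool" where
  "pair a f \<longleftrightarrow> is_complemented C a \<and> f \<in> Ar C \<and> Dom C f = Dom C a"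

definition sim :: "'m \<Rightarrow> 'm \<Rightarrow> 'm \<Rightarrow> 'm \<Rightarrow> bool" where
  "sim a f b g \<longleftrightarrow> (\<exists>x0 x1. is_coproduct C x0 x1 \<and> agree a f b g x0 \<and> null a f x1 \<and> null b g x1)"

section \<open>The calculus of \<open>null\<close> and \<open>agree\<close>\<close>

lemma pairD:
  assumes "pair a f"
  shows "a \<in> Ar C" "f \<in> Ar C" "Dom C f = Dom C a" "is_mono C a" "is_complemented C a"
  using assms complemented_mono complemented_arr by (auto simp: pair_def)

lemma pair_partial: "(a, f) \<in> partial_pairs C \<longleftrightarrow> pair a f"
  by (auto simp: partial_pairs_def pair_def)

lemma nullD:
  assumes "null a f x" "w \<in> Ar C" "u \<in> Ar C" "Cod C w = Dom C a" "Cod C u = Dom C x" "Dom C w = Dom C u"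
    "a \<cdot> w = x \<cdot> u"
  shows "triv (f \<cdot> w)"
  using assms unfolding null_def by blast

lemma nullI:
  assumes "\<And>w u. w \<in> Ar C \<Longrightarrow> u \<in> Ar C \<Longrightarrow> Cod C w = Dom C a \<Longrightarrow> Cod C u = Dom C x \<Longrightarrow> Dom C w = Dom C u \<Longrightarrow>
    a \<cdot> w = x \<cdot> u \<Longrightarrow> triv (f \<cdot> w)"
  shows "null a f x"
  using assms unfolding null_def by blast

lemma null_comp:
  assumes "null a f x" "x \<in> Ar C" "y \<in> Ar C" "Cod C y = Dom C x"
  shows "null a f (x \<cdot> y)"
proof (rule nullI)
  fix w u assume *: "w \<in> Ar C" "u \<in> Ar C" "Cod C w = Dom C a" "Cod C u = Dom C (x \<cdot> y)" "Dom C w = Dom C u"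
    "a \<cdot> w = (x \<cdot> y) \<cdot> u"
  show "triv (f \<cdot> w)" by (rule nullD[OF assms(1), of w "y \<cdot> u"]) (use assms(2-) * in simp_all)
qed

text \<open>A common element of \<open>a\<close> and its complement has an initial domain, where
  everything is trivial.\<close>

lemma null_disjoint:
  assumes "is_coproduct C a a'" "f \<in> Ar C" "Dom C f = Dom C a"
  shows "null a f a'"
proof (rule nullI)
  fix w u assume *: "w \<in> Ar C" "u \<in> Ar C" "Cod C w = Dom C a" "Cod C u = Dom C a'" "Dom C w = Dom C u"
    "a \<cdot> w = a' \<cdot> u"
  have "is_initial C (Dom C u)" by (rule disjoint[OF assms(1), of w]) (use * in simp_all)
  then show "triv (f \<cdot> w)" using assms(2,3) * by (intro triv_from_initial) simp_all
qed

text \<open>The test element over \<open>x\<close> is cut along \<open>i\<close> and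
  \<open>j\<close>, and triviality is glued from the two parts.\<close>

lemma null_glue:
  assumes "pair a f" "is_coproduct C i j" "x \<in> Ar C" "Dom C x = Cod C i" "Cod C x = Cod C a"
    "null a f (x \<cdot> i)" "null a f (x \<cdot> j)"
  shows "null a f x"
proof (rule nullI)
  note [simp] = coproductD[OF assms(2)] assms(3-5) pairD(1-3)[OF assms(1)]
  fix w u assume wu: "w \<in> Ar C" "u \<in> Ar C" "Cod C w = Dom C a" "Cod C u = Dom C x" "Dom C w = Dom C u"
    and eq: "a \<cdot> w = x \<cdot> u"
  note [simp] = wu
  obtain x1 g1 x2 g2 where y: "is_coproduct C x1 x2"
    and p1: "is_pullback C x1 g1 u i" and p2: "is_pullback C x2 g2 u j"
    by (rule decompose[OF assms(2), of u]) simp_all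
  note q1 = pullbackD[OF p1] and q2 = pullbackD[OF p2]
  note [simp] = q1(1-4,6-8) q2(1-4,6-8)
  show "triv (f \<cdot> w)"
  proof (rule triv_glue[OF y])
    have "triv (f \<cdot> (w \<cdot> x1))"
      by (rule nullD[OF assms(6), of _ g1]) (simp_all add: comp_square[OF eq] q1(9))
    then show "triv ((f \<cdot> w) \<cdot> x1)" by simp
    have "triv (f \<cdot> (w \<cdot> x2))"
      by (rule nullD[OF assms(7), of _ g2]) (simp_all add: comp_square[OF eq] q2(9))
    then show "triv ((f \<cdot> w) \<cdot> x2)" by simp
  qed simp_all
qed

text \<open>As \<open>a\<close> is monic, an element of \<open>a\<close> over
  \<open>x \<cdot> y\<close> has to run through the factorisation \<open>s\<close> of
  \<open>x\<close>, and there \<open>f\<close> has the same values as \<open>g\<close>.\<close>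

lemma null_agree:
  assumes "pair a f" "pair b g" "agree a f b g x" "y \<in> Ar C" "Cod C y = Dom C x" "null b g (x \<cdot> y)"
  shows "null a f (x \<cdot> y)"
proof (rule nullI)
  note [simp] = assms(4,5) pairD(1-3)[OF assms(1)] pairD(1-3)[OF assms(2)]
  obtain s t where st [simp]: "s \<in> Ar C" "t \<in> Ar C" "Cod C s = Dom C a" "Cod C t = Dom C b"
    and eq: "a \<cdot> s = x" "b \<cdot> t = x" "f \<cdot> s = g \<cdot> t"
    using assms(3) unfolding agree_def by blast
  have d [simp]: "x \<in> Ar C" "Dom C s = Dom C x" "Dom C t = Dom C x"
    using comp_arr[of s a] comp_arr(2)[of t b] eq by simp_all
  fix w u assume [simp]: "w \<in> Ar C" "u \<in> Ar C" "Cod C w = Dom C a" "Cod C u = Dom C (x \<cdot> y)" "Dom C w = Dom C u"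
    and w: "a \<cdot> w = (x \<cdot> y) \<cdot> u"
  have "w = s \<cdot> (y \<cdot> u)"
    by (rule monoD[OF pairD(4)[OF assms(1)]]) (simp_all add: w comp_tri[OF eq(1)])
  moreover have "triv (g \<cdot> (t \<cdot> (y \<cdot> u)))"
    by (rule nullD[OF assms(6), of _ u]) (simp_all add: comp_tri[OF eq(2)])
  moreover have "f \<cdot> (s \<cdot> (y \<cdot> u)) = g \<cdot> (t \<cdot> (y \<cdot> u))"
    by (rule comp_square[OF eq(3)]) simp_all
  ultimately show "triv (f \<cdot> w)" by simp
qed

lemma agreeD:
  assumes "pair a f" "pair b g" "agree a f b g x"
  shows "x \<in> Ar C" "Cod C x = Cod C a" "Cod C b = Cod C a" "Cod C g = Cod C f"
proof -
  note [simp] = pairD(1-3)[OF assms(1)] pairD(1-3)[OF assms(2)]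
  obtain s t where st [simp]: "s \<in> Ar C" "t \<in> Ar C" "Cod C s = Dom C a" "Cod C t = Dom C b"
    and eq: "a \<cdot> s = x" "b \<cdot> t = x" "f \<cdot> s = g \<cdot> t"
    using assms(3) unfolding agree_def by blast
  show "x \<in> Ar C" "Cod C x = Cod C a" "Cod C b = Cod C a" "Cod C g = Cod C f"
    using comp_arr[of s a] comp_arr[of t b] comp_arr[of s f] comp_arr[of t g] eq by simp_all
qed

lemma agree_comp:
  assumes "pair a f" "pair b g" "agree a f b g x" "y \<in> Ar C" "Cod C y = Dom C x"
  shows "agree a f b g (x \<cdot> y)"
proof -
  note [simp] = assms(4,5) pairD(1-3)[OF assms(1)] pairD(1-3)[OF assms(2)]
  obtain s t where st [simp]: "s \<in> Ar C" "t \<in> Ar C" "Cod C s = Dom C a" "Cod C t = Dom C b"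
    and eq: "a \<cdot> s = x" "b \<cdot> t = x" "f \<cdot> s = g \<cdot> t"
    using assms(3) unfolding agree_def by blast
  have d [simp]: "x \<in> Ar C" "Dom C s = Dom C x" "Dom C t = Dom C x"
    using comp_arr[of s a] comp_arr(2)[of t b] eq by simp_all
  show ?thesis unfolding agree_def
    by (rule bexI[of _ "s \<cdot> y"], rule bexI[of _ "t \<cdot> y"])
      (simp_all add: comp_tri[OF eq(1)] comp_tri[OF eq(2)] comp_square[OF eq(3)])
qed

lemma agree_sym: "agree a f b g x \<Longrightarrow> agree b g a f x"
  unfolding agree_def by metis

text \<open>The two factorisations of \<open>x\<close> through the middle subobject \<open>b\<close>
  coincide because \<open>b\<close> is monic.\<close>

lemma agree_trans:
  assumes "pair a f" "pair b g" "pair c h" "agree a f b g x" "agree b g c h x"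
  shows "agree a f c h x"
proof -
  obtain s t where st: "s \<in> Ar C" "t \<in> Ar C" "Cod C s = Dom C a" "Cod C t = Dom C b"
    and eq: "a \<cdot> s = x" "b \<cdot> t = x" "f \<cdot> s = g \<cdot> t"
    using assms(4) unfolding agree_def by blast
  obtain s' t' where st': "s' \<in> Ar C" "t' \<in> Ar C" "Cod C s' = Dom C b" "Cod C t' = Dom C c"
    and eq': "b \<cdot> s' = x" "c \<cdot> t' = x" "g \<cdot> s' = h \<cdot> t'"
    using assms(5) unfolding agree_def by blast
  have D: "Dom C t = Dom C x" "Dom C s' = Dom C x"
    using comp_arr(2)[of t b] comp_arr(2)[of s' b] st st' eq eq' pairD(1)[OF assms(2)] by simp_all
  have "t = s'" by (rule monoD[OF pairD(4)[OF assms(2)]]) (simp_all add: st st' D eq eq')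
  then show ?thesis unfolding agree_def
    by (intro bexI[of _ s] bexI[of _ t'] conjI) (simp_all add: st st' eq eq')
qed

text \<open>The form in which equivalences are usually proved: the final piece
  \<open>x0 \<cdot> u0\<close> arises in two cuts, and vanishing is checked on the two discarded
  pieces separately. Reassociation and gluing unite those pieces to one complement.\<close>

lemma simI:
  assumes p: "pair a f" "pair b g" and x: "is_coproduct C x0 x1" and u: "is_coproduct C u0 u1" "Cod C u0 = Dom C x0"
    and ag: "agree a f b g (x0 \<cdot> u0)" and n: "null a f (x0 \<cdot> u1)" "null b g (x0 \<cdot> u1)" "null a f x1" "null b g x1"
  shows "sim a f b g"
proof -
  note [simp] = coproductD[OF x] coproductD[OF u(1)] u(2)
  obtain k1 k2 where k: "is_coproduct C k1 k2" "Dom C k1 = Dom C u1" "Dom C k2 = Dom C x1"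
    by (rule coproduct_ex[of "Dom C u1" "Dom C x1"]) simp_all
  obtain z where z: "is_coproduct C (x0 \<cdot> u0) z" "Dom C z = Cod C k1" "z \<cdot> k1 = x0 \<cdot> u1" "z \<cdot> k2 = x1"
    by (rule coproduct_assoc[OF x u k])
  have c: "Cod C z = Cod C a" "Cod C b = Cod C a"
    using agreeD(2,3)[OF p ag] coproductD[OF z(1)] by simp_all
  have "null a f z"
    by (rule null_glue[OF p(1) k(1)]) (use z(2-) n c coproductD[OF z(1)] in simp_all)
  moreover have "null b g z"
    by (rule null_glue[OF p(2) k(1)]) (use z(2-) n c coproductD[OF z(1)] in simp_all)
  ultimately show ?thesis unfolding sim_def using z(1) ag by blast
qed

lemma simE:
  assumes "sim a f b g" "pair a f" "pair b g"
  obtains x0 x1 where "is_coproduct C x0 x1" "agree a f b g x0" "null a f x1" "null b g x1"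
    "Cod C x0 = Cod C a" "Cod C b = Cod C a" "Cod C g = Cod C f"
  using assms agreeD[OF assms(2,3)] unfolding sim_def by blast

lemma sim_refl:
  assumes "pair a f"
  shows "sim a f a f"
proof -
  obtain a' where a': "is_coproduct C a a'" using complementedE[OF pairD(5)[OF assms]] .
  have "agree a f a f a" unfolding agree_def
    by (rule bexI[of _ "Ident C (Dom C a)"], rule bexI[of _ "Ident C (Dom C a)"]) (simp_all add: pairD(1-3)[OF assms])
  moreover have "null a f a'" by (rule null_disjoint[OF a']) (simp_all add: pairD(1-3)[OF assms])
  ultimately show ?thesis using a' unfolding sim_def by blast
qed

lemma sim_sym: "sim a f b g \<Longrightarrow> sim b g a f"
  unfolding sim_def using agree_sym by blast

text \<open>Both pieces of the first cutting are cut by the second one. Where both agreements hold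
  they compose. On each mixed part the middle morphism vanishes by one hypothesis, and the agreement
  given by the other carries this to the remaining end. On the last part both ends vanish
  directly.\<close>

lemma sim_trans:
  assumes p: "pair a f" "pair b g" "pair c h" and ab: "sim a f b g" and bc: "sim b g c h"
  shows "sim a f c h"
proof -
  obtain x0 x1 where x: "is_coproduct C x0 x1" "agree a f b g x0" "null a f x1" "null b g x1"
    "Cod C x0 = Cod C a" "Cod C b = Cod C a" by (rule simE[OF ab p(1,2)])
  obtain y0 y1 where y: "is_coproduct C y0 y1" "agree b g c h y0" "null b g y1" "null c h y1"
    "Cod C y0 = Cod C b" "Cod C c = Cod C b" by (rule simE[OF bc p(2,3)])
  note [simp] = coproductD[OF x(1)] coproductD[OF y(1)] x(5,6) y(5,6)
  obtain u0 v0 u1 v1 where u: "is_coproduct C u0 u1"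
    and p0: "is_pullback C u0 v0 x0 y0" and p1: "is_pullback C u1 v1 x0 y1"
    by (rule decompose[OF y(1), of x0]) simp_all
  obtain r0 s0 r1 s1 where r: "is_coproduct C r0 r1"
    and p2: "is_pullback C r0 s0 x1 y0" and p3: "is_pullback C r1 s1 x1 y1"
    by (rule decompose[OF y(1), of x1]) simp_all
  note q0 = pullbackD[OF p0] and q1 = pullbackD[OF p1] and q2 = pullbackD[OF p2] and q3 = pullbackD[OF p3]
  note [simp] = q0(1-4,6-8) q1(1-4,6-8) q2(1-4,6-8) q3(1-4,6-8)
  show ?thesis
  proof (rule simI[OF p(1,3) x(1) u])
    show "Cod C u0 = Dom C x0" by simp
    have "agree b g c h (x0 \<cdot> u0)" unfolding q0(9) by (rule agree_comp[OF p(2,3) y(2)]) simp_all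
    moreover have "agree a f b g (x0 \<cdot> u0)" by (rule agree_comp[OF p(1,2) x(2)]) simp_all
    ultimately show "agree a f c h (x0 \<cdot> u0)" using agree_trans[OF p] by blast
    have "null b g (x0 \<cdot> u1)" unfolding q1(9) by (rule null_comp[OF y(3)]) simp_all
    then show "null a f (x0 \<cdot> u1)" by - (rule null_agree[OF p(1,2) x(2)]; simp)
    show "null c h (x0 \<cdot> u1)" unfolding q1(9) by (rule null_comp[OF y(4)]) simp_all
    show "null c h x1"
    proof (rule null_glue[OF p(3) r])
      have "null b g (x1 \<cdot> r0)" by (rule null_comp[OF x(4)]) simp_all
      then show "null c h (x1 \<cdot> r0)" unfolding q2(9)
        by - (rule null_agree[OF p(3,2) agree_sym[OF y(2)]]; simp)
      show "null c h (x1 \<cdot> r1)" unfolding q3(9) by (rule null_comp[OF y(4)]) simp_all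
    qed simp_all
  qed (rule x(3))
qed

text \<open>\<open>pair_sim\<close> cuts the two domains of definition separately,
  \<open>sim\<close> cuts the common source once. Forwards, the complement of \<open>a0\<close> in
  the source consists of \<open>a \<cdot> c1\<close> and the complement of \<open>a\<close>.
  Backwards, the complements inside the domains are the preimages of \<open>x1\<close>.\<close>

lemma pair_sim_iff:
  assumes p: "pair a f" "pair b g"
  shows "pair_sim C \<Z> (a, f) (b, g) \<longleftrightarrow> sim a f b g"
proof
  note [simp] = pairD(1-3)[OF p(1)] pairD(1-3)[OF p(2)]
  assume "pair_sim C \<Z> (a, f) (b, g)"
  then obtain a0 b1 b2 c1 c2 where s: "is_complemented C a0"
     "b1 \<in> hom C (Dom C a0) (Dom C a)" "b2 \<in> hom C (Dom C a0) (Dom C b)" "a \<cdot> b1 = a0" "b \<cdot> b2 = a0" "f \<cdot> b1 = g \<cdot> b2"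
     "is_complement C b1 c1" "triv (f \<cdot> c1)" "is_complement C b2 c2" "triv (g \<cdot> c2)"
    unfolding pair_sim_def by (auto simp del: in_hom)
  then have c: "is_coproduct C b1 c1" "is_coproduct C b2 c2" by (simp_all add: complement_iff)
  note [simp] = coproductD[OF c(1)] coproductD[OF c(2)]
  have [simp]: "Dom C b1 = Dom C a0" "Cod C b1 = Dom C a" "Dom C b2 = Dom C a0" "Cod C b2 = Dom C b"
    using s(2,3) by simp_all
  have [simp]: "Cod C a0 = Cod C a" using comp_arr(3)[of b1 a] s(4) by simp
  have [simp]: "Cod C b = Cod C a" using comp_arr(3)[of b2 b] s(5) by simp
  obtain a' where a': "is_coproduct C a a'" using complementedE[OF pairD(5)[OF p(1)]] .
  note [simp] = coproductD[OF a']
  have ag: "agree a f b g (a \<cdot> b1)"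
    unfolding agree_def by (rule bexI[of _ b1], rule bexI[of _ b2]) (simp_all add: s)
  \<comment> \<open>An element of \<open>b\<close> over an \<open>x\<close> disjoint from
    \<open>a0\<close> is cut along \<open>b2\<close> and \<open>c2\<close>: the first part lies in
    \<open>a0\<close> and is empty, on the second \<open>g\<close> is trivial by hypothesis. This
    covers both discarded pieces, which are described in terms of \<open>a\<close> and not of
    \<open>b\<close>.\<close>
  have nb: "null b g x" if x: "x \<in> Ar C" "Cod C x = Cod C a"
    and dis: "\<And>w u. w \<in> Ar C \<Longrightarrow> u \<in> Ar C \<Longrightarrow> Cod C w = Dom C a0 \<Longrightarrow> Cod C u = Dom C x \<Longrightarrow> Dom C w = Dom C u \<Longrightarrow>
      a0 \<cdot> w = x \<cdot> u \<Longrightarrow> is_initial C (Dom C u)" for x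
  proof (rule nullI)
    note [simp] = x
    fix w u assume [simp]: "w \<in> Ar C" "u \<in> Ar C" "Cod C w = Dom C b" "Cod C u = Dom C x" "Dom C w = Dom C u"
      and eq: "b \<cdot> w = x \<cdot> u"
    obtain r0 s0 r1 s1 where r: "is_coproduct C r0 r1"
      and p2: "is_pullback C r0 s0 w b2" and p3: "is_pullback C r1 s1 w c2"
      by (rule decompose[OF c(2), of w]) simp_all
    note q2 = pullbackD[OF p2] and q3 = pullbackD[OF p3]
    note [simp] = q2(1-4,6-8) q3(1-4,6-8)
    show "triv (g \<cdot> w)"
    proof (rule triv_glue[OF r])
      have "x \<cdot> (u \<cdot> r0) = b \<cdot> (w \<cdot> r0)" by (simp add: comp_square[OF eq])
      also have "\<dots> = a0 \<cdot> s0" by (simp only: q2(9)) (simp add: comp_tri[OF s(5)])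
      finally have "is_initial C (Dom C (u \<cdot> r0))" by - (rule dis[of s0]; simp)
      then show "triv ((g \<cdot> w) \<cdot> r0)" by - (rule triv_from_initial; simp)
      have "triv (g \<cdot> (c2 \<cdot> s1))" using trivial_comp2[OF s(10), of s1] by simp
      then show "triv ((g \<cdot> w) \<cdot> r1)" using q3(9) by simp
    qed simp_all
  qed
  show "sim a f b g"
  proof (rule simI[OF p a' c(1)])
    show "agree a f b g (a \<cdot> b1)" by (rule ag)
    show "null a f (a \<cdot> c1)"
    proof (rule nullI)
      fix w u assume [simp]: "w \<in> Ar C" "u \<in> Ar C" "Cod C w = Dom C a" "Cod C u = Dom C (a \<cdot> c1)" "Dom C w = Dom C u"
        and eq: "a \<cdot> w = (a \<cdot> c1) \<cdot> u"
      have "w = c1 \<cdot> u" by (rule monoD[OF pairD(4)[OF p(1)]]) (simp_all add: eq)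
      then show "triv (f \<cdot> w)" using trivial_comp2[OF s(8), of u] by simp
    qed
    show "null a f a'" by (rule null_disjoint[OF a']) simp_all
    show "null b g (a \<cdot> c1)"
    proof (rule nb)
      fix w u assume *: "w \<in> Ar C" "u \<in> Ar C" "Cod C w = Dom C a0" "Cod C u = Dom C (a \<cdot> c1)" "Dom C w = Dom C u"
        "a0 \<cdot> w = (a \<cdot> c1) \<cdot> u"
      then have "a \<cdot> (b1 \<cdot> w) = a \<cdot> (c1 \<cdot> u)" by (simp add: comp_tri[OF s(4)])
      with * have "b1 \<cdot> w = c1 \<cdot> u" by - (rule monoD[OF pairD(4)[OF p(1)]]; simp)
      with * show "is_initial C (Dom C u)" by - (rule disjoint[OF c(1), of w]; simp)
    qed simp_all
    show "null b g a'"
    proof (rule nb)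
      fix w u assume *: "w \<in> Ar C" "u \<in> Ar C" "Cod C w = Dom C a0" "Cod C u = Dom C a'" "Dom C w = Dom C u"
        "a0 \<cdot> w = a' \<cdot> u"
      then have "a \<cdot> (b1 \<cdot> w) = a' \<cdot> u" by (simp add: comp_tri[OF s(4)])
      with * show "is_initial C (Dom C u)" by - (rule disjoint[OF a', of "b1 \<cdot> w"]; simp)
    qed simp_all
  qed simp
next
  note [simp] = pairD(1-3)[OF p(1)] pairD(1-3)[OF p(2)]
  assume "sim a f b g"
  then obtain x0 x1 where x: "is_coproduct C x0 x1" "agree a f b g x0" "null a f x1" "null b g x1"
    "Cod C x0 = Cod C a" "Cod C b = Cod C a" by (rule simE[OF _ p])
  note [simp] = coproductD[OF x(1)] x(5,6)
  obtain s t where st [simp]: "s \<in> Ar C" "t \<in> Ar C" "Cod C s = Dom C a" "Cod C t = Dom C b"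
    and eq: "a \<cdot> s = x0" "b \<cdot> t = x0" "f \<cdot> s = g \<cdot> t"
    using x(2) unfolding agree_def by blast
  have d [simp]: "Dom C s = Dom C x0" "Dom C t = Dom C x0"
    using comp_arr[of s a] comp_arr(2)[of t b] eq by simp_all
  \<comment> \<open>The complement of \<open>s\<close> inside the domain of \<open>a\<close> is the
    preimage of \<open>x1\<close>, where vanishing is known.\<close>
  obtain c1 d1 where c1: "is_coproduct C s c1" and e1: "is_pullback C c1 d1 a x1"
    by (rule coproduct_restrict[OF pairD(4)[OF p(1)] x(1) _ _ _ eq(1)]) simp_all
  obtain c2 d2 where c2: "is_coproduct C t c2" and e2: "is_pullback C c2 d2 b x1"
    by (rule coproduct_restrict[OF pairD(4)[OF p(2)] x(1) _ _ _ eq(2)]) simp_all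
  note q1 = pullbackD[OF e1] and q2 = pullbackD[OF e2]
  have "triv (f \<cdot> c1)" by (rule nullD[OF x(3), of _ d1]) (simp_all add: q1(1-4,6-9))
  moreover have "triv (g \<cdot> c2)" by (rule nullD[OF x(4), of _ d2]) (simp_all add: q2(1-4,6-9))
  moreover have "is_complemented C x0" using x(1) complemented_iff by blast
  ultimately have "is_complemented C x0 \<and>
     s \<in> hom C (Dom C x0) (Dom C a) \<and> t \<in> hom C (Dom C x0) (Dom C b) \<and>
     a \<cdot> s = x0 \<and> b \<cdot> t = x0 \<and> f \<cdot> s = g \<cdot> t \<and>
     is_complement C s c1 \<and> triv (f \<cdot> c1) \<and> is_complement C t c2 \<and> triv (g \<cdot> c2)"
    using c1 c2 eq by (simp add: complement_iff)
  then show "pair_sim C \<Z> (a, f) (b, g)" unfolding pair_sim_def case_prod_conv by blast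
qed

section \<open>Compatibility of the equivalence with composition\<close>

lemma pair_comp:
  assumes "pair a f" "pair b g" "is_pullback C a' f' f b"
  shows "pair (a \<cdot> a') (g \<cdot> f')"
proof -
  note q = pullbackD[OF assms(3)]
  have "is_complemented C a'" by (rule complemented_pullback[OF pairD(5)[OF assms(2)] assms(3)])
  then have "is_complemented C (a \<cdot> a')"
    using pairD[OF assms(1)] q by (intro complemented_comp) simp_all
  then show ?thesis unfolding pair_def
    using pairD(1-3)[OF assms(1)] pairD(1-3)[OF assms(2)] q(1-4,6-8) by simp
qed

text \<open>On this part \<open>f\<close> takes its values in the complement of \<open>b\<close>. An
  element at which the composite is nevertheless defined would lie in \<open>b\<close> and in
  \<open>b'\<close>, so its domain is initial.\<close>

lemma comp_null_disjoint:
  assumes p: "pair a f" "pair b g" "is_pullback C a' f' f b"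
    and b': "is_coproduct C b b'" and [simp]: "s \<in> Ar C" "Cod C s = Dom C a" "u1 \<in> Ar C" "Cod C u1 = Dom C s"
      "v1 \<in> Ar C" "Cod C v1 = Dom C b'" "Dom C v1 = Dom C u1"
    and eq: "f \<cdot> (s \<cdot> u1) = b' \<cdot> v1"
  shows "null (a \<cdot> a') (g \<cdot> f') (a \<cdot> (s \<cdot> u1))"
proof (rule nullI)
  note q = pullbackD[OF p(3)]
  have [simp]: "Cod C f = Cod C b" using q(5) by simp
  note [simp] = pairD(1-3)[OF p(1)] pairD(1-3)[OF p(2)] q(1-4,6-8) coproductD[OF b']
  fix w u assume [simp]: "w \<in> Ar C" "u \<in> Ar C" "Cod C w = Dom C (a \<cdot> a')" "Cod C u = Dom C (a \<cdot> (s \<cdot> u1))" "Dom C w = Dom C u"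
    and w: "(a \<cdot> a') \<cdot> w = (a \<cdot> (s \<cdot> u1)) \<cdot> u"
  have "a' \<cdot> w = s \<cdot> (u1 \<cdot> u)" by (rule monoD[OF pairD(4)[OF p(1)]]) (use w in simp_all)
  then have "b \<cdot> (f' \<cdot> w) = f \<cdot> (s \<cdot> (u1 \<cdot> u))" by (simp flip: comp_square[OF q(9)])
  also have "\<dots> = b' \<cdot> (v1 \<cdot> u)" using comp_square[OF eq, of u] by simp
  finally have "is_initial C (Dom C (v1 \<cdot> u))" by - (rule disjoint[OF b', of "f' \<cdot> w"]; simp)
  then show "triv ((g \<cdot> f') \<cdot> w)" by - (rule triv_from_initial; simp)
qed

text \<open>Triviality of \<open>f\<close> at an element gives triviality only of
  \<open>b \<cdot> (f' \<cdot> w)\<close>; reflection along the monomorphism \<open>b\<close>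
  removes \<open>b\<close> before \<open>g\<close> is applied.\<close>

lemma comp_null:
  assumes p: "pair a f" "pair b g" "is_pullback C a' f' f b" and n: "null a f x"
    and x [simp]: "x \<in> Ar C" "Cod C x = Cod C a"
  shows "null (a \<cdot> a') (g \<cdot> f') x"
proof (rule nullI)
  note q = pullbackD[OF p(3)]
  have [simp]: "Cod C f = Cod C b" using q(5) by simp
  note [simp] = pairD(1-3)[OF p(1)] pairD(1-3)[OF p(2)] q(1-4,6-8)
  fix w u assume [simp]: "w \<in> Ar C" "u \<in> Ar C" "Cod C w = Dom C (a \<cdot> a')" "Cod C u = Dom C x" "Dom C w = Dom C u"
    and w: "(a \<cdot> a') \<cdot> w = x \<cdot> u"
  have "triv (f \<cdot> (a' \<cdot> w))" by (rule nullD[OF n, of _ u]) (use w in simp_all)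
  then have "triv (b \<cdot> (f' \<cdot> w))" by (simp add: comp_square[OF q(9)])
  then have "triv (f' \<cdot> w)" by - (rule triv_reflect[OF pairD(4)[OF p(2)]]; simp)
  then show "triv ((g \<cdot> f') \<cdot> w)" using trivial_comp[of \<Z> "f' \<cdot> w" g] by simp
qed

text \<open>The agreement piece \<open>x0\<close> is cut once more, by whether the common value of
  \<open>f1\<close> and \<open>f2\<close> lies in \<open>b\<close> or in its complement. In the
  first case the composites agree, in the second neither is defined; on \<open>x1\<close> both stay
  trivial.\<close>

lemma sim_comp_left:
  assumes p: "pair a1 f1" "pair a2 f2" "pair b g" and s: "sim a1 f1 a2 f2"
    and pb1: "is_pullback C a1' f1' f1 b" and pb2: "is_pullback C a2' f2' f2 b"
  shows "sim (a1 \<cdot> a1') (g \<cdot> f1') (a2 \<cdot> a2') (g \<cdot> f2')"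
proof -
  note q1 = pullbackD[OF pb1] and q2 = pullbackD[OF pb2]
  have [simp]: "Cod C f1 = Cod C b" "Cod C f2 = Cod C b" using q1(5) q2(5) by simp_all
  note [simp] = pairD(1-3)[OF p(1)] pairD(1-3)[OF p(2)] pairD(1-3)[OF p(3)] q1(1-4,6-8) q2(1-4,6-8)
  obtain x0 x1 where x: "is_coproduct C x0 x1" "agree a1 f1 a2 f2 x0" "null a1 f1 x1" "null a2 f2 x1"
    "Cod C x0 = Cod C a1" "Cod C a2 = Cod C a1" by (rule simE[OF s p(1,2)])
  note [simp] = coproductD[OF x(1)] x(5,6)
  obtain s t where st [simp]: "s \<in> Ar C" "t \<in> Ar C" "Cod C s = Dom C a1" "Cod C t = Dom C a2"
    and eq: "a1 \<cdot> s = x0" "a2 \<cdot> t = x0" "f1 \<cdot> s = f2 \<cdot> t"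
    using x(2) unfolding agree_def by blast
  have d [simp]: "Dom C s = Dom C x0" "Dom C t = Dom C x0"
    using comp_arr[of s a1] comp_arr(2)[of t a2] eq by simp_all
  obtain b' where b': "is_coproduct C b b'" using complementedE[OF pairD(5)[OF p(3)]] .
  note [simp] = coproductD[OF b']
  obtain u0 v0 u1 v1 where u: "is_coproduct C u0 u1"
    and p0: "is_pullback C u0 v0 (f1 \<cdot> s) b" and p1: "is_pullback C u1 v1 (f1 \<cdot> s) b'"
    by (rule decompose[OF b', of "f1 \<cdot> s"]) simp_all
  note r0 = pullbackD[OF p0] and r1 = pullbackD[OF p1]
  have [simp]: "Cod C u0 = Dom C x0" "Cod C u1 = Dom C x0" using r0(6) r1(6) by simp_all
  note [simp] = r0(3,4,7,8) r1(3,4,7,8)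
  obtain w1 where w1 [simp]: "w1 \<in> Ar C" "Dom C w1 = Dom C (s \<cdot> u0)" "Cod C w1 = Dom C a1'" and w1e: "a1' \<cdot> w1 = s \<cdot> u0" "f1' \<cdot> w1 = v0"
    by (rule pullbackE[OF pb1, of "s \<cdot> u0" v0]) (use r0(9) in simp_all)
  have f2: "f2 \<cdot> (t \<cdot> u0) = f1 \<cdot> (s \<cdot> u0)" by (rule comp_square[OF eq(3)[symmetric]]) simp_all
  obtain w2 where w2 [simp]: "w2 \<in> Ar C" "Dom C w2 = Dom C (t \<cdot> u0)" "Cod C w2 = Dom C a2'" and w2e: "a2' \<cdot> w2 = t \<cdot> u0" "f2' \<cdot> w2 = v0"
    by (rule pullbackE[OF pb2, of "t \<cdot> u0" v0]) (use r0(9) f2 in simp_all)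
  have e1: "f1 \<cdot> (s \<cdot> u1) = b' \<cdot> v1" using r1(9) by simp
  have e2: "f2 \<cdot> (t \<cdot> u1) = b' \<cdot> v1" using e1 comp_square[OF eq(3), of u1] by simp
  show ?thesis
  proof (rule simI[OF pair_comp[OF p(1,3) pb1] pair_comp[OF p(2,3) pb2] x(1) u])
    show "agree (a1 \<cdot> a1') (g \<cdot> f1') (a2 \<cdot> a2') (g \<cdot> f2') (x0 \<cdot> u0)" unfolding agree_def
      by (rule bexI[of _ w1], rule bexI[of _ w2])
        (simp_all add: w1e w2e comp_tri[OF eq(1)] comp_tri[OF eq(2)])
    show "null (a1 \<cdot> a1') (g \<cdot> f1') (x0 \<cdot> u1)"
      using comp_null_disjoint[OF p(1,3) pb1 b' _ _ _ _ _ _ _ e1] comp_tri[OF eq(1), of u1] by simp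
    show "null (a2 \<cdot> a2') (g \<cdot> f2') (x0 \<cdot> u1)"
      using comp_null_disjoint[OF p(2,3) pb2 b' _ _ _ _ _ _ _ e2] comp_tri[OF eq(2), of u1] by simp
    show "null (a1 \<cdot> a1') (g \<cdot> f1') x1" by (rule comp_null[OF p(1,3) pb1 x(3)]) simp_all
    show "null (a2 \<cdot> a2') (g \<cdot> f2') x1" by (rule comp_null[OF p(2,3) pb2 x(4)]) simp_all
  qed simp
qed

text \<open>The cutting that witnesses the equivalence of \<open>(b1, g1)\<close> and
  \<open>(b2, g2)\<close> is pulled back along \<open>f\<close> to the domain of \<open>a\<close>;
  together with the complement of \<open>a\<close> it gives the three pieces that
  \<open>simI\<close> expects.\<close>

lemma sim_comp_right:
  assumes p: "pair a f" "pair b1 g1" "pair b2 g2" and s: "sim b1 g1 b2 g2"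
    and pb1: "is_pullback C a1' f1' f b1" and pb2: "is_pullback C a2' f2' f b2"
  shows "sim (a \<cdot> a1') (g1 \<cdot> f1') (a \<cdot> a2') (g2 \<cdot> f2')"
proof -
  note q1 = pullbackD[OF pb1] and q2 = pullbackD[OF pb2]
  obtain y0 y1 where y: "is_coproduct C y0 y1" "agree b1 g1 b2 g2 y0" "null b1 g1 y1" "null b2 g2 y1"
    "Cod C y0 = Cod C b1" "Cod C b2 = Cod C b1" by (rule simE[OF s p(2,3)])
  have [simp]: "Cod C f = Cod C b1" using q1(5) by simp
  note [simp] = pairD(1-3)[OF p(1)] pairD(1-3)[OF p(2)] pairD(1-3)[OF p(3)] q1(1-4,6-8) q2(1-4,6-8)
  note [simp] = coproductD[OF y(1)] y(5,6)
  obtain s t where st [simp]: "s \<in> Ar C" "t \<in> Ar C" "Cod C s = Dom C b1" "Cod C t = Dom C b2"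
    and eq: "b1 \<cdot> s = y0" "b2 \<cdot> t = y0" "g1 \<cdot> s = g2 \<cdot> t"
    using y(2) unfolding agree_def by blast
  have d [simp]: "Dom C s = Dom C y0" "Dom C t = Dom C y0"
    using comp_arr[of s b1] comp_arr(2)[of t b2] eq by simp_all
  obtain a' where a': "is_coproduct C a a'" using complementedE[OF pairD(5)[OF p(1)]] .
  note [simp] = coproductD[OF a']
  obtain u0 v0 u1 v1 where u: "is_coproduct C u0 u1"
    and p0: "is_pullback C u0 v0 f y0" and p1: "is_pullback C u1 v1 f y1"
    by (rule decompose[OF y(1), of f]) simp_all
  note r0 = pullbackD[OF p0] and r1 = pullbackD[OF p1]
  note [simp] = r0(3,4,6-8) r1(3,4,6-8)
  obtain w1 where w1 [simp]: "w1 \<in> Ar C" "Dom C w1 = Dom C u0" "Cod C w1 = Dom C a1'" and w1e: "a1' \<cdot> w1 = u0" "f1' \<cdot> w1 = s \<cdot> v0"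
    by (rule pullbackE[OF pb1, of u0 "s \<cdot> v0"]) (simp_all add: r0(9) comp_tri[OF eq(1)])
  obtain w2 where w2 [simp]: "w2 \<in> Ar C" "Dom C w2 = Dom C u0" "Cod C w2 = Dom C a2'" and w2e: "a2' \<cdot> w2 = u0" "f2' \<cdot> w2 = t \<cdot> v0"
    by (rule pullbackE[OF pb2, of u0 "t \<cdot> v0"]) (simp_all add: r0(9) comp_tri[OF eq(2)])
  \<comment> \<open>Stated for a generic \<open>(b, g)\<close> so that it applies to both
    composites: over \<open>u1\<close> the values of \<open>f\<close> lie in \<open>y1\<close>,
    where \<open>(b, g)\<close> vanishes.\<close>
  have N: "null (a \<cdot> c') (g \<cdot> f') (a \<cdot> u1)"
    if pc: "pair b g" and pb: "is_pullback C c' f' f b" and n: "null b g y1" and [simp]: "Cod C b = Cod C b1" for b g c' f'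
  proof (rule nullI)
    note q = pullbackD[OF pb]
    note [simp] = pairD(1-3)[OF pc] q(1-4,6-8)
    fix w u assume [simp]: "w \<in> Ar C" "u \<in> Ar C" "Cod C w = Dom C (a \<cdot> c')" "Cod C u = Dom C (a \<cdot> u1)" "Dom C w = Dom C u"
      and w: "(a \<cdot> c') \<cdot> w = (a \<cdot> u1) \<cdot> u"
    have e: "c' \<cdot> w = u1 \<cdot> u" by (rule monoD[OF pairD(4)[OF p(1)]]) (use w in simp_all)
    have "b \<cdot> (f' \<cdot> w) = f \<cdot> (c' \<cdot> w)" by (rule comp_square[OF q(9)[symmetric]]) simp_all
    also have "\<dots> = y1 \<cdot> (v1 \<cdot> u)" unfolding e by (rule comp_square[OF r1(9)]) simp_all
    finally have "triv (g \<cdot> (f' \<cdot> w))" by - (rule nullD[OF n]; simp)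
    then show "triv ((g \<cdot> f') \<cdot> w)" by simp
  qed
  have N': "null (a \<cdot> c') (g \<cdot> f') a'"
    if pc: "pair b g" and pb: "is_pullback C c' f' f b" and [simp]: "Cod C b = Cod C b1" for b g c' f'
  proof (rule comp_null[OF p(1) pc pb])
    show "null a f a'" by (rule null_disjoint[OF a']) simp_all
  qed simp_all
  show ?thesis
  proof (rule simI[OF pair_comp[OF p(1,2) pb1] pair_comp[OF p(1,3) pb2] a' u])
    show "agree (a \<cdot> a1') (g1 \<cdot> f1') (a \<cdot> a2') (g2 \<cdot> f2') (a \<cdot> u0)" unfolding agree_def
      by (rule bexI[of _ w1], rule bexI[of _ w2])
        (simp_all add: w1e w2e comp_square[OF eq(3)])
    show "null (a \<cdot> a1') (g1 \<cdot> f1') (a \<cdot> u1)" by (rule N[OF p(2) pb1 y(3)]) simp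
    show "null (a \<cdot> a2') (g2 \<cdot> f2') (a \<cdot> u1)" by (rule N[OF p(3) pb2 y(4)]) simp
    show "null (a \<cdot> a1') (g1 \<cdot> f1') a'" by (rule N'[OF p(2) pb1]) simp
    show "null (a \<cdot> a2') (g2 \<cdot> f2') a'" by (rule N'[OF p(3) pb2]) simp
  qed simp
qed

end

section \<open>The stable category of an extensive category\<close>

text \<open>The construction of \<open>Stab\<close> uses preorders only through their category and
  the class of trivial objects. These copies have both as parameters; they agree with the given
  definitions by unfolding, see \<open>Stab_eq\<close>.\<close>

definition stable_cong :: "('o, 'm) cat \<Rightarrow> 'o set \<Rightarrow> (('m \<times> 'm) set \<times> ('m \<times> 'm) set) set" where
  "stable_cong D \<Z> = {(P, Q). P \<in> Ar (Partial D) \<and> Q \<in> Ar (Partial D) \<and>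
     Dom (Partial D) P = Dom (Partial D) Q \<and> Cod (Partial D) P = Cod (Partial D) Q \<and>
     (\<exists>p \<in> P. \<exists>q \<in> Q. pair_sim D \<Z> p q)}"

definition stable_cat :: "('o, 'm) cat \<Rightarrow> 'o set \<Rightarrow> ('o, ('m \<times> 'm) set set) cat" where
  "stable_cat D \<Z> = quotient_cat (Partial D) (stable_cong D \<Z>)"

definition stable_class :: "('o, 'm) cat \<Rightarrow> 'o set \<Rightarrow> 'm \<Rightarrow> 'm \<Rightarrow> ('m \<times> 'm) set set" where
  "stable_class D \<Z> a f = stable_cong D \<Z> `` {partial_iso D `` {(a, f)}}"

section \<open>Isomorphism classes of partial morphisms\<close>

context triv_cat
begin

abbreviation pcls :: "'m \<Rightarrow> 'm \<Rightarrow> ('m \<times> 'm) set" where "pcls a f \<equiv> partial_iso C `` {(a, f)}"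
abbreviation cls :: "'m \<Rightarrow> 'm \<Rightarrow> ('m \<times> 'm) set set" where "cls \<equiv> stable_class C \<Z>"
abbreviation St :: "('o, ('m \<times> 'm) set set) cat" where "St \<equiv> stable_cat C \<Z>"
abbreviation emb :: "'m \<Rightarrow> ('m \<times> 'm) set set" where "emb f \<equiv> stable_class C \<Z> (Ident C (Dom C f)) f"

lemma piso_iff:
  "((a, f), (b, g)) \<in> partial_iso C \<longleftrightarrow> pair a f \<and> pair b g \<and>
     (\<exists>i. is_iso C i \<and> Dom C i = Dom C a \<and> Cod C i = Dom C b \<and> b \<cdot> i = a \<and> g \<cdot> i = f)"
proof -
  have "((a, f), (b, g)) \<in> partial_iso C \<longleftrightarrow> pair a f \<and> pair b g \<and>
    (\<exists>i \<in> hom C (Dom C a) (Dom C b). is_iso C i \<and> b \<cdot> i = a \<and> g \<cdot> i = f)"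
    by (simp add: partial_iso_def pair_partial del: in_hom)
  also have "\<dots> \<longleftrightarrow> pair a f \<and> pair b g \<and>
     (\<exists>i. is_iso C i \<and> Dom C i = Dom C a \<and> Cod C i = Dom C b \<and> b \<cdot> i = a \<and> g \<cdot> i = f)"
    unfolding Bex_def in_hom using iso_arr by blast
  finally show ?thesis .
qed

lemma piso_equiv: "equiv (partial_pairs C) (partial_iso C)"
proof (rule equivI)
  show "partial_iso C \<subseteq> partial_pairs C \<times> partial_pairs C"
    by (auto simp: partial_iso_def)
  show "refl_on (partial_pairs C) (partial_iso C)"
  proof (rule refl_onI)
    fix x assume "x \<in> partial_pairs C"
    then obtain a f where x: "x = (a, f)" and p: "pair a f" by (cases x) (simp add: pair_partial)
    show "(x, x) \<in> partial_iso C" unfolding x piso_iff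
      by (intro conjI p exI[of _ "Ident C (Dom C a)"]) (simp_all add: pairD(1-3)[OF p])
  qed
  show "sym (partial_iso C)"
  proof (rule symI)
    fix x y assume "(x, y) \<in> partial_iso C"
    moreover obtain a f where x: "x = (a, f)" by (cases x)
    moreover obtain b g where y: "y = (b, g)" by (cases y)
    ultimately obtain i where p: "pair a f" "pair b g" and i: "is_iso C i" "Dom C i = Dom C a"
      "Cod C i = Dom C b" and e: "b \<cdot> i = a" "g \<cdot> i = f"
      by (auto simp: piso_iff)
    obtain i' where i' [simp]: "i \<in> Ar C" "i' \<in> Ar C" "Dom C i' = Cod C i" "Cod C i' = Dom C i"
      "i' \<cdot> i = Ident C (Dom C i)" "i \<cdot> i' = Ident C (Cod C i)" and ii: "is_iso C i'" by (rule isoE[OF i(1)])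
    note [simp] = i(2,3) pairD(1-3)[OF p(2)]
    have "(b \<cdot> i) \<cdot> i' = b" "(g \<cdot> i) \<cdot> i' = g" by simp_all
    then show "(y, x) \<in> partial_iso C" unfolding x y piso_iff e
      by (intro conjI p exI[of _ i'] ii) simp_all
  qed
  show "trans (partial_iso C)"
  proof (rule transI)
    fix x y z assume "(x, y) \<in> partial_iso C" "(y, z) \<in> partial_iso C"
    moreover obtain a f where x: "x = (a, f)" by (cases x)
    moreover obtain b g where y: "y = (b, g)" by (cases y)
    moreover obtain c h where z: "z = (c, h)" by (cases z)
    ultimately have xy: "((a, f), (b, g)) \<in> partial_iso C" and yz: "((b, g), (c, h)) \<in> partial_iso C" by simp_all
    obtain i where p: "pair a f" "pair b g" and i: "is_iso C i" "Dom C i = Dom C a"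
      "Cod C i = Dom C b" and e: "b \<cdot> i = a" "g \<cdot> i = f" using xy unfolding piso_iff by blast
    obtain j where p': "pair c h" and j: "is_iso C j" "Dom C j = Dom C b" "Cod C j = Dom C c"
      and e': "c \<cdot> j = b" "h \<cdot> j = g" using yz unfolding piso_iff by blast
    note p = p p'
    show "(x, z) \<in> partial_iso C" unfolding x z piso_iff
    proof (intro conjI p exI[of _ "j \<cdot> i"])
      note [simp] = i(2,3) j(2,3) iso_arr[OF i(1)] iso_arr[OF j(1)] pairD(1-3)[OF p(3)]
      show "is_iso C (j \<cdot> i)" by (rule iso_comp[OF i(1) j(1)]) simp
      show "c \<cdot> (j \<cdot> i) = a" "h \<cdot> (j \<cdot> i) = f" using e by (simp_all add: comp_tri[OF e'(1)] comp_tri[OF e'(2)])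
    qed (simp_all add: i j iso_arr[OF i(1)] iso_arr[OF j(1)])
  qed
qed

text \<open>The piece of agreement is \<open>a\<close> itself. Its complement also misses
  \<open>b\<close>, since \<open>a\<close> and \<open>b\<close> are the same subobject up to
  \<open>i\<close>.\<close>

lemma piso_sim:
  assumes "((a, f), (b, g)) \<in> partial_iso C"
  shows "sim a f b g"
proof -
  obtain i where p: "pair a f" "pair b g" and i: "is_iso C i" "Dom C i = Dom C a"
      "Cod C i = Dom C b" and e: "b \<cdot> i = a" "g \<cdot> i = f" using assms by (auto simp: piso_iff)
  obtain i' where i' [simp]: "i \<in> Ar C" "i' \<in> Ar C" "Dom C i' = Cod C i" "Cod C i' = Dom C i"
    "i' \<cdot> i = Ident C (Dom C i)" "i \<cdot> i' = Ident C (Cod C i)" and ii: "is_iso C i'" by (rule isoE[OF i(1)])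
  obtain a' where a': "is_coproduct C a a'" using complementedE[OF pairD(5)[OF p(1)]] .
  note [simp] = i(2,3) coproductD[OF a'] pairD(1-3)[OF p(1)] pairD(1-3)[OF p(2)]
  have [simp]: "Cod C b = Cod C a" using comp_arr(3)[of i b] e(1) by simp
  have "agree a f b g a" unfolding agree_def
    by (rule bexI[of _ "Ident C (Dom C a)"], rule bexI[of _ i]) (simp_all add: e)
  moreover have "null a f a'" by (rule null_disjoint[OF a']) simp_all
  moreover have "null b g a'"
  proof (rule nullI)
    fix w u assume [simp]: "w \<in> Ar C" "u \<in> Ar C" "Cod C w = Dom C b" "Cod C u = Dom C a'" "Dom C w = Dom C u"
      and w: "b \<cdot> w = a' \<cdot> u"
    have "a \<cdot> (i' \<cdot> w) = b \<cdot> (i \<cdot> (i' \<cdot> w))" by (simp add: comp_tri[OF e(1)])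
    also have "\<dots> = a' \<cdot> u" by (simp add: comp_tri[OF i'(6)] w)
    finally have "is_initial C (Dom C u)" by - (rule disjoint[OF a', of "i' \<cdot> w"]; simp)
    then show "triv (g \<cdot> w)" by - (rule triv_from_initial; simp)
  qed
  ultimately show ?thesis unfolding sim_def using a' by blast
qed

lemma piso_self: "pair a f \<Longrightarrow> (a, f) \<in> pcls a f"
  using equiv_class_self[OF piso_equiv, of "(a, f)"] by (simp add: pair_partial)

lemma Partial_Ob [simp]: "Ob (Partial C) = Ob C"
  by (simp add: Partial_def)

lemma Partial_Ar: "P \<in> Ar (Partial C) \<longleftrightarrow> (\<exists>a f. pair a f \<and> P = pcls a f)"
proof -
  have "P \<in> Ar (Partial C) \<longleftrightarrow> (\<exists>x \<in> partial_pairs C. P = partial_iso C `` {x})"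
    by (auto simp: Partial_def quotient_def)
  also have "\<dots> \<longleftrightarrow> (\<exists>a f. pair a f \<and> P = pcls a f)"
    unfolding Bex_def split_paired_Ex pair_partial ..
  finally show ?thesis .
qed

lemma Partial_Dom:
  assumes "pair a f"
  shows "Dom (Partial C) (pcls a f) = Cod C a"
proof -
  have "the_elem ((\<lambda>(a, f). Cod C a) ` pcls a f) = Cod C a"
  proof (rule the_elem_image_unique)
    show "pcls a f \<noteq> {}" using piso_self[OF assms] by blast
    fix y assume "y \<in> pcls a f"
    moreover obtain b g where y: "y = (b, g)" by (cases y)
    ultimately have "sim a f b g" "pair b g" using piso_sim by (auto simp: piso_iff)
    then show "(case y of (a, f) \<Rightarrow> Cod C a) = Cod C a"
      by - (erule simE[OF _ assms]; simp add: y)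
  qed
  then show ?thesis by (simp add: Partial_def)
qed

lemma Partial_Cod:
  assumes "pair a f"
  shows "Cod (Partial C) (pcls a f) = Cod C f"
proof -
  have "the_elem ((\<lambda>(a, f). Cod C f) ` pcls a f) = Cod C f"
  proof (rule the_elem_image_unique)
    show "pcls a f \<noteq> {}" using piso_self[OF assms] by blast
    fix y assume "y \<in> pcls a f"
    moreover obtain b g where y: "y = (b, g)" by (cases y)
    ultimately have "sim a f b g" "pair b g" using piso_sim by (auto simp: piso_iff)
    then show "(case y of (a, f) \<Rightarrow> Cod C f) = Cod C f"
      by - (erule simE[OF _ assms]; simp add: y)
  qed
  then show ?thesis by (simp add: Partial_def)
qed

text \<open>The composite of two classes collects all representatives and all pullbacks. Different
  choices give isomorphic pairs, because pullbacks are unique up to isomorphism and may be moved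
  between representatives; conversely every pair in the class of one composite occurs among
  them.\<close>

lemma Partial_Comp:
  assumes p: "pair a f" "pair b g" and pb: "is_pullback C a' f' f b"
  shows "Comp (Partial C) (pcls b g) (pcls a f) = pcls (a \<cdot> a') (g \<cdot> f')"
proof -
  note q = pullbackD[OF pb]
  note pc = pair_comp[OF p pb]
  note [simp] = q(1-4,6-8) pairD(1-3)[OF p(1)] pairD(1-3)[OF p(2)]
  have "{(c \<cdot> c', h \<cdot> d') | c d e h c' d'. (c, d) \<in> pcls a f \<and> (e, h) \<in> pcls b g \<and> is_pullback C c' d' d e}
    = pcls (a \<cdot> a') (g \<cdot> f')" (is "?L = ?R")
  proof
    show "?L \<subseteq> ?R"
    proof
      fix x assume "x \<in> ?L"
      then obtain c d e h c' d' where x: "x = (c \<cdot> c', h \<cdot> d')" and cd: "((a, f), (c, d)) \<in> partial_iso C"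
        and eh: "((b, g), (e, h)) \<in> partial_iso C" and pb': "is_pullback C c' d' d e" by auto
      obtain i where pcd: "pair c d" and i: "is_iso C i" "Dom C i = Dom C a" "Cod C i = Dom C c" "c \<cdot> i = a" "d \<cdot> i = f"
        using cd by (auto simp: piso_iff)
      obtain j where peh: "pair e h" and j: "is_iso C j" "Dom C j = Dom C b" "Cod C j = Dom C e" "e \<cdot> j = b" "h \<cdot> j = g"
        using eh by (auto simp: piso_iff)
      have "is_pullback C (i \<cdot> a') (j \<cdot> f') d e"
        using i j pairD[OF pcd] pairD[OF peh] pb by (intro pullback_base_iso) simp_all
      then obtain k where k: "is_iso C k" "Dom C k = Dom C (i \<cdot> a')" "Cod C k = Dom C c'" "c' \<cdot> k = i \<cdot> a'" "d' \<cdot> k = j \<cdot> f'"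
        by (rule pullback_unique[OF pb'])
      note q' = pullbackD[OF pb']
      note [simp] = q'(1-4,6-8) pairD(1-3)[OF pcd] pairD(1-3)[OF peh] iso_arr[OF i(1)] iso_arr[OF j(1)]
        iso_arr[OF k(1)] i(2,3) j(2,3) k(2,3)
      show "x \<in> ?R" unfolding x Image_singleton_iff piso_iff
      proof (intro conjI pc pair_comp[OF pcd peh pb'] exI[of _ k] k(1))
        show "(c \<cdot> c') \<cdot> k = a \<cdot> a'" by (simp add: k(4) comp_tri[OF i(4)])
        show "(h \<cdot> d') \<cdot> k = g \<cdot> f'" by (simp add: k(5) comp_tri[OF j(5)])
      qed simp_all
    qed
    show "?R \<subseteq> ?L"
    proof
      fix x assume x: "x \<in> ?R"
      obtain c h where xe: "x = (c, h)" by (cases x)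
      have "((c, h), (a \<cdot> a', g \<cdot> f')) \<in> partial_iso C"
        using x equivE[OF piso_equiv] unfolding xe by (metis Image_singleton_iff symD)
      then obtain l where l: "is_iso C l" "Dom C l = Dom C c" "Cod C l = Dom C (a \<cdot> a')"
        "(a \<cdot> a') \<cdot> l = c" "(g \<cdot> f') \<cdot> l = h" by (auto simp: piso_iff)
      note [simp] = iso_arr[OF l(1)]
      \<comment> \<open>An arbitrary member of the class differs from the chosen composite by an
        isomorphism \<open>l\<close>; precomposing the pullback projections with \<open>l\<close>
        realises that member as a composite of the same two representatives.\<close>
      have "is_pullback C (a' \<cdot> l) (f' \<cdot> l) f b" by (rule pullback_iso[OF pb l(1)]) (use l(3) in simp)
      moreover have "x = (a \<cdot> (a' \<cdot> l), g \<cdot> (f' \<cdot> l))" using l(3-5) by (simp add: xe)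
      ultimately show "x \<in> ?L" using piso_self[OF p(1)] piso_self[OF p(2)] by blast
    qed
  qed
  then show ?thesis by (simp add: Partial_def)
qed

section \<open>The quotient by the congruence\<close>

lemma cong_iff:
  assumes p: "pair a f" "pair b g"
  shows "(pcls a f, pcls b g) \<in> stable_cong C \<Z> \<longleftrightarrow> sim a f b g"
proof
  assume "(pcls a f, pcls b g) \<in> stable_cong C \<Z>"
  then obtain c h d k where 1: "((a, f), (c, h)) \<in> partial_iso C" and 2: "((b, g), (d, k)) \<in> partial_iso C"
    and 3: "pair_sim C \<Z> (c, h) (d, k)" unfolding stable_cong_def by auto
  have q: "pair c h" "pair d k" using 1 2 by (simp_all add: piso_iff)
  have "sim a f c h" "sim c h d k" "sim d k b g"
    using piso_sim[OF 1] sim_sym[OF piso_sim[OF 2]] 3 pair_sim_iff[OF q] by auto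
  then show "sim a f b g" using sim_trans p q by metis
next
  assume s: "sim a f b g"
  then have "Cod C b = Cod C a" "Cod C g = Cod C f" using simE[OF s p] by metis+
  then show "(pcls a f, pcls b g) \<in> stable_cong C \<Z>"
    unfolding stable_cong_def using p s pair_sim_iff[OF p] piso_self[OF p(1)] piso_self[OF p(2)]
    by (auto simp: Partial_Ar Partial_Dom Partial_Cod simp del: Image_singleton_iff)
qed

lemma cong_equiv: "equiv (Ar (Partial C)) (stable_cong C \<Z>)"
proof (rule equivI)
  show sub: "stable_cong C \<Z> \<subseteq> Ar (Partial C) \<times> Ar (Partial C)" by (auto simp: stable_cong_def)
  show "refl_on (Ar (Partial C)) (stable_cong C \<Z>)"
    by (rule refl_onI) (metis Partial_Ar cong_iff sim_refl)
  show "sym (stable_cong C \<Z>)"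
  proof (rule symI)
    fix x y assume xy: "(x, y) \<in> stable_cong C \<Z>"
    then have "x \<in> Ar (Partial C)" "y \<in> Ar (Partial C)" using sub by blast+
    then obtain a f b g where "pair a f" "pair b g" "x = pcls a f" "y = pcls b g"
      unfolding Partial_Ar by blast
    then show "(y, x) \<in> stable_cong C \<Z>" using xy cong_iff sim_sym by metis
  qed
  show "trans (stable_cong C \<Z>)"
  proof (rule transI)
    fix x y z assume xy: "(x, y) \<in> stable_cong C \<Z>" and yz: "(y, z) \<in> stable_cong C \<Z>"
    obtain a f where 1: "pair a f" "x = pcls a f" using sub xy Partial_Ar by blast
    obtain b g where 2: "pair b g" "y = pcls b g" using sub xy Partial_Ar by blast
    obtain c h where 3: "pair c h" "z = pcls c h" using sub yz Partial_Ar by blast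
    have "sim a f b g" "sim b g c h" using xy yz 1 2 3 cong_iff by metis+
    then show "(x, z) \<in> stable_cong C \<Z>" using 1 2 3 cong_iff sim_trans by metis
  qed
qed

lemma cls_mem:
  assumes "pair a f"
  shows "Q \<in> cls a f \<longleftrightarrow> (\<exists>b g. pair b g \<and> sim a f b g \<and> Q = pcls b g)"
proof
  assume "Q \<in> cls a f"
  then have Q: "(pcls a f, Q) \<in> stable_cong C \<Z>" by (simp add: stable_class_def)
  then have "Q \<in> Ar (Partial C)" by (simp add: stable_cong_def)
  then obtain b g where b: "pair b g" "Q = pcls b g" by (auto simp: Partial_Ar)
  then have "sim a f b g" using Q cong_iff[OF assms b(1)] by simp
  with b show "\<exists>b g. pair b g \<and> sim a f b g \<and> Q = pcls b g" by blast
next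
  assume "\<exists>b g. pair b g \<and> sim a f b g \<and> Q = pcls b g"
  then obtain b g where "pair b g" "sim a f b g" "Q = pcls b g" by blast
  then show "Q \<in> cls a f" using cong_iff[OF assms, of b g] by (simp add: stable_class_def)
qed

lemma St_Ob [simp]: "Ob St = Ob C"
  by (simp add: stable_cat_def quotient_cat_def)

lemma cls_arr: "pair a f \<Longrightarrow> cls a f \<in> Ar St"
  unfolding stable_cat_def quotient_cat_def stable_class_def cat.simps
  by (rule quotientI) (use Partial_Ar in blast)

lemma St_arrE:
  assumes "K \<in> Ar St"
  obtains a f where "pair a f" "K = cls a f"
proof -
  have "K \<in> Ar (Partial C) // stable_cong C \<Z>"
    using assms by (simp add: stable_cat_def quotient_cat_def)
  then obtain P where "P \<in> Ar (Partial C)" "K = stable_cong C \<Z> `` {P}" by (rule quotientE)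
  then show thesis using that by (auto simp: Partial_Ar stable_class_def)
qed

lemma cls_eq_iff:
  assumes "pair a f" "pair b g"
  shows "cls a f = cls b g \<longleftrightarrow> sim a f b g"
proof -
  have "pcls a f \<in> Ar (Partial C)" "pcls b g \<in> Ar (Partial C)" using assms by (auto simp: Partial_Ar)
  then show ?thesis unfolding stable_class_def eq_equiv_class_iff[OF cong_equiv] cong_iff[OF assms]
    using eq_equiv_class_iff[OF cong_equiv] cong_iff[OF assms] by simp
qed

lemma cls_Dom:
  assumes "pair a f"
  shows "Dom St (cls a f) = Cod C a" "Cod St (cls a f) = Cod C f"
proof -
  have s: "pcls a f \<in> cls a f" using cls_mem[OF assms] assms sim_refl by blast
  have "the_elem (Dom (Partial C) ` cls a f) = Cod C a"
  proof (rule the_elem_image_unique)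
    show "cls a f \<noteq> {}" using s by blast
    fix y assume "y \<in> cls a f"
    then obtain b g where y: "pair b g" "sim a f b g" "y = pcls b g" using cls_mem[OF assms] by blast
    then show "Dom (Partial C) y = Cod C a"
      by - (erule simE[OF _ assms]; simp add: Partial_Dom)
  qed
  then show "Dom St (cls a f) = Cod C a" by (simp add: stable_cat_def quotient_cat_def)
  have "the_elem (Cod (Partial C) ` cls a f) = Cod C f"
  proof (rule the_elem_image_unique)
    show "cls a f \<noteq> {}" using s by blast
    fix y assume "y \<in> cls a f"
    then obtain b g where y: "pair b g" "sim a f b g" "y = pcls b g" using cls_mem[OF assms] by blast
    then show "Cod (Partial C) y = Cod C f"
      by - (erule simE[OF _ assms]; simp add: Partial_Cod)
  qed
  then show "Cod St (cls a f) = Cod C f" by (simp add: stable_cat_def quotient_cat_def)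
qed

text \<open>Composition in the quotient is the image of a whole set of composites under the
  congruence. All of them are equivalent, so the image is one class and may be computed from any
  representatives and any pullback.\<close>

lemma cls_Comp:
  assumes p: "pair a f" "pair b g" and pb: "is_pullback C a' f' f b"
  shows "Comp St (cls b g) (cls a f) = cls (a \<cdot> a') (g \<cdot> f')"
proof -
  let ?r = "stable_cong C \<Z>"
  let ?M = "{Comp (Partial C) G F | F G. F \<in> cls a f \<and> G \<in> cls b g}"
  note q = pullbackD[OF pb]
  note pc = pair_comp[OF p pb]
  have M: "?r `` {x} = ?r `` {pcls (a \<cdot> a') (g \<cdot> f')}" if xM: "x \<in> ?M" for x
  proof -
    obtain F G where x: "x = Comp (Partial C) G F" and F: "F \<in> cls a f" and G: "G \<in> cls b g" using xM by blast
    obtain a1 f1 where 1: "pair a1 f1" "sim a f a1 f1" "F = pcls a1 f1" using F cls_mem[OF p(1)] by blast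
    obtain b1 g1 where 2: "pair b1 g1" "sim b g b1 g1" "G = pcls b1 g1" using G cls_mem[OF p(2)] by blast
    have [simp]: "Cod C f1 = Cod C f" "Cod C b1 = Cod C b" "Cod C f = Cod C b"
      using simE[OF 1(2) p(1) 1(1)] simE[OF 2(2) p(2) 2(1)] q(5) by metis+
    note [simp] = pairD(1-3)[OF p(1)] pairD(1-3)[OF p(2)] pairD(1-3)[OF 1(1)] pairD(1-3)[OF 2(1)]
    obtain c d where cd: "is_pullback C c d f1 b1" by (rule pullback_ex[of f1 b1]) simp_all
    obtain c' d' where cd': "is_pullback C c' d' f1 b" by (rule pullback_ex[of f1 b]) simp_all
    \<comment> \<open>The representatives are exchanged one at a time, through the composite of
      \<open>(a1, f1)\<close> with \<open>(b, g)\<close>.\<close>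
    have "sim (a \<cdot> a') (g \<cdot> f') (a1 \<cdot> c') (g \<cdot> d')" by (rule sim_comp_left[OF p(1) 1(1) p(2) 1(2) pb cd'])
    moreover have "sim (a1 \<cdot> c') (g \<cdot> d') (a1 \<cdot> c) (g1 \<cdot> d)" by (rule sim_comp_right[OF 1(1) p(2) 2(1) 2(2) cd' cd])
    ultimately have "sim (a \<cdot> a') (g \<cdot> f') (a1 \<cdot> c) (g1 \<cdot> d)"
      using sim_trans[OF pc pair_comp[OF 1(1) p(2) cd'] pair_comp[OF 1(1) 2(1) cd]] by blast
    then have "cls (a \<cdot> a') (g \<cdot> f') = cls (a1 \<cdot> c) (g1 \<cdot> d)"
      using cls_eq_iff[OF pc pair_comp[OF 1(1) 2(1) cd]] by simp
    then show ?thesis unfolding x 1(3) 2(3) Partial_Comp[OF 1(1) 2(1) cd] by (simp add: stable_class_def)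
  qed
  have "pcls a f \<in> cls a f" "pcls b g \<in> cls b g"
    unfolding cls_mem[OF p(1)] cls_mem[OF p(2)] using sim_refl p by metis+
  then have "pcls (a \<cdot> a') (g \<cdot> f') \<in> ?M"
    by (intro CollectI exI conjI) (rule Partial_Comp[OF p pb, symmetric], assumption+)
  then have "?r `` ?M = ?r `` {pcls (a \<cdot> a') (g \<cdot> f')}" using M by blast
  then show ?thesis by (simp add: stable_cat_def quotient_cat_def stable_class_def)
qed

section \<open>Total morphisms, and the category axioms for the quotient\<close>

lemma St_Ident: "Ident St A = cls (Ident C A) (Ident C A)"
  by (simp add: stable_cat_def quotient_cat_def stable_class_def Partial_def)

lemma pair_ident [simp]: "f \<in> Ar C \<Longrightarrow> Dom C f = A \<Longrightarrow> pair (Ident C A) f"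
  by (auto simp: pair_def)

lemma emb_arr [simp]:
  assumes "f \<in> Ar C" "Dom C f = A"
  shows "cls (Ident C A) f \<in> Ar St" "Dom St (cls (Ident C A) f) = A" "Cod St (cls (Ident C A) f) = Cod C f"
  using assms cls_arr cls_Dom[of "Ident C A" f] by auto

text \<open>Pulling back an identity changes nothing, so a total morphism on the left leaves the
  domain of definition alone. Questions about postcomposition thus reduce to second
  components.\<close>

lemma emb_comp_cls:
  assumes "pair a f" "g \<in> Ar C" "Cod C f = Dom C g"
  shows "Comp St (emb g) (cls a f) = cls a (g \<cdot> f)"
proof -
  note [simp] = pairD(1-3)[OF assms(1)]
  have "is_pullback C (Ident C (Dom C f)) f f (Ident C (Dom C g))"
    using pullback_ident[of f] assms by simp
  from cls_Comp[OF assms(1) _ this] assms show ?thesis by simp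
qed

lemma cls_comp_emb:
  assumes "f \<in> Ar C" "pair b g" "is_pullback C a' f' f b"
  shows "Comp St (cls b g) (emb f) = cls a' (g \<cdot> f')"
  using cls_Comp[OF _ assms(2,3), of "Ident C (Dom C f)"] assms(1) pullbackD[OF assms(3)] by simp

lemma emb_comp:
  assumes "f \<in> Ar C" "g \<in> Ar C" "Cod C f = Dom C g"
  shows "emb (g \<cdot> f) = Comp St (emb g) (emb f)"
  using emb_comp_cls[of "Ident C (Dom C f)" f g] assms by simp

lemma St_category: "category St"
proof
  fix F assume "F \<in> Ar St"
  then obtain a f where p: "pair a f" and F: "F = cls a f" by (rule St_arrE)
  show "Dom St F \<in> Ob St" "Cod St F \<in> Ob St" using pairD[OF p] by (simp_all add: F cls_Dom[OF p])
next
  fix A assume "A \<in> Ob St"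
  then show "Ident St A \<in> hom St A A" using emb_arr[of "Ident C A"] by (simp add: St_Ident)
next
  fix F X Y G Z assume FG: "F \<in> hom St X Y" "G \<in> hom St Y Z"
  then obtain a f where p: "pair a f" and F: "F = cls a f" by (auto elim: St_arrE)
  obtain b g where p': "pair b g" and G: "G = cls b g" using FG by (auto elim: St_arrE)
  note [simp] = pairD(1-3)[OF p] pairD(1-3)[OF p'] cls_Dom[OF p] cls_Dom[OF p']
  have c [simp]: "Cod C f = Cod C b" using FG by (simp add: F G)
  obtain a' f' where pb: "is_pullback C a' f' f b" by (rule pullback_ex[of f b]) simp_all
  note pc = pair_comp[OF p p' pb]
  show "Comp St G F \<in> hom St X Z" unfolding F G cls_Comp[OF p p' pb]
    using FG cls_arr[OF pc] cls_Dom[OF pc] pullbackD(1-4,6-8)[OF pb] by (simp add: F G)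
next
  fix F X Y assume FX: "F \<in> hom St X Y"
  then obtain a f where p: "pair a f" and F: "F = cls a f" by (auto elim: St_arrE)
  note [simp] = pairD(1-3)[OF p] cls_Dom[OF p]
  have X: "X = Cod C a" "Y = Cod C f" using FX by (simp_all add: F)
  have "is_pullback C a (Ident C (Dom C a)) (Ident C (Cod C a)) a"
    by (rule pullback_sym[OF pullback_ident]) simp
  from cls_Comp[OF _ p this, of "Ident C (Cod C a)"] show "Comp St F (Ident St X) = F"
    by (simp add: St_Ident F X)
  have "is_pullback C (Ident C (Dom C f)) f f (Ident C (Cod C f))" by (rule pullback_ident) simp
  from cls_Comp[OF p _ this, of "Ident C (Cod C f)"] show "Comp St (Ident St Y) F = F"
    by (simp add: St_Ident F X)
next
  fix F W X G Y H Z assume FGH: "F \<in> hom St W X" "G \<in> hom St X Y" "H \<in> hom St Y Z"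
  obtain a f where p1: "pair a f" and F: "F = cls a f" using FGH by (auto elim: St_arrE)
  obtain b g where p2: "pair b g" and G: "G = cls b g" using FGH by (auto elim: St_arrE)
  obtain c h where p3: "pair c h" and H: "H = cls c h" using FGH by (auto elim: St_arrE)
  note [simp] = pairD(1-3)[OF p1] pairD(1-3)[OF p2] pairD(1-3)[OF p3] cls_Dom[OF p1] cls_Dom[OF p2] cls_Dom[OF p3]
  have [simp]: "Cod C f = Cod C b" "Cod C g = Cod C c" using FGH by (simp_all add: F G H)
  obtain a' f' where pa: "is_pullback C a' f' f b" by (rule pullback_ex[of f b]) simp_all
  obtain b' g' where pb: "is_pullback C b' g' g c" by (rule pullback_ex[of g c]) simp_all
  note q1 = pullbackD[OF pa] and q2 = pullbackD[OF pb]
  note [simp] = q1(1-4,6-8) q2(1-4,6-8)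
  obtain s t where st: "is_pullback C s t f' b'" by (rule pullback_ex[of f' b']) simp_all
  note q3 = pullbackD[OF st]
  note [simp] = q3(1-4,6-8)
  \<comment> \<open>Both bracketings are computed from the three squares \<open>pa\<close>,
    \<open>pb\<close> and \<open>st\<close>; by pasting, they get literally the same
    representative.\<close>
  have 1: "is_pullback C (a' \<cdot> s) t f (b \<cdot> b')" by (rule pullback_paste[OF pa st])
  have 2: "is_pullback C s (g' \<cdot> t) (g \<cdot> f') c"
    by (rule pullback_sym, rule pullback_paste[OF pullback_sym[OF pb] pullback_sym[OF st]])
  show "Comp St (Comp St H G) F = Comp St H (Comp St G F)"
    unfolding F G H cls_Comp[OF p2 p3 pb] cls_Comp[OF p1 p2 pa]
      cls_Comp[OF p1 pair_comp[OF p2 p3 pb] 1] cls_Comp[OF pair_comp[OF p1 p2 pa] p3 2]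
    by simp
qed

sublocale St: category St
  by (rule St_category)

end

section \<open>Kernels, cokernels and canonical sequences relative to a class of trivial
  objects\<close>

context category
begin

lemma Z_kernelD:
  assumes "is_Z_kernel C \<Z> k c"
  shows "c \<in> Ar C" "k \<in> Ar C" "Cod C k = Dom C c" "is_trivial C \<Z> (c \<cdot> k)"
proof -
  have "c \<in> Ar C \<and> k \<in> hom C (Dom C k) (Dom C c) \<and> is_trivial C \<Z> (c \<cdot> k)"
    using assms unfolding is_Z_kernel_def by (elim conjE) (intro conjI; assumption)
  then show "c \<in> Ar C" "k \<in> Ar C" "Cod C k = Dom C c" "is_trivial C \<Z> (c \<cdot> k)" by simp_all
qed

lemma Z_kernel_ex1:
  assumes "is_Z_kernel C \<Z> k c" "u \<in> Ar C" "Cod C u = Dom C c" "is_trivial C \<Z> (c \<cdot> u)"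
  shows "\<exists>!w. w \<in> hom C (Dom C u) (Dom C k) \<and> k \<cdot> w = u"
proof -
  have A: "\<forall>X. \<forall>u \<in> hom C X (Dom C c). is_trivial C \<Z> (c \<cdot> u) \<longrightarrow>
        (\<exists>!w. w \<in> hom C X (Dom C k) \<and> k \<cdot> w = u)"
    using assms(1) unfolding is_Z_kernel_def by (elim conjE) assumption
  have "u \<in> hom C (Dom C u) (Dom C c)" using assms(2,3) by simp
  from A[rule_format, OF this assms(4)] show ?thesis .
qed

lemma Z_kernelE:
  assumes "is_Z_kernel C \<Z> k c" "u \<in> Ar C" "Cod C u = Dom C c" "is_trivial C \<Z> (c \<cdot> u)"
  obtains w where "w \<in> Ar C" "Dom C w = Dom C u" "Cod C w = Dom C k" "k \<cdot> w = u"
  using ex1_implies_ex[OF Z_kernel_ex1[OF assms]] that by auto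

lemma Z_kernel_mono:
  assumes k: "is_Z_kernel C \<Z> k c"
  shows "is_mono C k"
proof (rule monoI)
  note [simp] = Z_kernelD(1-3)[OF k]
  fix u v assume uv: "u \<in> Ar C" "v \<in> Ar C" "Cod C u = Dom C k" "Cod C v = Dom C k"
    "Dom C u = Dom C v" "k \<cdot> u = k \<cdot> v"
  have "is_trivial C \<Z> ((c \<cdot> k) \<cdot> v)" by (rule trivial_comp2[OF Z_kernelD(4)[OF k]]) (use uv in simp_all)
  then have "\<exists>!w. w \<in> hom C (Dom C (k \<cdot> v)) (Dom C k) \<and> k \<cdot> w = k \<cdot> v"
    by (intro Z_kernel_ex1[OF k]) (use uv in simp_all)
  moreover have "u \<in> hom C (Dom C (k \<cdot> v)) (Dom C k)" "v \<in> hom C (Dom C (k \<cdot> v)) (Dom C k)"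
    using uv by simp_all
  ultimately show "u = v" using uv(6) by blast
qed (rule Z_kernelD(2)[OF k])

lemma Z_kernelI:
  assumes "c \<in> Ar C" "is_mono C k" "Cod C k = Dom C c" "is_trivial C \<Z> (c \<cdot> k)"
    and ex: "\<And>u. u \<in> Ar C \<Longrightarrow> Cod C u = Dom C c \<Longrightarrow> is_trivial C \<Z> (c \<cdot> u) \<Longrightarrow>
      \<exists>w \<in> Ar C. Dom C w = Dom C u \<and> Cod C w = Dom C k \<and> k \<cdot> w = u"
  shows "is_Z_kernel C \<Z> k c"
  unfolding is_Z_kernel_def
proof (intro conjI allI ballI impI)
  show "k \<in> hom C (Dom C k) (Dom C c)" using assms mono_arr by simp
  fix X u assume u: "u \<in> hom C X (Dom C c)" "is_trivial C \<Z> (c \<cdot> u)"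
  then obtain w where w: "w \<in> Ar C" "Dom C w = X" "Cod C w = Dom C k" "k \<cdot> w = u"
    using ex[of u] by auto
  show "\<exists>!w. w \<in> hom C X (Dom C k) \<and> k \<cdot> w = u"
  proof (rule ex1I[of _ w])
    fix w' assume "w' \<in> hom C X (Dom C k) \<and> k \<cdot> w' = u"
    then show "w' = w" using w by - (rule monoD[OF assms(2)]; simp)
  qed (use w in simp)
qed (use assms in simp_all)

lemma Z_cokernelD:
  assumes "is_Z_cokernel C \<Z> c k"
  shows "k \<in> Ar C" "c \<in> Ar C" "Dom C c = Cod C k" "is_trivial C \<Z> (c \<cdot> k)"
proof -
  have "k \<in> Ar C \<and> c \<in> hom C (Cod C k) (Cod C c) \<and> is_trivial C \<Z> (c \<cdot> k)"
    using assms unfolding is_Z_cokernel_def by (elim conjE) (intro conjI; assumption)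
  then show "k \<in> Ar C" "c \<in> Ar C" "Dom C c = Cod C k" "is_trivial C \<Z> (c \<cdot> k)" by simp_all
qed

lemma Z_cokernel_ex1:
  assumes "is_Z_cokernel C \<Z> c k" "u \<in> Ar C" "Dom C u = Cod C k" "is_trivial C \<Z> (u \<cdot> k)"
  shows "\<exists>!w. w \<in> hom C (Cod C c) (Cod C u) \<and> w \<cdot> c = u"
proof -
  have A: "\<forall>Y. \<forall>u \<in> hom C (Cod C k) Y. is_trivial C \<Z> (u \<cdot> k) \<longrightarrow>
        (\<exists>!w. w \<in> hom C (Cod C c) Y \<and> w \<cdot> c = u)"
    using assms(1) unfolding is_Z_cokernel_def by (elim conjE) assumption
  have "u \<in> hom C (Cod C k) (Cod C u)" using assms(2,3) by simp
  from A[rule_format, OF this assms(4)] show ?thesis .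
qed

lemma Z_cokernelE:
  assumes "is_Z_cokernel C \<Z> c k" "u \<in> Ar C" "Dom C u = Cod C k" "is_trivial C \<Z> (u \<cdot> k)"
  obtains w where "w \<in> Ar C" "Dom C w = Cod C c" "Cod C w = Cod C u" "w \<cdot> c = u"
  using ex1_implies_ex[OF Z_cokernel_ex1[OF assms]] that by auto

lemma Z_cokernel_epi:
  assumes c: "is_Z_cokernel C \<Z> c k" and uv: "u \<in> Ar C" "v \<in> Ar C" "Dom C u = Cod C c" "Dom C v = Cod C c"
    "Cod C u = Cod C v" "u \<cdot> c = v \<cdot> c"
  shows "u = v"
proof -
  note [simp] = Z_cokernelD(1-3)[OF c]
  have "is_trivial C \<Z> (v \<cdot> (c \<cdot> k))" by (rule trivial_comp[OF Z_cokernelD(4)[OF c]]) (use uv in simp_all)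
  then have "\<exists>!w. w \<in> hom C (Cod C c) (Cod C (v \<cdot> c)) \<and> w \<cdot> c = v \<cdot> c"
    by (intro Z_cokernel_ex1[OF c]) (use uv in simp_all)
  moreover have "u \<in> hom C (Cod C c) (Cod C (v \<cdot> c))" "v \<in> hom C (Cod C c) (Cod C (v \<cdot> c))"
    using uv by simp_all
  ultimately show "u = v" using uv(6) by blast
qed

lemma Z_cokernelI:
  assumes "k \<in> Ar C" "c \<in> Ar C" "Dom C c = Cod C k" "is_trivial C \<Z> (c \<cdot> k)"
    and ex: "\<And>u. u \<in> Ar C \<Longrightarrow> Dom C u = Cod C k \<Longrightarrow> is_trivial C \<Z> (u \<cdot> k) \<Longrightarrow>
      \<exists>w \<in> Ar C. Dom C w = Cod C c \<and> Cod C w = Cod C u \<and> w \<cdot> c = u"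
    and epi: "\<And>u v. u \<in> Ar C \<Longrightarrow> v \<in> Ar C \<Longrightarrow> Dom C u = Cod C c \<Longrightarrow> Dom C v = Cod C c \<Longrightarrow>
      Cod C u = Cod C v \<Longrightarrow> u \<cdot> c = v \<cdot> c \<Longrightarrow> u = v"
  shows "is_Z_cokernel C \<Z> c k"
  unfolding is_Z_cokernel_def
proof (intro conjI allI ballI impI)
  show "c \<in> hom C (Cod C k) (Cod C c)" using assms by simp
  fix Y u assume u: "u \<in> hom C (Cod C k) Y" "is_trivial C \<Z> (u \<cdot> k)"
  then obtain w where w: "w \<in> Ar C" "Dom C w = Cod C c" "Cod C w = Y" "w \<cdot> c = u"
    using ex[of u] by auto
  show "\<exists>!w. w \<in> hom C (Cod C c) Y \<and> w \<cdot> c = u"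
  proof (rule ex1I[of _ w])
    fix w' assume "w' \<in> hom C (Cod C c) Y \<and> w' \<cdot> c = u"
    then show "w' = w" using w by - (rule epi; simp)
  qed (use w in simp)
qed (use assms in simp_all)

lemma canonical_seqD:
  assumes "canonical_seq C \<T> \<F> A k c"
  shows "is_Z_kernel C (\<T> \<inter> \<F>) k c" "is_Z_cokernel C (\<T> \<inter> \<F>) c k" "Cod C k = A" "Dom C c = A"
    "k \<in> Ar C" "c \<in> Ar C" "Dom C k \<in> \<T>" "Cod C c \<in> \<F>"
proof -
  show k: "is_Z_kernel C (\<T> \<inter> \<F>) k c" "is_Z_cokernel C (\<T> \<inter> \<F>) c k" "Cod C k = A"
     "Dom C k \<in> \<T>" "Cod C c \<in> \<F>"
    using assms by (simp_all add: canonical_seq_def short_Z_exact_def)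
  show "Dom C c = A" "k \<in> Ar C" "c \<in> Ar C" using Z_kernelD[OF k(1)] k(3) by simp_all
qed

lemma pretorsion_trivial:
  assumes "pretorsion_theory C \<T> \<F>" "f \<in> Ar C" "Dom C f \<in> \<T>" "Cod C f \<in> \<F>"
  shows "is_trivial C (\<T> \<inter> \<F>) f"
proof -
  have "\<forall>T \<in> \<T>. \<forall>F \<in> \<F>. \<forall>f \<in> hom C T F. is_trivial C (\<T> \<inter> \<F>) f"
    using assms(1) unfolding pretorsion_theory_def by (elim conjE) assumption
  moreover have "f \<in> hom C (Dom C f) (Cod C f)" using assms(2) by simp
  ultimately show ?thesis using assms(3,4) by blast
qed

text \<open>\<open>c \<cdot> k'\<close> and \<open>c' \<cdot> k\<close> lead from a torsion object
  to a torsion-free one and are therefore trivial, so each kernel factors through the other and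
  likewise each cokernel. The factorisations are inverse because kernels are monic and cokernels
  epic.\<close>

lemma canonical_unique:
  assumes pt: "pretorsion_theory C \<T> \<F>" and 1: "canonical_seq C \<T> \<F> A k c" and 2: "canonical_seq C \<T> \<F> A k' c'"
  obtains p q where "is_iso C p" "Dom C p = Dom C k'" "Cod C p = Dom C k" "k \<cdot> p = k'"
    "is_iso C q" "Dom C q = Cod C c'" "Cod C q = Cod C c" "q \<cdot> c' = c"
proof -
  note c1 = canonical_seqD[OF 1] and c2 = canonical_seqD[OF 2]
  note [simp] = c1(3-6) c2(3-6)
  have tr: "is_trivial C (\<T> \<inter> \<F>) f" if "f \<in> Ar C" "Dom C f \<in> \<T>" "Cod C f \<in> \<F>" for f
    by (rule pretorsion_trivial[OF pt that])
  have t: "is_trivial C (\<T> \<inter> \<F>) (c \<cdot> k')" "is_trivial C (\<T> \<inter> \<F>) (c' \<cdot> k)"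
    using c1(7,8) c2(7,8) by (auto intro!: tr)
  obtain p where p [simp]: "p \<in> Ar C" "Dom C p = Dom C k'" "Cod C p = Dom C k" and pk: "k \<cdot> p = k'"
    by (rule Z_kernelE[OF c1(1), of k']) (simp_all add: t)
  obtain p' where p' [simp]: "p' \<in> Ar C" "Dom C p' = Dom C k" "Cod C p' = Dom C k'" and pk': "k' \<cdot> p' = k"
    by (rule Z_kernelE[OF c2(1), of k]) (simp_all add: t)
  obtain q where q [simp]: "q \<in> Ar C" "Dom C q = Cod C c'" "Cod C q = Cod C c" and qc: "q \<cdot> c' = c"
    by (rule Z_cokernelE[OF c2(2), of c]) (simp_all add: t)
  obtain q' where q' [simp]: "q' \<in> Ar C" "Dom C q' = Cod C c" "Cod C q' = Cod C c'" and qc': "q' \<cdot> c = c'"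
    by (rule Z_cokernelE[OF c1(2), of c']) (simp_all add: t)
  have "p' \<cdot> p = Ident C (Dom C p)"
    by (rule monoD[OF Z_kernel_mono[OF c2(1)]]) (simp_all add: comp_tri[OF pk'] pk)
  moreover have "p \<cdot> p' = Ident C (Cod C p)"
    by (rule monoD[OF Z_kernel_mono[OF c1(1)]]) (simp_all add: comp_tri[OF pk] pk')
  ultimately have P: "is_iso C p" by (intro isoI[of p p']) simp_all
  have "q' \<cdot> q = Ident C (Dom C q)"
    by (rule Z_cokernel_epi[OF c2(2)]) (simp_all add: qc qc')
  moreover have "q \<cdot> q' = Ident C (Cod C q)"
    by (rule Z_cokernel_epi[OF c1(2)]) (simp_all add: qc qc')
  ultimately have "is_iso C q" by (intro isoI[of q q']) simp_all
  with P that pk qc show thesis by simp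
qed

text \<open>If both summands of a coproduct are cut in two, the first parts together and the second
  parts together cut the whole. This assembles partial morphisms, and witnesses of their
  equivalence, on a coproduct.\<close>

lemma coproduct_sum:
  assumes ij: "is_coproduct C i j" and a: "is_coproduct C a a'" "Cod C a = Dom C i"
    and b: "is_coproduct C b b'" "Cod C b = Dom C j"
    and p: "is_coproduct C p q" "Dom C p = Dom C a" "Dom C q = Dom C b"
    and r: "is_coproduct C r s" "Dom C r = Dom C a'" "Dom C s = Dom C b'"
    and m: "m \<in> Ar C" "Dom C m = Cod C p" "Cod C m = Cod C i" "m \<cdot> p = i \<cdot> a" "m \<cdot> q = j \<cdot> b"
    and n: "n \<in> Ar C" "Dom C n = Cod C r" "Cod C n = Cod C i" "n \<cdot> r = i \<cdot> a'" "n \<cdot> s = j \<cdot> b'"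
  shows "is_coproduct C m n"
proof -
  note [simp] = coproductD[OF ij] coproductD[OF a(1)] coproductD[OF b(1)] coproductD[OF p(1)] coproductD[OF r(1)]
    a(2) b(2) p(2,3) r(2,3) m(1-3) n(1-3)
  show ?thesis
  proof (rule coproductI)
    fix u v assume uv: "u \<in> Ar C" "v \<in> Ar C" "Dom C u = Dom C m" "Dom C v = Dom C n" "Cod C v = Cod C u"
    obtain f where f: "f \<in> Ar C" "Dom C f = Dom C i" "Cod C f = Cod C u" and fe: "f \<cdot> a = u \<cdot> p" "f \<cdot> a' = v \<cdot> r"
      by (rule copairE[OF a(1), of "u \<cdot> p" "v \<cdot> r"]) (use uv in simp_all)
    obtain g where g: "g \<in> Ar C" "Dom C g = Dom C j" "Cod C g = Cod C u" and ge: "g \<cdot> b = u \<cdot> q" "g \<cdot> b' = v \<cdot> s"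
      by (rule copairE[OF b(1), of "u \<cdot> q" "v \<cdot> s"]) (use uv in simp_all)
    obtain h where h: "h \<in> Ar C" "Dom C h = Cod C i" "Cod C h = Cod C u" and he: "h \<cdot> i = f" "h \<cdot> j = g"
      by (rule copairE[OF ij, of f g]) (use f g in simp_all)
    have "h \<cdot> m = u"
      by (rule coproduct_eqI[OF p(1)])
        (use uv f g h in \<open>simp_all add: m(4,5) comp_tri[OF he(1)] comp_tri[OF he(2)] fe ge\<close>)
    moreover have "h \<cdot> n = v"
      by (rule coproduct_eqI[OF r(1)])
        (use uv f g h in \<open>simp_all add: n(4,5) comp_tri[OF he(1)] comp_tri[OF he(2)] fe ge\<close>)
    ultimately show "\<exists>w\<in>Ar C. Dom C w = Cod C m \<and> Cod C w = Cod C u \<and> w \<cdot> m = u \<and> w \<cdot> n = v"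
      using h by (intro bexI[of _ h]) simp_all
  next
    fix f g assume fg: "f \<in> Ar C" "g \<in> Ar C" "Dom C f = Cod C m" "Dom C g = Cod C m" "Cod C f = Cod C g"
      "f \<cdot> m = g \<cdot> m" "f \<cdot> n = g \<cdot> n"
    have s: "f \<cdot> (m \<cdot> x) = g \<cdot> (m \<cdot> x)" if "x \<in> Ar C" "Cod C x = Dom C m" for x
      by (rule comp_square[OF fg(6)]) (use that fg(1-5) in simp_all)
    have s': "f \<cdot> (n \<cdot> x) = g \<cdot> (n \<cdot> x)" if "x \<in> Ar C" "Cod C x = Dom C n" for x
      by (rule comp_square[OF fg(7)]) (use that fg(1-5) in simp_all)
    show "f = g"
    proof (rule coproduct_eqI[OF ij])
      show "f \<cdot> i = g \<cdot> i"
        by (rule coproduct_eqI[OF a(1)]) (use fg(1-5) s[of p] s'[of r] in \<open>simp_all add: m(4) n(4)\<close>)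
      show "f \<cdot> j = g \<cdot> j"
        by (rule coproduct_eqI[OF b(1)]) (use fg(1-5) s[of q] s'[of s] in \<open>simp_all add: m(5) n(5)\<close>)
    qed (use fg in simp_all)
  qed simp_all
qed

end

section \<open>The torsion theory in the stable category\<close>

text \<open>Coproduct closure makes the sum of canonical sequences canonical. Closure under
  complemented subobjects handles arrows defined on a piece of a torsion object. Retracts recognise
  trivial objects by their identity, and they are all that an isomorphism of the stable category
  leaves on the pieces of its target.\<close>

locale pretor_cat = triv_cat C "\<T> \<inter> \<F>" for C :: "('o, 'm) cat" (structure) and \<T> \<F> :: "'o set" +
  assumes pretor: "pretorsion_theory C \<T> \<F>"
    and T_coproduct: "is_coproduct C i j \<Longrightarrow> Dom C i \<in> \<T> \<Longrightarrow> Dom C j \<in> \<T> \<Longrightarrow> Cod C i \<in> \<T>"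
    and F_coproduct: "is_coproduct C i j \<Longrightarrow> Dom C i \<in> \<F> \<Longrightarrow> Dom C j \<in> \<F> \<Longrightarrow> Cod C i \<in> \<F>"
    and T_complemented: "is_complemented C a \<Longrightarrow> Cod C a \<in> \<T> \<Longrightarrow> Dom C a \<in> \<T>"
    and F_complemented: "is_complemented C a \<Longrightarrow> Cod C a \<in> \<F> \<Longrightarrow> Dom C a \<in> \<F>"
    and T_retract: "r \<in> Ar C \<Longrightarrow> s \<in> Ar C \<Longrightarrow> Cod C s = Dom C r \<Longrightarrow> r \<cdot> s = Ident C (Dom C s) \<Longrightarrow>
      Dom C r \<in> \<T> \<Longrightarrow> Dom C s \<in> \<T>"
    and F_retract: "r \<in> Ar C \<Longrightarrow> s \<in> Ar C \<Longrightarrow> Cod C s = Dom C r \<Longrightarrow> r \<cdot> s = Ident C (Dom C s) \<Longrightarrow>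
      Dom C r \<in> \<F> \<Longrightarrow> Dom C s \<in> \<F>"
begin

section \<open>Trivial morphisms, zero objects and isomorphisms in the stable category\<close>

lemma TF_Ob: "\<T> \<subseteq> Ob C" "\<F> \<subseteq> Ob C"
  using pretor by (simp_all add: pretorsion_theory_def full_replete_def)

lemma TF_triv: "f \<in> Ar C \<Longrightarrow> Dom C f \<in> \<T> \<Longrightarrow> Cod C f \<in> \<F> \<Longrightarrow> triv f"
  by (rule pretorsion_trivial[OF pretor])

lemma canonical_ex:
  assumes "A \<in> Ob C"
  obtains k c where "canonical_seq C \<T> \<F> A k c"
  using pretor assms unfolding pretorsion_theory_def by blast

text \<open>A factorisation of the identity through a trivial object makes \<open>A\<close> a
  retract of that object.\<close>

lemma triv_ident_iff:
  assumes "A \<in> Ob C"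
  shows "triv (Ident C A) \<longleftrightarrow> A \<in> \<T> \<inter> \<F>"
proof
  assume "triv (Ident C A)"
  then obtain g h where gh: "h \<in> Ar C" "g \<in> Ar C" "Cod C g = Dom C h" "Cod C g \<in> \<T> \<inter> \<F>"
    "Ident C A = h \<cdot> g" "Dom C g = Dom C (Ident C A)" by (rule trivialE)
  have "Dom C g = A" using gh(6) assms by simp
  then have e: "h \<cdot> g = Ident C (Dom C g)" using gh(5) by simp
  have "Dom C g \<in> \<T>" by (rule T_retract[OF gh(1,2,3) e]) (use gh(3,4) in simp)
  moreover have "Dom C g \<in> \<F>" by (rule F_retract[OF gh(1,2,3) e]) (use gh(3,4) in simp)
  ultimately show "A \<in> \<T> \<inter> \<F>" using \<open>Dom C g = A\<close> by simp
next
  assume "A \<in> \<T> \<inter> \<F>"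
  then show "triv (Ident C A)" using assms TF_triv by simp
qed

lemma triv_Cod_Z: "f \<in> Ar C \<Longrightarrow> Cod C f \<in> \<T> \<inter> \<F> \<Longrightarrow> triv f"
  using trivialI[of "Ident C (Cod C f)" f] by simp

text \<open>Agreement on \<open>x0\<close> carries the triviality of \<open>g\<close> over to
  \<open>f\<close>, on \<open>x1\<close> the morphism \<open>f\<close> vanishes anyway. Gluing gives
  vanishing on the whole source, in particular along \<open>a\<close>.\<close>

lemma sim_triv:
  assumes p: "pair a f" "pair b g" and s: "sim a f b g" and g: "triv g"
  shows "triv f"
proof -
  obtain x0 x1 where x: "is_coproduct C x0 x1" "agree a f b g x0" "null a f x1" "null b g x1"
    "Cod C x0 = Cod C a" "Cod C b = Cod C a" by (rule simE[OF s p])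
  note [simp] = coproductD[OF x(1)] x(5,6) pairD(1-3)[OF p(1)] pairD(1-3)[OF p(2)]
  have "null b g (x0 \<cdot> Ident C (Dom C x0))"
    by (rule nullI, rule trivial_comp2[OF g]) simp_all
  then have "null a f (x0 \<cdot> Ident C (Dom C x0))" by - (rule null_agree[OF p x(2)]; simp)
  then have "null a f (Ident C (Cod C a))"
    by - (rule null_glue[OF p(1) x(1)]; simp add: x(3))
  from nullD[OF this, of "Ident C (Dom C a)" a] show ?thesis by simp
qed

text \<open>The piece of agreement is taken to be initial, so agreement is automatic and everything
  is left to vanishing. This makes zero morphisms of the stable category unique.\<close>

lemma triv_sim:
  assumes p: "pair a f" "pair b g" and t: "triv f" "triv g" and [simp]: "Cod C b = Cod C a" "Cod C g = Cod C f"
  shows "sim a f b g"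
proof -
  note [simp] = pairD(1-3)[OF p(1)] pairD(1-3)[OF p(2)]
  obtain I where I: "is_initial C I" by (rule initial_ex)
  obtain z where z [simp]: "z \<in> Ar C" "Dom C z = I" "Cod C z = Cod C a"
    by (rule initialE[OF I, of "Cod C a"]) simp_all
  obtain s where s [simp]: "s \<in> Ar C" "Dom C s = I" "Cod C s = Dom C a"
    by (rule initialE[OF I, of "Dom C a"]) simp_all
  obtain t where t' [simp]: "t \<in> Ar C" "Dom C t = I" "Cod C t = Dom C b"
    by (rule initialE[OF I, of "Dom C b"]) simp_all
  have "is_coproduct C z (Ident C (Cod C a))" using coproduct_sym[OF coproduct_initial[OF I z(1,2)]] by simp
  moreover have "agree a f b g z" unfolding agree_def
    by (rule bexI[of _ s], rule bexI[of _ t]; (intro conjI)?) (simp_all add: initial_unique[OF I])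
  moreover have "null a f (Ident C (Cod C a))" "null b g (Ident C (Cod C a))"
    by (rule nullI, rule trivial_comp2[OF t(1)]; simp) (rule nullI, rule trivial_comp2[OF t(2)]; simp)
  ultimately show ?thesis unfolding sim_def by blast
qed

text \<open>Triviality is the one property of a class that can be read off any representative.
  Kernels and cokernels of the two categories are compared through it.\<close>

lemma St_triv_iff:
  assumes p: "pair a f"
  shows "is_trivial St (\<T> \<inter> \<F>) (cls a f) \<longleftrightarrow> triv f"
proof
  note [simp] = pairD(1-3)[OF p]
  assume "triv f"
  then obtain g h where gh: "h \<in> Ar C" "g \<in> Ar C" "Cod C g = Dom C h" "Cod C g \<in> \<T> \<inter> \<F>" "f = h \<cdot> g"
    "Dom C g = Dom C f" by (rule trivialE)
  have pg: "pair a g" using pairD[OF p] gh(2,6) by (simp add: pair_def)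
  have "is_trivial St (\<T> \<inter> \<F>) (Comp St (emb h) (cls a g))"
    by (rule St.trivialI) (use gh(1-4) cls_arr[OF pg] cls_Dom[OF pg] in simp_all)
  then show "is_trivial St (\<T> \<inter> \<F>) (cls a f)" using emb_comp_cls[OF pg gh(1,3)] gh(5) by simp
next
  assume "is_trivial St (\<T> \<inter> \<F>) (cls a f)"
  then obtain G H where GH: "H \<in> Ar St" "G \<in> Ar St" "Cod St G = Dom St H" "Cod St G \<in> \<T> \<inter> \<F>"
    "cls a f = Comp St H G" by (rule St.trivialE)
  obtain b g where pb: "pair b g" "G = cls b g" using GH(2) by (rule St_arrE)
  obtain c h where pc: "pair c h" "H = cls c h" using GH(1) by (rule St_arrE)
  note [simp] = pairD(1-3)[OF p] pairD(1-3)[OF pb(1)] pairD(1-3)[OF pc(1)]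
  have e: "Cod C g = Cod C c" and Z: "Cod C c \<in> \<T> \<inter> \<F>"
    using GH(3,4) by (simp_all add: pb(2) pc(2) cls_Dom[OF pb(1)] cls_Dom[OF pc(1)])
  note [simp] = e
  obtain b' g' where pbk: "is_pullback C b' g' g c" by (rule pullback_ex[of g c]) simp_all
  note [simp] = pullbackD(1-4,6-8)[OF pbk]
  \<comment> \<open>\<open>g'\<close> lands only in a subobject of a trivial object. Its composite
    with \<open>c\<close> is trivial because of the codomain, and the monomorphism \<open>c\<close>
    reflects this.\<close>
  have "triv (c \<cdot> g')" by (rule triv_Cod_Z) (use Z in simp_all)
  then have "triv g'" by - (rule triv_reflect[OF pairD(4)[OF pc(1)]]; simp)
  then have t: "triv (h \<cdot> g')" by (rule trivial_comp) simp_all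
  have "cls a f = cls (b \<cdot> b') (h \<cdot> g')" unfolding GH(5) pb(2) pc(2) by (rule cls_Comp[OF pb(1) pc(1) pbk])
  then have "sim a f (b \<cdot> b') (h \<cdot> g')" using cls_eq_iff[OF p pair_comp[OF pb(1) pc(1) pbk]] by simp
  then show "triv f" using sim_triv[OF p pair_comp[OF pb(1) pc(1) pbk] _ t] by simp
qed

text \<open>The partial morphism with empty domain of definition.\<close>

lemma St_zero_ex:
  assumes "A \<in> Ob C" "B \<in> Ob C"
  obtains a f where "pair a f" "Cod C a = A" "Cod C f = B" "triv f"
proof -
  obtain I where I: "is_initial C I" by (rule initial_ex)
  obtain a where a [simp]: "a \<in> Ar C" "Dom C a = I" "Cod C a = A" using initialE[OF I assms(1)] .
  obtain f where f [simp]: "f \<in> Ar C" "Dom C f = I" "Cod C f = B" using initialE[OF I assms(2)] .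
  have "is_complemented C a"
    using coproduct_sym[OF coproduct_initial[OF I a(1,2)]] complemented_iff by blast
  then have "pair a f" by (simp add: pair_def)
  moreover have "triv f" by (rule triv_from_initial) (simp_all add: I)
  ultimately show thesis using that by simp
qed

lemma St_triv_unique:
  assumes "is_trivial St (\<T> \<inter> \<F>) K" "is_trivial St (\<T> \<inter> \<F>) L" "Dom St K = Dom St L" "Cod St K = Cod St L"
  shows "K = L"
proof -
  obtain a f where pa: "pair a f" "K = cls a f" using St.trivial_arr[OF assms(1)] by (rule St_arrE)
  obtain b g where pb: "pair b g" "L = cls b g" using St.trivial_arr[OF assms(2)] by (rule St_arrE)
  have "sim a f b g"
    using assms St_triv_iff[OF pa(1)] St_triv_iff[OF pb(1)] cls_Dom[OF pa(1)] cls_Dom[OF pb(1)] pa(2) pb(2)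
    by (intro triv_sim[OF pa(1) pb(1)]) simp_all
  then show ?thesis using cls_eq_iff[OF pa(1) pb(1)] pa(2) pb(2) by simp
qed

lemma St_zero_objects: "zero_objects St = \<T> \<inter> \<F>"
proof
  show "zero_objects St \<subseteq> \<T> \<inter> \<F>"
  proof
    fix A assume "A \<in> zero_objects St"
    then have A: "is_initial St A" by (simp add: zero_objects_def)
    then have AO [simp]: "A \<in> Ob C" by (simp add: is_initial_def)
    obtain a f where p: "pair a f" "Cod C a = A" "Cod C f = A" "triv f" by (rule St_zero_ex[OF AO AO])
    \<comment> \<open>At an initial object the identity coincides with the zero morphism, hence it
      is trivial already before passing to classes; by the retract property \<open>A\<close> is then
      a trivial object.\<close>
    have "emb (Ident C A) = cls a f"
      by (rule St.initial_unique[OF A]) (use p cls_arr[OF p(1)] cls_Dom[OF p(1)] emb_arr[of "Ident C A"] in simp_all)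
    then have "sim (Ident C A) (Ident C A) a f" using cls_eq_iff[OF _ p(1), of "Ident C A" "Ident C A"] by simp
    then have "triv (Ident C A)" by - (rule sim_triv[OF _ p(1) _ p(4)]; simp)
    then show "A \<in> \<T> \<inter> \<F>" using triv_ident_iff by simp
  qed
  show "\<T> \<inter> \<F> \<subseteq> zero_objects St"
  proof
    fix A assume A: "A \<in> \<T> \<inter> \<F>"
    then have AO [simp]: "A \<in> Ob C" using TF_Ob by blast
    have tD: "is_trivial St (\<T> \<inter> \<F>) K" if "K \<in> Ar St" "Dom St K = A" for K
      using St.trivialI[of K "Ident St A" "\<T> \<inter> \<F>"] that A by simp
    have tC: "is_trivial St (\<T> \<inter> \<F>) K" if "K \<in> Ar St" "Cod St K = A" for K
      using St.trivialI[of "Ident St A" K "\<T> \<inter> \<F>"] that A by simp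
    have "is_initial St A"
    proof (rule St.initialI)
      fix X assume "X \<in> Ob St"
      then have X: "X \<in> Ob C" by simp
      obtain a f where p: "pair a f" "Cod C a = A" "Cod C f = X" by (rule St_zero_ex[OF AO X])
      then show "\<exists>f\<in>Ar St. Dom St f = A \<and> Cod St f = X"
        by (intro bexI[of _ "cls a f"]) (simp_all add: cls_arr cls_Dom)
    next
      fix K L assume "K \<in> Ar St" "L \<in> Ar St" "Dom St K = A" "Dom St L = A" "Cod St K = Cod St L"
      then show "K = L" by (intro St_triv_unique tD) simp_all
    qed simp
    moreover have "is_terminal St A"
      unfolding is_terminal_def
    proof (intro conjI ballI)
      fix X assume "X \<in> Ob St"
      then have X: "X \<in> Ob C" by simp
      obtain a f where p: "pair a f" "Cod C a = X" "Cod C f = A" by (rule St_zero_ex[OF X AO])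
      show "\<exists>!K. K \<in> hom St X A"
      proof (rule ex1I[of _ "cls a f"])
        show "cls a f \<in> hom St X A" using p by (simp add: cls_arr cls_Dom)
        fix K assume "K \<in> hom St X A"
        then show "K = cls a f" using p by (intro St_triv_unique tC) (simp_all add: cls_arr cls_Dom)
      qed
    qed simp
    ultimately show "A \<in> zero_objects St" by (simp add: zero_objects_def)
  qed
qed

text \<open>The equation \<open>K L = 1\<close> on the target gives a cutting of the target into a
  piece \<open>x0\<close> on which the composite is the identity and a piece \<open>x1\<close> on
  which the identity vanishes. The latter is a trivial object. The former is a retract of a
  complemented subobject of the source. Both lie in \<open>P\<close>, hence so does their
  coproduct.\<close>

lemma St_iso_closed:
  assumes cop: "\<And>i j. is_coproduct C i j \<Longrightarrow> Dom C i \<in> P \<Longrightarrow> Dom C j \<in> P \<Longrightarrow> Cod C i \<in> P"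
    and sub: "\<And>a. is_complemented C a \<Longrightarrow> Cod C a \<in> P \<Longrightarrow> Dom C a \<in> P"
    and ret: "\<And>r s. r \<in> Ar C \<Longrightarrow> s \<in> Ar C \<Longrightarrow> Cod C s = Dom C r \<Longrightarrow> r \<cdot> s = Ident C (Dom C s) \<Longrightarrow>
      Dom C r \<in> P \<Longrightarrow> Dom C s \<in> P"
    and Z: "\<T> \<inter> \<F> \<subseteq> P" and K: "is_iso St K" "Dom St K \<in> P"
  shows "Cod St K \<in> P"
proof -
  obtain L where L: "K \<in> Ar St" "L \<in> Ar St" "Dom St L = Cod St K" "Cod St L = Dom St K"
    "Comp St K L = Ident St (Cod St K)" by (rule St.isoE[OF K(1)])
  obtain a f where pa: "pair a f" "K = cls a f" using L(1) by (rule St_arrE)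
  obtain b g where pb: "pair b g" "L = cls b g" using L(2) by (rule St_arrE)
  note [simp] = pairD(1-3)[OF pa(1)] pairD(1-3)[OF pb(1)]
  have B: "Cod C b = Cod C f" "Cod C g = Cod C a" using L(3,4)
    by (simp_all add: pa(2) pb(2) cls_Dom[OF pa(1)] cls_Dom[OF pb(1)])
  note [simp] = B
  have aP: "Dom C a \<in> P" using sub[OF pairD(5)[OF pa(1)]] K(2) by (simp add: pa(2) cls_Dom[OF pa(1)])
  obtain b' g' where pbk: "is_pullback C b' g' g a" by (rule pullback_ex[of g a]) simp_all
  note [simp] = pullbackD(1-4,6-8)[OF pbk]
  note pc = pair_comp[OF pb(1) pa(1) pbk]
  have pi: "pair (Ident C (Cod C f)) (Ident C (Cod C f))" by simp
  have "cls (b \<cdot> b') (f \<cdot> g') = cls (Ident C (Cod C f)) (Ident C (Cod C f))"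
    using L(5) unfolding pa(2) pb(2) cls_Comp[OF pb(1) pa(1) pbk] cls_Dom[OF pa(1)] St_Ident .
  then have "sim (b \<cdot> b') (f \<cdot> g') (Ident C (Cod C f)) (Ident C (Cod C f))" using cls_eq_iff[OF pc pi] by simp
  then obtain x0 x1 where x: "is_coproduct C x0 x1" "agree (b \<cdot> b') (f \<cdot> g') (Ident C (Cod C f)) (Ident C (Cod C f)) x0"
    "null (Ident C (Cod C f)) (Ident C (Cod C f)) x1" "Cod C x0 = Cod C (b \<cdot> b')" by (rule simE[OF _ pc pi])
  note [simp] = coproductD[OF x(1)]
  have x0 [simp]: "Cod C x0 = Cod C f" using x(4) by simp
  obtain s t where s [simp]: "s \<in> Ar C" "Cod C s = Dom C (b \<cdot> b')" and t: "t \<in> Ar C" "Cod C t = Dom C (Ident C (Cod C f))"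
    and "(b \<cdot> b') \<cdot> s = x0" "Ident C (Cod C f) \<cdot> t = x0" "(f \<cdot> g') \<cdot> s = Ident C (Cod C f) \<cdot> t"
    using x(2) unfolding agree_def by blast
  then have e: "(b \<cdot> b') \<cdot> s = x0" "f \<cdot> (g' \<cdot> s) = x0" by simp_all
  have [simp]: "Dom C s = Dom C x0" using comp_arr(2)[of s "b \<cdot> b'"] e(1) by simp
  \<comment> \<open>Vanishing of the identity on \<open>x1\<close> says that \<open>x1\<close> is
    trivial; reflecting along this monomorphism gives a trivial identity on its domain.\<close>
  have "triv (Ident C (Cod C f) \<cdot> x1)" by (rule nullD[OF x(3), of x1 "Ident C (Dom C x1)"]) simp_all
  then have "triv (Ident C (Dom C x1))"
    by - (rule triv_reflect[OF injection_mono[OF coproduct_sym[OF x(1)]]]; simp)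
  then have P1: "Dom C x1 \<in> P" using triv_ident_iff[of "Dom C x1"] Z by auto
  obtain p q where pq: "is_pullback C p q f x0" by (rule pullback_ex[of f x0]) simp_all
  note [simp] = pullbackD(1-4,6-8)[OF pq]
  have "is_complemented C x0" using x(1) complemented_iff by blast
  then have pP: "Dom C p \<in> P" using sub[OF complemented_pullback[OF _ pq]] aP by simp
  \<comment> \<open>\<open>w\<close> is a section of \<open>q\<close>, so the domain of
    \<open>x0\<close> is a retract of the preimage of \<open>x0\<close> under \<open>f\<close>,
    which is complemented in the domain of \<open>a\<close>.\<close>
  obtain w where w: "w \<in> Ar C" "Dom C w = Dom C (g' \<cdot> s)" "Cod C w = Dom C p" "p \<cdot> w = g' \<cdot> s" "q \<cdot> w = Ident C (Dom C x0)"
    by (rule pullbackE[OF pq, of "g' \<cdot> s" "Ident C (Dom C x0)"]) (simp_all add: e(2))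
  have "Dom C w \<in> P" by (rule ret[of q]) (use w pP in simp_all)
  then have "Dom C x0 \<in> P" using w(2) by simp
  from cop[OF x(1) this P1] show ?thesis by (simp add: pa(2) cls_Dom[OF pa(1)])
qed

text \<open>Let \<open>f \<cdot> c\<close> factor as \<open>h \<cdot> g\<close> through a trivial
  object. Then \<open>g \<cdot> k\<close> is trivial because of its codomain, so \<open>g\<close>
  descends along the cokernel \<open>c\<close>, and \<open>f\<close> itself factors through the same
  object.\<close>

lemma canonical_triv_cancel:
  assumes c: "canonical_seq C \<T> \<F> A k c" and f [simp]: "f \<in> Ar C" "Dom C f = Cod C c" and t: "triv (f \<cdot> c)"
  shows "triv f"
proof -
  note c' = canonical_seqD[OF c]
  note [simp] = c'(3-6)
  obtain g h where gh: "h \<in> Ar C" "g \<in> Ar C" "Cod C g = Dom C h" "Cod C g \<in> \<T> \<inter> \<F>" "f \<cdot> c = h \<cdot> g"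
    "Dom C g = Dom C (f \<cdot> c)" "Cod C h = Cod C (f \<cdot> c)" using t by (rule trivialE)
  have gk: "triv (g \<cdot> k)" by (rule triv_Cod_Z) (use gh(2,4,6) in simp_all)
  obtain w where w: "w \<in> Ar C" "Dom C w = Cod C c" "Cod C w = Cod C g" "w \<cdot> c = g"
    by (rule Z_cokernelE[OF c'(2) _ _ gk]) (use gh(2,6) in simp_all)
  have hf: "Cod C h = Cod C f" using gh(7) by simp
  have "f = h \<cdot> w" by (rule Z_cokernel_epi[OF c'(2)]) (use gh(1,3,5) hf w in simp_all)
  moreover have "triv (h \<cdot> w)" by (rule trivialI) (use gh(1,3,4) w in simp_all)
  ultimately show ?thesis by simp
qed

text \<open>A diagonal fill-in: canonical cokernels behave like strong epimorphisms.
  \<open>b \<cdot> (w \<cdot> k)\<close> is trivial, the monomorphism \<open>b\<close> reflects this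
  to \<open>w \<cdot> k\<close>, and so \<open>w\<close> descends along \<open>c\<close>.\<close>

lemma canonical_factor:
  assumes c: "canonical_seq C \<T> \<F> A k c" and b: "is_mono C b" and y [simp]: "y \<in> Ar C" "Dom C y = Cod C c"
    and w: "w \<in> Ar C" "Dom C w = A" "Cod C w = Dom C b" and yc: "Cod C b = Cod C y" and e: "y \<cdot> c = b \<cdot> w"
  obtains v where "v \<in> Ar C" "Dom C v = Cod C c" "Cod C v = Dom C b" "b \<cdot> v = y" "v \<cdot> c = w"
proof -
  note c' = canonical_seqD[OF c]
  note [simp] = c'(3-6) mono_arr[OF b] w yc
  have "triv (y \<cdot> (c \<cdot> k))" by (rule trivial_comp[OF Z_kernelD(4)[OF c'(1)]]) simp_all
  then have "triv (b \<cdot> (w \<cdot> k))" by (simp add: comp_square[OF e])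
  then have wk: "triv (w \<cdot> k)" by - (rule triv_reflect[OF b]; simp)
  obtain v where v [simp]: "v \<in> Ar C" "Dom C v = Cod C c" "Cod C v = Cod C w" and vc: "v \<cdot> c = w"
    by (rule Z_cokernelE[OF c'(2) _ _ wk]) simp_all
  have "b \<cdot> v = y" by (rule Z_cokernel_epi[OF c'(2)]) (simp_all add: e vc)
  then show thesis by - (rule that[of v]; simp add: vc)
qed

text \<open>The coproduct of the canonical sequences of the two pieces satisfies the universal
  properties for the whole object. By uniqueness it is isomorphic to the given sequence, which
  therefore splits accordingly. In particular a cutting of \<open>A\<close> is pushed forward to its
  torsion-free quotient.\<close>

lemma canonical_decompose:
  assumes c: "canonical_seq C \<T> \<F> A k c" and a: "is_coproduct C a a'" "Cod C a = A"
  obtains k1 c1 k2 c2 t t' b b' where "canonical_seq C \<T> \<F> (Dom C a) k1 c1" "canonical_seq C \<T> \<F> (Dom C a') k2 c2"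
    "is_coproduct C t t'" "Cod C t = Dom C k" "Dom C t = Dom C k1" "Dom C t' = Dom C k2" "k \<cdot> t = a \<cdot> k1" "k \<cdot> t' = a' \<cdot> k2"
    "is_coproduct C b b'" "Cod C b = Cod C c" "Dom C b = Cod C c1" "Dom C b' = Cod C c2" "c \<cdot> a = b \<cdot> c1" "c \<cdot> a' = b' \<cdot> c2"
proof -
  note [simp] = coproductD[OF a(1)] a(2)
  have ma: "is_mono C a" "is_mono C a'" using injection_mono[OF a(1)] injection_mono[OF coproduct_sym[OF a(1)]] by simp_all
  obtain k1 c1 where 1: "canonical_seq C \<T> \<F> (Dom C a) k1 c1" by (rule canonical_ex[of "Dom C a"]) simp_all
  obtain k2 c2 where 2: "canonical_seq C \<T> \<F> (Dom C a') k2 c2" by (rule canonical_ex[of "Dom C a'"]) simp_all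
  note d = canonical_seqD[OF c] and d1 = canonical_seqD[OF 1] and d2 = canonical_seqD[OF 2]
  note [simp] = d(3-6) d1(3-6) d2(3-6)
  note m1 = Z_kernel_mono[OF d1(1)] and m2 = Z_kernel_mono[OF d2(1)]
  obtain t t' where t: "is_coproduct C t t'" and [simp]: "Dom C t = Dom C k1" "Dom C t' = Dom C k2"
    by (rule coproduct_ex[of "Dom C k1" "Dom C k2"]) simp_all
  obtain b b' where b: "is_coproduct C b b'" and [simp]: "Dom C b = Cod C c1" "Dom C b' = Cod C c2"
    by (rule coproduct_ex[of "Cod C c1" "Cod C c2"]) simp_all
  note [simp] = coproductD[OF t] coproductD[OF b]
  have mb: "is_mono C b" "is_mono C b'" using injection_mono[OF b] injection_mono[OF coproduct_sym[OF b]] by simp_all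
  obtain K where K [simp]: "K \<in> Ar C" "Dom C K = Cod C t" "Cod C K = A" and Ke: "K \<cdot> t = a \<cdot> k1" "K \<cdot> t' = a' \<cdot> k2"
    by (rule copairE[OF t, of "a \<cdot> k1" "a' \<cdot> k2"]) simp_all
  obtain E where E [simp]: "E \<in> Ar C" "Dom C E = A" "Cod C E = Cod C b" and Ee: "E \<cdot> a = b \<cdot> c1" "E \<cdot> a' = b' \<cdot> c2"
    by (rule copairE[OF a(1), of "b \<cdot> c1" "b' \<cdot> c2"]) simp_all
  note sq [simp] = comp_square[OF Ke(1)] comp_square[OF Ke(2)] comp_square[OF Ee(1)] comp_square[OF Ee(2)]
  \<comment> \<open>The two parts \<open>a \<cdot> k1\<close> and \<open>a' \<cdot> k2\<close> are
    monic and disjoint, since they lie in complementary pieces.\<close>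
  have Kmono: "is_mono C K"
  proof (rule copair_mono[OF mono_comp[OF m1 ma(1)] mono_comp[OF m2 ma(2)] _ t _ _ _ _ _ Ke])
    fix u v assume uv: "u \<in> Ar C" "v \<in> Ar C" "Cod C u = Dom C (a \<cdot> k1)" "Cod C v = Dom C (a' \<cdot> k2)" "Dom C u = Dom C v"
      "(a \<cdot> k1) \<cdot> u = (a' \<cdot> k2) \<cdot> v"
    then have "is_initial C (Dom C (k2 \<cdot> v))" by - (rule disjoint[OF a(1), of "k1 \<cdot> u"]; simp)
    then show "is_initial C (Dom C v)" using uv by simp
  qed simp_all
  have trEK: "triv (E \<cdot> K)"
  proof (rule triv_glue[OF t])
    have "triv (b \<cdot> (c1 \<cdot> k1))" "triv (b' \<cdot> (c2 \<cdot> k2))"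
      using trivial_comp[OF Z_kernelD(4)[OF d1(1)], of b] trivial_comp[OF Z_kernelD(4)[OF d2(1)], of b'] by simp_all
    then show "triv ((E \<cdot> K) \<cdot> t)" "triv ((E \<cdot> K) \<cdot> t')" by (simp_all add: Ke)
  qed simp_all
  have kerE: "is_Z_kernel C (\<T> \<inter> \<F>) K E"
  proof (rule Z_kernelI[OF _ Kmono _ trEK])
    fix u assume u [simp]: "u \<in> Ar C" "Cod C u = Dom C E" and tu: "triv (E \<cdot> u)"
    obtain x1 g1 x2 g2 where x: "is_coproduct C x1 x2" and p1: "is_pullback C x1 g1 u a" and p2: "is_pullback C x2 g2 u a'"
      by (rule decompose[OF a(1), of u]) simp_all
    note q1 = pullbackD[OF p1] and q2 = pullbackD[OF p2]
    note [simp] = coproductD[OF x] q1(1-4,6-8) q2(1-4,6-8)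
    have "triv (E \<cdot> (u \<cdot> x1))" "triv (E \<cdot> (u \<cdot> x2))"
      using trivial_comp2[OF tu, of x1] trivial_comp2[OF tu, of x2] by simp_all
    then have "triv (b \<cdot> (c1 \<cdot> g1))" "triv (b' \<cdot> (c2 \<cdot> g2))" by (simp_all add: q1(9) q2(9))
    then have tt: "triv (c1 \<cdot> g1)" "triv (c2 \<cdot> g2)"
      using triv_reflect[OF mb(1), of "c1 \<cdot> g1"] triv_reflect[OF mb(2), of "c2 \<cdot> g2"] by simp_all
    obtain w1 where w1 [simp]: "w1 \<in> Ar C" "Dom C w1 = Dom C g1" "Cod C w1 = Dom C k1" and w1e: "k1 \<cdot> w1 = g1"
      by (rule Z_kernelE[OF d1(1), of g1]) (simp_all add: tt)
    obtain w2 where w2 [simp]: "w2 \<in> Ar C" "Dom C w2 = Dom C g2" "Cod C w2 = Dom C k2" and w2e: "k2 \<cdot> w2 = g2"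
      by (rule Z_kernelE[OF d2(1), of g2]) (simp_all add: tt)
    obtain w where w [simp]: "w \<in> Ar C" "Dom C w = Cod C x1" "Cod C w = Cod C (t \<cdot> w1)"
      and we: "w \<cdot> x1 = t \<cdot> w1" "w \<cdot> x2 = t' \<cdot> w2"
      by (rule copairE[OF x, of "t \<cdot> w1" "t' \<cdot> w2"]) simp_all
    have "K \<cdot> w = u" by (rule coproduct_eqI[OF x]) (simp_all add: we w1e w2e q1(9) q2(9))
    then show "\<exists>w\<in>Ar C. Dom C w = Dom C u \<and> Cod C w = Dom C K \<and> K \<cdot> w = u"
      by (intro bexI[of _ w]) simp_all
  qed simp_all
  have cokE: "is_Z_cokernel C (\<T> \<inter> \<F>) E K"
  proof (rule Z_cokernelI[OF _ _ _ trEK])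
    fix u assume u [simp]: "u \<in> Ar C" "Dom C u = Cod C K" and tu: "triv (u \<cdot> K)"
    have "triv (u \<cdot> (K \<cdot> t))" "triv (u \<cdot> (K \<cdot> t'))"
      using trivial_comp2[OF tu, of t] trivial_comp2[OF tu, of t'] by simp_all
    then have tt: "triv ((u \<cdot> a) \<cdot> k1)" "triv ((u \<cdot> a') \<cdot> k2)" by (simp_all add: Ke)
    obtain v1 where v1 [simp]: "v1 \<in> Ar C" "Dom C v1 = Cod C c1" "Cod C v1 = Cod C (u \<cdot> a)" and v1e: "v1 \<cdot> c1 = u \<cdot> a"
      by (rule Z_cokernelE[OF d1(2) _ _ tt(1)]) simp_all
    obtain v2 where v2 [simp]: "v2 \<in> Ar C" "Dom C v2 = Cod C c2" "Cod C v2 = Cod C (u \<cdot> a')" and v2e: "v2 \<cdot> c2 = u \<cdot> a'"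
      by (rule Z_cokernelE[OF d2(2) _ _ tt(2)]) simp_all
    obtain v where v [simp]: "v \<in> Ar C" "Dom C v = Cod C b" "Cod C v = Cod C v1" and ve: "v \<cdot> b = v1" "v \<cdot> b' = v2"
      by (rule copairE[OF b, of v1 v2]) simp_all
    have "v \<cdot> E = u"
      by (rule coproduct_eqI[OF a(1)]) (simp_all add: Ee comp_tri[OF ve(1)] comp_tri[OF ve(2)] v1e v2e)
    then show "\<exists>w\<in>Ar C. Dom C w = Cod C E \<and> Cod C w = Cod C u \<and> w \<cdot> E = u"
      by (intro bexI[of _ v]) simp_all
  next
    fix u v assume uv: "u \<in> Ar C" "v \<in> Ar C" "Dom C u = Cod C E" "Dom C v = Cod C E" "Cod C u = Cod C v" "u \<cdot> E = v \<cdot> E"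
    have ee: "u \<cdot> (E \<cdot> x) = v \<cdot> (E \<cdot> x)" if "x \<in> Ar C" "Cod C x = A" for x
      by (rule comp_square[OF uv(6)]) (use uv(1-5) that in simp_all)
    show "u = v"
    proof (rule coproduct_eqI[OF b])
      show "u \<cdot> b = v \<cdot> b" by (rule Z_cokernel_epi[OF d1(2)]) (use uv(1-5) ee[of a] in \<open>simp_all add: Ee\<close>)
      show "u \<cdot> b' = v \<cdot> b'" by (rule Z_cokernel_epi[OF d2(2)]) (use uv(1-5) ee[of a'] in \<open>simp_all add: Ee\<close>)
    qed (use uv in simp_all)
  qed simp_all
  have KE: "canonical_seq C \<T> \<F> A K E"
    using kerE cokE T_coproduct[OF t] F_coproduct[OF b] d1(7,8) d2(7,8)
    by (simp add: canonical_seq_def short_Z_exact_def)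
  \<comment> \<open>Comparison of the given sequence with the coproduct sequence; the injections
    into the latter are transported along \<open>p\<close> and \<open>q\<close>.\<close>
  obtain p q where p: "is_iso C p" "Dom C p = Dom C K" "Cod C p = Dom C k" "k \<cdot> p = K"
    and q: "is_iso C q" "Dom C q = Cod C E" "Cod C q = Cod C c" "q \<cdot> E = c"
    by (rule canonical_unique[OF pretor c KE])
  note [simp] = iso_arr[OF p(1)] iso_arr[OF q(1)] p(2,3) q(2,3)
  show thesis
  proof (rule that[OF 1 2])
    show "is_coproduct C (p \<cdot> t) (p \<cdot> t')" by (rule coproduct_iso[OF t p(1)]) simp
    show "is_coproduct C (q \<cdot> b) (q \<cdot> b')" by (rule coproduct_iso[OF b q(1)]) simp
    show "k \<cdot> (p \<cdot> t) = a \<cdot> k1" "k \<cdot> (p \<cdot> t') = a' \<cdot> k2" by (simp_all add: comp_tri[OF p(4)] Ke)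
    have "q \<cdot> (E \<cdot> a) = c \<cdot> a" "q \<cdot> (E \<cdot> a') = c \<cdot> a'" by (simp_all only: comp_tri[OF q(4)] E K coproductD[OF a(1)] iso_arr[OF q(1)] q(2) a(2))
    then show "c \<cdot> a = (q \<cdot> b) \<cdot> c1" "c \<cdot> a' = (q \<cdot> b') \<cdot> c2" by (simp_all add: Ee)
  qed simp_all
qed

end

section \<open>The embedding preserves monomorphisms, canonical sequences and coproducts\<close>

context pretor_cat
begin

text \<open>The same cutting works: \<open>k\<close> is cancelled on the piece of agreement and
  reflects triviality on the other one.\<close>

lemma sim_mono_cancel:
  assumes p: "pair a f" "pair b g" and k: "is_mono C k" "Cod C f = Dom C k" "Cod C g = Dom C k"
    and s: "sim a (k \<cdot> f) b (k \<cdot> g)"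
  shows "sim a f b g"
proof -
  note [simp] = pairD(1-3)[OF p(1)] pairD(1-3)[OF p(2)] mono_arr[OF k(1)] k(2,3)
  have q: "pair a (k \<cdot> f)" "pair b (k \<cdot> g)" using pairD(5)[OF p(1)] pairD(5)[OF p(2)] by (simp_all add: pair_def)
  obtain x0 x1 where x: "is_coproduct C x0 x1" "agree a (k \<cdot> f) b (k \<cdot> g) x0" "null a (k \<cdot> f) x1" "null b (k \<cdot> g) x1"
    by (rule simE[OF s q])
  have n: "null c h x1" if c: "pair c h" "Cod C h = Dom C k" "null c (k \<cdot> h) x1" for c h
  proof (rule nullI)
    note [simp] = pairD(1-3)[OF c(1)] c(2)
    fix w u assume wu: "w \<in> Ar C" "u \<in> Ar C" "Cod C w = Dom C c" "Cod C u = Dom C x1" "Dom C w = Dom C u" "c \<cdot> w = x1 \<cdot> u"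
    have "triv (k \<cdot> (h \<cdot> w))" using nullD[OF c(3) wu] wu(1,3) by simp
    then show "triv (h \<cdot> w)" by - (rule triv_reflect[OF k(1)]; simp add: wu)
  qed
  obtain s t where st: "s \<in> Ar C" "t \<in> Ar C" "Cod C s = Dom C a" "Cod C t = Dom C b"
    and eq: "a \<cdot> s = x0" "b \<cdot> t = x0" "(k \<cdot> f) \<cdot> s = (k \<cdot> g) \<cdot> t"
    using x(2) unfolding agree_def by blast
  have d: "Dom C s = Dom C t" using comp_arr(2)[of s a] comp_arr(2)[of t b] eq st by simp
  have "f \<cdot> s = g \<cdot> t" by (rule monoD[OF k(1)]) (use st d eq in simp_all)
  then have "agree a f b g x0" unfolding agree_def using st eq by blast
  then show ?thesis unfolding sim_def using x(1) n[OF p(1) k(2) x(3)] n[OF p(2) k(3) x(4)] by blast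
qed

lemma emb_mono:
  assumes k: "is_mono C k"
  shows "is_mono St (emb k)"
proof (rule St.monoI)
  note [simp] = mono_arr[OF k]
  show "emb k \<in> Ar St" by simp
  fix U V assume UV: "U \<in> Ar St" "V \<in> Ar St" "Cod St U = Dom St (emb k)" "Cod St V = Dom St (emb k)"
    "Dom St U = Dom St V" "Comp St (emb k) U = Comp St (emb k) V"
  obtain a f where a: "pair a f" "U = cls a f" using UV(1) by (rule St_arrE)
  obtain b g where b: "pair b g" "V = cls b g" using UV(2) by (rule St_arrE)
  have c: "Cod C f = Dom C k" "Cod C g = Dom C k"
    using UV(3,4) by (simp_all add: a(2) b(2) cls_Dom[OF a(1)] cls_Dom[OF b(1)])
  note [simp] = pairD(1-3)[OF a(1)] pairD(1-3)[OF b(1)] c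
  have q: "pair a (k \<cdot> f)" "pair b (k \<cdot> g)" using pairD(5)[OF a(1)] pairD(5)[OF b(1)] by (simp_all add: pair_def)
  have "cls a (k \<cdot> f) = cls b (k \<cdot> g)" using UV(6) emb_comp_cls[OF a(1), of k] emb_comp_cls[OF b(1), of k]
    by (simp add: a(2) b(2))
  then have "sim a (k \<cdot> f) b (k \<cdot> g)" using cls_eq_iff[OF q] by simp
  then have "sim a f b g" by (rule sim_mono_cancel[OF a(1) b(1) k c])
  then show "U = V" using cls_eq_iff[OF a(1) b(1)] by (simp add: a(2) b(2))
qed

text \<open>Postcomposition does not touch the domain of definition, and triviality is tested on
  representatives, so the factorisation through the kernel takes place entirely in the second
  component.\<close>

lemma emb_kernel:
  assumes k: "is_Z_kernel C (\<T> \<inter> \<F>) k c"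
  shows "is_Z_kernel St (\<T> \<inter> \<F>) (emb k) (emb c)"
proof (rule St.Z_kernelI)
  note [simp] = Z_kernelD(1-3)[OF k]
  show "is_mono St (emb k)" by (rule emb_mono[OF Z_kernel_mono[OF k]])
  show "is_trivial St (\<T> \<inter> \<F>) (Comp St (emb c) (emb k))"
    using Z_kernelD(4)[OF k] St_triv_iff[of "Ident C (Dom C k)" "c \<cdot> k"] emb_comp[of k c] by simp
  fix U assume U: "U \<in> Ar St" "Cod St U = Dom St (emb c)" "is_trivial St (\<T> \<inter> \<F>) (Comp St (emb c) U)"
  obtain a f where a: "pair a f" "U = cls a f" using U(1) by (rule St_arrE)
  have c: "Cod C f = Dom C c" using U(2) by (simp add: a(2) cls_Dom[OF a(1)])
  note [simp] = pairD(1-3)[OF a(1)] c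
  have q: "pair a (c \<cdot> f)" using pairD(5)[OF a(1)] by (simp add: pair_def)
  have "triv (c \<cdot> f)" using U(3) emb_comp_cls[OF a(1), of c] St_triv_iff[OF q] by (simp add: a(2))
  then obtain w where w [simp]: "w \<in> Ar C" "Dom C w = Dom C f" "Cod C w = Dom C k" and kw: "k \<cdot> w = f"
    by (rule Z_kernelE[OF k pairD(2)[OF a(1)] c])
  have aw: "pair a w" using pairD(5)[OF a(1)] by (simp add: pair_def)
  show "\<exists>W\<in>Ar St. Dom St W = Dom St U \<and> Cod St W = Dom St (emb k) \<and> Comp St (emb k) W = U"
    using emb_comp_cls[OF aw, of k] cls_arr[OF aw] cls_Dom[OF aw] cls_Dom[OF a(1)]
    by (intro bexI[of _ "cls a w"]) (simp_all add: a(2) kw)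
qed (simp_all add: Z_kernelD(1-3)[OF k])

text \<open>Vanishing descends from the piece \<open>x1\<close> of \<open>A\<close> to the
  corresponding piece \<open>y1\<close> of the torsion-free quotient. \<open>x1\<close> is cut by
  whether its image under \<open>c\<close> lies in \<open>b\<close>, and the cutting is pushed
  forward to \<open>y1\<close>. The part in \<open>b\<close> is handled by cancelling a canonical
  cokernel, the other part is disjoint from \<open>b\<close>.\<close>

lemma canonical_null:
  assumes p: "pair b g" and pb: "is_pullback C a c' c b" and c: "c \<in> Ar C"
    and 1: "canonical_seq C \<T> \<F> (Dom C x1) k1 c1" and x [simp]: "x1 \<in> Ar C" "Cod C x1 = Dom C c"
    and y [simp]: "y1 \<in> Ar C" "Dom C y1 = Cod C c1" "Cod C y1 = Cod C c" and sq: "c \<cdot> x1 = y1 \<cdot> c1"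
    and n: "null a (g \<cdot> c') x1"
  shows "null b g y1"
proof -
  obtain b' where b': "is_coproduct C b b'" using complementedE[OF pairD(5)[OF p]] .
  note d1 = canonical_seqD[OF 1]
  note q0 = pullbackD[OF pb]
  have cb: "Cod C c = Cod C b" using q0(5) by simp
  note [simp] = c cb pairD(1-3)[OF p] q0(1-4,6-8) coproductD[OF b'] d1(3-6)
  have mb: "is_mono C b" "is_mono C b'" using injection_mono[OF b'] injection_mono[OF coproduct_sym[OF b']] by simp_all
  obtain a' c'' where pb': "is_pullback C a' c'' c b'" by (rule pullback_ex[of c b']) simp_all
  have aa: "is_coproduct C a a'" by (rule pullback_coproduct[OF b' pb pb'])
  note q0' = pullbackD[OF pb']
  note [simp] = q0'(1-4,6-8)
  obtain r0 s0 r1 s1 where r: "is_coproduct C r0 r1"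
    and p2: "is_pullback C r0 s0 x1 a" and p3: "is_pullback C r1 s1 x1 a'"
    by (rule decompose[OF aa, of x1]) simp_all
  note q2 = pullbackD[OF p2] and q3 = pullbackD[OF p3]
  note [simp] = q2(1-4,6-8) q3(1-4,6-8)
  obtain l0 d0 l1 d1' t t' z0 z1 where
    c0: "canonical_seq C \<T> \<F> (Dom C r0) l0 d0" and c1': "canonical_seq C \<T> \<F> (Dom C r1) l1 d1'"
    and z: "is_coproduct C z0 z1" "Cod C z0 = Cod C c1" "Dom C z0 = Cod C d0" "Dom C z1 = Cod C d1'"
    and ze: "c1 \<cdot> r0 = z0 \<cdot> d0" "c1 \<cdot> r1 = z1 \<cdot> d1'"
    by (rule canonical_decompose[OF 1 r]) simp_all
  note [simp] = coproductD[OF z(1)] z(2-4) canonical_seqD(3-6)[OF c0] canonical_seqD(3-6)[OF c1']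
  have e0: "(y1 \<cdot> z0) \<cdot> d0 = b \<cdot> (c' \<cdot> s0)"
  proof -
    have "(y1 \<cdot> z0) \<cdot> d0 = y1 \<cdot> (c1 \<cdot> r0)" by (simp add: ze)
    also have "\<dots> = c \<cdot> (x1 \<cdot> r0)" by (rule comp_square[OF sq[symmetric]]) simp_all
    also have "\<dots> = c \<cdot> (a \<cdot> s0)" by (simp only: q2(9))
    also have "\<dots> = b \<cdot> (c' \<cdot> s0)" by (rule comp_square[OF q0(9)]) simp_all
    finally show ?thesis .
  qed
  have e1: "(y1 \<cdot> z1) \<cdot> d1' = b' \<cdot> (c'' \<cdot> s1)"
  proof -
    have "(y1 \<cdot> z1) \<cdot> d1' = y1 \<cdot> (c1 \<cdot> r1)" by (simp add: ze)
    also have "\<dots> = c \<cdot> (x1 \<cdot> r1)" by (rule comp_square[OF sq[symmetric]]) simp_all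
    also have "\<dots> = c \<cdot> (a' \<cdot> s1)" by (simp only: q3(9))
    also have "\<dots> = b' \<cdot> (c'' \<cdot> s1)" by (rule comp_square[OF q0'(9)]) simp_all
    finally show ?thesis .
  qed
  \<comment> \<open>The fill-in shows that the piece \<open>z0\<close> of \<open>y1\<close> lands in
    \<open>b\<close>, which so far was known only for the piece of \<open>x1\<close> above it. In
    the same way \<open>z1\<close> lands in the complement of \<open>b\<close>.\<close>
  obtain w where w [simp]: "w \<in> Ar C" "Dom C w = Cod C d0" "Cod C w = Dom C b" and we: "b \<cdot> w = y1 \<cdot> z0" "w \<cdot> d0 = c' \<cdot> s0"
    by (rule canonical_factor[OF c0 mb(1) _ _ _ _ _ _ e0]) simp_all
  obtain v where v [simp]: "v \<in> Ar C" "Dom C v = Cod C d1'" "Cod C v = Dom C b'" and ve: "b' \<cdot> v = y1 \<cdot> z1" "v \<cdot> d1' = c'' \<cdot> s1"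
    by (rule canonical_factor[OF c1' mb(2) _ _ _ _ _ _ e1]) simp_all
  have "triv ((g \<cdot> c') \<cdot> s0)" by (rule nullD[OF n, of _ r0]) (simp_all add: q2(9))
  then have "triv ((g \<cdot> w) \<cdot> d0)" by (simp add: we)
  then have gw: "triv (g \<cdot> w)" by - (rule canonical_triv_cancel[OF c0]; simp)
  show ?thesis
  proof (rule null_glue[OF p z(1)])
    show "null b g (y1 \<cdot> z0)"
    proof (rule nullI)
      fix h u assume hu [simp]: "h \<in> Ar C" "u \<in> Ar C" "Cod C h = Dom C b" "Cod C u = Dom C (y1 \<cdot> z0)" "Dom C h = Dom C u"
        and e: "b \<cdot> h = (y1 \<cdot> z0) \<cdot> u"
      have "h = w \<cdot> u" by (rule monoD[OF mb(1)]) (use e in \<open>simp_all add: comp_tri[OF we(1)]\<close>)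
      then show "triv (g \<cdot> h)" using trivial_comp2[OF gw, of u] by simp
    qed
    show "null b g (y1 \<cdot> z1)"
    proof (rule nullI)
      fix h u assume hu [simp]: "h \<in> Ar C" "u \<in> Ar C" "Cod C h = Dom C b" "Cod C u = Dom C (y1 \<cdot> z1)" "Dom C h = Dom C u"
        and e: "b \<cdot> h = (y1 \<cdot> z1) \<cdot> u"
      have "b \<cdot> h = b' \<cdot> (v \<cdot> u)" using e by (simp add: comp_tri[OF ve(1)])
      then have "is_initial C (Dom C (v \<cdot> u))" by - (rule disjoint[OF b', of h]; simp)
      then show "triv (g \<cdot> h)" by - (rule triv_from_initial; simp)
    qed
  qed simp_all
qed

text \<open>Precomposition with \<open>c\<close> pulls back domains of definition, so both halves
  must push cuttings from \<open>A\<close> forward to its torsion-free quotient. For existence it is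
  the domain \<open>a\<close> of the given partial morphism, for uniqueness the cutting that
  witnesses the equality of the two composites.\<close>

lemma emb_cokernel:
  assumes can: "canonical_seq C \<T> \<F> A k c"
  shows "is_Z_cokernel St (\<T> \<inter> \<F>) (emb c) (emb k)"
proof (rule St.Z_cokernelI)
  note d = canonical_seqD[OF can]
  note [simp] = d(3-6)
  show "is_trivial St (\<T> \<inter> \<F>) (Comp St (emb c) (emb k))"
    using Z_kernelD(4)[OF d(1)] St_triv_iff[of "Ident C (Dom C k)" "c \<cdot> k"] emb_comp[of k c] by simp
  fix U assume U: "U \<in> Ar St" "Dom St U = Cod St (emb k)" "is_trivial St (\<T> \<inter> \<F>) (Comp St U (emb k))"
  obtain a f where a: "pair a f" "U = cls a f" using U(1) by (rule St_arrE)
  have aA: "Cod C a = A" using U(2) by (simp add: a(2) cls_Dom[OF a(1)])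
  note [simp] = pairD(1-3)[OF a(1)] aA
  obtain a' k' where pb: "is_pullback C a' k' k a" by (rule pullback_ex[of k a]) simp_all
  note q = pullbackD[OF pb]
  note [simp] = q(1-4,6-8)
  have "pair a' (f \<cdot> k')" using complemented_pullback[OF pairD(5)[OF a(1)] pb] by (simp add: pair_def)
  then have tr: "triv (f \<cdot> k')" using U(3) cls_comp_emb[OF d(5) a(1) pb] St_triv_iff by (simp add: a(2))
  obtain ac where ac: "is_coproduct C a ac" using complementedE[OF pairD(5)[OF a(1)]] .
  note [simp] = coproductD[OF ac]
  obtain k1 c1 k2 c2 t t' b b' where 1: "canonical_seq C \<T> \<F> (Dom C a) k1 c1" and 2: "canonical_seq C \<T> \<F> (Dom C ac) k2 c2"
    and t: "is_coproduct C t t'" "Cod C t = Dom C k" "Dom C t = Dom C k1" and ke: "k \<cdot> t = a \<cdot> k1"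
    and b: "is_coproduct C b b'" "Cod C b = Cod C c" "Dom C b = Cod C c1" "Dom C b' = Cod C c2"
    and ce: "c \<cdot> a = b \<cdot> c1" "c \<cdot> ac = b' \<cdot> c2"
    by (rule canonical_decompose[OF can ac aA])
  note d1 = canonical_seqD[OF 1] and d2 = canonical_seqD[OF 2]
  note [simp] = d1(3-6) d2(3-6) coproductD[OF t(1)] t(2,3) coproductD[OF b(1)] b(2-4)
  \<comment> \<open>The torsion part \<open>k1\<close> of the domain of \<open>a\<close> factors
    through the pullback of \<open>a\<close> along \<open>k\<close>, so \<open>f\<close> is trivial
    on it and descends to \<open>v\<close>.\<close>
  obtain w where w [simp]: "w \<in> Ar C" "Dom C w = Dom C t" "Cod C w = Dom C a'" and we: "a' \<cdot> w = t" "k' \<cdot> w = k1"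
    by (rule pullbackE[OF pb, of t k1]) (simp_all add: ke)
  have "triv ((f \<cdot> k') \<cdot> w)" by (rule trivial_comp2[OF tr]) simp_all
  then have "triv (f \<cdot> k1)" by (simp add: we)
  then obtain v where v [simp]: "v \<in> Ar C" "Dom C v = Cod C c1" "Cod C v = Cod C f" and ve: "v \<cdot> c1 = f"
    by - (rule Z_cokernelE[OF d1(2), of f]; simp)
  have bv: "pair b v" using b(1) complemented_iff by (auto simp: pair_def)
  \<comment> \<open>Extensivity identifies \<open>a\<close> as the preimage under \<open>c\<close>
    of the pushed-forward piece \<open>b\<close>, so the domain of the composite is again
    \<open>a\<close>.\<close>
  have "is_pullback C a c1 c b"
    using ext_iff[OF b(1), of c a ac c1 c2] ac by (simp add: ce)
  from cls_comp_emb[OF d(6) bv this]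
  show "\<exists>W\<in>Ar St. Dom St W = Cod St (emb c) \<and> Cod St W = Cod St U \<and> Comp St W (emb c) = U"
    using cls_arr[OF bv] cls_Dom[OF bv] cls_Dom[OF a(1)]
    by (intro bexI[of _ "cls b v"]) (simp_all add: a(2) ve)
next
  note d = canonical_seqD[OF can]
  note [simp] = d(3-6)
  fix U V assume UV: "U \<in> Ar St" "V \<in> Ar St" "Dom St U = Cod St (emb c)" "Dom St V = Cod St (emb c)"
    "Cod St U = Cod St V" "Comp St U (emb c) = Comp St V (emb c)"
  obtain b1 g1 where 1: "pair b1 g1" "U = cls b1 g1" using UV(1) by (rule St_arrE)
  obtain b2 g2 where 2: "pair b2 g2" "V = cls b2 g2" using UV(2) by (rule St_arrE)
  have bc [simp]: "Cod C b1 = Cod C c" "Cod C b2 = Cod C c"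
    using UV(3,4) by (simp_all add: 1(2) 2(2) cls_Dom[OF 1(1)] cls_Dom[OF 2(1)])
  note [simp] = pairD(1-3)[OF 1(1)] pairD(1-3)[OF 2(1)]
  obtain a1 c1 where p1: "is_pullback C a1 c1 c b1" by (rule pullback_ex[of c b1]) simp_all
  obtain a2 c2 where p2: "is_pullback C a2 c2 c b2" by (rule pullback_ex[of c b2]) simp_all
  note q1 = pullbackD[OF p1] and q2 = pullbackD[OF p2]
  note [simp] = q1(1-4,6-8) q2(1-4,6-8)
  have pa: "pair a1 (g1 \<cdot> c1)" "pair a2 (g2 \<cdot> c2)"
    using complemented_pullback[OF pairD(5)[OF 1(1)] p1] complemented_pullback[OF pairD(5)[OF 2(1)] p2]
    by (simp_all add: pair_def)
  have "cls a1 (g1 \<cdot> c1) = cls a2 (g2 \<cdot> c2)"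
    using UV(6) cls_comp_emb[OF d(6) 1(1) p1] cls_comp_emb[OF d(6) 2(1) p2] by (simp add: 1(2) 2(2))
  then have "sim a1 (g1 \<cdot> c1) a2 (g2 \<cdot> c2)" using cls_eq_iff[OF pa] by simp
  then obtain x0 x1 where x: "is_coproduct C x0 x1" "agree a1 (g1 \<cdot> c1) a2 (g2 \<cdot> c2) x0"
    "null a1 (g1 \<cdot> c1) x1" "null a2 (g2 \<cdot> c2) x1" "Cod C x0 = Cod C a1" by (rule simE[OF _ pa])
  note [simp] = coproductD[OF x(1)] x(5)
  obtain s t where st [simp]: "s \<in> Ar C" "t \<in> Ar C" "Cod C s = Dom C a1" "Cod C t = Dom C a2"
    and eq: "a1 \<cdot> s = x0" "a2 \<cdot> t = x0" "(g1 \<cdot> c1) \<cdot> s = (g2 \<cdot> c2) \<cdot> t"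
    using x(2) unfolding agree_def by blast
  have [simp]: "Dom C s = Dom C x0" "Dom C t = Dom C x0"
    using comp_arr(2)[of s a1] comp_arr(2)[of t a2] eq by simp_all
  \<comment> \<open>The cutting \<open>x0\<close>, \<open>x1\<close> of \<open>A\<close> is pushed
    forward to \<open>y0\<close>, \<open>y1\<close>, which will witness the equality of
    \<open>U\<close> and \<open>V\<close>.\<close>
  obtain k0 e0 k1 e1 t0 t1 y0 y1 where 3: "canonical_seq C \<T> \<F> (Dom C x0) k0 e0" and 4: "canonical_seq C \<T> \<F> (Dom C x1) k1 e1"
    and y: "is_coproduct C y0 y1" "Cod C y0 = Cod C c" "Dom C y0 = Cod C e0" "Dom C y1 = Cod C e1"
    and ye: "c \<cdot> x0 = y0 \<cdot> e0" "c \<cdot> x1 = y1 \<cdot> e1"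
    by (rule canonical_decompose[OF can x(1)]) simp_all
  note d3 = canonical_seqD[OF 3] and d4 = canonical_seqD[OF 4]
  note [simp] = d3(3-6) d4(3-6) coproductD[OF y(1)] y(2-4)
  have E1: "y0 \<cdot> e0 = b1 \<cdot> (c1 \<cdot> s)"
    unfolding ye(1)[symmetric] eq(1)[symmetric] by (rule comp_square[OF q1(9)]) simp_all
  have E2: "y0 \<cdot> e0 = b2 \<cdot> (c2 \<cdot> t)"
    unfolding ye(1)[symmetric] eq(2)[symmetric] by (rule comp_square[OF q2(9)]) simp_all
  \<comment> \<open>That \<open>y0\<close> lies in \<open>b1\<close> is seen above on
    \<open>x0\<close> and descends by the fill-in; likewise for \<open>b2\<close>.\<close>
  obtain w1 where w1 [simp]: "w1 \<in> Ar C" "Dom C w1 = Cod C e0" "Cod C w1 = Dom C b1" and w1e: "b1 \<cdot> w1 = y0" "w1 \<cdot> e0 = c1 \<cdot> s"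
    by (rule canonical_factor[OF 3 pairD(4)[OF 1(1)] _ _ _ _ _ _ E1]) simp_all
  obtain w2 where w2 [simp]: "w2 \<in> Ar C" "Dom C w2 = Cod C e0" "Cod C w2 = Dom C b2" and w2e: "b2 \<cdot> w2 = y0" "w2 \<cdot> e0 = c2 \<cdot> t"
    by (rule canonical_factor[OF 3 pairD(4)[OF 2(1)] _ _ _ _ _ _ E2]) simp_all
  have gc: "Cod C g1 = Cod C g2" using UV(5) by (simp add: 1(2) 2(2) cls_Dom[OF 1(1)] cls_Dom[OF 2(1)])
  have "g1 \<cdot> w1 = g2 \<cdot> w2"
    by (rule Z_cokernel_epi[OF d3(2)]) (use eq(3) gc in \<open>simp_all add: w1e w2e\<close>)
  then have "agree b1 g1 b2 g2 y0" unfolding agree_def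
    by (intro bexI[of _ w1] bexI[of _ w2] conjI) (simp_all add: w1e w2e)
  moreover have "null b1 g1 y1" by (rule canonical_null[OF 1(1) p1 _ 4 _ _ _ _ _ ye(2) x(3)]) simp_all
  moreover have "null b2 g2 y1" by (rule canonical_null[OF 2(1) p2 _ 4 _ _ _ _ _ ye(2) x(4)]) simp_all
  ultimately have "sim b1 g1 b2 g2" unfolding sim_def using y(1) by blast
  then show "U = V" using cls_eq_iff[OF 1(1) 2(1)] by (simp add: 1(2) 2(2))
qed (use canonical_seqD[OF can] in simp_all)

lemma emb_canonical:
  assumes "canonical_seq C \<T> \<F> A k c"
  shows "canonical_seq St \<T> \<F> A (emb k) (emb c)"
  using emb_kernel[OF canonical_seqD(1)[OF assms]] emb_cokernel[OF assms] canonical_seqD[OF assms]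
  by (simp add: canonical_seq_def short_Z_exact_def)

lemma St_pretorsion: "pretorsion_theory St \<T> \<F>"
  unfolding pretorsion_theory_def
proof (intro conjI ballI)
  show "category St" by (rule St_category)
  show "full_replete St \<T>" unfolding full_replete_def
    using TF_Ob St_iso_closed[of \<T>] T_coproduct T_complemented T_retract by (simp; blast)
  show "full_replete St \<F>" unfolding full_replete_def
    using TF_Ob St_iso_closed[of \<F>] F_coproduct F_complemented F_retract by (simp; blast)
  fix T F K assume TF: "T \<in> \<T>" "F \<in> \<F>" "K \<in> hom St T F"
  then obtain a f where a: "pair a f" "K = cls a f" by (auto elim: St_arrE)
  note [simp] = pairD(1-3)[OF a(1)]
  have "Cod C a \<in> \<T>" "Cod C f \<in> \<F>" using TF by (simp_all add: a(2) cls_Dom[OF a(1)])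
  then have "triv f" using T_complemented[OF pairD(5)[OF a(1)]] TF_triv by simp
  then show "is_trivial St (\<T> \<inter> \<F>) K" using St_triv_iff[OF a(1)] a(2) by simp
next
  fix A assume "A \<in> Ob St"
  then obtain k c where "canonical_seq C \<T> \<F> A k c" using canonical_ex by auto
  then show "\<exists>k c. canonical_seq St \<T> \<F> A k c" using emb_canonical by blast
qed

lemma St_torsion: "torsion_theory St \<T> \<F>"
proof -
  obtain I where "is_initial C I" by (rule initial_ex)
  then have "I \<in> \<T> \<inter> \<F>" by (rule initial_Z)
  then show ?thesis using St_pretorsion by (auto simp: torsion_theory_def pointed_def St_zero_objects)
qed

lemma emb_initial: "is_initial C I \<Longrightarrow> is_initial St I"
  using initial_Z[of I] St_zero_objects by (auto simp: zero_objects_def)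

text \<open>Partial morphisms out of the two summands are joined on the coproduct of their domains,
  which is complemented because the complements can be joined as well. For uniqueness, the cuttings
  that witness equality on the summands are added.\<close>

lemma emb_coproduct:
  assumes ij: "is_coproduct C i j"
  shows "is_coproduct St (emb i) (emb j)"
proof (rule St.coproductI)
  note [simp] = coproductD[OF ij]
  fix U V assume UV: "U \<in> Ar St" "V \<in> Ar St" "Dom St U = Dom St (emb i)" "Dom St V = Dom St (emb j)" "Cod St V = Cod St U"
  obtain a f where a: "pair a f" "U = cls a f" using UV(1) by (rule St_arrE)
  obtain b g where b: "pair b g" "V = cls b g" using UV(2) by (rule St_arrE)
  note [simp] = pairD(1-3)[OF a(1)] pairD(1-3)[OF b(1)]
  have [simp]: "Cod C a = Dom C i" "Cod C b = Dom C j" "Cod C g = Cod C f"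
    using UV(3-5) by (simp_all add: a(2) b(2) cls_Dom[OF a(1)] cls_Dom[OF b(1)])
  obtain a' where a': "is_coproduct C a a'" using complementedE[OF pairD(5)[OF a(1)]] .
  obtain b' where b': "is_coproduct C b b'" using complementedE[OF pairD(5)[OF b(1)]] .
  note [simp] = coproductD[OF a'] coproductD[OF b']
  obtain p q where pq: "is_coproduct C p q" and [simp]: "Dom C p = Dom C a" "Dom C q = Dom C b"
    by (rule coproduct_ex[of "Dom C a" "Dom C b"]) simp_all
  obtain r s where rs: "is_coproduct C r s" and [simp]: "Dom C r = Dom C a'" "Dom C s = Dom C b'"
    by (rule coproduct_ex[of "Dom C a'" "Dom C b'"]) simp_all
  note [simp] = coproductD[OF pq] coproductD[OF rs]
  obtain m where m [simp]: "m \<in> Ar C" "Dom C m = Cod C p" "Cod C m = Cod C (i \<cdot> a)" and me: "m \<cdot> p = i \<cdot> a" "m \<cdot> q = j \<cdot> b"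
    by (rule copairE[OF pq, of "i \<cdot> a" "j \<cdot> b"]) simp_all
  obtain n where n [simp]: "n \<in> Ar C" "Dom C n = Cod C r" "Cod C n = Cod C (i \<cdot> a')" and ne: "n \<cdot> r = i \<cdot> a'" "n \<cdot> s = j \<cdot> b'"
    by (rule copairE[OF rs, of "i \<cdot> a'" "j \<cdot> b'"]) simp_all
  obtain h where h [simp]: "h \<in> Ar C" "Dom C h = Cod C p" "Cod C h = Cod C f" and he: "h \<cdot> p = f" "h \<cdot> q = g"
    by (rule copairE[OF pq, of f g]) simp_all
  \<comment> \<open>The complement of the joined domain \<open>m\<close> is the sum \<open>n\<close>
    of the two complements.\<close>
  have mn: "is_coproduct C m n"
    by (rule coproduct_sum[OF ij a' _ b' _ pq _ _ rs _ _ _ _ _ me _ _ _ ne]) simp_all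
  then have mh: "pair m h" using complemented_iff by (auto simp: pair_def)
  \<comment> \<open>Extensivity: restricting the joined domain to a summand gives back the original
    domain, so the composites with the injections are \<open>U\<close> and \<open>V\<close>.\<close>
  have "is_pullback C p a m i \<and> is_pullback C q b m j"
    using ext_iff[OF ij, of m p q a b] pq by (simp add: me)
  then have pb: "is_pullback C a p i m" "is_pullback C b q j m" using pullback_sym by blast+
  have "Comp St (cls m h) (emb i) = U" "Comp St (cls m h) (emb j) = V"
    using cls_comp_emb[OF _ mh pb(1)] cls_comp_emb[OF _ mh pb(2)] by (simp_all add: he a(2) b(2))
  then show "\<exists>W\<in>Ar St. Dom St W = Cod St (emb i) \<and> Cod St W = Cod St U \<and> Comp St W (emb i) = U \<and> Comp St W (emb j) = V"
    using cls_arr[OF mh] cls_Dom[OF mh] cls_Dom[OF a(1)] by (intro bexI[of _ "cls m h"]) (simp_all add: a(2))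
next
  note [simp] = coproductD[OF ij]
  fix U V assume UV: "U \<in> Ar St" "V \<in> Ar St" "Dom St U = Cod St (emb i)" "Dom St V = Cod St (emb i)" "Cod St U = Cod St V"
    "Comp St U (emb i) = Comp St V (emb i)" "Comp St U (emb j) = Comp St V (emb j)"
  obtain m1 h1 where 1: "pair m1 h1" "U = cls m1 h1" using UV(1) by (rule St_arrE)
  obtain m2 h2 where 2: "pair m2 h2" "V = cls m2 h2" using UV(2) by (rule St_arrE)
  note [simp] = pairD(1-3)[OF 1(1)] pairD(1-3)[OF 2(1)]
  have [simp]: "Cod C m1 = Cod C i" "Cod C m2 = Cod C i"
    using UV(3,4) by (simp_all add: 1(2) 2(2) cls_Dom[OF 1(1)] cls_Dom[OF 2(1)])
  have gc: "Cod C h2 = Cod C h1" using UV(5) by (simp add: 1(2) 2(2) cls_Dom[OF 1(1)] cls_Dom[OF 2(1)])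
  \<comment> \<open>Used for both injections in place of \<open>l\<close>: equality after
    restriction to \<open>l\<close> gives a cutting of the domain of \<open>l\<close>, with
    agreement and vanishing stated for the unrestricted representatives.\<close>
  have R: "\<exists>x0 x1 s t. is_coproduct C x0 x1 \<and> Cod C x0 = Dom C l \<and> s \<in> Ar C \<and> t \<in> Ar C \<and> Cod C s = Dom C m1 \<and> Cod C t = Dom C m2 \<and>
      Dom C s = Dom C x0 \<and> Dom C t = Dom C x0 \<and>
      m1 \<cdot> s = l \<cdot> x0 \<and> m2 \<cdot> t = l \<cdot> x0 \<and> h1 \<cdot> s = h2 \<cdot> t \<and> null m1 h1 (l \<cdot> x1) \<and> null m2 h2 (l \<cdot> x1)"
    if l [simp]: "l \<in> Ar C" "Cod C l = Cod C i" and eq: "Comp St U (emb l) = Comp St V (emb l)" for l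
  proof -
    obtain a1 p1 where pb1: "is_pullback C a1 p1 l m1" by (rule pullback_ex[of l m1]) simp_all
    obtain a2 p2 where pb2: "is_pullback C a2 p2 l m2" by (rule pullback_ex[of l m2]) simp_all
    note q1 = pullbackD[OF pb1] and q2 = pullbackD[OF pb2]
    note [simp] = q1(1-4,6-8) q2(1-4,6-8)
    have pa: "pair a1 (h1 \<cdot> p1)" "pair a2 (h2 \<cdot> p2)"
      using complemented_pullback[OF pairD(5)[OF 1(1)] pb1] complemented_pullback[OF pairD(5)[OF 2(1)] pb2]
      by (simp_all add: pair_def)
    have "cls a1 (h1 \<cdot> p1) = cls a2 (h2 \<cdot> p2)"
      using eq by (simp add: 1(2) 2(2) cls_comp_emb[OF l(1) 1(1) pb1] cls_comp_emb[OF l(1) 2(1) pb2])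
    then have "sim a1 (h1 \<cdot> p1) a2 (h2 \<cdot> p2)" using cls_eq_iff[OF pa] by simp
    then obtain x0 x1 where x: "is_coproduct C x0 x1" "agree a1 (h1 \<cdot> p1) a2 (h2 \<cdot> p2) x0"
      "null a1 (h1 \<cdot> p1) x1" "null a2 (h2 \<cdot> p2) x1" "Cod C x0 = Cod C a1" by (rule simE[OF _ pa])
    note [simp] = coproductD[OF x(1)] x(5)
    obtain s t where st [simp]: "s \<in> Ar C" "t \<in> Ar C" "Cod C s = Dom C a1" "Cod C t = Dom C a2"
      and e: "a1 \<cdot> s = x0" "a2 \<cdot> t = x0" "(h1 \<cdot> p1) \<cdot> s = (h2 \<cdot> p2) \<cdot> t"
      using x(2) unfolding agree_def by blast
    have [simp]: "Dom C s = Dom C x0" "Dom C t = Dom C x0"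
      using comp_arr(2)[of s a1] comp_arr(2)[of t a2] e by simp_all
    \<comment> \<open>Vanishing of the pulled-back partial morphism on \<open>x1\<close> is
      vanishing of the original one on \<open>l \<cdot> x1\<close>, since an element of
      \<open>m\<close> over the latter lifts to the pullback.\<close>
    have N: "null m h (l \<cdot> x1)" if p: "pair m h" and [simp]: "Cod C m = Cod C i" and pb: "is_pullback C a p l m"
      and n: "null a (h \<cdot> p) x1" for m h a p
    proof (rule nullI)
      note q = pullbackD[OF pb]
      note [simp] = pairD(1-3)[OF p] q(1-4,6-8)
      fix w u assume wu [simp]: "w \<in> Ar C" "u \<in> Ar C" "Cod C w = Dom C m" "Cod C u = Dom C (l \<cdot> x1)" "Dom C w = Dom C u"
        and mw: "m \<cdot> w = (l \<cdot> x1) \<cdot> u"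
      obtain v where v: "v \<in> Ar C" "Dom C v = Dom C (x1 \<cdot> u)" "Cod C v = Dom C a" "a \<cdot> v = x1 \<cdot> u" "p \<cdot> v = w"
        by (rule pullbackE[OF pb, of "x1 \<cdot> u" w]) (simp_all add: mw)
      have "triv ((h \<cdot> p) \<cdot> v)" by (rule nullD[OF n, of _ u]) (use v in simp_all)
      then show "triv (h \<cdot> w)" using v by simp
    qed
    have "m1 \<cdot> (p1 \<cdot> s) = l \<cdot> x0" "m2 \<cdot> (p2 \<cdot> t) = l \<cdot> x0"
      using comp_square[OF q1(9)[symmetric], of s] comp_square[OF q2(9)[symmetric], of t] e by simp_all
    moreover have "h1 \<cdot> (p1 \<cdot> s) = h2 \<cdot> (p2 \<cdot> t)" using e(3) by simp
    moreover have "null m1 h1 (l \<cdot> x1)" "null m2 h2 (l \<cdot> x1)"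
      using N[OF 1(1) _ pb1 x(3)] N[OF 2(1) _ pb2 x(4)] by simp_all
    ultimately show ?thesis using x(1)
      by (intro exI[of _ x0] exI[of _ x1] exI[of _ "p1 \<cdot> s"] exI[of _ "p2 \<cdot> t"]) simp
  qed
  obtain x0 x1 s t where x: "is_coproduct C x0 x1" and xs [simp]: "Cod C x0 = Dom C i" "s \<in> Ar C" "t \<in> Ar C" "Cod C s = Dom C m1" "Cod C t = Dom C m2"
    "Dom C s = Dom C x0" "Dom C t = Dom C x0"
    and xe: "m1 \<cdot> s = i \<cdot> x0" "m2 \<cdot> t = i \<cdot> x0" "h1 \<cdot> s = h2 \<cdot> t" and xn: "null m1 h1 (i \<cdot> x1)" "null m2 h2 (i \<cdot> x1)"
    using R[OF _ _ UV(6)] by auto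
  obtain y0 y1 s' t' where y: "is_coproduct C y0 y1" and ys [simp]: "Cod C y0 = Dom C j" "s' \<in> Ar C" "t' \<in> Ar C" "Cod C s' = Dom C m1" "Cod C t' = Dom C m2"
    "Dom C s' = Dom C y0" "Dom C t' = Dom C y0"
    and ye: "m1 \<cdot> s' = j \<cdot> y0" "m2 \<cdot> t' = j \<cdot> y0" "h1 \<cdot> s' = h2 \<cdot> t'" and yn: "null m1 h1 (j \<cdot> y1)" "null m2 h2 (j \<cdot> y1)"
    using R[OF _ _ UV(7)] by auto
  note [simp] = coproductD[OF x] coproductD[OF y]
  obtain p q where pq: "is_coproduct C p q" and [simp]: "Dom C p = Dom C x0" "Dom C q = Dom C y0"
    by (rule coproduct_ex[of "Dom C x0" "Dom C y0"]) simp_all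
  obtain p' q' where pq': "is_coproduct C p' q'" and [simp]: "Dom C p' = Dom C x1" "Dom C q' = Dom C y1"
    by (rule coproduct_ex[of "Dom C x1" "Dom C y1"]) simp_all
  note [simp] = coproductD[OF pq] coproductD[OF pq']
  obtain z0 where z0 [simp]: "z0 \<in> Ar C" "Dom C z0 = Cod C p" "Cod C z0 = Cod C (i \<cdot> x0)" and z0e: "z0 \<cdot> p = i \<cdot> x0" "z0 \<cdot> q = j \<cdot> y0"
    by (rule copairE[OF pq, of "i \<cdot> x0" "j \<cdot> y0"]) simp_all
  obtain z1 where z1 [simp]: "z1 \<in> Ar C" "Dom C z1 = Cod C p'" "Cod C z1 = Cod C (i \<cdot> x1)" and z1e: "z1 \<cdot> p' = i \<cdot> x1" "z1 \<cdot> q' = j \<cdot> y1"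
    by (rule copairE[OF pq', of "i \<cdot> x1" "j \<cdot> y1"]) simp_all
  \<comment> \<open>The pieces of agreement of both summands form \<open>z0\<close>, the pieces of
    vanishing form \<open>z1\<close>.\<close>
  have z: "is_coproduct C z0 z1"
    by (rule coproduct_sum[OF ij x _ y _ pq _ _ pq' _ _ _ _ _ z0e _ _ _ z1e]) simp_all
  obtain S where S [simp]: "S \<in> Ar C" "Dom C S = Cod C p" "Cod C S = Cod C s" and Se: "S \<cdot> p = s" "S \<cdot> q = s'"
    by (rule copairE[OF pq, of s s']) simp_all
  obtain T where T [simp]: "T \<in> Ar C" "Dom C T = Cod C p" "Cod C T = Cod C t" and Te: "T \<cdot> p = t" "T \<cdot> q = t'"
    by (rule copairE[OF pq, of t t']) simp_all
  have "m1 \<cdot> S = z0" by (rule coproduct_eqI[OF pq]) (simp_all add: Se xe ye z0e)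
  moreover have "m2 \<cdot> T = z0" by (rule coproduct_eqI[OF pq]) (simp_all add: Te xe ye z0e)
  moreover have "h1 \<cdot> S = h2 \<cdot> T" by (rule coproduct_eqI[OF pq]) (simp_all add: Se Te xe ye gc)
  ultimately have "agree m1 h1 m2 h2 z0" unfolding agree_def
    by (intro bexI[of _ S] bexI[of _ T] conjI) simp_all
  moreover have "null m1 h1 z1" by (rule null_glue[OF 1(1) pq']) (simp_all add: z1e xn yn)
  moreover have "null m2 h2 z1" by (rule null_glue[OF 2(1) pq']) (simp_all add: z1e xn yn)
  ultimately have "sim m1 h1 m2 h2" unfolding sim_def using z by blast
  then show "U = V" using cls_eq_iff[OF 1(1) 2(1)] by (simp add: 1(2) 2(2))
qed (use coproductD[OF ij] in simp_all)

lemma St_coproducts: "has_finite_coproducts St"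
  unfolding has_finite_coproducts_def
proof (intro conjI ballI)
  obtain I where "is_initial C I" by (rule initial_ex)
  then show "\<exists>I. is_initial St I" using emb_initial by blast
  fix A B assume "A \<in> Ob St" "B \<in> Ob St"
  then obtain i j where ij: "is_coproduct C i j" "Dom C i = A" "Dom C j = B" using coproduct_ex[of A B] by auto
  then show "\<exists>i j. is_coproduct St i j \<and> Dom St i = A \<and> Dom St j = B"
    using emb_coproduct[OF ij(1)] coproductD[OF ij(1)]
    by (intro exI[of _ "emb i"] exI[of _ "emb j"]) simp
qed

end

section \<open>Zero morphisms of pointed categories, and functors\<close>

context category
begin

lemma terminalE:
  assumes "is_terminal C T" "X \<in> Ob C"
  obtains f where "f \<in> Ar C" "Dom C f = X" "Cod C f = T"
  using assms unfolding is_terminal_def by auto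

lemma terminal_unique:
  assumes "is_terminal C T" "f \<in> Ar C" "g \<in> Ar C" "Cod C f = T" "Cod C g = T" "Dom C f = Dom C g"
  shows "f = g"
proof -
  have "\<exists>!h. h \<in> hom C (Dom C f) T" using assms(1,2) unfolding is_terminal_def by simp
  moreover have "f \<in> hom C (Dom C f) T" "g \<in> hom C (Dom C f) T" using assms by auto
  ultimately show ?thesis by blast
qed

lemma zero_trivial_ex:
  assumes "pointed C" "A \<in> Ob C" "B \<in> Ob C"
  obtains f where "is_trivial C (zero_objects C) f" "Dom C f = A" "Cod C f = B"
proof -
  obtain Z where Z: "Z \<in> zero_objects C" using assms(1) by (auto simp: pointed_def)
  then have z: "is_initial C Z" "is_terminal C Z" by (simp_all add: zero_objects_def)
  obtain g where g: "g \<in> Ar C" "Dom C g = A" "Cod C g = Z" by (rule terminalE[OF z(2) assms(2)])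
  obtain h where h: "h \<in> Ar C" "Dom C h = Z" "Cod C h = B" by (rule initialE[OF z(1) assms(3)])
  show thesis by (rule that[of "h \<cdot> g"]; (rule trivialI)?) (use g h Z in simp_all)
qed

lemma zero_trivial_unique:
  assumes "is_trivial C (zero_objects C) f" "is_trivial C (zero_objects C) f'" "Dom C f = Dom C f'" "Cod C f = Cod C f'"
  shows "f = f'"
proof -
  obtain g h where f: "f \<in> Ar C" "h \<in> Ar C" "g \<in> Ar C" "Cod C g = Dom C h" "Cod C g \<in> zero_objects C" "f = h \<cdot> g"
    "Dom C g = Dom C f" "Cod C h = Cod C f" by (rule trivialE[OF assms(1)])
  obtain g' h' where f': "f' \<in> Ar C" "h' \<in> Ar C" "g' \<in> Ar C" "Cod C g' = Dom C h'" "Cod C g' \<in> zero_objects C" "f' = h' \<cdot> g'"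
    "Dom C g' = Dom C f'" "Cod C h' = Cod C f'" by (rule trivialE[OF assms(2)])
  have z: "is_initial C (Dom C h)" "is_terminal C (Dom C h')" using f(4,5) f'(4,5) by (simp_all add: zero_objects_def)
  obtain u where u: "u \<in> Ar C" "Dom C u = Dom C h" "Cod C u = Dom C h'"
    by (rule initialE[OF z(1), of "Dom C h'"]) (use f'(2) in simp_all)
  have 1: "h' \<cdot> u = h" by (rule initial_unique[OF z(1)]) (use u f(2,8) f'(2,8) assms(4) in simp_all)
  have 2: "u \<cdot> g = g'" by (rule terminal_unique[OF z(2)]) (use u f(3,4,7) f'(3,4,7) assms(3) in simp_all)
  have "h \<cdot> g = h' \<cdot> g'" unfolding 1[symmetric] 2[symmetric] using u f(2-4) f'(2) by simp
  then show ?thesis using f(6) f'(6) by simp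
qed

text \<open>On both summands \<open>f\<close> coincides with the zero morphism, and injections are
  jointly epic. This is the counterpart in \<open>X\<close> of gluing trivial morphisms.\<close>

lemma zero_trivial_glue:
  assumes pt: "pointed C" and ij: "is_coproduct C i j" and f: "f \<in> Ar C" "Dom C f = Cod C i"
    and t: "is_trivial C (zero_objects C) (f \<cdot> i)" "is_trivial C (zero_objects C) (f \<cdot> j)"
  shows "is_trivial C (zero_objects C) f"
proof -
  note [simp] = coproductD[OF ij] f
  obtain g where g: "is_trivial C (zero_objects C) g" "Dom C g = Cod C i" "Cod C g = Cod C f"
    by (rule zero_trivial_ex[OF pt, of "Cod C i" "Cod C f"]) simp_all
  note [simp] = trivial_arr[OF g(1)] g(2,3)
  have "f = g"
  proof (rule coproduct_eqI[OF ij])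
    show "f \<cdot> i = g \<cdot> i" by (rule zero_trivial_unique[OF t(1)]) (use trivial_comp2[OF g(1), of i] in simp_all)
    show "f \<cdot> j = g \<cdot> j" by (rule zero_trivial_unique[OF t(2)]) (use trivial_comp2[OF g(1), of j] in simp_all)
  qed simp_all
  then show ?thesis using g(1) by simp
qed

lemma short_exact_iso:
  assumes ex: "short_Z_exact C \<Z> k c" and p: "is_iso C p" "Cod C p = Dom C k" and q: "is_iso C q" "Dom C q = Cod C c"
  shows "short_Z_exact C \<Z> (k \<cdot> p) (q \<cdot> c)"
proof -
  have K: "is_Z_kernel C \<Z> k c" and E: "is_Z_cokernel C \<Z> c k" using ex by (simp_all add: short_Z_exact_def)
  obtain p' where p' [simp]: "p \<in> Ar C" "p' \<in> Ar C" "Dom C p' = Cod C p" "Cod C p' = Dom C p"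
    "p' \<cdot> p = Ident C (Dom C p)" "p \<cdot> p' = Ident C (Cod C p)" by (rule isoE[OF p(1)])
  obtain q' where q' [simp]: "q \<in> Ar C" "q' \<in> Ar C" "Dom C q' = Cod C q" "Cod C q' = Dom C q"
    "q' \<cdot> q = Ident C (Dom C q)" "q \<cdot> q' = Ident C (Cod C q)" by (rule isoE[OF q(1)])
  note [simp] = p(2) q(2) Z_kernelD(1-3)[OF K] comp_tri[OF p'(5)] comp_tri[OF p'(6)] comp_tri[OF q'(5)] comp_tri[OF q'(6)]
  have t: "is_trivial C \<Z> (q \<cdot> (c \<cdot> (k \<cdot> p)))"
    using trivial_comp[OF trivial_comp2[OF Z_kernelD(4)[OF K], of p], of q] by simp
  have "is_Z_kernel C \<Z> (k \<cdot> p) (q \<cdot> c)"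
  proof (rule Z_kernelI)
    show "is_mono C (k \<cdot> p)" by (rule mono_comp[OF iso_mono[OF p(1)] Z_kernel_mono[OF K]]) simp
    show "is_trivial C \<Z> ((q \<cdot> c) \<cdot> (k \<cdot> p))" using t by simp
    fix u assume [simp]: "u \<in> Ar C" "Cod C u = Dom C (q \<cdot> c)" and tu: "is_trivial C \<Z> ((q \<cdot> c) \<cdot> u)"
    have "is_trivial C \<Z> (c \<cdot> u)" using trivial_comp[OF tu, of q'] by simp
    then obtain w where w [simp]: "w \<in> Ar C" "Dom C w = Dom C u" "Cod C w = Dom C k" "k \<cdot> w = u"
      by - (rule Z_kernelE[OF K, of u]; simp)
    show "\<exists>w\<in>Ar C. Dom C w = Dom C u \<and> Cod C w = Dom C (k \<cdot> p) \<and> (k \<cdot> p) \<cdot> w = u"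
      by (rule bexI[of _ "p' \<cdot> w"]) simp_all
  qed simp_all
  moreover have "is_Z_cokernel C \<Z> (q \<cdot> c) (k \<cdot> p)"
  proof (rule Z_cokernelI)
    show "is_trivial C \<Z> ((q \<cdot> c) \<cdot> (k \<cdot> p))" using t by simp
    fix u assume [simp]: "u \<in> Ar C" "Dom C u = Cod C (k \<cdot> p)" and tu: "is_trivial C \<Z> (u \<cdot> (k \<cdot> p))"
    have "is_trivial C \<Z> (u \<cdot> k)" using trivial_comp2[OF tu, of p'] by simp
    then obtain w where w [simp]: "w \<in> Ar C" "Dom C w = Cod C c" "Cod C w = Cod C u" and wc: "w \<cdot> c = u"
      by - (rule Z_cokernelE[OF E, of u]; simp)
    show "\<exists>w\<in>Ar C. Dom C w = Cod C (q \<cdot> c) \<and> Cod C w = Cod C u \<and> w \<cdot> (q \<cdot> c) = u"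
      by (rule bexI[of _ "w \<cdot> q'"]) (simp_all add: wc)
  next
    fix u v assume uv: "u \<in> Ar C" "v \<in> Ar C" "Dom C u = Cod C (q \<cdot> c)" "Dom C v = Cod C (q \<cdot> c)" "Cod C u = Cod C v"
      "u \<cdot> (q \<cdot> c) = v \<cdot> (q \<cdot> c)"
    have "u \<cdot> q = v \<cdot> q" by (rule Z_cokernel_epi[OF E]) (use uv in simp_all)
    then have "(u \<cdot> q) \<cdot> q' = (v \<cdot> q) \<cdot> q'" by simp
    then show "u = v" using uv by simp
  qed simp_all
  ultimately show ?thesis by (simp add: short_Z_exact_def)
qed

end

lemma functorD:
  assumes "is_functor C D F"
  shows "category C" "category D"
    and "A \<in> Ob C \<Longrightarrow> omap F A \<in> Ob D"
    and "f \<in> Ar C \<Longrightarrow> amap F f \<in> Ar D" "f \<in> Ar C \<Longrightarrow> Dom D (amap F f) = omap F (Dom C f)"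
      "f \<in> Ar C \<Longrightarrow> Cod D (amap F f) = omap F (Cod C f)"
    and "A \<in> Ob C \<Longrightarrow> amap F (Ident C A) = Ident D (omap F A)"
    and "f \<in> Ar C \<Longrightarrow> g \<in> Ar C \<Longrightarrow> Cod C f = Dom C g \<Longrightarrow> amap F (g \<cdot>\<^bsub>C\<^esub> f) = amap F g \<cdot>\<^bsub>D\<^esub> amap F f"
  using assms by (auto simp: is_functor_def)

lemma functor_iso:
  assumes F: "is_functor C D F" and f: "is_iso C f"
  shows "is_iso D (amap F f)"
proof -
  interpret C: category C by (rule functorD(1)[OF F])
  interpret D: category D by (rule functorD(2)[OF F])
  note [simp] = functorD(3-6)[OF F]
  obtain g where g [simp]: "f \<in> Ar C" "g \<in> Ar C" "Dom C g = Cod C f" "Cod C g = Dom C f"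
    "g \<cdot>\<^bsub>C\<^esub> f = Ident C (Dom C f)" "f \<cdot>\<^bsub>C\<^esub> g = Ident C (Cod C f)" by (rule C.isoE[OF f])
  show ?thesis
    by (rule D.isoI[of _ "amap F g"]) (simp_all add: functorD(7)[OF F] flip: functorD(8)[OF F])
qed

lemma functor_trivial:
  assumes F: "is_functor C D F" and Z: "omap F ` \<Z> \<subseteq> \<Z>'" and f: "is_trivial C \<Z> f"
  shows "is_trivial D \<Z>' (amap F f)"
proof -
  interpret C: category C by (rule functorD(1)[OF F])
  interpret D: category D by (rule functorD(2)[OF F])
  obtain g h where gh: "h \<in> Ar C" "g \<in> Ar C" "Cod C g = Dom C h" "Cod C g \<in> \<Z>" "f = h \<cdot>\<^bsub>C\<^esub> g"
    by (rule C.trivialE[OF f])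
  have "is_trivial D \<Z>' (amap F h \<cdot>\<^bsub>D\<^esub> amap F g)"
    by (rule D.trivialI) (use gh(1-4) Z in \<open>auto simp: functorD(3-6)[OF F]\<close>)
  then show ?thesis unfolding gh(5) by (simp add: functorD(8)[OF F gh(2,1,3)])
qed

section \<open>The universal property\<close>

locale torsion_functor = pretor_cat C \<T> \<F> for C :: "('o, 'm) cat" (structure) and \<T> \<F> :: "'o set" +
  fixes X :: "('x, 'y) cat" and \<T>' \<F>' :: "'x set" and G :: "('o, 'm, 'x, 'y) funct"
  assumes X_torsion: "torsion_theory X \<T>' \<F>'"
    and G_coproducts: "preserves_finite_coproducts C X G"
    and G_torsion: "torsion_theory_functor C \<T> \<F> X \<T>' \<F>' G"
begin

lemma X_pointed: "pointed X" and X_zero: "\<T>' \<inter> \<F>' = zero_objects X"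
  using X_torsion by (simp_all add: torsion_theory_def)

lemma G_functor: "is_functor C X G"
  using G_torsion by (simp add: torsion_theory_functor_def)

sublocale X: category X
  by (rule functorD(2)[OF G_functor])

abbreviation zero :: "'y \<Rightarrow> bool" where "zero \<equiv> is_trivial X (zero_objects X)"

lemma G_simps [simp]:
  "A \<in> Ob C \<Longrightarrow> omap G A \<in> Ob X"
  "f \<in> Ar C \<Longrightarrow> amap G f \<in> Ar X"
  "f \<in> Ar C \<Longrightarrow> Dom X (amap G f) = omap G (Dom C f)"
  "f \<in> Ar C \<Longrightarrow> Cod X (amap G f) = omap G (Cod C f)"
  using functorD(3-6)[OF G_functor] by auto

lemma G_comp: "f \<in> Ar C \<Longrightarrow> g \<in> Ar C \<Longrightarrow> Cod C f = Dom C g \<Longrightarrow> amap G g \<cdot>\<^bsub>X\<^esub> amap G f = amap G (g \<cdot> f)"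
  using functorD(8)[OF G_functor] by simp

lemma G_coproduct: "is_coproduct C i j \<Longrightarrow> is_coproduct X (amap G i) (amap G j)"
  using G_coproducts by (simp add: preserves_finite_coproducts_def)

lemma G_zero_objects: "omap G ` (\<T> \<inter> \<F>) \<subseteq> zero_objects X"
  using G_torsion X_zero by (auto simp: torsion_theory_functor_def)

lemma G_triv: "triv f \<Longrightarrow> zero (amap G f)"
  by (rule functor_trivial[OF G_functor G_zero_objects])

text \<open>The characterisation of the value at \<open>(a, f)\<close>. Zero is demanded on every
  arrow along which \<open>(a, f)\<close> vanishes and not on one chosen complement, so that the
  condition can be evaluated on the pieces given by an equivalence with another
  representative.\<close>

definition induced_rel :: "'m \<Rightarrow> 'm \<Rightarrow> 'y \<Rightarrow> bool" where
  "induced_rel a f h \<longleftrightarrow> h \<in> Ar X \<and> Dom X h = omap G (Cod C a) \<and> Cod X h = omap G (Cod C f) \<and>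
     h \<cdot>\<^bsub>X\<^esub> amap G a = amap G f \<and> (\<forall>x \<in> Ar C. Cod C x = Cod C a \<longrightarrow> null a f x \<longrightarrow> zero (h \<cdot>\<^bsub>X\<^esub> amap G x))"

text \<open>One complement suffices: an arrow along which \<open>(a, f)\<close> vanishes is cut by
  \<open>a\<close> and \<open>a'\<close>. On the first part \<open>h\<close> is the image of a
  trivial morphism, on the second it is zero by hypothesis, and \<open>G\<close> keeps the cutting a
  coproduct.\<close>

lemma induced_relI:
  assumes p: "pair a f" and a': "is_coproduct C a a'" and h [simp]: "h \<in> Ar X" "Dom X h = omap G (Cod C a)"
      "Cod X h = omap G (Cod C f)" and ha: "h \<cdot>\<^bsub>X\<^esub> amap G a = amap G f" and z: "zero (h \<cdot>\<^bsub>X\<^esub> amap G a')"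
  shows "induced_rel a f h"
  unfolding induced_rel_def
proof (intro conjI ballI impI)
  note [simp] = pairD(1-3)[OF p] coproductD[OF a']
  fix x assume x [simp]: "x \<in> Ar C" "Cod C x = Cod C a" and n: "null a f x"
  obtain r0 s0 r1 s1 where r: "is_coproduct C r0 r1"
    and p2: "is_pullback C r0 s0 x a" and p3: "is_pullback C r1 s1 x a'"
    by (rule decompose[OF a', of x]) simp_all
  note q2 = pullbackD[OF p2] and q3 = pullbackD[OF p3]
  note [simp] = q2(1-4,6-8) q3(1-4,6-8)
  show "zero (h \<cdot>\<^bsub>X\<^esub> amap G x)"
  proof (rule X.zero_trivial_glue[OF X_pointed G_coproduct[OF r]])
    have "(h \<cdot>\<^bsub>X\<^esub> amap G x) \<cdot>\<^bsub>X\<^esub> amap G r0 = h \<cdot>\<^bsub>X\<^esub> (amap G (a \<cdot> s0))"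
      by (simp add: G_comp q2(9))
    also have "\<dots> = (h \<cdot>\<^bsub>X\<^esub> amap G a) \<cdot>\<^bsub>X\<^esub> amap G s0" by (simp flip: G_comp)
    also have "\<dots> = amap G (f \<cdot> s0)" unfolding ha by (simp add: G_comp)
    finally have e: "(h \<cdot>\<^bsub>X\<^esub> amap G x) \<cdot>\<^bsub>X\<^esub> amap G r0 = amap G (f \<cdot> s0)" .
    show "zero ((h \<cdot>\<^bsub>X\<^esub> amap G x) \<cdot>\<^bsub>X\<^esub> amap G r0)" unfolding e
      by (rule G_triv, rule nullD[OF n, of _ r0]) (simp_all add: q2(9))
    have "(h \<cdot>\<^bsub>X\<^esub> amap G x) \<cdot>\<^bsub>X\<^esub> amap G r1 = h \<cdot>\<^bsub>X\<^esub> (amap G (a' \<cdot> s1))"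
      by (simp add: G_comp q3(9))
    also have "\<dots> = (h \<cdot>\<^bsub>X\<^esub> amap G a') \<cdot>\<^bsub>X\<^esub> amap G s1" by (simp flip: G_comp)
    finally have e: "(h \<cdot>\<^bsub>X\<^esub> amap G x) \<cdot>\<^bsub>X\<^esub> amap G r1 = (h \<cdot>\<^bsub>X\<^esub> amap G a') \<cdot>\<^bsub>X\<^esub> amap G s1" .
    show "zero ((h \<cdot>\<^bsub>X\<^esub> amap G x) \<cdot>\<^bsub>X\<^esub> amap G r1)" unfolding e
      by (rule X.trivial_comp2[OF z]) simp_all
  qed simp_all
qed (use assms in simp_all)

lemma induced_rel_agree:
  assumes p: "pair a f" and h: "induced_rel a f h" and x: "agree a f b g x" and "pair b g" and k: "induced_rel b g k"
  shows "h \<cdot>\<^bsub>X\<^esub> amap G x = k \<cdot>\<^bsub>X\<^esub> amap G x"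
proof -
  note [simp] = pairD(1-3)[OF p] pairD(1-3)[OF assms(4)]
  have h' [simp]: "h \<in> Ar X" "Dom X h = omap G (Cod C a)" and ha: "h \<cdot>\<^bsub>X\<^esub> amap G a = amap G f"
    using h by (simp_all add: induced_rel_def)
  have k' [simp]: "k \<in> Ar X" "Dom X k = omap G (Cod C b)" and kb: "k \<cdot>\<^bsub>X\<^esub> amap G b = amap G g"
    using k by (simp_all add: induced_rel_def)
  obtain s t where st [simp]: "s \<in> Ar C" "t \<in> Ar C" "Cod C s = Dom C a" "Cod C t = Dom C b"
    and e: "a \<cdot> s = x" "b \<cdot> t = x" "f \<cdot> s = g \<cdot> t"
    using x unfolding agree_def by blast
  have "h \<cdot>\<^bsub>X\<^esub> amap G (a \<cdot> s) = (h \<cdot>\<^bsub>X\<^esub> amap G a) \<cdot>\<^bsub>X\<^esub> amap G s" by (simp flip: G_comp)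
  also have "\<dots> = amap G (f \<cdot> s)" unfolding ha by (simp add: G_comp)
  also have "\<dots> = amap G (g \<cdot> t)" by (simp only: e(3))
  also have "\<dots> = (k \<cdot>\<^bsub>X\<^esub> amap G b) \<cdot>\<^bsub>X\<^esub> amap G t" unfolding kb by (simp add: G_comp)
  also have "\<dots> = k \<cdot>\<^bsub>X\<^esub> amap G (b \<cdot> t)" by (simp flip: G_comp)
  finally show ?thesis unfolding e .
qed

text \<open>Well-definedness: \<open>G\<close> sends the cutting of the equivalence to a coproduct
  in \<open>X\<close>. The two values agree on its first injection and are zero on the
  second.\<close>

lemma induced_rel_sim:
  assumes p: "pair a f" "pair b g" and s: "sim a f b g" and h: "induced_rel a f h" and k: "induced_rel b g k"
  shows "h = k"
proof -
  obtain x0 x1 where x: "is_coproduct C x0 x1" "agree a f b g x0" "null a f x1" "null b g x1"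
    "Cod C x0 = Cod C a" "Cod C b = Cod C a" "Cod C g = Cod C f" by (rule simE[OF s p])
  note [simp] = coproductD[OF x(1)] x(5-7) pairD(1-3)[OF p(1)] pairD(1-3)[OF p(2)]
  have [simp]: "h \<in> Ar X" "Dom X h = omap G (Cod C a)" "Cod X h = omap G (Cod C f)"
      "k \<in> Ar X" "Dom X k = omap G (Cod C a)" "Cod X k = omap G (Cod C f)"
    using h k by (simp_all add: induced_rel_def)
  show ?thesis
  proof (rule X.coproduct_eqI[OF G_coproduct[OF x(1)]])
    show "h \<cdot>\<^bsub>X\<^esub> amap G x0 = k \<cdot>\<^bsub>X\<^esub> amap G x0" by (rule induced_rel_agree[OF p(1) h x(2) p(2) k])
    have "zero (h \<cdot>\<^bsub>X\<^esub> amap G x1)" "zero (k \<cdot>\<^bsub>X\<^esub> amap G x1)"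
      using h k x(3,4) by (simp_all add: induced_rel_def)
    then show "h \<cdot>\<^bsub>X\<^esub> amap G x1 = k \<cdot>\<^bsub>X\<^esub> amap G x1" by (rule X.zero_trivial_unique) simp_all
  qed simp_all
qed

text \<open>Since \<open>G\<close> preserves the coproduct of \<open>a\<close> and its complement,
  \<open>G f\<close> and a zero morphism can be copaired.\<close>

lemma induced_rel_ex:
  assumes p: "pair a f"
  shows "\<exists>h. induced_rel a f h"
proof -
  obtain a' where a': "is_coproduct C a a'" using complementedE[OF pairD(5)[OF p]] .
  note [simp] = pairD(1-3)[OF p] coproductD[OF a']
  obtain z where z: "zero z" "Dom X z = omap G (Dom C a')" "Cod X z = omap G (Cod C f)"
    by (rule X.zero_trivial_ex[OF X_pointed, of "omap G (Dom C a')" "omap G (Cod C f)"]) simp_all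
  note [simp] = X.trivial_arr[OF z(1)] z(2,3)
  obtain h where h: "h \<in> Ar X" "Dom X h = Cod X (amap G a)" "Cod X h = Cod X (amap G f)"
    "h \<cdot>\<^bsub>X\<^esub> amap G a = amap G f" "h \<cdot>\<^bsub>X\<^esub> amap G a' = z"
    by (rule X.copairE[OF G_coproduct[OF a'], of "amap G f" z]) simp_all
  show ?thesis by (rule exI, rule induced_relI[OF p a' h(1)]) (use h z(1) in simp_all)
qed

text \<open>The choice covers the representative and the value together; by
  \<open>induced_rel_sim\<close> any choice gives the same value.\<close>

definition induced :: "('m \<times> 'm) set set \<Rightarrow> 'y" where
  "induced K = (SOME h. \<exists>a f. pair a f \<and> K = cls a f \<and> induced_rel a f h)"

lemma induced_eq:
  assumes p: "pair a f" and h: "induced_rel a f h"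
  shows "induced (cls a f) = h"
proof -
  have "\<exists>b g. pair b g \<and> cls a f = cls b g \<and> induced_rel b g (induced (cls a f))"
    unfolding induced_def by (rule someI_ex) (use p h in blast)
  then obtain b g where b: "pair b g" "cls a f = cls b g" "induced_rel b g (induced (cls a f))" by blast
  have "sim a f b g" using cls_eq_iff[OF p b(1)] b(2) by simp
  from induced_rel_sim[OF p b(1) this h b(3)] show ?thesis ..
qed

lemma induced_rel: "pair a f \<Longrightarrow> induced_rel a f (induced (cls a f))"
  using induced_rel_ex induced_eq by metis

lemma induced_relD:
  assumes "pair a f" "induced_rel a f h"
  shows "h \<in> Ar X" "Dom X h = omap G (Cod C a)" "Cod X h = omap G (Cod C f)" "h \<cdot>\<^bsub>X\<^esub> amap G a = amap G f"
    and "x \<in> Ar C \<Longrightarrow> Cod C x = Cod C a \<Longrightarrow> null a f x \<Longrightarrow> zero (h \<cdot>\<^bsub>X\<^esub> amap G x)"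
  using assms by (simp_all add: induced_rel_def)

lemma induced_emb:
  assumes [simp]: "f \<in> Ar C"
  shows "induced (emb f) = amap G f"
proof (rule induced_eq)
  obtain I where I: "is_initial C I" by (rule initial_ex)
  obtain a where a [simp]: "a \<in> Ar C" "Dom C a = I" "Cod C a = Dom C f"
    by (rule initialE[OF I, of "Dom C f"]) simp_all
  have c: "is_coproduct C (Ident C (Dom C f)) a" using coproduct_initial[OF I a(1,2)] by simp
  show "induced_rel (Ident C (Dom C f)) f (amap G f)"
  proof (rule induced_relI[OF _ c])
    have "triv (f \<cdot> a)" by (rule triv_from_initial) (simp_all add: I)
    then show "zero (amap G f \<cdot>\<^bsub>X\<^esub> amap G a)" using G_triv by (simp add: G_comp)
  qed (simp_all add: G_comp)
qed simp

text \<open>The composite of the two values satisfies the characterisation for the composite class: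
  on the domain it is the functoriality of \<open>G\<close>, and on each part of the complement one
  of the two factors is zero.\<close>

lemma induced_comp:
  assumes p: "pair a f" "pair b g" and fb: "Cod C f = Cod C b"
  shows "induced (Comp St (cls b g) (cls a f)) = induced (cls b g) \<cdot>\<^bsub>X\<^esub> induced (cls a f)"
proof -
  define h where "h = induced (cls a f)"
  define k where "k = induced (cls b g)"
  have h: "induced_rel a f h" and k: "induced_rel b g k" unfolding h_def k_def by (simp_all add: induced_rel p)
  note hD = induced_relD[OF p(1) h] and kD = induced_relD[OF p(2) k]
  note [simp] = pairD(1-3)[OF p(1)] pairD(1-3)[OF p(2)] fb hD(1-3) kD(1-3)
  obtain a' where a': "is_coproduct C a a'" using complementedE[OF pairD(5)[OF p(1)]] .
  obtain b' where b': "is_coproduct C b b'" using complementedE[OF pairD(5)[OF p(2)]] .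
  note [simp] = coproductD[OF a'] coproductD[OF b']
  obtain u0 v0 u1 v1 where u: "is_coproduct C u0 u1"
    and pb: "is_pullback C u0 v0 f b" and pb': "is_pullback C u1 v1 f b'"
    by (rule decompose[OF b', of f]) simp_all
  note q0 = pullbackD[OF pb] and q1 = pullbackD[OF pb']
  note [simp] = q0(1-4,6-8) q1(1-4,6-8)
  obtain k1 k2 where k12: "is_coproduct C k1 k2" "Dom C k1 = Dom C u1" "Dom C k2 = Dom C a'"
    by (rule coproduct_ex[of "Dom C u1" "Dom C a'"]) simp_all
  note [simp] = coproductD[OF k12(1)] k12(2,3)
  \<comment> \<open>The complement of the composite domain \<open>a \<cdot> u0\<close> has two
    parts: \<open>u1\<close>, where \<open>f\<close> leaves the domain of \<open>g\<close>, and the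
    complement \<open>a'\<close> of \<open>a\<close>.\<close>
  obtain z where z: "is_coproduct C (a \<cdot> u0) z" "Dom C z = Cod C k1" "z \<cdot> k1 = a \<cdot> u1" "z \<cdot> k2 = a'"
    by (rule coproduct_assoc[OF a' u _ k12]) simp_all
  have zz [simp]: "z \<in> Ar C" "Cod C z = Cod C a" using coproductD[OF z(1)] by simp_all
  note [simp] = z(2)
  have ha: "h \<cdot>\<^bsub>X\<^esub> amap G (a \<cdot> s) = amap G (f \<cdot> s)" if [simp]: "s \<in> Ar C" "Cod C s = Dom C a" for s
  proof -
    have "h \<cdot>\<^bsub>X\<^esub> amap G (a \<cdot> s) = (h \<cdot>\<^bsub>X\<^esub> amap G a) \<cdot>\<^bsub>X\<^esub> amap G s" by (simp flip: G_comp)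
    also have "\<dots> = amap G (f \<cdot> s)" unfolding hD(4) by (simp add: G_comp)
    finally show ?thesis .
  qed
  have kb: "k \<cdot>\<^bsub>X\<^esub> amap G (b \<cdot> s) = amap G (g \<cdot> s)" if [simp]: "s \<in> Ar C" "Cod C s = Dom C b" for s
  proof -
    have "k \<cdot>\<^bsub>X\<^esub> amap G (b \<cdot> s) = (k \<cdot>\<^bsub>X\<^esub> amap G b) \<cdot>\<^bsub>X\<^esub> amap G s" by (simp flip: G_comp)
    also have "\<dots> = amap G (g \<cdot> s)" unfolding kD(4) by (simp add: G_comp)
    finally show ?thesis .
  qed
  have "induced_rel (a \<cdot> u0) (g \<cdot> v0) (k \<cdot>\<^bsub>X\<^esub> h)"
  proof (rule induced_relI[OF pair_comp[OF p pb] z(1)])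
    show "(k \<cdot>\<^bsub>X\<^esub> h) \<cdot>\<^bsub>X\<^esub> amap G (a \<cdot> u0) = amap G (g \<cdot> v0)" by (simp add: ha kb q0(9))
    show "zero ((k \<cdot>\<^bsub>X\<^esub> h) \<cdot>\<^bsub>X\<^esub> amap G z)"
    proof (rule X.zero_trivial_glue[OF X_pointed G_coproduct[OF k12(1)]])
      have n: "null b g b'" by (rule null_disjoint[OF b']) simp_all
      have "null b g (b' \<cdot> v1)" by (rule null_comp[OF n]) simp_all
      then have "zero (k \<cdot>\<^bsub>X\<^esub> amap G (b' \<cdot> v1))" by - (rule kD(5); simp)
      then show "zero (((k \<cdot>\<^bsub>X\<^esub> h) \<cdot>\<^bsub>X\<^esub> amap G z) \<cdot>\<^bsub>X\<^esub> amap G k1)" by (simp add: G_comp z(3) ha q1(9))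
      have n: "null a f a'" by (rule null_disjoint[OF a']) simp_all
      then have "zero (h \<cdot>\<^bsub>X\<^esub> amap G a')" by - (rule hD(5); simp)
      then have "zero (k \<cdot>\<^bsub>X\<^esub> (h \<cdot>\<^bsub>X\<^esub> amap G a'))" by (rule X.trivial_comp) simp_all
      then show "zero (((k \<cdot>\<^bsub>X\<^esub> h) \<cdot>\<^bsub>X\<^esub> amap G z) \<cdot>\<^bsub>X\<^esub> amap G k2)" by (simp add: G_comp z(4))
    qed simp_all
  qed simp_all
  from induced_eq[OF pair_comp[OF p pb] this] show ?thesis
    unfolding cls_Comp[OF p pb] h_def k_def .
qed

definition induced_functor :: "('o, ('m \<times> 'm) set set, 'x, 'y) funct" where
  "induced_functor = \<lparr>omap = omap G, amap = induced\<rparr>"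

lemma induced_functor: "is_functor St X induced_functor"
  unfolding is_functor_def induced_functor_def
proof (intro conjI ballI impI; (simp only: funct.simps)?)
  show "category St" by (rule St_category)
  show "category X" by (rule X.category_axioms)
  show "omap G A \<in> Ob X" if "A \<in> Ob St" for A using that by simp
  show "induced (Ident St A) = Ident X (omap G A)" if "A \<in> Ob St" for A
    using that induced_emb[of "Ident C A"] functorD(7)[OF G_functor] by (simp add: St_Ident)
  fix K assume "K \<in> Ar St"
  then obtain a f where a: "pair a f" "K = cls a f" by (rule St_arrE)
  show "induced K \<in> hom X (omap G (Dom St K)) (omap G (Cod St K))"
    unfolding a(2) using induced_relD[OF a(1) induced_rel[OF a(1)]] cls_Dom[OF a(1)] by simp
  fix L assume "L \<in> Ar St" and c: "Cod St K = Dom St L"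
  then obtain b g where b: "pair b g" "L = cls b g" by - (erule St_arrE)
  have "Cod C f = Cod C b" using c by (simp add: a(2) b(2) cls_Dom[OF a(1)] cls_Dom[OF b(1)])
  then show "induced (Comp St L K) = induced L \<cdot>\<^bsub>X\<^esub> induced K" unfolding a(2) b(2) by (rule induced_comp[OF a(1) b(1)])
qed

text \<open>The value of \<open>H\<close> satisfies the characterisation. Precomposing the class
  with the embedded \<open>a\<close> yields the embedded \<open>f\<close>; precomposing it with the
  embedded complement yields a trivial class, and \<open>H\<close> sends this to zero.\<close>

lemma induced_unique:
  assumes H: "is_functor St X H" and G: "\<And>f. f \<in> Ar C \<Longrightarrow> amap H (emb f) = amap G f"
    and GO: "\<And>A. A \<in> Ob C \<Longrightarrow> omap H A = omap G A" and K: "K \<in> Ar St"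
  shows "amap H K = induced K"
proof -
  obtain a f where a: "pair a f" "K = cls a f" using K by (rule St_arrE)
  note [simp] = pairD(1-3)[OF a(1)] cls_Dom[OF a(1)] cls_arr[OF a(1)]
  obtain a' where a': "is_coproduct C a a'" using complementedE[OF pairD(5)[OF a(1)]] .
  note [simp] = coproductD[OF a']
  have "induced_rel a f (amap H K)" unfolding a(2)
  proof (rule induced_relI[OF a(1) a'])
    show "amap H (cls a f) \<in> Ar X" "Dom X (amap H (cls a f)) = omap G (Cod C a)" "Cod X (amap H (cls a f)) = omap G (Cod C f)"
      using functorD(4-6)[OF H, of "cls a f"] GO by simp_all
    have pb: "is_pullback C (Ident C (Dom C a)) (Ident C (Dom C a)) a a"
    proof (rule pullbackI)
      fix u v assume uv: "u \<in> Ar C" "v \<in> Ar C" "Cod C u = Dom C a" "Cod C v = Dom C a" "Dom C v = Dom C u" "a \<cdot> u = a \<cdot> v"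
      then have "u = v" by - (rule monoD[OF pairD(4)[OF a(1)]]; simp)
      with uv show "\<exists>w\<in>Ar C. Dom C w = Dom C u \<and> Cod C w = Dom C (Ident C (Dom C a)) \<and>
          Ident C (Dom C a) \<cdot> w = u \<and> Ident C (Dom C a) \<cdot> w = v"
        by (intro bexI[of _ u]) simp_all
    qed simp_all
    have "amap H (cls a f) \<cdot>\<^bsub>X\<^esub> amap H (emb a) = amap H (Comp St (cls a f) (emb a))"
      by (rule functorD(8)[OF H, symmetric]) simp_all
    also have "Comp St (cls a f) (emb a) = emb f" using cls_comp_emb[OF _ a(1) pb] by simp
    finally show "amap H (cls a f) \<cdot>\<^bsub>X\<^esub> amap G a = amap G f" using G[of a] G[of f] by simp
    obtain s t where st: "is_pullback C s t a' a" by (rule pullback_ex[of a' a]) simp_all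
    note q = pullbackD[OF st]
    note [simp] = q(1-4,6-8)
    \<comment> \<open>The composite with the embedded complement is defined on the intersection of
      \<open>a\<close> and \<open>a'\<close>, which is empty.\<close>
    have "is_initial C (Dom C s)" by (rule disjoint[OF a', of t s]) (simp_all add: q(9))
    then have t: "triv (f \<cdot> t)" by - (rule triv_from_initial; simp)
    have ps: "pair s (f \<cdot> t)" using complemented_pullback[OF pairD(5)[OF a(1)] st] by (simp add: pair_def)
    have "is_trivial St (\<T> \<inter> \<F>) (cls s (f \<cdot> t))" using St_triv_iff[OF ps] t by simp
    \<comment> \<open>\<open>H\<close> agrees with \<open>G\<close> on objects, so it sends trivial
      objects to zero objects.\<close>
    moreover have "omap H ` (\<T> \<inter> \<F>) \<subseteq> zero_objects X" using G_zero_objects GO TF_Ob by (auto simp: image_subset_iff)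
    ultimately have "zero (amap H (cls s (f \<cdot> t)))" by - (rule functor_trivial[OF H])
    also have "cls s (f \<cdot> t) = Comp St (cls a f) (emb a')" using cls_comp_emb[OF _ a(1) st] by simp
    also have "amap H \<dots> = amap H (cls a f) \<cdot>\<^bsub>X\<^esub> amap H (emb a')" by (rule functorD(8)[OF H]) simp_all
    finally show "zero (amap H (cls a f) \<cdot>\<^bsub>X\<^esub> amap G a')" using G[of a'] by simp
  qed
  from induced_eq[OF a(1) this] show ?thesis by (simp add: a(2))
qed

text \<open>Every coproduct of the stable category is isomorphic to an embedded one with the same
  summands, and on embedded arrows the induced functor is \<open>G\<close>.\<close>

lemma induced_coproducts: "preserves_finite_coproducts St X induced_functor"
  unfolding preserves_finite_coproducts_def
proof (intro conjI allI impI)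
  fix I assume I: "is_initial St I"
  obtain J where J: "is_initial C J" by (rule initial_ex)
  obtain K where K: "is_iso St K" "Dom St K = J" "Cod St K = I"
    by (rule St.initial_isomorphic[OF emb_initial[OF J] I])
  have 1: "is_iso X (amap induced_functor K)" by (rule functor_iso[OF induced_functor K(1)])
  have 2: "is_initial X (omap G J)" using G_coproducts J by (simp add: preserves_finite_coproducts_def)
  show "is_initial X (omap induced_functor I)"
    using X.initial_iso[OF 2 1] functorD(5,6)[OF induced_functor St.iso_arr[OF K(1)]] K(2,3)
    by (simp add: induced_functor_def)
next
  fix K L assume KL: "is_coproduct St K L"
  note kl = St.coproductD[OF KL]
  have "Dom St K \<in> Ob C" "Dom St L \<in> Ob C"
    using St.dom_cod_Ob(1)[OF kl(1)] St.dom_cod_Ob(1)[OF kl(2)] by simp_all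
  then obtain i j where ij: "is_coproduct C i j" "Dom C i = Dom St K" "Dom C j = Dom St L" by (rule coproduct_ex)
  note [simp] = coproductD[OF ij(1)]
  obtain M where M: "is_iso St M" "Dom St M = Cod St (emb i)" "Cod St M = Cod St K"
    "Comp St M (emb i) = K" "Comp St M (emb j) = L"
    by (rule St.coproduct_unique[OF emb_coproduct[OF ij(1)] KL]) (simp_all add: ij(2,3))
  note F = functorD[OF induced_functor]
  have MA [simp]: "M \<in> Ar St" by (rule St.iso_arr[OF M(1)])
  have "is_coproduct X (amap induced_functor M \<cdot>\<^bsub>X\<^esub> amap G i) (amap induced_functor M \<cdot>\<^bsub>X\<^esub> amap G j)"
    by (rule X.coproduct_iso[OF G_coproduct[OF ij(1)] functor_iso[OF induced_functor M(1)]])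
      (use F(5)[OF MA] M(2) in \<open>simp add: induced_functor_def\<close>)
  moreover have "amap induced_functor (emb i) = amap G i" "amap induced_functor (emb j) = amap G j"
    using induced_emb[of i] induced_emb[of j] by (simp_all add: induced_functor_def)
  moreover have "amap induced_functor K = amap induced_functor M \<cdot>\<^bsub>X\<^esub> amap induced_functor (emb i)"
    unfolding M(4)[symmetric] by (rule F(8)) (use M(2) in simp_all)
  moreover have "amap induced_functor L = amap induced_functor M \<cdot>\<^bsub>X\<^esub> amap induced_functor (emb j)"
    unfolding M(5)[symmetric] by (rule F(8)) (use M(2) in simp_all)
  ultimately show "is_coproduct X (amap induced_functor K) (amap induced_functor L)" by simp
qed

text \<open>Condition (2) speaks of every canonical sequence of the stable category. Each is
  isomorphic to an embedded one, whose image under \<open>G\<close> is short exact.\<close>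

lemma induced_torsion: "torsion_theory_functor St \<T> \<F> X \<T>' \<F>' induced_functor"
  unfolding torsion_theory_functor_def
proof (intro conjI ballI allI impI)
  show "is_functor St X induced_functor" by (rule induced_functor)
  show "omap induced_functor ` \<T> \<subseteq> \<T>'" "omap induced_functor ` \<F> \<subseteq> \<F>'"
    using G_torsion by (simp_all add: torsion_theory_functor_def induced_functor_def)
  note F = functorD[OF induced_functor]
  fix A K L assume A: "A \<in> Ob St" and KL: "canonical_seq St \<T> \<F> A K L"
  obtain k c where kc: "canonical_seq C \<T> \<F> A k c" using A by (auto intro: canonical_ex)
  note d = canonical_seqD[OF kc] and D = St.canonical_seqD[OF KL]
  have ex: "short_Z_exact X (zero_objects X) (amap G k) (amap G c)"
    using G_torsion kc A by (simp add: torsion_theory_functor_def)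
  note kc' = emb_canonical[OF kc]
  obtain P where P: "is_iso St P" "Dom St P = Dom St K" "Cod St P = Dom St (emb k)" "Comp St (emb k) P = K"
    by (rule St.canonical_unique[OF St_pretorsion kc' KL])
  obtain Q where Q: "is_iso St Q" "Dom St Q = Cod St (emb c)" "Cod St Q = Cod St L" "Comp St Q (emb c) = L"
    by (rule St.canonical_unique[OF St_pretorsion KL kc'])
  note [simp] = d(5,6) St.iso_arr[OF P(1)] St.iso_arr[OF Q(1)]
  have e: "amap induced_functor (emb k) = amap G k" "amap induced_functor (emb c) = amap G c"
    using induced_emb[of k] induced_emb[of c] by (simp_all add: induced_functor_def)
  have "amap induced_functor K = amap G k \<cdot>\<^bsub>X\<^esub> amap induced_functor P"
    unfolding P(4)[symmetric] e(1)[symmetric] by (rule F(8)) (use P(3) in simp_all)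
  moreover have "amap induced_functor L = amap induced_functor Q \<cdot>\<^bsub>X\<^esub> amap G c"
    unfolding Q(4)[symmetric] e(2)[symmetric] by (rule F(8)) (use Q(2) in simp_all)
  moreover have "short_Z_exact X (zero_objects X) (amap G k \<cdot>\<^bsub>X\<^esub> amap induced_functor P) (amap induced_functor Q \<cdot>\<^bsub>X\<^esub> amap G c)"
  proof (rule X.short_exact_iso[OF ex functor_iso[OF induced_functor P(1)] _ functor_iso[OF induced_functor Q(1)]])
    show "Cod X (amap induced_functor P) = Dom X (amap G k)"
      using F(6)[of P] P(3) by (simp add: induced_functor_def)
    show "Dom X (amap induced_functor Q) = Cod X (amap G c)"
      using F(5)[of Q] Q(2) by (simp add: induced_functor_def)
  qed
  ultimately show "short_Z_exact X (zero_objects X) (amap induced_functor K) (amap induced_functor L)" by simp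
qed

end

section \<open>Internal relations through generalised elements\<close>

text \<open>\<open>x\<close> and \<open>y\<close> are generalised elements of the base, and the pair
  they form factors through the relation. Their types are not demanded; \<open>holdsD\<close>
  recovers them from the factorisation.\<close>

definition holds :: "('o, 'm) cat \<Rightarrow> ('o, 'm) irel \<Rightarrow> 'm \<Rightarrow> 'm \<Rightarrow> bool" where
  "holds C R x y \<longleftrightarrow> (\<exists>t \<in> Ar C. Cod C t = Dom C (pr1 R) \<and> pr1 R \<cdot>\<^bsub>C\<^esub> t = x \<and> pr2 R \<cdot>\<^bsub>C\<^esub> t = y)"

lemma holdsE:
  assumes "holds C R x y"
  obtains t where "t \<in> Ar C" "Cod C t = Dom C (pr1 R)" "pr1 R \<cdot>\<^bsub>C\<^esub> t = x" "pr2 R \<cdot>\<^bsub>C\<^esub> t = y"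
  using assms by (auto simp: holds_def)

lemma holdsI:
  assumes "t \<in> Ar C" "Cod C t = Dom C (pr1 R)" "pr1 R \<cdot>\<^bsub>C\<^esub> t = x" "pr2 R \<cdot>\<^bsub>C\<^esub> t = y"
  shows "holds C R x y"
  using assms by (auto simp: holds_def)

lemma relD:
  assumes "is_relation C R"
  shows "base R \<in> Ob C" "pr1 R \<in> Ar C" "pr2 R \<in> Ar C" "Cod C (pr1 R) = base R" "Cod C (pr2 R) = base R"
    "Dom C (pr2 R) = Dom C (pr1 R)"
  using assms by (simp_all add: is_relation_def)

lemma rel_eqI:
  assumes "is_relation C R" "u \<in> Ar C" "v \<in> Ar C" "Cod C u = Dom C (pr1 R)" "Cod C v = Dom C (pr1 R)"
    "Dom C u = Dom C v" "pr1 R \<cdot>\<^bsub>C\<^esub> u = pr1 R \<cdot>\<^bsub>C\<^esub> v" "pr2 R \<cdot>\<^bsub>C\<^esub> u = pr2 R \<cdot>\<^bsub>C\<^esub> v"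
  shows "u = v"
  using assms by (simp add: is_relation_def)

lemma relI:
  assumes "pr1 R \<in> Ar C" "pr2 R \<in> Ar C" "Cod C (pr1 R) = base R" "Cod C (pr2 R) = base R"
    "Dom C (pr2 R) = Dom C (pr1 R)" "base R \<in> Ob C"
    and "\<And>u v. u \<in> Ar C \<Longrightarrow> v \<in> Ar C \<Longrightarrow> Cod C u = Dom C (pr1 R) \<Longrightarrow> Cod C v = Dom C (pr1 R) \<Longrightarrow>
      Dom C u = Dom C v \<Longrightarrow> pr1 R \<cdot>\<^bsub>C\<^esub> u = pr1 R \<cdot>\<^bsub>C\<^esub> v \<Longrightarrow> pr2 R \<cdot>\<^bsub>C\<^esub> u = pr2 R \<cdot>\<^bsub>C\<^esub> v \<Longrightarrow> u = v"
  shows "is_relation C R"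
  using assms by (simp add: is_relation_def)

section \<open>Inclusion, symmetry and monotonicity in terms of elements\<close>

context category
begin

lemma holdsD:
  assumes "is_relation C R" "holds C R x y"
  shows "x \<in> Ar C" "y \<in> Ar C" "Cod C x = base R" "Cod C y = base R" "Dom C y = Dom C x"
proof -
  obtain t where t: "t \<in> Ar C" "Cod C t = Dom C (pr1 R)" "pr1 R \<cdot> t = x" "pr2 R \<cdot> t = y"
    using assms(2) by (rule holdsE)
  show "x \<in> Ar C" "y \<in> Ar C" "Cod C x = base R" "Cod C y = base R" "Dom C y = Dom C x"
    unfolding t(3)[symmetric] t(4)[symmetric] using t(1,2) relD[OF assms(1)] by simp_all
qed

lemma holds_comp:
  assumes R: "is_relation C R" and h: "holds C R x y" and z: "z \<in> Ar C" "Cod C z = Dom C x"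
  shows "holds C R (x \<cdot> z) (y \<cdot> z)"
proof -
  obtain t where t: "t \<in> Ar C" "Cod C t = Dom C (pr1 R)" "pr1 R \<cdot> t = x" "pr2 R \<cdot> t = y"
    using h by (rule holdsE)
  note [simp] = relD[OF R] t(1,2) z(1)
  have [simp]: "Cod C z = Dom C t" using z(2) unfolding t(3)[symmetric] by simp
  show ?thesis by (rule holdsI[of "t \<cdot> z"]) (simp_all add: comp_tri[OF t(3)] comp_tri[OF t(4)])
qed

lemma holds_pr: "is_relation C R \<Longrightarrow> holds C R (pr1 R) (pr2 R)"
  by (rule holdsI[of "Ident C (Dom C (pr1 R))"]) (simp_all add: relD)

text \<open>The projections form the universal related pair; every related pair is a restriction of
  it.\<close>

lemma holds_imp:
  assumes R: "is_relation C R" and h: "holds C R x y" and S: "is_relation C S" and f: "f \<in> Ar C" "Dom C f = base R"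
    and S': "holds C S (f \<cdot> pr1 R) (f \<cdot> pr2 R)"
  shows "holds C S (f \<cdot> x) (f \<cdot> y)"
proof -
  obtain t where t: "t \<in> Ar C" "Cod C t = Dom C (pr1 R)" "pr1 R \<cdot> t = x" "pr2 R \<cdot> t = y"
    using h by (rule holdsE)
  have "holds C S ((f \<cdot> pr1 R) \<cdot> t) ((f \<cdot> pr2 R) \<cdot> t)"
    by (rule holds_comp[OF S S']) (use t(1,2) relD[OF R] f in simp_all)
  then show ?thesis using t relD[OF R] f by simp
qed

lemma rel_le_iff:
  assumes R: "is_relation C R" and S: "is_relation C S" and b: "base R = base S"
  shows "rel_le C R S \<longleftrightarrow> (\<forall>x y. holds C R x y \<longrightarrow> holds C S x y)"
proof
  assume "rel_le C R S"
  then obtain t where t: "t \<in> Ar C" "Dom C t = Dom C (pr1 R)" "Cod C t = Dom C (pr1 S)" "pr1 S \<cdot> t = pr1 R" "pr2 S \<cdot> t = pr2 R"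
    by (auto simp: rel_le_def)
  have "holds C S (pr1 R) (pr2 R)" by (rule holdsI[of t]) (use t in simp_all)
  then have *: "holds C S (Ident C (base R) \<cdot> pr1 R) (Ident C (base R) \<cdot> pr2 R)" using relD[OF R] by simp
  show "\<forall>x y. holds C R x y \<longrightarrow> holds C S x y"
  proof (intro allI impI)
    fix x y assume h: "holds C R x y"
    show "holds C S x y"
      using holds_imp[OF R h S _ _ *] relD[OF R] holdsD[OF R h] by simp
  qed
next
  assume "\<forall>x y. holds C R x y \<longrightarrow> holds C S x y"
  then have "holds C S (pr1 R) (pr2 R)" using holds_pr[OF R] by blast
  then obtain t where t: "t \<in> Ar C" "Cod C t = Dom C (pr1 S)" "pr1 S \<cdot> t = pr1 R" "pr2 S \<cdot> t = pr2 R" by (rule holdsE)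
  have "Dom C t = Dom C (pr1 R)" using comp_arr(2)[of t "pr1 S"] t relD[OF S] by simp
  then show "rel_le C R S" using t b by (auto simp: rel_le_def)
qed

lemma rel_conv_relation:
  assumes R: "is_relation C R"
  shows "is_relation C (rel_conv R)" "holds C (rel_conv R) x y \<longleftrightarrow> holds C R y x" "base (rel_conv R) = base R"
proof -
  show "is_relation C (rel_conv R)"
    by (rule relI) (use relD[OF R] in \<open>simp_all add: rel_conv_def\<close>, rule rel_eqI[OF R], simp_all)
  show "holds C (rel_conv R) x y \<longleftrightarrow> holds C R y x"
    unfolding holds_def rel_conv_def using relD[OF R] by auto
qed (simp add: rel_conv_def)

lemma rel_diag_relation:
  assumes A: "A \<in> Ob C"
  shows "is_relation C (rel_diag C A)" "holds C (rel_diag C A) x y \<longleftrightarrow> x \<in> Ar C \<and> Cod C x = A \<and> x = y"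
    "base (rel_diag C A) = A"
proof -
  show "is_relation C (rel_diag C A)"
    by (rule relI) (use A in \<open>simp_all add: rel_diag_def\<close>)
  show "holds C (rel_diag C A) x y \<longleftrightarrow> x \<in> Ar C \<and> Cod C x = A \<and> x = y"
    unfolding holds_def rel_diag_def using A by auto
qed (simp add: rel_diag_def)

lemma symmetric_iff:
  assumes R: "is_relation C R"
  shows "rel_symmetric C R \<longleftrightarrow> (\<forall>x y. holds C R x y \<longrightarrow> holds C R y x)"
  unfolding rel_symmetric_def
  using rel_le_iff[OF rel_conv_relation(1)[OF R] R] rel_le_iff[OF R rel_conv_relation(1)[OF R]]
  by (auto simp: rel_conv_relation(2,3)[OF R])

lemma monotone_iff:
  assumes R: "is_relation C R" and S: "is_relation C S"
  shows "is_monotone C R S f \<longleftrightarrow> f \<in> Ar C \<and> Dom C f = base R \<and> Cod C f = base S \<and>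
    (\<forall>x y. holds C R x y \<longrightarrow> holds C S (f \<cdot> x) (f \<cdot> y))"
proof
  assume "is_monotone C R S f"
  then obtain f' where f: "f \<in> Ar C" "Dom C f = base R" "Cod C f = base S"
    and f': "f' \<in> Ar C" "Dom C f' = Dom C (pr1 R)" "Cod C f' = Dom C (pr1 S)"
      "f \<cdot> pr1 R = pr1 S \<cdot> f'" "f \<cdot> pr2 R = pr2 S \<cdot> f'"
    by (auto simp: is_monotone_def)
  have "holds C S (f \<cdot> pr1 R) (f \<cdot> pr2 R)" by (rule holdsI[of f']) (use f' in simp_all)
  then show "f \<in> Ar C \<and> Dom C f = base R \<and> Cod C f = base S \<and> (\<forall>x y. holds C R x y \<longrightarrow> holds C S (f \<cdot> x) (f \<cdot> y))"
    using f holds_imp[OF R _ S f(1,2)] by blast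
next
  assume f: "f \<in> Ar C \<and> Dom C f = base R \<and> Cod C f = base S \<and> (\<forall>x y. holds C R x y \<longrightarrow> holds C S (f \<cdot> x) (f \<cdot> y))"
  then have "holds C S (f \<cdot> pr1 R) (f \<cdot> pr2 R)" using holds_pr[OF R] by blast
  then obtain t where t: "t \<in> Ar C" "Cod C t = Dom C (pr1 S)" "pr1 S \<cdot> t = f \<cdot> pr1 R" "pr2 S \<cdot> t = f \<cdot> pr2 R" by (rule holdsE)
  have "Dom C t = Dom C (f \<cdot> pr1 R)" using comp_arr(2)[of t "pr1 S"] t relD[OF S] by simp
  then have "Dom C t = Dom C (pr1 R)" using f relD[OF R] by simp
  then show "is_monotone C R S f" unfolding is_monotone_def using f t by (intro conjI bexI[of _ t]) simp_all
qed

end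

section \<open>Relations and coproducts: gluing, induction and sums\<close>

context ext_cat
begin

lemma preorder_iff:
  "is_preorder C R \<longleftrightarrow> is_relation C R \<and> (\<forall>x \<in> Ar C. Cod C x = base R \<longrightarrow> holds C R x x) \<and>
     (\<forall>x y z. holds C R x y \<longrightarrow> holds C R y z \<longrightarrow> holds C R x z)"
proof (cases "is_relation C R")
  case R: True
  note [simp] = relD[OF R]
  have 1: "rel_reflexive C R \<longleftrightarrow> (\<forall>x \<in> Ar C. Cod C x = base R \<longrightarrow> holds C R x x)"
    unfolding rel_reflexive_def
    using rel_le_iff[OF rel_diag_relation(1) R, of "base R"] rel_diag_relation(2,3)[of "base R"] by auto
  have "rel_transitive C R \<longleftrightarrow> (\<forall>x y z. holds C R x y \<longrightarrow> holds C R y z \<longrightarrow> holds C R x z)"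
  proof
    assume tr: "rel_transitive C R"
    show "\<forall>x y z. holds C R x y \<longrightarrow> holds C R y z \<longrightarrow> holds C R x z"
    proof (intro allI impI)
      fix x y z assume "holds C R x y" "holds C R y z"
      then obtain s s' where s: "s \<in> Ar C" "Cod C s = Dom C (pr1 R)" "pr1 R \<cdot> s = x" "pr2 R \<cdot> s = y"
        and s': "s' \<in> Ar C" "Cod C s' = Dom C (pr1 R)" "pr1 R \<cdot> s' = y" "pr2 R \<cdot> s' = z" by (elim holdsE)
      obtain p q where pq: "is_pullback C p q (pr2 R) (pr1 R)" by (rule pullback_ex[of "pr2 R" "pr1 R"]) simp_all
      obtain t where t: "t \<in> hom C (Dom C p) (Dom C (pr1 R))" "pr1 R \<cdot> t = pr1 R \<cdot> p" "pr2 R \<cdot> t = pr2 R \<cdot> q"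
        using tr pq unfolding rel_transitive_def by blast
      have d: "Dom C s' = Dom C s" using comp_arr(2)[of s "pr2 R"] comp_arr(2)[of s' "pr1 R"] s s' by simp
      obtain w where w: "w \<in> Ar C" "Dom C w = Dom C s" "Cod C w = Dom C p" "p \<cdot> w = s" "q \<cdot> w = s'"
        by (rule pullbackE[OF pq, of s s']) (use s s' d in simp_all)
      note [simp] = pullbackD(1-4,6-8)[OF pq]
      show "holds C R x z"
        by (rule holdsI[of "t \<cdot> w"]) (use t w s s' in \<open>simp_all add: comp_square[OF t(2)] comp_square[OF t(3)]\<close>)
    qed
  next
    assume tr: "\<forall>x y z. holds C R x y \<longrightarrow> holds C R y z \<longrightarrow> holds C R x z"
    show "rel_transitive C R" unfolding rel_transitive_def
    proof (intro allI impI)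
      fix p q assume pq: "is_pullback C p q (pr2 R) (pr1 R)"
      note d = pullbackD[OF pq]
      have "holds C R (pr1 R \<cdot> p) (pr2 R \<cdot> p)" "holds C R (pr1 R \<cdot> q) (pr2 R \<cdot> q)"
        by (rule holdsI[of p]; use d in simp) (rule holdsI[of q]; use d in simp)
      then have "holds C R (pr1 R \<cdot> p) (pr2 R \<cdot> q)" using tr unfolding d(9) by blast
      then obtain t where t: "t \<in> Ar C" "Cod C t = Dom C (pr1 R)" "pr1 R \<cdot> t = pr1 R \<cdot> p" "pr2 R \<cdot> t = pr2 R \<cdot> q"
        by (rule holdsE)
      have "Dom C t = Dom C p" using comp_arr(2)[of t "pr1 R"] comp_arr(2)[of p "pr1 R"] t d by simp
      then show "\<exists>t \<in> hom C (Dom C p) (Dom C (pr1 R)). pr1 R \<cdot> t = pr1 R \<cdot> p \<and> pr2 R \<cdot> t = pr2 R \<cdot> q"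
        using t by (intro bexI[of _ t]) simp_all
    qed
  qed
  with 1 R show ?thesis by (simp add: is_preorder_def)
qed (simp add: is_preorder_def)

lemma preorderD:
  assumes "is_preorder C R"
  shows "is_relation C R" "x \<in> Ar C \<Longrightarrow> Cod C x = base R \<Longrightarrow> holds C R x x"
    "holds C R x y \<Longrightarrow> holds C R y z \<Longrightarrow> holds C R x z"
  using assms unfolding preorder_iff by blast+

text \<open>The factorisations through the relation on the two summands are copaired. Relatedness
  may thus be checked on the pieces of a cutting of the domain.\<close>

lemma holds_glue:
  assumes S: "is_relation C S" and ij: "is_coproduct C i j" and x [simp]: "x \<in> Ar C" "Dom C x = Cod C i" "Cod C x = base S"
    and y [simp]: "y \<in> Ar C" "Dom C y = Cod C i" "Cod C y = base S"
    and h: "holds C S (x \<cdot> i) (y \<cdot> i)" "holds C S (x \<cdot> j) (y \<cdot> j)"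
  shows "holds C S x y"
proof -
  note [simp] = coproductD[OF ij] relD[OF S]
  obtain s where s [simp]: "s \<in> Ar C" "Cod C s = Dom C (pr1 S)" and se: "pr1 S \<cdot> s = x \<cdot> i" "pr2 S \<cdot> s = y \<cdot> i" using h(1) by (rule holdsE)
  obtain t where t [simp]: "t \<in> Ar C" "Cod C t = Dom C (pr1 S)" and te: "pr1 S \<cdot> t = x \<cdot> j" "pr2 S \<cdot> t = y \<cdot> j" using h(2) by (rule holdsE)
  have [simp]: "Dom C s = Dom C i" "Dom C t = Dom C j"
    using comp_arr(2)[of s "pr1 S"] comp_arr(2)[of t "pr1 S"] se te by simp_all
  obtain w where w [simp]: "w \<in> Ar C" "Dom C w = Cod C i" "Cod C w = Cod C s" and we: "w \<cdot> i = s" "w \<cdot> j = t"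
    by (rule copairE[OF ij, of s t]) simp_all
  have "pr1 S \<cdot> w = x" by (rule coproduct_eqI[OF ij]) (simp_all add: we se te)
  moreover have "pr2 S \<cdot> w = y" by (rule coproduct_eqI[OF ij]) (simp_all add: we se te)
  ultimately show ?thesis by (intro holdsI[of w]) simp_all
qed

lemma holds_initial:
  assumes "is_preorder C S" "is_initial C (Dom C x)" "x \<in> Ar C" "y \<in> Ar C" "Dom C y = Dom C x" "Cod C x = base S" "Cod C y = base S"
  shows "holds C S x y"
proof -
  have "y = x" by (rule initial_unique[OF assms(2)]) (use assms in simp_all)
  then show ?thesis using preorderD(2)[OF assms(1)] assms by simp
qed

text \<open>\<open>R\<close> is no larger than the sum of \<open>R1\<close> and \<open>R2\<close>:
  it restricts into them along the injections, and no element of one summand is related to an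
  element of the other unless the domain is initial. The opposite inclusion is monotonicity of the
  injections.\<close>

definition sum_cond :: "'m \<Rightarrow> 'm \<Rightarrow> ('o, 'm) irel \<Rightarrow> ('o, 'm) irel \<Rightarrow> ('o, 'm) irel \<Rightarrow> bool" where
  "sum_cond i j R R1 R2 \<longleftrightarrow>
     (\<forall>x \<in> Ar C. \<forall>y \<in> Ar C. Cod C x = Dom C i \<longrightarrow> Cod C y = Dom C i \<longrightarrow> holds C R (i \<cdot> x) (i \<cdot> y) \<longrightarrow> holds C R1 x y) \<and>
     (\<forall>x \<in> Ar C. \<forall>y \<in> Ar C. Cod C x = Dom C j \<longrightarrow> Cod C y = Dom C j \<longrightarrow> holds C R (j \<cdot> x) (j \<cdot> y) \<longrightarrow> holds C R2 x y) \<and>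
     (\<forall>x \<in> Ar C. \<forall>y \<in> Ar C. Cod C x = Dom C i \<longrightarrow> Cod C y = Dom C j \<longrightarrow> holds C R (i \<cdot> x) (j \<cdot> y) \<longrightarrow> is_initial C (Dom C x)) \<and>
     (\<forall>x \<in> Ar C. \<forall>y \<in> Ar C. Cod C x = Dom C j \<longrightarrow> Cod C y = Dom C i \<longrightarrow> holds C R (j \<cdot> x) (i \<cdot> y) \<longrightarrow> is_initial C (Dom C x))"

lemma sum_condD:
  assumes "sum_cond i j R R1 R2" "x \<in> Ar C" "y \<in> Ar C"
  shows "Cod C x = Dom C i \<Longrightarrow> Cod C y = Dom C i \<Longrightarrow> holds C R (i \<cdot> x) (i \<cdot> y) \<Longrightarrow> holds C R1 x y"
    "Cod C x = Dom C j \<Longrightarrow> Cod C y = Dom C j \<Longrightarrow> holds C R (j \<cdot> x) (j \<cdot> y) \<Longrightarrow> holds C R2 x y"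
    "Cod C x = Dom C i \<Longrightarrow> Cod C y = Dom C j \<Longrightarrow> holds C R (i \<cdot> x) (j \<cdot> y) \<Longrightarrow> is_initial C (Dom C x)"
    "Cod C x = Dom C j \<Longrightarrow> Cod C y = Dom C i \<Longrightarrow> holds C R (j \<cdot> x) (i \<cdot> y) \<Longrightarrow> is_initial C (Dom C x)"
  using assms unfolding sum_cond_def by blast+

lemma sum_cond_sym: "sum_cond i j R R1 R2 \<Longrightarrow> sum_cond j i R R2 R1"
  unfolding sum_cond_def by blast

text \<open>The case where the first component already lies in \<open>i\<close>. The second
  component is cut: the part in \<open>i\<close> is a pair of \<open>R1\<close>, the part in
  \<open>j\<close> has an initial domain.\<close>

lemma sum_induct_aux:
  assumes ij: "is_coproduct C i j" and sc: "sum_cond i j R R1 R2" and R: "is_relation C R" "base R = Cod C i"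
    and h: "holds C R x y"
    and glue: "\<And>p q z. is_coproduct C p q \<Longrightarrow> z \<in> Ar C \<Longrightarrow> Cod C z = Dom C x \<Longrightarrow> Dom C z = Cod C p \<Longrightarrow>
      P (z \<cdot> p) \<Longrightarrow> P (z \<cdot> q) \<Longrightarrow> P z"
    and init: "\<And>z. z \<in> Ar C \<Longrightarrow> Cod C z = Dom C x \<Longrightarrow> is_initial C (Dom C z) \<Longrightarrow> P z"
    and ci: "\<And>z a b. z \<in> Ar C \<Longrightarrow> Cod C z = Dom C x \<Longrightarrow> a \<in> Ar C \<Longrightarrow> b \<in> Ar C \<Longrightarrow> Cod C a = Dom C i \<Longrightarrow> Cod C b = Dom C i \<Longrightarrow>
      x \<cdot> z = i \<cdot> a \<Longrightarrow> y \<cdot> z = i \<cdot> b \<Longrightarrow> holds C R1 a b \<Longrightarrow> P z"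
    and z [simp]: "z \<in> Ar C" "Cod C z = Dom C x" "g \<in> Ar C" "Dom C g = Dom C z" "Cod C g = Dom C i" and zg: "x \<cdot> z = i \<cdot> g"
  shows "P z"
proof -
  note [simp] = coproductD[OF ij] relD[OF R(1)] R(2) holdsD[OF R(1) h]
  obtain u v u' v' where u: "is_coproduct C u u'" and p1: "is_pullback C u v (y \<cdot> z) i" and p2: "is_pullback C u' v' (y \<cdot> z) j"
    by (rule decompose[OF ij, of "y \<cdot> z"]) simp_all
  note q1 = pullbackD[OF p1] and q2 = pullbackD[OF p2]
  have [simp]: "Cod C u = Dom C z" "Cod C u' = Dom C z" using q1(6) q2(6) by simp_all
  note [simp] = q1(3,4,7,8) q2(3,4,7,8)
  have hz: "holds C R (x \<cdot> (z \<cdot> w)) (y \<cdot> (z \<cdot> w))" if "w \<in> Ar C" "Cod C w = Dom C z" for w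
    by (rule holds_comp[OF R(1) h]) (use that in simp_all)
  have e: "x \<cdot> (z \<cdot> u) = i \<cdot> (g \<cdot> u)" "x \<cdot> (z \<cdot> u') = i \<cdot> (g \<cdot> u')" by (simp_all add: comp_square[OF zg])
  have e': "y \<cdot> (z \<cdot> u) = i \<cdot> v" "y \<cdot> (z \<cdot> u') = j \<cdot> v'" using q1(9) q2(9) by simp_all
  show "P z"
  proof (rule glue[OF u])
    have "holds C R (i \<cdot> (g \<cdot> u)) (i \<cdot> v)" using hz[of u] e e' by simp
    then have "holds C R1 (g \<cdot> u) v" by - (rule sum_condD(1)[OF sc]; simp)
    then show "P (z \<cdot> u)" by - (rule ci[of _ "g \<cdot> u" v]; simp add: e e')
    have "holds C R (i \<cdot> (g \<cdot> u')) (j \<cdot> v')" using hz[of u'] e e' by simp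
    then have "is_initial C (Dom C (g \<cdot> u'))" by - (rule sum_condD(3)[OF sc, of _ v']; simp)
    then show "P (z \<cdot> u')" by - (rule init; simp)
  qed simp_all
qed

text \<open>Induction over a related pair of a sum. The predicate speaks of the restriction of the
  pair along \<open>z\<close>; it has to hold on empty restrictions and on pairs from one summand,
  and to be stable under gluing. The identity gives the pair itself.\<close>

lemma sum_induct:
  assumes ij: "is_coproduct C i j" and sc: "sum_cond i j R R1 R2" and R: "is_relation C R" "base R = Cod C i"
    and h: "holds C R x y"
    and glue: "\<And>p q z. is_coproduct C p q \<Longrightarrow> z \<in> Ar C \<Longrightarrow> Cod C z = Dom C x \<Longrightarrow> Dom C z = Cod C p \<Longrightarrow>
      P (z \<cdot> p) \<Longrightarrow> P (z \<cdot> q) \<Longrightarrow> P z"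
    and init: "\<And>z. z \<in> Ar C \<Longrightarrow> Cod C z = Dom C x \<Longrightarrow> is_initial C (Dom C z) \<Longrightarrow> P z"
    and ci: "\<And>z a b. z \<in> Ar C \<Longrightarrow> Cod C z = Dom C x \<Longrightarrow> a \<in> Ar C \<Longrightarrow> b \<in> Ar C \<Longrightarrow> Cod C a = Dom C i \<Longrightarrow> Cod C b = Dom C i \<Longrightarrow>
      x \<cdot> z = i \<cdot> a \<Longrightarrow> y \<cdot> z = i \<cdot> b \<Longrightarrow> holds C R1 a b \<Longrightarrow> P z"
    and cj: "\<And>z a b. z \<in> Ar C \<Longrightarrow> Cod C z = Dom C x \<Longrightarrow> a \<in> Ar C \<Longrightarrow> b \<in> Ar C \<Longrightarrow> Cod C a = Dom C j \<Longrightarrow> Cod C b = Dom C j \<Longrightarrow>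
      x \<cdot> z = j \<cdot> a \<Longrightarrow> y \<cdot> z = j \<cdot> b \<Longrightarrow> holds C R2 a b \<Longrightarrow> P z"
  shows "P (Ident C (Dom C x))"
proof -
  note [simp] = coproductD[OF ij] relD[OF R(1)] R(2) holdsD[OF R(1) h]
  obtain u v u' v' where u: "is_coproduct C u u'" and p1: "is_pullback C u v x i" and p2: "is_pullback C u' v' x j"
    by (rule decompose[OF ij, of x]) simp_all
  note q1 = pullbackD[OF p1] and q2 = pullbackD[OF p2]
  note [simp] = q1(3,4,6-8) q2(3,4,6-8)
  show ?thesis
  proof (rule glue[OF u])
    have "P u" by (rule sum_induct_aux[where P = P and z = u and g = v, OF ij sc R h], fact glue, fact init, fact ci) (simp_all add: q1(9))
    then show "P (Ident C (Dom C x) \<cdot> u)" by simp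
    have "P u'"
      by (rule sum_induct_aux[where P = P and z = u' and g = v', OF coproduct_sym[OF ij] sum_cond_sym[OF sc] R(1) _ h], simp, fact glue, fact init, fact cj) (simp_all add: q2(9))
    then show "P (Ident C (Dom C x) \<cdot> u')" by simp
  qed simp_all
qed

text \<open>The object of the sum of two relations is the coproduct of their objects, with injections \<open>k\<close> and \<open>l\<close>.\<close>

definition is_sum :: "'m \<Rightarrow> 'm \<Rightarrow> 'm \<Rightarrow> 'm \<Rightarrow> ('o, 'm) irel \<Rightarrow> ('o, 'm) irel \<Rightarrow> ('o, 'm) irel \<Rightarrow> bool" where
  "is_sum k l i j R R1 R2 \<longleftrightarrow> is_coproduct C i j \<and> is_coproduct C k l \<and> is_relation C R1 \<and> is_relation C R2 \<and>
     base R1 = Dom C i \<and> base R2 = Dom C j \<and> base R = Cod C i \<and> pr1 R \<in> Ar C \<and> pr2 R \<in> Ar C \<and>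
     Cod C (pr1 R) = Cod C i \<and> Cod C (pr2 R) = Cod C i \<and> Dom C (pr1 R) = Cod C k \<and> Dom C (pr2 R) = Cod C k \<and>
     Dom C k = Dom C (pr1 R1) \<and> Dom C l = Dom C (pr1 R2) \<and>
     pr1 R \<cdot> k = i \<cdot> pr1 R1 \<and> pr2 R \<cdot> k = i \<cdot> pr2 R1 \<and> pr1 R \<cdot> l = j \<cdot> pr1 R2 \<and> pr2 R \<cdot> l = j \<cdot> pr2 R2"

lemma is_sumD:
  assumes "is_sum k l i j R R1 R2"
  shows "is_coproduct C i j" "is_coproduct C k l" "is_relation C R1" "is_relation C R2"
     "base R1 = Dom C i" "base R2 = Dom C j" "base R = Cod C i" "pr1 R \<in> Ar C" "pr2 R \<in> Ar C"
     "Cod C (pr1 R) = Cod C i" "Cod C (pr2 R) = Cod C i" "Dom C (pr1 R) = Cod C k" "Dom C (pr2 R) = Cod C k"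
     "Dom C k = Dom C (pr1 R1)" "Dom C l = Dom C (pr1 R2)"
     "pr1 R \<cdot> k = i \<cdot> pr1 R1" "pr2 R \<cdot> k = i \<cdot> pr2 R1" "pr1 R \<cdot> l = j \<cdot> pr1 R2" "pr2 R \<cdot> l = j \<cdot> pr2 R2"
  using assms by (simp_all only: is_sum_def)

lemma is_sum_sym:
  assumes "is_sum k l i j R R1 R2"
  shows "is_sum l k j i R R2 R1"
  unfolding is_sum_def
  using is_sumD[OF assms] coproduct_sym[OF is_sumD(1)[OF assms]] coproduct_sym[OF is_sumD(2)[OF assms]]
    coproductD(3)[OF is_sumD(1)[OF assms]] coproductD(3)[OF is_sumD(2)[OF assms]]
  by simp

text \<open>The first projection of the sum is the sum of the first projections, so by extensivity
  the square over \<open>i\<close> is a pullback. A related pair whose first component lies in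
  \<open>i\<close> therefore comes from \<open>R1\<close>, and its second component lies in
  \<open>i\<close> too.\<close>

lemma is_sum_lift:
  assumes s: "is_sum k l i j R R1 R2" and t: "t \<in> Ar C" "Cod C t = Cod C k" and x: "x \<in> Ar C" "Cod C x = Dom C i"
    and e: "pr1 R \<cdot> t = i \<cdot> x"
  obtains t' where "t' \<in> Ar C" "Dom C t' = Dom C t" "Cod C t' = Dom C (pr1 R1)" "k \<cdot> t' = t" "pr1 R1 \<cdot> t' = x"
    "pr2 R \<cdot> t = i \<cdot> (pr2 R1 \<cdot> t')"
proof -
  note d = is_sumD[OF s]
  note [simp] = coproductD[OF d(1)] coproductD[OF d(2)] relD[OF d(3)] relD[OF d(4)] d(5-15) t x
  have dx: "Dom C x = Dom C t" using comp_arr(2)[of t "pr1 R"] comp_arr(2)[of x i] e by simp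
  have "is_pullback C k (pr1 R1) (pr1 R) i"
    using ext_iff[OF d(1), of "pr1 R" k l "pr1 R1" "pr1 R2"] d(2) by (simp add: d(16,18))
  then obtain t' where t' [simp]: "t' \<in> Ar C" "Dom C t' = Dom C t" "Cod C t' = Dom C k" and te: "k \<cdot> t' = t" "pr1 R1 \<cdot> t' = x"
    by (rule pullbackE[of _ _ _ _ t x]) (simp_all add: e dx)
  have "pr2 R \<cdot> t = i \<cdot> (pr2 R1 \<cdot> t')" unfolding te(1)[symmetric] by (rule comp_square[OF d(17)]) simp_all
  with that[of t'] te show thesis by simp
qed

lemma is_sum_reflect:
  assumes s: "is_sum k l i j R R1 R2" and x [simp]: "x \<in> Ar C" "Cod C x = Dom C i" and h: "holds C R (i \<cdot> x) y"
  obtains z where "z \<in> Ar C" "Cod C z = Dom C i" "y = i \<cdot> z" "holds C R1 x z"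
proof -
  note d = is_sumD[OF s]
  note [simp] = coproductD[OF d(1)] coproductD[OF d(2)] relD[OF d(3)] relD[OF d(4)] d(5-15)
  obtain t where t: "t \<in> Ar C" "Cod C t = Dom C (pr1 R)" "pr1 R \<cdot> t = i \<cdot> x" "pr2 R \<cdot> t = y" using h by (rule holdsE)
  obtain t' where t' [simp]: "t' \<in> Ar C" "Cod C t' = Dom C (pr1 R1)" and te: "pr1 R1 \<cdot> t' = x" "pr2 R \<cdot> t = i \<cdot> (pr2 R1 \<cdot> t')"
    by (rule is_sum_lift[OF s t(1) _ x t(3)]) (use t(2) in simp_all)
  have "holds C R1 x (pr2 R1 \<cdot> t')" by (rule holdsI[of t']) (simp_all add: te)
  with that[of "pr2 R1 \<cdot> t'"] te(2) t(4) show thesis by simp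
qed

lemma is_sum_inject:
  assumes s: "is_sum k l i j R R1 R2" and h: "holds C R1 x y"
  shows "holds C R (i \<cdot> x) (i \<cdot> y)"
proof -
  note d = is_sumD[OF s]
  note [simp] = coproductD[OF d(1)] coproductD[OF d(2)] relD[OF d(3)] relD[OF d(4)] d(5-15)
  obtain t where t: "t \<in> Ar C" "Cod C t = Dom C (pr1 R1)" "pr1 R1 \<cdot> t = x" "pr2 R1 \<cdot> t = y" using h by (rule holdsE)
  show ?thesis
    by (rule holdsI[of "k \<cdot> t"]) (use t in \<open>simp_all add: comp_square[OF d(16)] comp_square[OF d(17)]\<close>)
qed

text \<open>Joint monicity of the projections on one summand: if \<open>u\<close> factors through
  \<open>k\<close>, then by its first component so does \<open>v\<close>, and joint monicity of
  \<open>R1\<close> applies to the two factorisations.\<close>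

lemma is_sum_eq:
  assumes s: "is_sum k l i j R R1 R2" and uv: "u \<in> Ar C" "v \<in> Ar C" "Cod C u = Cod C k" "Cod C v = Cod C k" "Dom C u = Dom C v"
    and e: "pr1 R \<cdot> u = pr1 R \<cdot> v" "pr2 R \<cdot> u = pr2 R \<cdot> v" and g: "g \<in> Ar C" "Cod C g = Dom C k" "u = k \<cdot> g"
  shows "u = v"
proof -
  note d = is_sumD[OF s]
  note [simp] = coproductD[OF d(1)] coproductD[OF d(2)] relD[OF d(3)] relD[OF d(4)] d(5-15) g(1,2)
  have gd: "Dom C g = Dom C v" using uv(5) unfolding g(3) by simp
  have "pr1 R \<cdot> v = i \<cdot> (pr1 R1 \<cdot> g)"
    unfolding e(1)[symmetric] g(3) by (rule comp_square[OF d(16)]) simp_all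
  then obtain t where t: "t \<in> Ar C" "Dom C t = Dom C v" "Cod C t = Dom C (pr1 R1)" "k \<cdot> t = v" "pr1 R1 \<cdot> t = pr1 R1 \<cdot> g"
    "pr2 R \<cdot> v = i \<cdot> (pr2 R1 \<cdot> t)"
    by - (rule is_sum_lift[OF s uv(2,4), of "pr1 R1 \<cdot> g"]; simp)
  have "i \<cdot> (pr2 R1 \<cdot> t) = i \<cdot> (pr2 R1 \<cdot> g)"
    unfolding t(6)[symmetric] e(2)[symmetric] g(3) by (rule comp_square[OF d(17)]) simp_all
  then have "pr2 R1 \<cdot> t = pr2 R1 \<cdot> g" by - (rule monoD[OF injection_mono[OF d(1)]]; simp add: t(1-3) gd)
  then have "t = g" by - (rule rel_eqI[OF d(3)]; simp add: t(1-3,5) gd)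
  then show ?thesis using t(4) g(3) by simp
qed

lemma is_sum_relation:
  assumes s: "is_sum k l i j R R1 R2"
  shows "is_relation C R"
proof (rule relI)
  note d = is_sumD[OF s]
  note [simp] = coproductD[OF d(1)] coproductD[OF d(2)] relD[OF d(3)] relD[OF d(4)] d(5-15)
  show "pr1 R \<in> Ar C" "pr2 R \<in> Ar C" "Cod C (pr1 R) = base R" "Cod C (pr2 R) = base R" "Dom C (pr2 R) = Dom C (pr1 R)" "base R \<in> Ob C"
    by simp_all
  fix u v assume uv [simp]: "u \<in> Ar C" "v \<in> Ar C" "Cod C u = Dom C (pr1 R)" "Cod C v = Dom C (pr1 R)" "Dom C u = Dom C v"
    and e: "pr1 R \<cdot> u = pr1 R \<cdot> v" "pr2 R \<cdot> u = pr2 R \<cdot> v"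
  obtain x g x' g' where x: "is_coproduct C x x'" and p1: "is_pullback C x g u k" and p2: "is_pullback C x' g' u l"
    by (rule decompose[OF d(2), of u]) simp_all
  note q1 = pullbackD[OF p1] and q2 = pullbackD[OF p2]
  have [simp]: "Cod C x = Dom C v" "Cod C x' = Dom C v" using q1(6) q2(6) by simp_all
  note [simp] = q1(3,4,7,8) q2(3,4,7,8)
  show "u = v"
  proof (rule coproduct_eqI[OF x])
    show "u \<cdot> x = v \<cdot> x"
      by (rule is_sum_eq[OF s _ _ _ _ _ _ _ _ _ q1(9)]) (simp_all add: comp_square[OF e(1)] comp_square[OF e(2)])
    show "u \<cdot> x' = v \<cdot> x'"
      by (rule is_sum_eq[OF is_sum_sym[OF s] _ _ _ _ _ _ _ _ _ q2(9)]) (simp_all add: comp_square[OF e(1)] comp_square[OF e(2)])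
  qed simp_all
qed

text \<open>A chain that starts in one summand stays in it, so transitivity is that of
  \<open>R1\<close>.\<close>

lemma is_sum_trans:
  assumes s: "is_sum k l i j R R1 R2" and P1: "is_preorder C R1" and g: "g \<in> Ar C" "Cod C g = Dom C i"
    and h: "holds C R (i \<cdot> g) y" "holds C R y z"
  shows "holds C R (i \<cdot> g) z"
proof -
  obtain a where a: "a \<in> Ar C" "Cod C a = Dom C i" "y = i \<cdot> a" "holds C R1 g a" by (rule is_sum_reflect[OF s g h(1)])
  obtain b where b: "z = i \<cdot> b" "holds C R1 a b" by (rule is_sum_reflect[OF s a(1,2)]) (use h(2) a(3) in simp)
  show ?thesis unfolding b(1) by (rule is_sum_inject[OF s preorderD(3)[OF P1 a(4) b(2)]])
qed

lemma is_sum_preorder: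
  assumes s: "is_sum k l i j R R1 R2" and P1: "is_preorder C R1" and P2: "is_preorder C R2"
  shows "is_preorder C R"
  unfolding preorder_iff
proof (intro conjI ballI impI allI)
  note d = is_sumD[OF s]
  note [simp] = coproductD[OF d(1)] coproductD[OF d(2)] relD[OF d(3)] relD[OF d(4)] d(5-15)
  note R = is_sum_relation[OF s]
  show "is_relation C R" by (rule R)
  fix x assume x [simp]: "x \<in> Ar C" and "Cod C x = base R"
  then have [simp]: "Cod C x = Cod C i" by simp
  obtain p g p' g' where p: "is_coproduct C p p'" and p1: "is_pullback C p g x i" and p2: "is_pullback C p' g' x j"
    by (rule decompose[OF d(1), of x]) simp_all
  note q1 = pullbackD[OF p1] and q2 = pullbackD[OF p2]
  note [simp] = q1(3,4,6-8) q2(3,4,6-8) coproductD[OF p]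
  show "holds C R x x"
  proof (rule holds_glue[OF R p])
    show "holds C R (x \<cdot> p) (x \<cdot> p)" unfolding q1(9) by (rule is_sum_inject[OF s preorderD(2)[OF P1]]) simp_all
    show "holds C R (x \<cdot> p') (x \<cdot> p')" unfolding q2(9) by (rule is_sum_inject[OF is_sum_sym[OF s] preorderD(2)[OF P2]]) simp_all
  qed simp_all
next
  note d = is_sumD[OF s]
  note R = is_sum_relation[OF s]
  note [simp] = coproductD[OF d(1)] d(7)
  fix x y z assume xy: "holds C R x y" and yz: "holds C R y z"
  note [simp] = holdsD[OF R xy] holdsD[OF R yz]
  obtain p g p' g' where p: "is_coproduct C p p'" and p1: "is_pullback C p g x i" and p2: "is_pullback C p' g' x j"
    by (rule decompose[OF d(1), of x]) simp_all
  note q1 = pullbackD[OF p1] and q2 = pullbackD[OF p2]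
  note [simp] = q1(3,4,6-8) q2(3,4,6-8) coproductD[OF p]
  have h: "holds C R (x \<cdot> w) (y \<cdot> w)" "holds C R (y \<cdot> w) (z \<cdot> w)" if "w \<in> Ar C" "Cod C w = Dom C x" for w
    using holds_comp[OF R xy that(1)] holds_comp[OF R yz that(1)] that by simp_all
  show "holds C R x z"
  proof (rule holds_glue[OF R p])
    show "holds C R (x \<cdot> p) (z \<cdot> p)"
      using is_sum_trans[OF s P1, of g "y \<cdot> p" "z \<cdot> p"] h[of p] by (simp add: q1(9))
    show "holds C R (x \<cdot> p') (z \<cdot> p')"
      using is_sum_trans[OF is_sum_sym[OF s] P2, of g' "y \<cdot> p'" "z \<cdot> p'"] h[of p'] by (simp add: q2(9))
  qed simp_all
qed

lemma is_sum_cond: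
  assumes s: "is_sum k l i j R R1 R2"
  shows "sum_cond i j R R1 R2"
proof -
  have A: "holds C R1 x y"
    if s: "is_sum k l i j R R1 R2" and xy: "x \<in> Ar C" "y \<in> Ar C" "Cod C x = Dom C i" "Cod C y = Dom C i" "holds C R (i \<cdot> x) (i \<cdot> y)"
    for k l i j R1 R2 x y
  proof -
    note d = is_sumD[OF s]
    note [simp] = coproductD[OF d(1)]
    obtain z where z: "z \<in> Ar C" "Cod C z = Dom C i" "i \<cdot> y = i \<cdot> z" "holds C R1 x z" by (rule is_sum_reflect[OF s xy(1,3,5)])
    have "Dom C y = Dom C z" using comp_arr(2)[of y i] comp_arr(2)[of z i] z xy by simp
    then have "y = z" by - (rule monoD[OF injection_mono[OF d(1)]]; simp add: z xy)
    then show ?thesis using z by simp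
  qed
  have B: "is_initial C (Dom C x)"
    if s: "is_sum k l i j R R1 R2" and xy: "x \<in> Ar C" "y \<in> Ar C" "Cod C x = Dom C i" "Cod C y = Dom C j" "holds C R (i \<cdot> x) (j \<cdot> y)"
    for k l i j R1 R2 x y
  proof -
    note d = is_sumD[OF s]
    note [simp] = coproductD[OF d(1)]
    obtain z where z: "z \<in> Ar C" "Cod C z = Dom C i" "j \<cdot> y = i \<cdot> z" "holds C R1 x z" by (rule is_sum_reflect[OF s xy(1,3,5)])
    have "Dom C y = Dom C z" using comp_arr(2)[of y j] comp_arr(2)[of z i] z xy by simp
    then have "is_initial C (Dom C y)" using disjoint[OF d(1), of z y] z xy by simp
    moreover have "Dom C y = Dom C x" using holdsD(5)[OF is_sum_relation[OF s] xy(5)] xy by simp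
    ultimately show ?thesis by simp
  qed
  note s' = is_sum_sym[OF s]
  show ?thesis unfolding sum_cond_def
    by (intro conjI ballI impI; (rule A[OF s] A[OF s'] B[OF s] B[OF s']; assumption))
qed

lemma sum_ex:
  assumes ij: "is_coproduct C i j" and P1: "is_preorder C R1" "base R1 = Dom C i" and P2: "is_preorder C R2" "base R2 = Dom C j"
  obtains R k l where "is_sum k l i j R R1 R2"
proof -
  have R1: "is_relation C R1" and R2: "is_relation C R2" using preorderD(1)[OF P1(1)] preorderD(1)[OF P2(1)] .
  note [simp] = coproductD[OF ij] relD[OF R1] relD[OF R2] P1(2) P2(2)
  obtain k l where k: "is_coproduct C k l" and k' [simp]: "Dom C k = Dom C (pr1 R1)" "Dom C l = Dom C (pr1 R2)"
    by (rule coproduct_ex[of "Dom C (pr1 R1)" "Dom C (pr1 R2)"]) simp_all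
  note [simp] = coproductD[OF k]
  obtain p where p [simp]: "p \<in> Ar C" "Dom C p = Cod C k" "Cod C p = Cod C (i \<cdot> pr1 R1)" and pe: "p \<cdot> k = i \<cdot> pr1 R1" "p \<cdot> l = j \<cdot> pr1 R2"
    by (rule copairE[OF k, of "i \<cdot> pr1 R1" "j \<cdot> pr1 R2"]) simp_all
  obtain q where q [simp]: "q \<in> Ar C" "Dom C q = Cod C k" "Cod C q = Cod C (i \<cdot> pr2 R1)" and qe: "q \<cdot> k = i \<cdot> pr2 R1" "q \<cdot> l = j \<cdot> pr2 R2"
    by (rule copairE[OF k, of "i \<cdot> pr2 R1" "j \<cdot> pr2 R2"]) simp_all
  have "is_sum k l i j \<lparr>base = Cod C i, pr1 = p, pr2 = q\<rparr> R1 R2"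
    unfolding is_sum_def using ij k R1 R2 pe qe by simp
  then show thesis by (rule that)
qed

end

section \<open>The category of internal preorders\<close>

lemma PreOrd_Ob: "R \<in> Ob (PreOrd C) \<longleftrightarrow> is_preorder C R"
  by (simp add: PreOrd_def)

lemma PreOrd_Dom: "Dom (PreOrd C) F = fst F"
  by (simp add: PreOrd_def case_prod_beta)

lemma PreOrd_Cod: "Cod (PreOrd C) F = snd (snd F)"
  by (simp add: PreOrd_def case_prod_beta)

lemma PreOrd_Ident: "Ident (PreOrd C) R = (R, Ident C (base R), R)"
  by (simp add: PreOrd_def)

lemma PreOrd_Comp: "Comp (PreOrd C) G F = (fst F, fst (snd G) \<cdot>\<^bsub>C\<^esub> fst (snd F), snd (snd G))"
  by (simp add: PreOrd_def case_prod_beta)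

text \<open>A terminal object together with pullbacks provides the products in which relations live
  as subobjects.\<close>

locale lex_ext_cat = ext_cat C for C :: "('o, 'm) cat" (structure) +
  assumes terminal: "\<exists>T. is_terminal C T"
begin

abbreviation PO :: "(('o, 'm) irel, ('o, 'm) preord_arr) cat" where "PO \<equiv> PreOrd C"

abbreviation und :: "('o, 'm) preord_arr \<Rightarrow> 'm" where "und F \<equiv> fst (snd F)"

lemmas PO_simps = PreOrd_Ob PreOrd_Dom PreOrd_Cod PreOrd_Ident PreOrd_Comp

lemma PO_Ar: "F \<in> Ar PO \<longleftrightarrow> is_preorder C (fst F) \<and> is_preorder C (snd (snd F)) \<and>
    und F \<in> Ar C \<and> Dom C (und F) = base (fst F) \<and> Cod C (und F) = base (snd (snd F)) \<and>
    (\<forall>x y. holds C (fst F) x y \<longrightarrow> holds C (snd (snd F)) (und F \<cdot> x) (und F \<cdot> y))"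
proof -
  have "F \<in> Ar PO \<longleftrightarrow> is_preorder C (fst F) \<and> is_preorder C (snd (snd F)) \<and> is_monotone C (fst F) (snd (snd F)) (und F)"
    by (simp add: PreOrd_def case_prod_beta)
  moreover have "is_monotone C (fst F) (snd (snd F)) (und F) \<longleftrightarrow> und F \<in> Ar C \<and> Dom C (und F) = base (fst F) \<and>
      Cod C (und F) = base (snd (snd F)) \<and>
      (\<forall>x y. holds C (fst F) x y \<longrightarrow> holds C (snd (snd F)) (und F \<cdot> x) (und F \<cdot> y))"
    if "is_preorder C (fst F)" "is_preorder C (snd (snd F))"
    by (rule monotone_iff[OF preorderD(1)[OF that(1)] preorderD(1)[OF that(2)]])
  ultimately show ?thesis by blast
qed

lemma PO_ArD:
  assumes "F \<in> Ar PO"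
  shows "is_preorder C (fst F)" "is_preorder C (snd (snd F))" "is_relation C (fst F)" "is_relation C (snd (snd F))"
    "und F \<in> Ar C" "Dom C (und F) = base (fst F)" "Cod C (und F) = base (snd (snd F))"
    "holds C (fst F) x y \<Longrightarrow> holds C (snd (snd F)) (und F \<cdot> x) (und F \<cdot> y)"
  using assms preorderD(1) unfolding PO_Ar by blast+

lemma PO_ArI:
  assumes "is_preorder C R" "is_preorder C S" "f \<in> Ar C" "Dom C f = base R" "Cod C f = base S"
    "\<And>x y. holds C R x y \<Longrightarrow> holds C S (f \<cdot> x) (f \<cdot> y)"
  shows "(R, f, S) \<in> Ar PO"
  unfolding PO_Ar using assms by simp

lemma PO_eqI: "fst F = fst G \<Longrightarrow> und F = und G \<Longrightarrow> snd (snd F) = snd (snd G) \<Longrightarrow> F = G"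
  by (simp add: prod_eq_iff)

lemma base_Ob: "is_preorder C R \<Longrightarrow> base R \<in> Ob C"
  using preorderD(1) relD(1) by blast

lemma PO_category: "category PO"
proof
  show "Dom PO F \<in> Ob PO" "Cod PO F \<in> Ob PO" if "F \<in> Ar PO" for F
    using PO_ArD[OF that] by (simp_all add: PO_simps)
next
  fix R assume "R \<in> Ob PO"
  then have R: "is_preorder C R" by (simp add: PO_simps)
  have "(R, Ident C (base R), R) \<in> Ar PO"
  proof (rule PO_ArI[OF R R])
    fix x y assume h: "holds C R x y"
    then show "holds C R (Ident C (base R) \<cdot> x) (Ident C (base R) \<cdot> y)"
      using holdsD[OF preorderD(1)[OF R] h] by simp
  qed (use base_Ob[OF R] in simp_all)
  then show "Ident PO R \<in> hom PO R R" by (simp add: PO_simps)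
next
  fix F X Y G Z assume FG: "F \<in> hom PO X Y" "G \<in> hom PO Y Z"
  then have F: "F \<in> Ar PO" and G: "G \<in> Ar PO" and e: "snd (snd F) = fst G" by (simp_all add: PO_simps)
  note f = PO_ArD[OF F] and g = PO_ArD[OF G]
  have "(fst F, und G \<cdot> und F, snd (snd G)) \<in> Ar PO"
  proof (rule PO_ArI[OF f(1) g(2)])
    fix x y assume h: "holds C (fst F) x y"
    have "holds C (snd (snd G)) (und G \<cdot> (und F \<cdot> x)) (und G \<cdot> (und F \<cdot> y))"
      by (rule g(8)) (use f(8)[OF h] e in simp)
    then show "holds C (snd (snd G)) ((und G \<cdot> und F) \<cdot> x) ((und G \<cdot> und F) \<cdot> y)"
      using holdsD[OF f(3) h] f(5-7) g(5-7) e by simp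
  qed (use f(5-7) g(5-7) e in simp_all)
  then show "Comp PO G F \<in> hom PO X Z" using FG by (simp add: PO_simps)
next
  fix F X Y assume F: "F \<in> hom PO X Y"
  then have FA: "F \<in> Ar PO" by simp
  show "Comp PO F (Ident PO X) = F" "Comp PO (Ident PO Y) F = F"
    using F PO_ArD(5-7)[OF FA] by (auto simp: PO_simps intro!: PO_eqI)
next
  fix F W X G Y H Z assume FGH: "F \<in> hom PO W X" "G \<in> hom PO X Y" "H \<in> hom PO Y Z"
  then have "F \<in> Ar PO" "G \<in> Ar PO" "H \<in> Ar PO" "snd (snd F) = fst G" "snd (snd G) = fst H" by (simp_all add: PO_simps)
  then show "Comp PO (Comp PO H G) F = Comp PO H (Comp PO G F)"
    using PO_ArD(5-7)[of F] PO_ArD(5-7)[of G] PO_ArD(5-7)[of H] by (simp add: PO_simps)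
qed

sublocale PO: category PO
  by (rule PO_category)

section \<open>Comprehension, inverse images and intersections of relations\<close>

lemma product_ex:
  assumes "A \<in> Ob C" "B \<in> Ob C"
  obtains p q where "p \<in> Ar C" "q \<in> Ar C" "Dom C q = Dom C p" "Cod C p = A" "Cod C q = B"
    "\<And>u v. u \<in> Ar C \<Longrightarrow> v \<in> Ar C \<Longrightarrow> Dom C v = Dom C u \<Longrightarrow> Cod C u = A \<Longrightarrow> Cod C v = B \<Longrightarrow>
      \<exists>w \<in> Ar C. Dom C w = Dom C u \<and> Cod C w = Dom C p \<and> p \<cdot> w = u \<and> q \<cdot> w = v"
    "\<And>u v. u \<in> Ar C \<Longrightarrow> v \<in> Ar C \<Longrightarrow> Cod C u = Dom C p \<Longrightarrow> Cod C v = Dom C p \<Longrightarrow> Dom C u = Dom C v \<Longrightarrow>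
      p \<cdot> u = p \<cdot> v \<Longrightarrow> q \<cdot> u = q \<cdot> v \<Longrightarrow> u = v"
proof -
  obtain T where T: "is_terminal C T" using terminal by blast
  obtain a where a [simp]: "a \<in> Ar C" "Dom C a = A" "Cod C a = T" by (rule terminalE[OF T assms(1)])
  obtain b where b [simp]: "b \<in> Ar C" "Dom C b = B" "Cod C b = T" by (rule terminalE[OF T assms(2)])
  obtain p q where pq: "is_pullback C p q a b" by (rule pullback_ex[of a b]) simp_all
  note d = pullbackD[OF pq]
  show thesis
  proof (rule that)
    show "p \<in> Ar C" "q \<in> Ar C" "Dom C q = Dom C p" "Cod C p = A" "Cod C q = B" using d by simp_all
    fix u v
    show "\<exists>w \<in> Ar C. Dom C w = Dom C u \<and> Cod C w = Dom C p \<and> p \<cdot> w = u \<and> q \<cdot> w = v"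
      if [simp]: "u \<in> Ar C" "v \<in> Ar C" "Dom C v = Dom C u" "Cod C u = A" "Cod C v = B"
    proof -
      have "a \<cdot> u = b \<cdot> v" by (rule terminal_unique[OF T]) simp_all
      then obtain w where "w \<in> Ar C" "Dom C w = Dom C u" "Cod C w = Dom C p" "p \<cdot> w = u" "q \<cdot> w = v"
        by - (rule pullbackE[OF pq, of u v]; simp)
      then show ?thesis by blast
    qed
    show "u = v" if "u \<in> Ar C" "v \<in> Ar C" "Cod C u = Dom C p" "Cod C v = Dom C p" "Dom C u = Dom C v"
      "p \<cdot> u = p \<cdot> v" "q \<cdot> u = q \<cdot> v" by (rule pullback_eqI[OF pq that])
  qed
qed

text \<open>The subobject of those \<open>z\<close> at which \<open>x\<close> and \<open>y\<close>
  are related: the pullback along the pairing of \<open>x\<close> and \<open>y\<close> of the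
  monomorphism into the product that the relation represents.\<close>

lemma rel_comprehension:
  assumes R: "is_relation C R" and x [simp]: "x \<in> Ar C" "Cod C x = base R" and y [simp]: "y \<in> Ar C" "Cod C y = base R" "Dom C y = Dom C x"
  obtains e where "is_mono C e" "Cod C e = Dom C x"
    "\<And>z. z \<in> Ar C \<Longrightarrow> Cod C z = Dom C x \<Longrightarrow>
      holds C R (x \<cdot> z) (y \<cdot> z) \<longleftrightarrow> (\<exists>w \<in> Ar C. Cod C w = Dom C e \<and> e \<cdot> w = z)"
proof -
  note [simp] = relD[OF R]
  obtain p q where p [simp]: "p \<in> Ar C" "q \<in> Ar C" "Dom C q = Dom C p" "Cod C p = base R" "Cod C q = base R"
    and pe: "\<And>u v. u \<in> Ar C \<Longrightarrow> v \<in> Ar C \<Longrightarrow> Dom C v = Dom C u \<Longrightarrow> Cod C u = base R \<Longrightarrow> Cod C v = base R \<Longrightarrow>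
      \<exists>w \<in> Ar C. Dom C w = Dom C u \<and> Cod C w = Dom C p \<and> p \<cdot> w = u \<and> q \<cdot> w = v"
    and pu: "\<And>u v. u \<in> Ar C \<Longrightarrow> v \<in> Ar C \<Longrightarrow> Cod C u = Dom C p \<Longrightarrow> Cod C v = Dom C p \<Longrightarrow> Dom C u = Dom C v \<Longrightarrow>
      p \<cdot> u = p \<cdot> v \<Longrightarrow> q \<cdot> u = q \<cdot> v \<Longrightarrow> u = v"
    using product_ex[of "base R" "base R"] relD(1)[OF R] by blast
  obtain m where m [simp]: "m \<in> Ar C" "Dom C m = Dom C (pr1 R)" "Cod C m = Dom C p" and me: "p \<cdot> m = pr1 R" "q \<cdot> m = pr2 R"
    using pe[of "pr1 R" "pr2 R"] by auto
  obtain n where n [simp]: "n \<in> Ar C" "Dom C n = Dom C x" "Cod C n = Dom C p" and ne: "p \<cdot> n = x" "q \<cdot> n = y"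
    using pe[of x y] by auto
  have mm: "is_mono C m"
  proof (rule monoI[OF m(1)])
    fix u v assume uv: "u \<in> Ar C" "v \<in> Ar C" "Cod C u = Dom C m" "Cod C v = Dom C m" "Dom C u = Dom C v" "m \<cdot> u = m \<cdot> v"
    have "p \<cdot> (m \<cdot> u) = p \<cdot> (m \<cdot> v)" "q \<cdot> (m \<cdot> u) = q \<cdot> (m \<cdot> v)" by (simp_all only: uv(6))
    then have "pr1 R \<cdot> u = pr1 R \<cdot> v" "pr2 R \<cdot> u = pr2 R \<cdot> v"
      using uv(1-4) by (simp_all add: comp_tri[OF me(1)] comp_tri[OF me(2)])
    then show "u = v" by - (rule rel_eqI[OF R]; use uv in simp)
  qed
  obtain e d where ed: "is_pullback C e d n m" by (rule pullback_ex[of n m]) simp_all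
  note q = pullbackD[OF ed]
  note [simp] = q(3,4,6-8)
  have "is_mono C e"
  proof (rule monoI)
    fix u v assume uv: "u \<in> Ar C" "v \<in> Ar C" "Cod C u = Dom C e" "Cod C v = Dom C e" "Dom C u = Dom C v" "e \<cdot> u = e \<cdot> v"
    have "m \<cdot> (d \<cdot> u) = n \<cdot> (e \<cdot> u)" by (rule comp_square[OF q(9)[symmetric]]) (use uv in simp_all)
    also have "\<dots> = n \<cdot> (e \<cdot> v)" by (simp only: uv(6))
    also have "\<dots> = m \<cdot> (d \<cdot> v)" by (rule comp_square[OF q(9)]) (use uv in simp_all)
    finally have "d \<cdot> u = d \<cdot> v" by - (rule monoD[OF mm]; use uv in simp)
    then show "u = v" by - (rule pullback_eqI[OF ed]; use uv in simp)
  qed simp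
  moreover have "holds C R (x \<cdot> z) (y \<cdot> z) \<longleftrightarrow> (\<exists>w \<in> Ar C. Cod C w = Dom C e \<and> e \<cdot> w = z)"
    if z [simp]: "z \<in> Ar C" "Cod C z = Dom C x" for z
  proof
    assume "holds C R (x \<cdot> z) (y \<cdot> z)"
    then obtain t where t [simp]: "t \<in> Ar C" "Cod C t = Dom C (pr1 R)" and te: "pr1 R \<cdot> t = x \<cdot> z" "pr2 R \<cdot> t = y \<cdot> z" by (rule holdsE)
    have [simp]: "Dom C t = Dom C z" using comp_arr(2)[of t "pr1 R"] te by simp
    have "n \<cdot> z = m \<cdot> t"
      by (rule pu) (simp_all add: comp_tri[OF ne(1)] comp_tri[OF ne(2)] comp_tri[OF me(1)] comp_tri[OF me(2)] te)
    then obtain w where "w \<in> Ar C" "Cod C w = Dom C e" "e \<cdot> w = z"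
      by - (rule pullbackE[OF ed, of z t]; simp)
    then show "\<exists>w \<in> Ar C. Cod C w = Dom C e \<and> e \<cdot> w = z" by blast
  next
    assume "\<exists>w \<in> Ar C. Cod C w = Dom C e \<and> e \<cdot> w = z"
    then obtain w where w [simp]: "w \<in> Ar C" "Cod C w = Dom C e" and ew: "e \<cdot> w = z" by blast
    have nz: "n \<cdot> z = m \<cdot> (d \<cdot> w)" unfolding ew[symmetric] by (rule comp_square[OF q(9)]) simp_all
    have "x \<cdot> z = p \<cdot> (n \<cdot> z)" "y \<cdot> z = q \<cdot> (n \<cdot> z)" by (simp_all add: comp_tri[OF ne(1)] comp_tri[OF ne(2)])
    then have "x \<cdot> z = pr1 R \<cdot> (d \<cdot> w)" "y \<cdot> z = pr2 R \<cdot> (d \<cdot> w)"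
      unfolding nz by (simp_all add: comp_tri[OF me(1)] comp_tri[OF me(2)])
    then show "holds C R (x \<cdot> z) (y \<cdot> z)" by (intro holdsI[of "d \<cdot> w"]) simp_all
  qed
  ultimately show thesis using that[of e] by simp
qed

text \<open>Comprehension of \<open>R\<close> at the two projections of the product, composed with
  \<open>f\<close>.\<close>

lemma rel_inverse_image:
  assumes R: "is_relation C R" and f [simp]: "f \<in> Ar C" "Cod C f = base R"
  obtains S where "is_relation C S" "base S = Dom C f"
    "\<And>x y. holds C S x y \<longleftrightarrow> x \<in> Ar C \<and> y \<in> Ar C \<and> Cod C x = Dom C f \<and> Cod C y = Dom C f \<and> holds C R (f \<cdot> x) (f \<cdot> y)"
proof -
  note [simp] = relD[OF R]
  obtain p q where p [simp]: "p \<in> Ar C" "q \<in> Ar C" "Dom C q = Dom C p" "Cod C p = Dom C f" "Cod C q = Dom C f"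
    and pe: "\<And>u v. u \<in> Ar C \<Longrightarrow> v \<in> Ar C \<Longrightarrow> Dom C v = Dom C u \<Longrightarrow> Cod C u = Dom C f \<Longrightarrow> Cod C v = Dom C f \<Longrightarrow>
      \<exists>w \<in> Ar C. Dom C w = Dom C u \<and> Cod C w = Dom C p \<and> p \<cdot> w = u \<and> q \<cdot> w = v"
    and pu: "\<And>u v. u \<in> Ar C \<Longrightarrow> v \<in> Ar C \<Longrightarrow> Cod C u = Dom C p \<Longrightarrow> Cod C v = Dom C p \<Longrightarrow> Dom C u = Dom C v \<Longrightarrow>
      p \<cdot> u = p \<cdot> v \<Longrightarrow> q \<cdot> u = q \<cdot> v \<Longrightarrow> u = v"
    using product_ex[of "Dom C f" "Dom C f"] dom_cod_Ob(1)[OF f(1)] by blast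
  obtain e where me: "is_mono C e" and e [simp]: "Cod C e = Dom C (f \<cdot> p)"
    and eh: "\<And>z. z \<in> Ar C \<Longrightarrow> Cod C z = Dom C (f \<cdot> p) \<Longrightarrow>
      holds C R ((f \<cdot> p) \<cdot> z) ((f \<cdot> q) \<cdot> z) \<longleftrightarrow> (\<exists>w \<in> Ar C. Cod C w = Dom C e \<and> e \<cdot> w = z)"
    by (rule rel_comprehension[OF R, of "f \<cdot> p" "f \<cdot> q"]) simp_all
  note [simp] = mono_arr[OF me]
  define S where "S = \<lparr>base = Dom C f, pr1 = p \<cdot> e, pr2 = q \<cdot> e\<rparr>"
  have S [simp]: "base S = Dom C f" "pr1 S = p \<cdot> e" "pr2 S = q \<cdot> e" by (simp_all add: S_def)
  have "is_relation C S"
  proof (rule relI)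
    fix u v assume uv: "u \<in> Ar C" "v \<in> Ar C" "Cod C u = Dom C (pr1 S)" "Cod C v = Dom C (pr1 S)" "Dom C u = Dom C v"
      "pr1 S \<cdot> u = pr1 S \<cdot> v" "pr2 S \<cdot> u = pr2 S \<cdot> v"
    have "e \<cdot> u = e \<cdot> v" by (rule pu) (use uv in simp_all)
    then show "u = v" by - (rule monoD[OF me]; use uv in simp)
  qed simp_all
  moreover have "holds C S x y \<longleftrightarrow> x \<in> Ar C \<and> y \<in> Ar C \<and> Cod C x = Dom C f \<and> Cod C y = Dom C f \<and> holds C R (f \<cdot> x) (f \<cdot> y)" for x y
  proof
    assume h: "holds C S x y"
    then obtain t where t: "t \<in> Ar C" "Cod C t = Dom C e" "p \<cdot> (e \<cdot> t) = x" "q \<cdot> (e \<cdot> t) = y" by (auto elim!: holdsE)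
    have "holds C R ((f \<cdot> p) \<cdot> (e \<cdot> t)) ((f \<cdot> q) \<cdot> (e \<cdot> t))" using eh[of "e \<cdot> t"] t by auto
    then show "x \<in> Ar C \<and> y \<in> Ar C \<and> Cod C x = Dom C f \<and> Cod C y = Dom C f \<and> holds C R (f \<cdot> x) (f \<cdot> y)"
      unfolding t(3,4)[symmetric] using t(1,2) by simp
  next
    assume h: "x \<in> Ar C \<and> y \<in> Ar C \<and> Cod C x = Dom C f \<and> Cod C y = Dom C f \<and> holds C R (f \<cdot> x) (f \<cdot> y)"
    then have "Dom C y = Dom C x" using holdsD(5)[OF R, of "f \<cdot> x" "f \<cdot> y"] by simp
    then obtain z where z: "z \<in> Ar C" "Cod C z = Dom C p" "p \<cdot> z = x" "q \<cdot> z = y" using pe[of x y] h by auto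
    have "holds C R ((f \<cdot> p) \<cdot> z) ((f \<cdot> q) \<cdot> z)" using h z by simp
    then obtain w where "w \<in> Ar C" "Cod C w = Dom C e" "e \<cdot> w = z" using eh[of z] z by auto
    then show "holds C S x y" using z by (intro holdsI[of w]) simp_all
  qed
  ultimately show thesis using that[of S] by simp
qed

text \<open>Comprehension of \<open>S\<close> at the universal related pair of
  \<open>R\<close>.\<close>

lemma rel_inter:
  assumes R: "is_relation C R" and S: "is_relation C S" "base S = base R"
  obtains T where "is_relation C T" "base T = base R" "\<And>x y. holds C T x y \<longleftrightarrow> holds C R x y \<and> holds C S x y"
proof -
  note [simp] = relD[OF R] relD[OF S(1)] S(2)
  obtain e where me: "is_mono C e" and e [simp]: "Cod C e = Dom C (pr1 R)"
    and eh: "\<And>z. z \<in> Ar C \<Longrightarrow> Cod C z = Dom C (pr1 R) \<Longrightarrow>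
      holds C S (pr1 R \<cdot> z) (pr2 R \<cdot> z) \<longleftrightarrow> (\<exists>w \<in> Ar C. Cod C w = Dom C e \<and> e \<cdot> w = z)"
    by (rule rel_comprehension[OF S(1), of "pr1 R" "pr2 R"]) simp_all
  note [simp] = mono_arr[OF me]
  define T where "T = \<lparr>base = base R, pr1 = pr1 R \<cdot> e, pr2 = pr2 R \<cdot> e\<rparr>"
  have T [simp]: "base T = base R" "pr1 T = pr1 R \<cdot> e" "pr2 T = pr2 R \<cdot> e" by (simp_all add: T_def)
  have "is_relation C T"
  proof (rule relI)
    fix u v assume uv: "u \<in> Ar C" "v \<in> Ar C" "Cod C u = Dom C (pr1 T)" "Cod C v = Dom C (pr1 T)" "Dom C u = Dom C v"
      "pr1 T \<cdot> u = pr1 T \<cdot> v" "pr2 T \<cdot> u = pr2 T \<cdot> v"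
    have "e \<cdot> u = e \<cdot> v" by (rule rel_eqI[OF R]) (use uv in simp_all)
    then show "u = v" by - (rule monoD[OF me]; use uv in simp)
  qed simp_all
  moreover have "holds C T x y \<longleftrightarrow> holds C R x y \<and> holds C S x y" for x y
  proof
    assume "holds C T x y"
    then obtain t where t: "t \<in> Ar C" "Cod C t = Dom C e" "pr1 R \<cdot> (e \<cdot> t) = x" "pr2 R \<cdot> (e \<cdot> t) = y" by (auto elim!: holdsE)
    have "holds C S (pr1 R \<cdot> (e \<cdot> t)) (pr2 R \<cdot> (e \<cdot> t))" using eh[of "e \<cdot> t"] t by auto
    then show "holds C R x y \<and> holds C S x y" using t by (auto intro!: holdsI[of "e \<cdot> t"])
  next
    assume h: "holds C R x y \<and> holds C S x y"
    then obtain t where t: "t \<in> Ar C" "Cod C t = Dom C (pr1 R)" "pr1 R \<cdot> t = x" "pr2 R \<cdot> t = y" by (auto elim: holdsE)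
    then obtain w where "w \<in> Ar C" "Cod C w = Dom C e" "e \<cdot> w = t" using eh[of t] h by auto
    then show "holds C T x y" using t by (intro holdsI[of w]) simp_all
  qed
  ultimately show thesis using that[of T] by simp
qed

text \<open>The defining condition tests the intersection with the opposite relation through all its
  lower bounds. As the intersection exists, it can be tested on that relation itself, whose elements
  are the pairs related in both directions.\<close>

lemma antisymmetric_iff:
  assumes P: "is_preorder C R"
  shows "rel_antisymmetric C R \<longleftrightarrow> (\<forall>x y. holds C R x y \<longrightarrow> holds C R y x \<longrightarrow> x = y)"
proof -
  note R = preorderD(1)[OF P]
  note c = rel_conv_relation[OF R] and d = rel_diag_relation[OF relD(1)[OF R]]
  have le1: "rel_le C S R \<and> rel_le C S (rel_conv R) \<longleftrightarrow> (\<forall>x y. holds C S x y \<longrightarrow> holds C R x y \<and> holds C R y x)"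
    if S: "is_relation C S" "base S = base R" for S
  proof -
    have "base S = base (rel_conv R)" using S(2) c(3) by simp
    note e = rel_le_iff[OF S(1) c(1) this]
    show ?thesis unfolding rel_le_iff[OF S(1) R S(2)] e c(2) by blast
  qed
  have le2: "rel_le C S (rel_diag C (base R)) \<longleftrightarrow> (\<forall>x y. holds C S x y \<longrightarrow> x = y)"
    if S: "is_relation C S" "base S = base R" for S
  proof -
    have "base S = base (rel_diag C (base R))" using S(2) d(3) by simp
    note e = rel_le_iff[OF S(1) d(1) this]
    show ?thesis unfolding e d(2) using holdsD(1,3)[OF S(1)] S(2) by auto
  qed
  show ?thesis
  proof
    assume a: "rel_antisymmetric C R"
    obtain S where S: "is_relation C S" "base S = base R" "\<And>x y. holds C S x y \<longleftrightarrow> holds C R x y \<and> holds C (rel_conv R) x y"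
      by (rule rel_inter[OF R c(1,3)]) blast
    have "rel_le C S R \<and> rel_le C S (rel_conv R)" using le1[OF S(1,2)] S(3) c(2) by blast
    then have "rel_le C S (rel_diag C (base R))" using a S(1) unfolding rel_antisymmetric_def by blast
    then show "\<forall>x y. holds C R x y \<longrightarrow> holds C R y x \<longrightarrow> x = y" using le2[OF S(1,2)] S(3) c(2) by blast
  next
    assume a: "\<forall>x y. holds C R x y \<longrightarrow> holds C R y x \<longrightarrow> x = y"
    show "rel_antisymmetric C R" unfolding rel_antisymmetric_def
    proof (intro allI impI)
      fix S assume S: "is_relation C S"
      show "(rel_le C S R \<and> rel_le C S (rel_conv R)) = rel_le C S (rel_diag C (base R))"
      proof (cases "base S = base R")
        case True
        show ?thesis unfolding le1[OF S True] le2[OF S True] using a preorderD(2)[OF P] holdsD[OF S] True by metis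
      next
        case False
        then show ?thesis by (simp add: rel_le_def rel_diag_def)
      qed
    qed
  qed
qed

lemma diag_preorder:
  assumes A: "A \<in> Ob C"
  shows "is_preorder C (rel_diag C A)"
  unfolding preorder_iff using rel_diag_relation[OF A] by auto

text \<open>The product itself as a relation. Every arrow into its base is monotone, so coproducts
  of preorders can be tested on arrows of the base category.\<close>

lemma indiscrete_ex:
  assumes A: "A \<in> Ob C"
  obtains U where "is_preorder C U" "base U = A"
    "\<And>x y. x \<in> Ar C \<Longrightarrow> y \<in> Ar C \<Longrightarrow> Dom C y = Dom C x \<Longrightarrow> Cod C x = A \<Longrightarrow> Cod C y = A \<Longrightarrow> holds C U x y"
proof -
  obtain p q where p [simp]: "p \<in> Ar C" "q \<in> Ar C" "Dom C q = Dom C p" "Cod C p = A" "Cod C q = A"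
    and pe: "\<And>u v. u \<in> Ar C \<Longrightarrow> v \<in> Ar C \<Longrightarrow> Dom C v = Dom C u \<Longrightarrow> Cod C u = A \<Longrightarrow> Cod C v = A \<Longrightarrow>
      \<exists>w \<in> Ar C. Dom C w = Dom C u \<and> Cod C w = Dom C p \<and> p \<cdot> w = u \<and> q \<cdot> w = v"
    and pu: "\<And>u v. u \<in> Ar C \<Longrightarrow> v \<in> Ar C \<Longrightarrow> Cod C u = Dom C p \<Longrightarrow> Cod C v = Dom C p \<Longrightarrow> Dom C u = Dom C v \<Longrightarrow>
      p \<cdot> u = p \<cdot> v \<Longrightarrow> q \<cdot> u = q \<cdot> v \<Longrightarrow> u = v"
    using product_ex[OF A A] by blast
  define U where "U = \<lparr>base = A, pr1 = p, pr2 = q\<rparr>"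
  have U [simp]: "base U = A" "pr1 U = p" "pr2 U = q" by (simp_all add: U_def)
  have rel: "is_relation C U" by (rule relI) (use A pu in simp_all)
  have h: "holds C U x y" if "x \<in> Ar C" "y \<in> Ar C" "Dom C y = Dom C x" "Cod C x = A" "Cod C y = A" for x y
    using pe[OF that] by (auto intro: holdsI)
  have "is_preorder C U" unfolding preorder_iff
  proof (intro conjI ballI impI allI)
    show "is_relation C U" by (rule rel)
    show "holds C U x x" if "x \<in> Ar C" "Cod C x = base U" for x using h that by simp
    fix x y z assume xy: "holds C U x y" and yz: "holds C U y z"
    show "holds C U x z" by (rule h) (use holdsD[OF rel xy] holdsD[OF rel yz] in simp_all)
  qed
  then show thesis using that[of U] h by simp
qed

section \<open>Monomorphisms and pullbacks of internal preorders\<close>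

lemma PO_discrete:
  assumes S: "is_preorder C S" and w: "w \<in> Ar C" "Cod C w = base S"
  shows "(rel_diag C (Dom C w), w, S) \<in> Ar PO"
proof (rule PO_ArI)
  have o: "Dom C w \<in> Ob C" using w by simp
  show "is_preorder C (rel_diag C (Dom C w))" by (rule diag_preorder[OF o])
  show "Dom C w = base (rel_diag C (Dom C w))" by (simp add: rel_diag_def)
  fix x y assume "holds C (rel_diag C (Dom C w)) x y"
  then have "x \<in> Ar C" "Cod C x = Dom C w" "x = y" unfolding rel_diag_relation(2)[OF o] by blast+
  then show "holds C S (w \<cdot> x) (w \<cdot> y)" using preorderD(2)[OF S, of "w \<cdot> x"] w by simp
qed (use assms in simp_all)

text \<open>Arrows of the base category into a preorder become monotone once their domain carries
  the discrete preorder, so cancellation can be tested on them.\<close>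

lemma PO_mono_iff:
  assumes M: "M \<in> Ar PO"
  shows "is_mono PO M \<longleftrightarrow> is_mono C (und M)"
proof
  note m = PO_ArD[OF M]
  assume mono: "is_mono PO M"
  show "is_mono C (und M)"
  proof (rule monoI[OF m(5)])
    fix u v assume uv: "u \<in> Ar C" "v \<in> Ar C" "Cod C u = Dom C (und M)" "Cod C v = Dom C (und M)"
      "Dom C u = Dom C v" "und M \<cdot> u = und M \<cdot> v"
    have D: "(rel_diag C (Dom C v), u, fst M) \<in> Ar PO" "(rel_diag C (Dom C v), v, fst M) \<in> Ar PO"
      using PO_discrete[OF m(1), of u] PO_discrete[OF m(1), of v] uv(1-5) m(6) by simp_all
    have "(rel_diag C (Dom C v), u, fst M) = (rel_diag C (Dom C v), v, fst M)"
      by (rule PO.monoD[OF mono]) (use D uv in \<open>simp_all add: PO_simps\<close>)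
    then show "u = v" by simp
  qed
next
  note m = PO_ArD[OF M]
  assume mono: "is_mono C (und M)"
  show "is_mono PO M"
  proof (rule PO.monoI[OF M])
    fix U V assume UV: "U \<in> Ar PO" "V \<in> Ar PO" "Cod PO U = Dom PO M" "Cod PO V = Dom PO M" "Dom PO U = Dom PO V"
      "Comp PO M U = Comp PO M V"
    note u = PO_ArD[OF UV(1)] and v = PO_ArD[OF UV(2)]
    have "und U = und V" by (rule monoD[OF mono]) (use UV(3-6) u(5-7) v(5-7) m(5-7) in \<open>simp_all add: PO_simps\<close>)
    then show "U = V" using UV(3-5) by (intro PO_eqI) (simp_all add: PO_simps)
  qed
qed

lemma PO_pullbackI:
  assumes A: "P \<in> Ar PO" "Q \<in> Ar PO" "F \<in> Ar PO" "G \<in> Ar PO" "snd (snd G) = snd (snd F)" "snd (snd P) = fst F"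
      "snd (snd Q) = fst G" "fst Q = fst P"
    and pb: "is_pullback C (und P) (und Q) (und F) (und G)"
    and h: "\<And>x y. x \<in> Ar C \<Longrightarrow> y \<in> Ar C \<Longrightarrow> Cod C x = base (fst P) \<Longrightarrow> Cod C y = base (fst P) \<Longrightarrow>
      holds C (fst F) (und P \<cdot> x) (und P \<cdot> y) \<Longrightarrow> holds C (fst G) (und Q \<cdot> x) (und Q \<cdot> y) \<Longrightarrow> holds C (fst P) x y"
  shows "is_pullback PO P Q F G"
proof (rule PO.pullbackI)
  note p = PO_ArD[OF A(1)] and q = PO_ArD[OF A(2)] and f = PO_ArD[OF A(3)] and g = PO_ArD[OF A(4)]
  show "Comp PO F P = Comp PO G Q" using A pullbackD(9)[OF pb] by (simp add: PO_simps)
  fix U V assume UV: "U \<in> Ar PO" "V \<in> Ar PO" "Cod PO U = Dom PO F" "Cod PO V = Dom PO G" "Dom PO V = Dom PO U"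
    "Comp PO F U = Comp PO G V"
  note u = PO_ArD[OF UV(1)] and v = PO_ArD[OF UV(2)]
  obtain w where w: "w \<in> Ar C" "Dom C w = Dom C (und U)" "Cod C w = Dom C (und P)" "und P \<cdot> w = und U" "und Q \<cdot> w = und V"
    by (rule pullbackE[OF pb, of "und U" "und V"]) (use UV(3-6) u(5-7) v(5-7) f(5-7) g(5-7) in \<open>simp_all add: PO_simps\<close>)
  have "(fst U, w, fst P) \<in> Ar PO"
  proof (rule PO_ArI[OF u(1) p(1) w(1)])
    fix x y assume xy: "holds C (fst U) x y"
    note d = holdsD[OF u(3) xy]
    have 1: "und P \<cdot> (w \<cdot> x) = und U \<cdot> x" "und P \<cdot> (w \<cdot> y) = und U \<cdot> y" "und Q \<cdot> (w \<cdot> x) = und V \<cdot> x" "und Q \<cdot> (w \<cdot> y) = und V \<cdot> y"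
      using d w(1-3) u(5-7) p(5-7) q(5-7) A(8) by (simp_all add: comp_tri[OF w(4)] comp_tri[OF w(5)])
    have "fst V = fst U" using UV(5) by (simp add: PO_simps)
    then have 2: "holds C (fst F) (und U \<cdot> x) (und U \<cdot> y)" "holds C (fst G) (und V \<cdot> x) (und V \<cdot> y)"
      using u(8)[OF xy] v(8)[of x y] xy UV(3,4) by (simp_all add: PO_simps)
    show "holds C (fst P) (w \<cdot> x) (w \<cdot> y)" by (rule h) (use 1 2 d w(1-3) u(5-7) p(5-7) in simp_all)
  qed (use w u(5-7) p(5-7) in simp_all)
  then show "\<exists>W \<in> Ar PO. Dom PO W = Dom PO U \<and> Cod PO W = Dom PO P \<and> Comp PO P W = U \<and> Comp PO Q W = V"
    using UV(3-5) A(6-8) w by (intro bexI[of _ "(fst U, w, fst P)"]) (auto simp: PO_simps intro!: PO_eqI)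
next
  note p = PO_ArD[OF A(1)] and q = PO_ArD[OF A(2)]
  fix U V assume UV: "U \<in> Ar PO" "V \<in> Ar PO" "Cod PO U = Dom PO P" "Cod PO V = Dom PO P" "Dom PO U = Dom PO V"
    "Comp PO P U = Comp PO P V" "Comp PO Q U = Comp PO Q V"
  note u = PO_ArD[OF UV(1)] and v = PO_ArD[OF UV(2)]
  have "und U = und V"
    by (rule pullback_eqI[OF pb]) (use UV(3-7) u(5-7) v(5-7) p(5-7) in \<open>simp_all add: PO_simps\<close>)
  then show "U = V" using UV(3-5) by (intro PO_eqI) (simp_all add: PO_simps)
qed (use A in \<open>simp_all add: PO_simps\<close>)

text \<open>The intersection of the two inverse images, the largest relation for which both
  \<open>p\<close> and \<open>q\<close> are monotone.\<close>

lemma pullback_preorder_ex: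
  assumes S1: "is_preorder C S1" and S2: "is_preorder C S2" and p: "p \<in> Ar C" "Cod C p = base S1"
    and q: "q \<in> Ar C" "Cod C q = base S2" "Dom C q = Dom C p"
  obtains S where "is_preorder C S" "base S = Dom C p"
    "\<And>x y. holds C S x y \<longleftrightarrow> x \<in> Ar C \<and> y \<in> Ar C \<and> Cod C x = Dom C p \<and> Cod C y = Dom C p \<and>
      holds C S1 (p \<cdot> x) (p \<cdot> y) \<and> holds C S2 (q \<cdot> x) (q \<cdot> y)"
proof -
  obtain T1 where T1: "is_relation C T1" "base T1 = Dom C p"
    "\<And>x y. holds C T1 x y \<longleftrightarrow> x \<in> Ar C \<and> y \<in> Ar C \<and> Cod C x = Dom C p \<and> Cod C y = Dom C p \<and> holds C S1 (p \<cdot> x) (p \<cdot> y)"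
    by (rule rel_inverse_image[OF preorderD(1)[OF S1] p]) (rule that, assumption+)
  obtain T2 where T2: "is_relation C T2" "base T2 = Dom C q"
    "\<And>x y. holds C T2 x y \<longleftrightarrow> x \<in> Ar C \<and> y \<in> Ar C \<and> Cod C x = Dom C q \<and> Cod C y = Dom C q \<and> holds C S2 (q \<cdot> x) (q \<cdot> y)"
    by (rule rel_inverse_image[OF preorderD(1)[OF S2] q(1,2)]) (rule that, assumption+)
  obtain S where S: "is_relation C S" "base S = base T1" "\<And>x y. holds C S x y \<longleftrightarrow> holds C T1 x y \<and> holds C T2 x y"
    by (rule rel_inter[OF T1(1) T2(1)]) (use T1(2) T2(2) q(3) in simp_all)
  have h: "holds C S x y \<longleftrightarrow> x \<in> Ar C \<and> y \<in> Ar C \<and> Cod C x = Dom C p \<and> Cod C y = Dom C p \<and>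
      holds C S1 (p \<cdot> x) (p \<cdot> y) \<and> holds C S2 (q \<cdot> x) (q \<cdot> y)" for x y
    using S(3) T1(3) T2(3) q(3) by auto
  have "is_preorder C S" unfolding preorder_iff
  proof (intro conjI ballI impI allI)
    show "is_relation C S" by (rule S(1))
    show "holds C S x x" if "x \<in> Ar C" "Cod C x = base S" for x
      unfolding h using that S(2) T1(2) p q preorderD(2)[OF S1, of "p \<cdot> x"] preorderD(2)[OF S2, of "q \<cdot> x"] by simp
    show "holds C S x z" if "holds C S x y" "holds C S y z" for x y z
      using that unfolding h using preorderD(3)[OF S1] preorderD(3)[OF S2] by blast
  qed
  then show thesis using that[of S] S(2) T1(2) h by simp
qed

lemma PO_pullback_ex:
  assumes F: "F \<in> Ar PO" and G: "G \<in> Ar PO" and e: "Cod PO F = Cod PO G"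
  shows "\<exists>P Q. is_pullback PO P Q F G"
proof -
  note f = PO_ArD[OF F] and g = PO_ArD[OF G]
  have e' [simp]: "snd (snd F) = snd (snd G)" using e by (simp add: PO_simps)
  obtain p q where pq: "is_pullback C p q (und F) (und G)"
    by (rule pullback_ex[of "und F" "und G"]) (use f(5-7) g(5-7) in simp_all)
  note d = pullbackD[OF pq]
  obtain S where S: "is_preorder C S" "base S = Dom C p"
    "\<And>x y. holds C S x y \<longleftrightarrow> x \<in> Ar C \<and> y \<in> Ar C \<and> Cod C x = Dom C p \<and> Cod C y = Dom C p \<and>
      holds C (fst F) (p \<cdot> x) (p \<cdot> y) \<and> holds C (fst G) (q \<cdot> x) (q \<cdot> y)"
    by (rule pullback_preorder_ex[OF f(1) g(1), of p q]) (use d f(6) g(6) in simp_all)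
  have P: "(S, p, fst F) \<in> Ar PO" by (rule PO_ArI[OF S(1) f(1)]) (use d f(6) S(2,3) in simp_all)
  have Q: "(S, q, fst G) \<in> Ar PO" by (rule PO_ArI[OF S(1) g(1)]) (use d g(6) S(2,3) in simp_all)
  have "is_pullback PO (S, p, fst F) (S, q, fst G) F G"
    by (rule PO_pullbackI[OF P Q F G]) (use pq S(2,3) in simp_all)
  then show ?thesis by blast
qed

text \<open>The underlying square is tested with discrete preorders. That the vertex carries the
  largest possible relation is tested with the base of the vertex under that largest
  relation.\<close>

lemma PO_pullbackD:
  assumes pb: "is_pullback PO P Q F G"
  shows "is_pullback C (und P) (und Q) (und F) (und G)"
    "x \<in> Ar C \<Longrightarrow> y \<in> Ar C \<Longrightarrow> Cod C x = base (fst P) \<Longrightarrow> Cod C y = base (fst P) \<Longrightarrow>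
      holds C (fst F) (und P \<cdot> x) (und P \<cdot> y) \<Longrightarrow> holds C (fst G) (und Q \<cdot> x) (und Q \<cdot> y) \<Longrightarrow> holds C (fst P) x y"
proof -
  note D = PO.pullbackD[OF pb]
  note p = PO_ArD[OF D(3)] and q = PO_ArD[OF D(4)] and f = PO_ArD[OF D(1)] and g = PO_ArD[OF D(2)]
  have E: "snd (snd G) = snd (snd F)" "snd (snd P) = fst F" "snd (snd Q) = fst G" "fst Q = fst P"
    "und F \<cdot> und P = und G \<cdot> und Q" using D by (simp_all add: PO_simps)
  have disc: "(rel_diag C (Dom C w), w, S) \<in> Ar PO" if "w \<in> Ar C" "Cod C w = base S" "is_preorder C S" for w S
    by (rule PO_discrete[OF that(3,1,2)])
  show pb': "is_pullback C (und P) (und Q) (und F) (und G)"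
  proof (rule pullbackI)
    fix u v assume uv: "u \<in> Ar C" "v \<in> Ar C" "Cod C u = Dom C (und F)" "Cod C v = Dom C (und G)" "Dom C v = Dom C u"
      "und F \<cdot> u = und G \<cdot> v"
    obtain W where W: "W \<in> Ar PO" "Dom PO W = Dom PO (rel_diag C (Dom C u), u, fst F)" "Cod PO W = Dom PO P"
      "Comp PO P W = (rel_diag C (Dom C u), u, fst F)" "Comp PO Q W = (rel_diag C (Dom C u), v, fst G)"
    proof (rule PO.pullbackE[OF pb])
      show "(rel_diag C (Dom C u), u, fst F) \<in> Ar PO" "(rel_diag C (Dom C u), v, fst G) \<in> Ar PO"
        using disc[of u "fst F"] disc[of v "fst G"] uv f g by simp_all
    qed (use uv E in \<open>simp_all add: PO_simps\<close>)
    note w = PO_ArD[OF W(1)]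
    show "\<exists>w \<in> Ar C. Dom C w = Dom C u \<and> Cod C w = Dom C (und P) \<and> und P \<cdot> w = u \<and> und Q \<cdot> w = v"
      using W(2-5) w(5-7) p(6) by (intro bexI[of _ "und W"]) (simp_all add: PO_simps rel_diag_def)
  next
    fix u v assume uv: "u \<in> Ar C" "v \<in> Ar C" "Cod C u = Dom C (und P)" "Cod C v = Dom C (und P)" "Dom C u = Dom C v"
      "und P \<cdot> u = und P \<cdot> v" "und Q \<cdot> u = und Q \<cdot> v"
    have "(rel_diag C (Dom C v), u, fst P) = (rel_diag C (Dom C v), v, fst P)"
    proof (rule PO.pullback_eqI[OF pb])
      show "(rel_diag C (Dom C v), u, fst P) \<in> Ar PO" "(rel_diag C (Dom C v), v, fst P) \<in> Ar PO"
        using disc[of u "fst P"] disc[of v "fst P"] uv p by simp_all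
    qed (use uv in \<open>simp_all add: PO_simps\<close>)
    then show "u = v" by simp
  qed (use E f(5-7) g(5-7) p(5-7) q(5-7) in simp_all)
  show "holds C (fst P) x y" if xy: "x \<in> Ar C" "y \<in> Ar C" "Cod C x = base (fst P)" "Cod C y = base (fst P)"
     "holds C (fst F) (und P \<cdot> x) (und P \<cdot> y)" "holds C (fst G) (und Q \<cdot> x) (und Q \<cdot> y)"
  proof -
    obtain S where S: "is_preorder C S" "base S = Dom C (und P)"
      "\<And>x y. holds C S x y \<longleftrightarrow> x \<in> Ar C \<and> y \<in> Ar C \<and> Cod C x = Dom C (und P) \<and> Cod C y = Dom C (und P) \<and>
        holds C (fst F) (und P \<cdot> x) (und P \<cdot> y) \<and> holds C (fst G) (und Q \<cdot> x) (und Q \<cdot> y)"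
      by (rule pullback_preorder_ex[OF f(1) g(1), of "und P" "und Q"]) (use E p(5-7) q(5-7) in simp_all)
    have U: "(S, und P, fst F) \<in> Ar PO" by (rule PO_ArI[OF S(1) f(1)]) (use p(5-7) E S(2,3) in simp_all)
    have V: "(S, und Q, fst G) \<in> Ar PO" by (rule PO_ArI[OF S(1) g(1)]) (use p(5-7) q(5-7) E S(2,3) in simp_all)
    obtain W where W: "W \<in> Ar PO" "Dom PO W = Dom PO (S, und P, fst F)" "Cod PO W = Dom PO P"
      "Comp PO P W = (S, und P, fst F)" "Comp PO Q W = (S, und Q, fst G)"
      by (rule PO.pullbackE[OF pb U V]) (use E in \<open>simp_all add: PO_simps\<close>)
    note w = PO_ArD[OF W(1)]
    have We: "fst W = S" "snd (snd W) = fst P" "und P \<cdot> und W = und P" "und Q \<cdot> und W = und Q" using W(2-5) by (simp_all add: PO_simps)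
    \<comment> \<open>The mediating arrow from the largest preorder \<open>S\<close> has the
      identity underneath, so its monotonicity says that \<open>S\<close> is contained in the
      relation of the vertex.\<close>
    have "und W = Ident C (base (fst P))"
      by (rule pullback_eqI[OF pb']) (use We w(5-7) p(3,5-7) q(5-7) S(2) E relD(1)[OF p(3)] in simp_all)
    moreover have "holds C S x y" unfolding S(3) using xy p(6) by simp
    ultimately show ?thesis using w(8)[of x y] We xy by simp
  qed
qed

end

section \<open>Coproducts and extensivity of internal preorders\<close>

context lex_ext_cat
begin

text \<open>The copairing exists in the base category. It is monotone by induction over a related
  pair of the sum, with relatedness of the images as predicate.\<close>

lemma PO_coproductI:
  assumes I: "I \<in> Ar PO" and J: "J \<in> Ar PO" and c: "snd (snd J) = snd (snd I)"
    and ij: "is_coproduct C (und I) (und J)" and sc: "sum_cond (und I) (und J) (snd (snd I)) (fst I) (fst J)"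
  shows "is_coproduct PO I J"
proof (rule PO.coproductI)
  note i = PO_ArD[OF I] and j = PO_ArD[OF J]
  fix U V assume UV: "U \<in> Ar PO" "V \<in> Ar PO" "Dom PO U = Dom PO I" "Dom PO V = Dom PO J" "Cod PO V = Cod PO U"
  note u = PO_ArD[OF UV(1)] and v = PO_ArD[OF UV(2)]
  have e [simp]: "fst U = fst I" "fst V = fst J" "snd (snd V) = snd (snd U)" using UV(3-5) by (simp_all add: PO_simps)
  obtain w where w [simp]: "w \<in> Ar C" "Dom C w = Cod C (und I)" "Cod C w = Cod C (und U)" and we: "w \<cdot> und I = und U" "w \<cdot> und J = und V"
    by (rule copairE[OF ij, of "und U" "und V"]) (use i(5-7) j(5-7) u(5-7) v(5-7) in simp_all)
  have "(snd (snd I), w, snd (snd U)) \<in> Ar PO"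
  proof (rule PO_ArI[OF i(2) u(2)])
    fix x y assume xy: "holds C (snd (snd I)) x y"
    note d [simp] = holdsD[OF i(4) xy]
    note [simp] = i(5-7) j(5-7) u(5-7) v(5-7) c
    let ?P = "\<lambda>z. holds C (snd (snd U)) (w \<cdot> (x \<cdot> z)) (w \<cdot> (y \<cdot> z))"
    have "?P (Ident C (Dom C x))"
    proof (rule sum_induct[where P = ?P, OF ij sc i(4) _ xy])
      fix p q z assume pq: "is_coproduct C p q" and [simp]: "z \<in> Ar C" "Cod C z = Dom C x" "Dom C z = Cod C p" and h: "?P (z \<cdot> p)" "?P (z \<cdot> q)"
      note [simp] = coproductD[OF pq]
      show "?P z" by (rule holds_glue[OF u(4) pq]) (use h in simp_all)
    next
      fix z assume "z \<in> Ar C" "Cod C z = Dom C x" "is_initial C (Dom C z)"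
      then show "?P z" by - (rule holds_initial[OF u(2)]; simp)
    next
      fix z a b assume [simp]: "a \<in> Ar C" "b \<in> Ar C" "Cod C a = Dom C (und I)" "Cod C b = Dom C (und I)" and ab: "holds C (fst I) a b"
        and "x \<cdot> z = und I \<cdot> a" "y \<cdot> z = und I \<cdot> b"
      then show "?P z" using u(8)[of a b] by (simp add: comp_tri[OF we(1)])
    next
      fix z a b assume [simp]: "a \<in> Ar C" "b \<in> Ar C" "Cod C a = Dom C (und J)" "Cod C b = Dom C (und J)" and ab: "holds C (fst J) a b"
        and "x \<cdot> z = und J \<cdot> a" "y \<cdot> z = und J \<cdot> b"
      then show "?P z" using v(8)[of a b] by (simp add: comp_tri[OF we(2)])
    qed simp_all
    then show "holds C (snd (snd U)) (w \<cdot> x) (w \<cdot> y)" by simp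
  qed (use i(5-7) u(5-7) in simp_all)
  then show "\<exists>W \<in> Ar PO. Dom PO W = Cod PO I \<and> Cod PO W = Cod PO U \<and> Comp PO W I = U \<and> Comp PO W J = V"
    using we by (intro bexI[of _ "(snd (snd I), w, snd (snd U))"]) (auto simp: PO_simps intro!: PO_eqI)
next
  note i = PO_ArD[OF I] and j = PO_ArD[OF J]
  fix U V assume UV: "U \<in> Ar PO" "V \<in> Ar PO" "Dom PO U = Cod PO I" "Dom PO V = Cod PO I" "Cod PO U = Cod PO V"
    "Comp PO U I = Comp PO V I" "Comp PO U J = Comp PO V J"
  note u = PO_ArD[OF UV(1)] and v = PO_ArD[OF UV(2)]
  have "und U = und V"
    by (rule coproduct_eqI[OF ij]) (use UV(3-7) u(5-7) v(5-7) i(5-7) in \<open>simp_all add: PO_simps\<close>)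
  then show "U = V" using UV(3-5) by (intro PO_eqI) (simp_all add: PO_simps)
qed (use I J c in \<open>simp_all add: PO_simps\<close>)

text \<open>Indiscrete codomains show that the underlying arrows form a coproduct. For the relation,
  the given coproduct is compared with the sum relation on the same base.\<close>

lemma PO_coproductD:
  assumes IJ: "is_coproduct PO I J"
  shows "I \<in> Ar PO" "J \<in> Ar PO" "snd (snd J) = snd (snd I)" "is_coproduct C (und I) (und J)"
    "sum_cond (und I) (und J) (snd (snd I)) (fst I) (fst J)"
proof -
  show I: "I \<in> Ar PO" and J: "J \<in> Ar PO" and c: "snd (snd J) = snd (snd I)"
    using PO.coproductD[OF IJ] by (simp_all add: PO_simps)
  note i = PO_ArD[OF I] and j = PO_ArD[OF J]
  have ind: "(S, w, U) \<in> Ar PO"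
    if "is_preorder C S" "is_preorder C U" "w \<in> Ar C" "Dom C w = base S" "Cod C w = base U"
      "\<And>x y. x \<in> Ar C \<Longrightarrow> y \<in> Ar C \<Longrightarrow> Dom C y = Dom C x \<Longrightarrow> Cod C x = base U \<Longrightarrow> Cod C y = base U \<Longrightarrow> holds C U x y" for S w U
  proof (rule PO_ArI[OF that(1-5)])
    fix x y assume "holds C S x y"
    from holdsD[OF preorderD(1)[OF that(1)] this] show "holds C U (w \<cdot> x) (w \<cdot> y)"
      using that(3-5) by (intro that(6)) simp_all
  qed
  show ij: "is_coproduct C (und I) (und J)"
  proof (rule coproductI)
    fix u v assume uv: "u \<in> Ar C" "v \<in> Ar C" "Dom C u = Dom C (und I)" "Dom C v = Dom C (und J)" "Cod C v = Cod C u"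
    obtain U where U: "is_preorder C U" "base U = Cod C u"
      "\<And>x y. x \<in> Ar C \<Longrightarrow> y \<in> Ar C \<Longrightarrow> Dom C y = Dom C x \<Longrightarrow> Cod C x = Cod C u \<Longrightarrow> Cod C y = Cod C u \<Longrightarrow> holds C U x y"
      by (rule indiscrete_ex[of "Cod C u"]) (use uv in auto)
    have UV: "(fst I, u, U) \<in> Ar PO" "(fst J, v, U) \<in> Ar PO"
      by (rule ind[OF i(1) U(1)]; use uv i j U in simp) (rule ind[OF j(1) U(1)]; use uv i j U in simp)
    obtain W where W: "W \<in> Ar PO" "Dom PO W = Cod PO I" "Cod PO W = Cod PO (fst I, u, U)" "Comp PO W I = (fst I, u, U)" "Comp PO W J = (fst J, v, U)"
      by (rule PO.copairE[OF IJ UV]) (simp_all add: PO_simps)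
    show "\<exists>w \<in> Ar C. Dom C w = Cod C (und I) \<and> Cod C w = Cod C u \<and> w \<cdot> und I = u \<and> w \<cdot> und J = v"
      using PO_ArD(5-7)[OF W(1)] W(2-5) i(5-7) U(2) by (intro bexI[of _ "und W"]) (simp_all add: PO_simps)
  next
    fix f g assume fg: "f \<in> Ar C" "g \<in> Ar C" "Dom C f = Cod C (und I)" "Dom C g = Cod C (und I)" "Cod C f = Cod C g"
      "f \<cdot> und I = g \<cdot> und I" "f \<cdot> und J = g \<cdot> und J"
    obtain U where U: "is_preorder C U" "base U = Cod C g"
      "\<And>x y. x \<in> Ar C \<Longrightarrow> y \<in> Ar C \<Longrightarrow> Dom C y = Dom C x \<Longrightarrow> Cod C x = Cod C g \<Longrightarrow> Cod C y = Cod C g \<Longrightarrow> holds C U x y"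
      by (rule indiscrete_ex[of "Cod C g"]) (use fg in auto)
    have A: "(snd (snd I), f, U) \<in> Ar PO" "(snd (snd I), g, U) \<in> Ar PO"
      by (rule ind[OF i(2) U(1)]; use fg i U in simp) (rule ind[OF i(2) U(1)]; use fg i U in simp)
    have "(snd (snd I), f, U) = (snd (snd I), g, U)"
      by (rule PO.coproduct_eqI[OF IJ A]) (use fg in \<open>simp_all add: PO_simps\<close>)
    then show "f = g" by simp
  qed (use i(5-7) j(5-7) c in simp_all)
  obtain R k l where s: "is_sum k l (und I) (und J) R (fst I) (fst J)"
    by (rule sum_ex[OF ij i(1) _ j(1)]) (use i(6) j(6) in simp_all)
  note d = is_sumD[OF s]
  note sc = is_sum_cond[OF s]
  have R: "is_preorder C R" by (rule is_sum_preorder[OF s i(1) j(1)])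
  have A: "(fst I, und I, R) \<in> Ar PO"
    by (rule PO_ArI[OF i(1) R]) (use i(5-7) d(7) is_sum_inject[OF s] in simp_all)
  have B: "(fst J, und J, R) \<in> Ar PO"
    by (rule PO_ArI[OF j(1) R]) (use i(5-7) j(5-7) d(7) c is_sum_inject[OF is_sum_sym[OF s]] in simp_all)
  obtain W where W: "W \<in> Ar PO" "Dom PO W = Cod PO I" "Cod PO W = Cod PO (fst I, und I, R)"
    "Comp PO W I = (fst I, und I, R)" "Comp PO W J = (fst J, und J, R)"
    by (rule PO.copairE[OF IJ A B]) (simp_all add: PO_simps)
  note w = PO_ArD[OF W(1)]
  have We: "fst W = snd (snd I)" "snd (snd W) = R" "und W \<cdot> und I = und I" "und W \<cdot> und J = und J"
    using W(2-5) by (simp_all add: PO_simps)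
  \<comment> \<open>The mediating arrow to the sum relation fixes both injections, so it is the
    identity underneath. Its monotonicity puts the given relation below the sum, and
    \<open>sum_cond\<close> passes to smaller relations.\<close>
  have id: "und W = Ident C (base (snd (snd I)))"
    by (rule coproduct_eqI[OF ij]) (use We w(5-7) i(5-7) j(5-7) c d(7) relD(1)[OF i(4)] in simp_all)
  have le: "holds C R x y" if h: "holds C (snd (snd I)) x y" for x y
    using w(8)[of x y] h We id holdsD[OF i(4) h] by simp
  show "sum_cond (und I) (und J) (snd (snd I)) (fst I) (fst J)"
    using sc le unfolding sum_cond_def by blast
qed

lemma PO_initial:
  assumes R: "is_preorder C R" and b: "is_initial C (base R)"
  shows "is_initial PO R"
proof (rule PO.initialI)
  show "R \<in> Ob PO" using R by (simp add: PO_simps)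
  fix S assume "S \<in> Ob PO"
  then have S: "is_preorder C S" by (simp add: PO_simps)
  obtain f where f: "f \<in> Ar C" "Dom C f = base R" "Cod C f = base S" by (rule initialE[OF b base_Ob[OF S]])
  have "(R, f, S) \<in> Ar PO"
  proof (rule PO_ArI[OF R S f])
    fix x y assume h: "holds C R x y"
    note d = holdsD[OF preorderD(1)[OF R] h]
    have "is_initial C (Dom C x)" by (rule strict_initial[OF b d(1,3)])
    then show "holds C S (f \<cdot> x) (f \<cdot> y)" by - (rule holds_initial[OF S]; use d f in simp)
  qed
  then show "\<exists>F \<in> Ar PO. Dom PO F = R \<and> Cod PO F = S" by (intro bexI[of _ "(R, f, S)"]) (simp_all add: PO_simps)
next
  fix F G assume FG: "F \<in> Ar PO" "G \<in> Ar PO" "Dom PO F = R" "Dom PO G = R" "Cod PO F = Cod PO G"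
  have "und F = und G"
    by (rule initial_unique[OF b]) (use FG(3-5) PO_ArD(5-7)[OF FG(1)] PO_ArD(5-7)[OF FG(2)] in \<open>simp_all add: PO_simps\<close>)
  then show "F = G" using FG(3-5) by (intro PO_eqI) (simp_all add: PO_simps)
qed

text \<open>An initial preorder maps to the discrete preorder on an initial object, and initial
  objects of the base category are strict.\<close>

lemma PO_initialD:
  assumes R: "is_initial PO R"
  shows "is_preorder C R" "is_initial C (base R)"
proof -
  show P: "is_preorder C R" using R by (simp add: is_initial_def PO_simps)
  obtain I where I: "is_initial C I" by (rule initial_ex)
  then have IO: "I \<in> Ob C" by (simp add: is_initial_def)
  have "rel_diag C I \<in> Ob PO" using diag_preorder[OF IO] by (simp add: PO_simps)
  then obtain F where F: "F \<in> Ar PO" "Dom PO F = R" "Cod PO F = rel_diag C I" by (rule PO.initialE[OF R])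
  note f = PO_ArD[OF F(1)]
  have "is_initial C (Dom C (und F))"
    by (rule strict_initial[OF I]) (use f(5-7) F(2,3) in \<open>simp_all add: PO_simps rel_diag_def\<close>)
  then show "is_initial C (base R)" using f(6) F(2) by (simp add: PO_simps)
qed

lemma PO_coproduct_ex:
  assumes P1: "is_preorder C R1" and P2: "is_preorder C R2"
  shows "\<exists>I J. is_coproduct PO I J \<and> Dom PO I = R1 \<and> Dom PO J = R2"
proof -
  obtain i j where ij: "is_coproduct C i j" and d: "Dom C i = base R1" "Dom C j = base R2"
    by (rule coproduct_ex[OF base_Ob[OF P1] base_Ob[OF P2]])
  note [simp] = coproductD[OF ij]
  obtain R k l where s: "is_sum k l i j R R1 R2" by (rule sum_ex[OF ij P1 _ P2]) (use d in simp_all)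
  note b = is_sumD(7)[OF s]
  have R: "is_preorder C R" by (rule is_sum_preorder[OF s P1 P2])
  have I: "(R1, i, R) \<in> Ar PO" by (rule PO_ArI[OF P1 R]) (use d b is_sum_inject[OF s] in simp_all)
  have J: "(R2, j, R) \<in> Ar PO" by (rule PO_ArI[OF P2 R]) (use d b is_sum_inject[OF is_sum_sym[OF s]] in simp_all)
  have "is_coproduct PO (R1, i, R) (R2, j, R)" by (rule PO_coproductI[OF I J]) (use ij is_sum_cond[OF s] in simp_all)
  then show ?thesis by (auto simp: PO_simps)
qed

text \<open>Underneath, this is extensivity of the base category; what remains are the relations.
  From a coproduct, the restriction clauses of \<open>sum_cond\<close> give the relations required
  of the pullbacks. Conversely, \<open>F\<close> carries a related pair of its domain to a related
  pair of the coproduct, where \<open>sum_cond\<close> applies; a pair across the pieces is sent to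
  a pair across the summands and so has an initial domain.\<close>

lemma PO_extensive_square:
  assumes IJ: "is_coproduct PO I1 I2"
    and F: "F \<in> Ar PO" "snd (snd F) = snd (snd I1)"
    and X1: "X1 \<in> Ar PO" "snd (snd X1) = fst F" and X2: "X2 \<in> Ar PO" "snd (snd X2) = fst F"
    and G1: "G1 \<in> Ar PO" "fst G1 = fst X1" "snd (snd G1) = fst I1" and G2: "G2 \<in> Ar PO" "fst G2 = fst X2" "snd (snd G2) = fst I2"
    and e: "und F \<cdot> und X1 = und I1 \<cdot> und G1" "und F \<cdot> und X2 = und I2 \<cdot> und G2"
  shows "is_coproduct PO X1 X2 \<longleftrightarrow> is_pullback PO X1 G1 F I1 \<and> is_pullback PO X2 G2 F I2"
proof
  note D = PO_coproductD[OF IJ]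
  note i1 = PO_ArD[OF D(1)] and i2 = PO_ArD[OF D(2)] and f = PO_ArD[OF F(1)] and x1 = PO_ArD[OF X1(1)] and x2 = PO_ArD[OF X2(1)]
    and g1 = PO_ArD[OF G1(1)] and g2 = PO_ArD[OF G2(1)]
  note E = F(2) X1(2) X2(2) G1(2,3) G2(2,3) D(3)
  have iff: "is_coproduct C (und X1) (und X2) \<longleftrightarrow> is_pullback C (und X1) (und G1) (und F) (und I1) \<and> is_pullback C (und X2) (und G2) (und F) (und I2)"
    by (rule ext_iff[OF D(4)]) (use e E i1(5-7) i2(5-7) f(5-7) x1(5-7) x2(5-7) g1(5-7) g2(5-7) in simp_all)
  {
    assume XX: "is_coproduct PO X1 X2"
    note DX = PO_coproductD[OF XX]
    have pb: "is_pullback C (und X1) (und G1) (und F) (und I1)" "is_pullback C (und X2) (und G2) (und F) (und I2)"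
      using iff DX(4) by simp_all
    show "is_pullback PO X1 G1 F I1 \<and> is_pullback PO X2 G2 F I2"
    proof
      show "is_pullback PO X1 G1 F I1"
      proof (rule PO_pullbackI[OF X1(1) G1(1) F(1) D(1)])
        fix x y assume "x \<in> Ar C" "y \<in> Ar C" "Cod C x = base (fst X1)" "Cod C y = base (fst X1)" "holds C (fst F) (und X1 \<cdot> x) (und X1 \<cdot> y)"
        then show "holds C (fst X1) x y" using sum_condD(1)[OF DX(5), of x y] E x1(6) by simp
      qed (use E pb in simp_all)
      show "is_pullback PO X2 G2 F I2"
      proof (rule PO_pullbackI[OF X2(1) G2(1) F(1) D(2)])
        fix x y assume "x \<in> Ar C" "y \<in> Ar C" "Cod C x = base (fst X2)" "Cod C y = base (fst X2)" "holds C (fst F) (und X2 \<cdot> x) (und X2 \<cdot> y)"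
        then show "holds C (fst X2) x y" using sum_condD(2)[OF DX(5), of x y] E x2(6) by simp
      qed (use E pb in simp_all)
    qed
  next
    assume PB: "is_pullback PO X1 G1 F I1 \<and> is_pullback PO X2 G2 F I2"
    then have P1: "is_pullback PO X1 G1 F I1" and P2: "is_pullback PO X2 G2 F I2" by simp_all
    have xx: "is_coproduct C (und X1) (und X2)" using iff PO_pullbackD(1)[OF P1] PO_pullbackD(1)[OF P2] by simp
    have T: "und F \<cdot> (und X1 \<cdot> x) = und I1 \<cdot> (und G1 \<cdot> x)" if "x \<in> Ar C" "Cod C x = base (fst X1)" for x
      by (rule comp_square[OF e(1)]) (use that E i1(5-7) f(5-7) x1(5-7) g1(5-7) in simp_all)
    have T': "und F \<cdot> (und X2 \<cdot> x) = und I2 \<cdot> (und G2 \<cdot> x)" if "x \<in> Ar C" "Cod C x = base (fst X2)" for x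
      by (rule comp_square[OF e(2)]) (use that E i2(5-7) f(5-7) x2(5-7) g2(5-7) in simp_all)
    have fh: "holds C (snd (snd I1)) (und F \<cdot> x) (und F \<cdot> y)" if "holds C (fst F) x y" for x y
      using f(8)[OF that] E by simp
    have "sum_cond (und X1) (und X2) (snd (snd X1)) (fst X1) (fst X2)"
      unfolding sum_cond_def
    proof (intro conjI ballI impI)
      fix x y assume xy: "x \<in> Ar C" "y \<in> Ar C"
      note sc = sum_condD[OF D(5)]
      show "holds C (fst X1) x y" if "Cod C x = Dom C (und X1)" "Cod C y = Dom C (und X1)" "holds C (snd (snd X1)) (und X1 \<cdot> x) (und X1 \<cdot> y)"
      proof -
        have "holds C (fst F) (und X1 \<cdot> x) (und X1 \<cdot> y)" using that E by simp
        from fh[OF this] have "holds C (fst I1) (und G1 \<cdot> x) (und G1 \<cdot> y)"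
          using that(1,2) xy E i1(5-7) g1(5-7) x1(5-7) by (intro sc(1)) (simp_all add: T)
        then show ?thesis using that xy E x1(6) by (intro PO_pullbackD(2)[OF P1]) simp_all
      qed
      show "holds C (fst X2) x y" if "Cod C x = Dom C (und X2)" "Cod C y = Dom C (und X2)" "holds C (snd (snd X1)) (und X2 \<cdot> x) (und X2 \<cdot> y)"
      proof -
        have "holds C (fst F) (und X2 \<cdot> x) (und X2 \<cdot> y)" using that E by simp
        from fh[OF this] have "holds C (fst I2) (und G2 \<cdot> x) (und G2 \<cdot> y)"
          using that(1,2) xy E i2(5-7) g2(5-7) x2(5-7) by (intro sc(2)) (simp_all add: T')
        then show ?thesis using that xy E x2(6) by (intro PO_pullbackD(2)[OF P2]) simp_all
      qed
      show "is_initial C (Dom C x)" if "Cod C x = Dom C (und X1)" "Cod C y = Dom C (und X2)" "holds C (snd (snd X1)) (und X1 \<cdot> x) (und X2 \<cdot> y)"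
      proof -
        have "holds C (fst F) (und X1 \<cdot> x) (und X2 \<cdot> y)" using that E by simp
        from fh[OF this] have "is_initial C (Dom C (und G1 \<cdot> x))"
          using that(1,2) xy E i1(5-7) i2(5-7) g1(5-7) g2(5-7) x1(5-7) x2(5-7) by (intro sc(3)[of _ "und G2 \<cdot> y"]) (simp_all add: T T')
        then show ?thesis using that(1) xy E g1(5-7) x1(5-7) by simp
      qed
      show "is_initial C (Dom C x)" if "Cod C x = Dom C (und X2)" "Cod C y = Dom C (und X1)" "holds C (snd (snd X1)) (und X2 \<cdot> x) (und X1 \<cdot> y)"
      proof -
        have "holds C (fst F) (und X2 \<cdot> x) (und X1 \<cdot> y)" using that E by simp
        from fh[OF this] have "is_initial C (Dom C (und G2 \<cdot> x))"
          using that(1,2) xy E i1(5-7) i2(5-7) g1(5-7) g2(5-7) x1(5-7) x2(5-7) by (intro sc(4)[of _ "und G1 \<cdot> y"]) (simp_all add: T T')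
        then show ?thesis using that(1) xy E g2(5-7) x2(5-7) by simp
      qed
    qed
    then show "is_coproduct PO X1 X2" by (intro PO_coproductI[OF X1(1) X2(1) _ xx]) (use E in simp_all)
  }
qed

lemma PO_extensive: "is_extensive PO"
  unfolding is_extensive_def has_finite_coproducts_def
proof (intro conjI ballI allI impI)
  obtain I where I: "is_initial C I" by (rule initial_ex)
  then have IO: "I \<in> Ob C" by (simp add: is_initial_def)
  have "is_initial PO (rel_diag C I)"
    by (rule PO_initial[OF diag_preorder[OF IO]]) (use I in \<open>simp add: rel_diag_def\<close>)
  then show "\<exists>I. is_initial PO I" by blast
  show "\<exists>i j. is_coproduct PO i j \<and> Dom PO i = A \<and> Dom PO j = B" if "A \<in> Ob PO" "B \<in> Ob PO" for A B
    using PO_coproduct_ex that by (simp add: PO_simps)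
  fix i1 i2 x1 x2 f g1 g2
  assume a: "is_coproduct PO i1 i2 \<and>
        f \<in> hom PO (Dom PO f) (Cod PO i1) \<and>
        x1 \<in> hom PO (Dom PO g1) (Dom PO f) \<and> x2 \<in> hom PO (Dom PO g2) (Dom PO f) \<and>
        g1 \<in> hom PO (Dom PO g1) (Dom PO i1) \<and> g2 \<in> hom PO (Dom PO g2) (Dom PO i2) \<and>
        Comp PO f x1 = Comp PO i1 g1 \<and> Comp PO f x2 = Comp PO i2 g2"
  then have "is_coproduct PO i1 i2" by (elim conjE)
  then show "is_coproduct PO x1 x2 = (is_pullback PO x1 g1 f i1 \<and> is_pullback PO x2 g2 f i2)"
    by (rule PO_extensive_square) (use a in \<open>simp_all add: PO_simps\<close>)
qed

sublocale POx: ext_cat PO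
  by unfold_locales (use PO_extensive PO_pullback_ex in blast)+

section \<open>Equivalence relations, partial orders and trivial morphisms among preorders\<close>

lemma Eq_iff: "R \<in> Eq_objs C \<longleftrightarrow> is_preorder C R \<and> (\<forall>x y. holds C R x y \<longrightarrow> holds C R y x)"
  using symmetric_iff preorderD(1) by (auto simp: Eq_objs_def)

lemma ParOrd_iff: "R \<in> ParOrd_objs C \<longleftrightarrow> is_preorder C R \<and> (\<forall>x y. holds C R x y \<longrightarrow> holds C R y x \<longrightarrow> x = y)"
  using antisymmetric_iff by (auto simp: ParOrd_objs_def)

lemma diag_Z: "A \<in> Ob C \<Longrightarrow> rel_diag C A \<in> Eq_objs C \<inter> ParOrd_objs C"
  using diag_preorder rel_diag_relation(2) by (simp add: Eq_iff ParOrd_iff)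

text \<open>Related elements of a trivial object are equal, as its relation is symmetric and
  antisymmetric. Conversely, an arrow that identifies related elements is monotone into the discrete
  preorder on its target.\<close>

lemma PO_trivial_iff:
  assumes F: "F \<in> Ar PO"
  shows "is_trivial PO (Eq_objs C \<inter> ParOrd_objs C) F \<longleftrightarrow> (\<forall>x y. holds C (fst F) x y \<longrightarrow> und F \<cdot> x = und F \<cdot> y)"
proof
  note f = PO_ArD[OF F]
  assume "is_trivial PO (Eq_objs C \<inter> ParOrd_objs C) F"
  then obtain G H where GH: "H \<in> Ar PO" "G \<in> Ar PO" "Cod PO G = Dom PO H" "Cod PO G \<in> Eq_objs C \<inter> ParOrd_objs C"
    "F = Comp PO H G" by (rule PO.trivialE)
  note g = PO_ArD[OF GH(2)] and h = PO_ArD[OF GH(1)]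
  have e: "fst F = fst G" "und F = und H \<cdot> und G" "snd (snd G) = fst H" using GH(3,5) by (simp_all add: PO_simps)
  show "\<forall>x y. holds C (fst F) x y \<longrightarrow> und F \<cdot> x = und F \<cdot> y"
  proof (intro allI impI)
    fix x y assume xy: "holds C (fst F) x y"
    note d = holdsD[OF f(3) xy]
    have "holds C (snd (snd G)) (und G \<cdot> x) (und G \<cdot> y)" using g(8) xy e by simp
    then have "und G \<cdot> x = und G \<cdot> y" using GH(4) by (simp add: Eq_iff ParOrd_iff PO_simps)
    then show "und F \<cdot> x = und F \<cdot> y" using d e g(5-7) h(5-7) by simp
  qed
next
  note f = PO_ArD[OF F]
  assume t: "\<forall>x y. holds C (fst F) x y \<longrightarrow> und F \<cdot> x = und F \<cdot> y"
  let ?Z = "rel_diag C (base (snd (snd F)))"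
  have o: "base (snd (snd F)) \<in> Ob C" by (rule base_Ob[OF f(2)])
  note d = rel_diag_relation[OF o]
  have G: "(fst F, und F, ?Z) \<in> Ar PO"
  proof (rule PO_ArI[OF f(1) diag_preorder[OF o]])
    fix x y assume xy: "holds C (fst F) x y"
    then show "holds C ?Z (und F \<cdot> x) (und F \<cdot> y)" unfolding d(2) using t holdsD[OF f(3) xy] f(5-7) by simp
  qed (use f(5-7) d(3) in simp_all)
  have H: "(?Z, Ident C (base (snd (snd F))), snd (snd F)) \<in> Ar PO"
    using PO_discrete[OF f(2), of "Ident C (base (snd (snd F)))"] o by simp
  have "is_trivial PO (Eq_objs C \<inter> ParOrd_objs C) (Comp PO (?Z, Ident C (base (snd (snd F))), snd (snd F)) (fst F, und F, ?Z))"
    by (rule PO.trivialI[OF H G]) (use diag_Z[OF o] in \<open>simp_all add: PO_simps\<close>)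
  moreover have "Comp PO (?Z, Ident C (base (snd (snd F))), snd (snd F)) (fst F, und F, ?Z) = F"
    using f(5-7) by (intro PO_eqI) (simp_all add: PO_simps)
  ultimately show "is_trivial PO (Eq_objs C \<inter> ParOrd_objs C) F" by simp
qed

text \<open>Induction over a related pair of the sum; equality of two composites glues along
  coproducts.\<close>

lemma PO_holds_coproduct:
  assumes IJ: "is_coproduct PO I J" and xy: "holds C (snd (snd I)) x y"
    and f: "f \<in> Ar C" "Dom C f = base (snd (snd I))"
    and ci: "\<And>a b. holds C (fst I) a b \<Longrightarrow> f \<cdot> (und I \<cdot> a) = f \<cdot> (und I \<cdot> b)"
    and cj: "\<And>a b. holds C (fst J) a b \<Longrightarrow> f \<cdot> (und J \<cdot> a) = f \<cdot> (und J \<cdot> b)"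
  shows "f \<cdot> x = f \<cdot> y"
proof -
  note D = PO_coproductD[OF IJ]
  note i = PO_ArD[OF D(1)] and j = PO_ArD[OF D(2)]
  note d [simp] = holdsD[OF i(4) xy]
  note [simp] = f i(5-7) j(5-7)
  have "f \<cdot> (x \<cdot> Ident C (Dom C x)) = f \<cdot> (y \<cdot> Ident C (Dom C x))"
  proof (rule sum_induct[where P = "\<lambda>z. f \<cdot> (x \<cdot> z) = f \<cdot> (y \<cdot> z)", OF D(4,5) i(4) _ xy])
    fix p q z assume pq: "is_coproduct C p q" and [simp]: "z \<in> Ar C" "Cod C z = Dom C x" "Dom C z = Cod C p"
      and h: "f \<cdot> (x \<cdot> (z \<cdot> p)) = f \<cdot> (y \<cdot> (z \<cdot> p))" "f \<cdot> (x \<cdot> (z \<cdot> q)) = f \<cdot> (y \<cdot> (z \<cdot> q))"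
    note [simp] = coproductD[OF pq]
    show "f \<cdot> (x \<cdot> z) = f \<cdot> (y \<cdot> z)" by (rule coproduct_eqI[OF pq]) (use h in simp_all)
  next
    fix z assume z: "z \<in> Ar C" "Cod C z = Dom C x" "is_initial C (Dom C z)"
    show "f \<cdot> (x \<cdot> z) = f \<cdot> (y \<cdot> z)" by (rule initial_unique[OF z(3)]) (use z in simp_all)
  qed (use ci cj in simp_all)
  then show ?thesis by simp
qed

lemma PO_sym_coproduct:
  assumes IJ: "is_coproduct PO I J" and S: "fst I \<in> Eq_objs C" "fst J \<in> Eq_objs C"
  shows "snd (snd I) \<in> Eq_objs C"
proof -
  note D = PO_coproductD[OF IJ]
  note i = PO_ArD[OF D(1)] and j = PO_ArD[OF D(2)]
  have "holds C (snd (snd I)) y x" if xy: "holds C (snd (snd I)) x y" for x y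
  proof -
    note d [simp] = holdsD[OF i(4) xy]
    note [simp] = i(5-7) j(5-7)
    let ?P = "\<lambda>z. holds C (snd (snd I)) (y \<cdot> z) (x \<cdot> z)"
    have "?P (Ident C (Dom C x))"
    proof (rule sum_induct[where P = ?P, OF D(4,5) i(4) _ xy])
      fix p q z assume pq: "is_coproduct C p q" and [simp]: "z \<in> Ar C" "Cod C z = Dom C x" "Dom C z = Cod C p" and h: "?P (z \<cdot> p)" "?P (z \<cdot> q)"
      note [simp] = coproductD[OF pq]
      show "?P z" by (rule holds_glue[OF i(4) pq]) (use h in simp_all)
    next
      fix z assume "z \<in> Ar C" "Cod C z = Dom C x" "is_initial C (Dom C z)"
      then show "?P z" by - (rule holds_initial[OF i(2)]; simp)
    next
      fix z a b assume ab: "holds C (fst I) a b" and e: "x \<cdot> z = und I \<cdot> a" "y \<cdot> z = und I \<cdot> b"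
      show "?P z" unfolding e by (rule i(8)) (use ab S(1) in \<open>simp add: Eq_iff\<close>)
    next
      fix z a b assume ab: "holds C (fst J) a b" and e: "x \<cdot> z = und J \<cdot> a" "y \<cdot> z = und J \<cdot> b"
      show "?P z" unfolding e D(3)[symmetric] by (rule j(8)) (use ab S(2) in \<open>simp add: Eq_iff\<close>)
    qed simp_all
    then show ?thesis by simp
  qed
  then show ?thesis using i(2) by (simp add: Eq_iff)
qed

lemma PO_antisym_coproduct:
  assumes IJ: "is_coproduct PO I J" and S: "fst I \<in> ParOrd_objs C" "fst J \<in> ParOrd_objs C"
  shows "snd (snd I) \<in> ParOrd_objs C"
proof -
  note D = PO_coproductD[OF IJ]
  note i = PO_ArD[OF D(1)] and j = PO_ArD[OF D(2)]
  note sc = sum_condD[OF D(5)]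
  have "x = y" if xy: "holds C (snd (snd I)) x y" and yx: "holds C (snd (snd I)) y x" for x y
  proof -
    note d [simp] = holdsD[OF i(4) xy]
    note [simp] = i(5-7) j(5-7)
    have h: "holds C (snd (snd I)) (y \<cdot> z) (x \<cdot> z)" if "z \<in> Ar C" "Cod C z = Dom C x" for z
      by (rule holds_comp[OF i(4) yx]) (use that in simp_all)
    have "x \<cdot> Ident C (Dom C x) = y \<cdot> Ident C (Dom C x)"
    proof (rule sum_induct[where P = "\<lambda>z. x \<cdot> z = y \<cdot> z", OF D(4,5) i(4) _ xy])
      fix p q z assume pq: "is_coproduct C p q" and [simp]: "z \<in> Ar C" "Cod C z = Dom C x" "Dom C z = Cod C p"
        and e: "x \<cdot> (z \<cdot> p) = y \<cdot> (z \<cdot> p)" "x \<cdot> (z \<cdot> q) = y \<cdot> (z \<cdot> q)"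
      note [simp] = coproductD[OF pq]
      show "x \<cdot> z = y \<cdot> z" by (rule coproduct_eqI[OF pq]) (use e in simp_all)
    next
      fix z assume z: "z \<in> Ar C" "Cod C z = Dom C x" "is_initial C (Dom C z)"
      show "x \<cdot> z = y \<cdot> z" by (rule initial_unique[OF z(3)]) (use z in simp_all)
    next
      fix z a b assume z: "z \<in> Ar C" "Cod C z = Dom C x" and a: "a \<in> Ar C" "b \<in> Ar C" "Cod C a = Dom C (und I)" "Cod C b = Dom C (und I)"
        and ab: "holds C (fst I) a b" and e: "x \<cdot> z = und I \<cdot> a" "y \<cdot> z = und I \<cdot> b"
      \<comment> \<open>The reverse relation on this part restricts into the summand, so
        antisymmetry of the summand applies.\<close>
      have "holds C (fst I) b a" by (rule sc(1)) (use h[OF z] a e in simp_all)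
      then have "a = b" using ab S(1) by (simp add: ParOrd_iff)
      then show "x \<cdot> z = y \<cdot> z" by (simp add: e)
    next
      fix z a b assume z: "z \<in> Ar C" "Cod C z = Dom C x" and a: "a \<in> Ar C" "b \<in> Ar C" "Cod C a = Dom C (und J)" "Cod C b = Dom C (und J)"
        and ab: "holds C (fst J) a b" and e: "x \<cdot> z = und J \<cdot> a" "y \<cdot> z = und J \<cdot> b"
      have "holds C (fst J) b a" by (rule sc(2)) (use h[OF z] a e in simp_all)
      then have "a = b" using ab S(2) by (simp add: ParOrd_iff)
      then show "x \<cdot> z = y \<cdot> z" by (simp add: e)
    qed simp_all
    then show ?thesis by simp
  qed
  then show ?thesis using i(2) by (simp add: ParOrd_iff)
qed

text \<open>The section sends a related pair to the larger preorder, where the property holds; the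
  retraction brings the conclusion back.\<close>

lemma PO_retract:
  assumes r: "R \<in> Ar PO" and s: "S \<in> Ar PO" and c: "Cod PO S = Dom PO R" and e: "Comp PO R S = Ident PO (Dom PO S)"
  shows "Dom PO R \<in> Eq_objs C \<Longrightarrow> Dom PO S \<in> Eq_objs C" "Dom PO R \<in> ParOrd_objs C \<Longrightarrow> Dom PO S \<in> ParOrd_objs C"
proof -
  note r' = PO_ArD[OF r] and s' = PO_ArD[OF s]
  have E: "snd (snd S) = fst R" "snd (snd R) = fst S" "und R \<cdot> und S = Ident C (base (fst S))" using c e by (simp_all add: PO_simps)
  have id: "und R \<cdot> (und S \<cdot> x) = x" if "x \<in> Ar C" "Cod C x = base (fst S)" for x
    using comp_tri[OF E(3), of x] that r'(5-7) s'(5-7) E by simp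
  show "Dom PO S \<in> Eq_objs C" if R: "Dom PO R \<in> Eq_objs C"
  proof -
    have "holds C (fst S) y x" if xy: "holds C (fst S) x y" for x y
    proof -
      have "holds C (fst R) (und S \<cdot> y) (und S \<cdot> x)" using s'(8)[OF xy] R E by (simp add: Eq_iff PO_simps)
      from r'(8)[OF this] show ?thesis using id holdsD[OF s'(3) xy] E by simp
    qed
    then show ?thesis using s'(1) by (simp add: Eq_iff PO_simps)
  qed
  show "Dom PO S \<in> ParOrd_objs C" if R: "Dom PO R \<in> ParOrd_objs C"
  proof -
    have "x = y" if xy: "holds C (fst S) x y" and yx: "holds C (fst S) y x" for x y
    proof -
      have e: "und S \<cdot> x = und S \<cdot> y" using s'(8)[OF xy] s'(8)[OF yx] R E by (simp add: ParOrd_iff PO_simps)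
      note d = holdsD[OF s'(3) xy]
      have "x = und R \<cdot> (und S \<cdot> x)" by (rule id[OF d(1,3), symmetric])
      also have "\<dots> = y" unfolding e by (rule id[OF d(2,4)])
      finally show ?thesis .
    qed
    then show ?thesis using s'(1) by (simp add: ParOrd_iff PO_simps)
  qed
qed

lemma PO_complemented:
  assumes "is_complemented PO A"
  shows "Cod PO A \<in> Eq_objs C \<Longrightarrow> Dom PO A \<in> Eq_objs C" "Cod PO A \<in> ParOrd_objs C \<Longrightarrow> Dom PO A \<in> ParOrd_objs C"
proof -
  obtain B where AB: "is_coproduct PO A B" using POx.complementedE[OF assms] .
  note D = PO_coproductD[OF AB]
  note a = PO_ArD[OF D(1)]
  show "Dom PO A \<in> Eq_objs C" if S: "Cod PO A \<in> Eq_objs C"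
  proof -
    have "holds C (fst A) y x" if xy: "holds C (fst A) x y" for x y
      by (rule sum_condD(1)[OF D(5)]) (use holdsD[OF a(3) xy] a(6) a(8)[OF xy] S in \<open>simp_all add: Eq_iff PO_simps\<close>)
    then show ?thesis using a(1) by (simp add: Eq_iff PO_simps)
  qed
  show "Dom PO A \<in> ParOrd_objs C" if S: "Cod PO A \<in> ParOrd_objs C"
  proof -
    have "x = y" if xy: "holds C (fst A) x y" and yx: "holds C (fst A) y x" for x y
    proof -
      have "und A \<cdot> x = und A \<cdot> y" using a(8)[OF xy] a(8)[OF yx] S by (simp add: ParOrd_iff PO_simps)
      then show ?thesis
        by - (rule monoD[OF injection_mono[OF D(4)]]; use holdsD[OF a(3) xy] a(6) in simp)
    qed
    then show ?thesis using a(1) by (simp add: ParOrd_iff PO_simps)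
  qed
qed

text \<open>All three conditions follow from the description of trivial arrows as those that
  identify related elements: this glues over sums, it is reflected by monomorphisms because they are
  monic underneath, and elements of an initial object have initial domains.\<close>

lemma PO_triv_cat: "triv_cat PO (Eq_objs C \<inter> ParOrd_objs C)"
proof
  fix I J F assume IJ: "is_coproduct PO I J" and F: "F \<in> Ar PO" "Dom PO F = Cod PO I"
    and t: "is_trivial PO (Eq_objs C \<inter> ParOrd_objs C) (Comp PO F I)" "is_trivial PO (Eq_objs C \<inter> ParOrd_objs C) (Comp PO F J)"
  note D = PO_coproductD[OF IJ]
  note i = PO_ArD[OF D(1)] and j = PO_ArD[OF D(2)] and f = PO_ArD[OF F(1)]
  have e: "fst F = snd (snd I)" using F(2) by (simp add: PO_simps)
  have 1: "Comp PO F I \<in> Ar PO" "Comp PO F J \<in> Ar PO"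
    using PO.comp_arr(1)[OF D(1) F(1)] PO.comp_arr(1)[OF D(2) F(1)] F(2) PO.coproductD(3)[OF IJ] by simp_all
  show "is_trivial PO (Eq_objs C \<inter> ParOrd_objs C) F"
    unfolding PO_trivial_iff[OF F(1)]
  proof (intro allI impI)
    fix x y assume "holds C (fst F) x y"
    then have xy: "holds C (snd (snd I)) x y" using e by simp
    show "und F \<cdot> x = und F \<cdot> y"
    proof (rule PO_holds_coproduct[OF IJ xy])
      show "und F \<cdot> (und I \<cdot> a) = und F \<cdot> (und I \<cdot> b)" if ab: "holds C (fst I) a b" for a b
      proof -
        have "(und F \<cdot> und I) \<cdot> a = (und F \<cdot> und I) \<cdot> b" using t(1) ab unfolding PO_trivial_iff[OF 1(1)] by (simp add: PO_simps)
        then show ?thesis using holdsD[OF i(3) ab] i(5-7) f(5-7) e by simp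
      qed
      show "und F \<cdot> (und J \<cdot> a) = und F \<cdot> (und J \<cdot> b)" if ab: "holds C (fst J) a b" for a b
      proof -
        have "(und F \<cdot> und J) \<cdot> a = (und F \<cdot> und J) \<cdot> b" using t(2) ab unfolding PO_trivial_iff[OF 1(2)] by (simp add: PO_simps)
        then show ?thesis using holdsD[OF j(3) ab] j(5-7) f(5-7) e D(3) by simp
      qed
    qed (use f(5,6) e in simp_all)
  qed
next
  fix M F assume M: "is_mono PO M" and F: "F \<in> Ar PO" "Cod PO F = Dom PO M"
    and t: "is_trivial PO (Eq_objs C \<inter> ParOrd_objs C) (Comp PO M F)"
  have MA: "M \<in> Ar PO" by (rule PO.mono_arr[OF M])
  note m = PO_ArD[OF MA] and f = PO_ArD[OF F(1)]
  have e: "snd (snd F) = fst M" using F(2) by (simp add: PO_simps)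
  have 1: "Comp PO M F \<in> Ar PO" using F MA by simp
  show "is_trivial PO (Eq_objs C \<inter> ParOrd_objs C) F"
    unfolding PO_trivial_iff[OF F(1)]
  proof (intro allI impI)
    fix x y assume xy: "holds C (fst F) x y"
    note d = holdsD[OF f(3) xy]
    have "(und M \<cdot> und F) \<cdot> x = (und M \<cdot> und F) \<cdot> y" using t xy unfolding PO_trivial_iff[OF 1] by (simp add: PO_simps)
    then show "und F \<cdot> x = und F \<cdot> y"
      by - (rule monoD[OF M[unfolded PO_mono_iff[OF MA]]]; use d e m(5-7) f(5-7) in simp)
  qed
next
  fix R assume "is_initial PO R"
  then have R: "is_preorder C R" "is_initial C (base R)" by (rule PO_initialD)+
  have e: "x = y" if h: "holds C R x y" for x y
  proof -
    note d = holdsD[OF preorderD(1)[OF R(1)] h]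
    show ?thesis by (rule initial_unique[OF strict_initial[OF R(2) d(1,3)]]) (use d in simp_all)
  qed
  show "R \<in> Eq_objs C \<inter> ParOrd_objs C" unfolding Int_iff Eq_iff ParOrd_iff using R(1) e by metis
qed

end

section \<open>The pretorsion theory of equivalence relations and partial orders\<close>

context category
begin

lemma coequalizerD:
  assumes "is_coequalizer C q f g"
  shows "f \<in> Ar C" "g \<in> Ar C" "Dom C g = Dom C f" "Cod C g = Cod C f" "q \<in> Ar C" "Dom C q = Cod C f" "q \<cdot> f = q \<cdot> g"
proof -
  have "f \<in> Ar C \<and> g \<in> hom C (Dom C f) (Cod C f) \<and> q \<in> hom C (Cod C f) (Cod C q) \<and> q \<cdot> f = q \<cdot> g"
    using assms unfolding is_coequalizer_def by (elim conjE) (intro conjI; assumption)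
  then show "f \<in> Ar C" "g \<in> Ar C" "Dom C g = Dom C f" "Cod C g = Cod C f" "q \<in> Ar C" "Dom C q = Cod C f" "q \<cdot> f = q \<cdot> g"
    by simp_all
qed

lemma coequalizer_ex1:
  assumes "is_coequalizer C q f g" "u \<in> Ar C" "Dom C u = Cod C f" "u \<cdot> f = u \<cdot> g"
  shows "\<exists>!w. w \<in> hom C (Cod C q) (Cod C u) \<and> w \<cdot> q = u"
proof -
  have A: "\<forall>Y. \<forall>u \<in> hom C (Cod C f) Y. u \<cdot> f = u \<cdot> g \<longrightarrow> (\<exists>!w. w \<in> hom C (Cod C q) Y \<and> w \<cdot> q = u)"
    using assms(1) unfolding is_coequalizer_def by (elim conjE) assumption
  have "u \<in> hom C (Cod C f) (Cod C u)" using assms(2,3) by simp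
  from A[rule_format, OF this assms(4)] show ?thesis .
qed

lemma coequalizerE:
  assumes "is_coequalizer C q f g" "u \<in> Ar C" "Dom C u = Cod C f" "u \<cdot> f = u \<cdot> g"
  obtains w where "w \<in> Ar C" "Dom C w = Cod C q" "Cod C w = Cod C u" "w \<cdot> q = u"
  using ex1_implies_ex[OF coequalizer_ex1[OF assms]] that by auto

lemma coequalizer_epi:
  assumes q: "is_coequalizer C q f g" and uv: "u \<in> Ar C" "v \<in> Ar C" "Dom C u = Cod C q" "Dom C v = Cod C q"
    "Cod C u = Cod C v" "u \<cdot> q = v \<cdot> q"
  shows "u = v"
proof -
  note [simp] = coequalizerD(1-6)[OF q] coequalizerD(7)[OF q]
  have "\<exists>!w. w \<in> hom C (Cod C q) (Cod C (v \<cdot> q)) \<and> w \<cdot> q = v \<cdot> q"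
    by (rule coequalizer_ex1[OF q]) (use uv(1-4) in simp_all)
  moreover have "u \<in> hom C (Cod C q) (Cod C (v \<cdot> q))" "v \<in> hom C (Cod C q) (Cod C (v \<cdot> q))"
    using uv(1-5) by simp_all
  ultimately show ?thesis using uv(6) by blast
qed

lemma regular_epi_arr: "is_regular_epi C q \<Longrightarrow> q \<in> Ar C"
  using coequalizerD(5) unfolding is_regular_epi_def by blast

lemma regular_epi_epi:
  assumes "is_regular_epi C q" "u \<in> Ar C" "v \<in> Ar C" "Dom C u = Cod C q" "Dom C v = Cod C q"
    "Cod C u = Cod C v" "u \<cdot> q = v \<cdot> q"
  shows "u = v"
proof -
  obtain f g where "is_coequalizer C q f g" using assms(1) unfolding is_regular_epi_def by blast
  from coequalizer_epi[OF this assms(2-)] show ?thesis .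
qed

text \<open>The factorisation of the restricted pair through \<open>S\<close> coequalises the arrows
  whose coequaliser is \<open>e\<close>, by joint monicity of the projections; hence it descends. A
  relation may thus be checked on a cover of the domain.\<close>

lemma holds_descend:
  assumes S: "is_relation C S" and e: "is_regular_epi C e" and x [simp]: "x \<in> Ar C" "Dom C x = Cod C e"
    and y [simp]: "y \<in> Ar C" "Dom C y = Cod C e" and b: "Cod C x = base S" "Cod C y = base S" and h: "holds C S (x \<cdot> e) (y \<cdot> e)"
  shows "holds C S x y"
proof -
  obtain f g where q: "is_coequalizer C e f g" using e unfolding is_regular_epi_def by blast
  note qD = coequalizerD[OF q]
  note [simp] = qD(1-6) relD[OF S] b
  obtain t where t [simp]: "t \<in> Ar C" "Cod C t = Dom C (pr1 S)" and te: "pr1 S \<cdot> t = x \<cdot> e" "pr2 S \<cdot> t = y \<cdot> e" using h by (rule holdsE)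
  have dt [simp]: "Dom C t = Cod C f" using comp_arr(2)[of t "pr1 S"] te by simp
  have "t \<cdot> f = t \<cdot> g"
    by (rule rel_eqI[OF S]) (simp_all add: comp_square[OF te(1)] comp_square[OF te(2)] qD(7))
  then obtain w where w [simp]: "w \<in> Ar C" "Dom C w = Cod C e" "Cod C w = Cod C t" and we: "w \<cdot> e = t"
    by - (rule coequalizerE[OF q, of t]; simp)
  have "pr1 S \<cdot> w = x" by (rule coequalizer_epi[OF q]) (simp_all add: we te)
  moreover have "pr2 S \<cdot> w = y" by (rule coequalizer_epi[OF q]) (simp_all add: we te)
  ultimately show ?thesis by (intro holdsI[of w]) simp_all
qed

end

section \<open>Images, the quotient by the symmetric part, and canonical sequences of
  preorders\<close>

locale pretopos_cat = lex_ext_cat C for C :: "('o, 'm) cat" (structure) +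
  assumes exact: "is_exact_category C"
begin

lemma regular: "is_regular_category C"
  using exact by (simp add: is_exact_category_def)

lemma kernel_pair_coequalizer:
  assumes "is_pullback C p q f f"
  obtains e where "is_coequalizer C e p q"
proof -
  have "\<forall>f p q. is_pullback C p q f f \<longrightarrow> (\<exists>e. is_coequalizer C e p q)"
    using regular unfolding is_regular_category_def by (elim conjE) assumption
  then show thesis using assms that by blast
qed

text \<open>Stability of regular epimorphisms under pullback, read as local lifting: an element of
  the codomain of \<open>e\<close> has a preimage after restriction along a regular epimorphism
  \<open>p\<close>.\<close>

lemma cover:
  assumes e: "is_regular_epi C e" and u: "u \<in> Ar C" "Cod C u = Cod C e"
  obtains p a where "is_regular_epi C p" "p \<in> Ar C" "Cod C p = Dom C u" "a \<in> Ar C" "Dom C a = Dom C p" "Cod C a = Dom C e" "e \<cdot> a = u \<cdot> p"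
proof -
  obtain p a where pa: "is_pullback C p a u e" by (rule pullback_ex[of u e]) (use u regular_epi_arr[OF e] in simp_all)
  have "\<forall>p q f e. is_pullback C p q f e \<and> is_regular_epi C e \<longrightarrow> is_regular_epi C p"
    using regular unfolding is_regular_category_def by (elim conjE) assumption
  then have "is_regular_epi C p" using pa e by blast
  with that[of p a] pullbackD[OF pa] show thesis by simp
qed

text \<open>The image of the pairing \<open>n\<close> of \<open>f\<close> and \<open>g\<close> in
  the product, as the coequaliser \<open>e\<close> of the kernel pair of \<open>n\<close>. That the
  induced arrow \<open>m\<close> is monic is the point where regularity is used.\<close>

lemma image_ex:
  assumes f: "f \<in> Ar C" "Cod C f = A" and g: "g \<in> Ar C" "Cod C g = A" "Dom C g = Dom C f"
  obtains S e where "is_relation C S" "base S = A" "is_regular_epi C e" "Dom C e = Dom C f" "Cod C e = Dom C (pr1 S)"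
    "pr1 S \<cdot> e = f" "pr2 S \<cdot> e = g"
proof -
  have A: "A \<in> Ob C" using f by auto
  obtain p q where p [simp]: "p \<in> Ar C" "q \<in> Ar C" "Dom C q = Dom C p" "Cod C p = A" "Cod C q = A"
    and pe: "\<And>u v. u \<in> Ar C \<Longrightarrow> v \<in> Ar C \<Longrightarrow> Dom C v = Dom C u \<Longrightarrow> Cod C u = A \<Longrightarrow> Cod C v = A \<Longrightarrow>
      \<exists>w \<in> Ar C. Dom C w = Dom C u \<and> Cod C w = Dom C p \<and> p \<cdot> w = u \<and> q \<cdot> w = v"
    and pu: "\<And>u v. u \<in> Ar C \<Longrightarrow> v \<in> Ar C \<Longrightarrow> Cod C u = Dom C p \<Longrightarrow> Cod C v = Dom C p \<Longrightarrow> Dom C u = Dom C v \<Longrightarrow>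
      p \<cdot> u = p \<cdot> v \<Longrightarrow> q \<cdot> u = q \<cdot> v \<Longrightarrow> u = v"
    using product_ex[OF A A] by blast
  obtain n where n [simp]: "n \<in> Ar C" "Dom C n = Dom C f" "Cod C n = Dom C p" and ne: "p \<cdot> n = f" "q \<cdot> n = g"
    using pe[of f g] f g by auto
  obtain r s where rs: "is_pullback C r s n n" by (rule pullback_ex[of n n]) simp_all
  note k = pullbackD[OF rs]
  note [simp] = k(3,4,6-8)
  obtain e where e: "is_coequalizer C e r s" using kernel_pair_coequalizer[OF rs] .
  note eD = coequalizerD[OF e]
  have re: "is_regular_epi C e" using e unfolding is_regular_epi_def by blast
  note [simp] = eD(5,6)
  obtain m where m [simp]: "m \<in> Ar C" "Dom C m = Cod C e" "Cod C m = Cod C n" and me: "m \<cdot> e = n"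
    by (rule coequalizerE[OF e, of n]) (use k(9) in simp_all)
  define S where "S = \<lparr>base = A, pr1 = p \<cdot> m, pr2 = q \<cdot> m\<rparr>"
  have S [simp]: "base S = A" "pr1 S = p \<cdot> m" "pr2 S = q \<cdot> m" by (simp_all add: S_def)
  have "is_relation C S"
  proof (rule relI)
    fix u v assume uv [simp]: "u \<in> Ar C" "v \<in> Ar C" "Cod C u = Dom C (pr1 S)" "Cod C v = Dom C (pr1 S)" "Dom C u = Dom C v"
      and eq: "pr1 S \<cdot> u = pr1 S \<cdot> v" "pr2 S \<cdot> u = pr2 S \<cdot> v"
    have mm: "m \<cdot> u = m \<cdot> v" by (rule pu) (use eq in simp_all)
    \<comment> \<open>Both \<open>u\<close> and \<open>v\<close> are lifted along \<open>e\<close>,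
      on two successive covers. The lifts have equal images under \<open>n\<close>, so they form an
      element of the kernel pair and are identified by \<open>e\<close>; the covers are then
      cancelled.\<close>
    obtain c a where c: "is_regular_epi C c" and ca [simp]: "c \<in> Ar C" "Cod C c = Dom C u" "a \<in> Ar C" "Dom C a = Dom C c" "Cod C a = Dom C e" and cae: "e \<cdot> a = u \<cdot> c"
      by (rule cover[OF re, of u]) simp_all
    obtain d b where d: "is_regular_epi C d" and db [simp]: "d \<in> Ar C" "Cod C d = Dom C (v \<cdot> c)" "b \<in> Ar C" "Dom C b = Dom C d" "Cod C b = Dom C e" and dbe: "e \<cdot> b = (v \<cdot> c) \<cdot> d"
      by (rule cover[OF re, of "v \<cdot> c"]) simp_all
    have "n \<cdot> (a \<cdot> d) = m \<cdot> (e \<cdot> (a \<cdot> d))" by (simp add: comp_tri[OF me])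
    also have "\<dots> = m \<cdot> (u \<cdot> (c \<cdot> d))" by (simp add: comp_square[OF cae])
    also have "\<dots> = m \<cdot> (v \<cdot> (c \<cdot> d))" by (rule comp_square[OF mm]) simp_all
    also have "\<dots> = m \<cdot> (e \<cdot> b)" by (simp add: dbe)
    also have "\<dots> = n \<cdot> b" by (simp add: comp_tri[OF me])
    finally obtain w where w [simp]: "w \<in> Ar C" "Dom C w = Dom C (a \<cdot> d)" "Cod C w = Dom C r" and we: "r \<cdot> w = a \<cdot> d" "s \<cdot> w = b"
      by - (rule pullbackE[OF rs, of "a \<cdot> d" b]; simp)
    have "e \<cdot> (r \<cdot> w) = e \<cdot> (s \<cdot> w)" by (rule comp_square[OF eD(7)]) simp_all
    then have "(u \<cdot> c) \<cdot> d = (v \<cdot> c) \<cdot> d" unfolding we dbe[symmetric] by (simp add: comp_square[OF cae])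
    then have "u \<cdot> c = v \<cdot> c" by - (rule regular_epi_epi[OF d]; simp)
    then show "u = v" by - (rule regular_epi_epi[OF c]; simp)
  qed (use A in simp_all)
  then show thesis by (rule that[of S e]) (simp_all add: re me ne)
qed

text \<open>An element of the image \<open>S\<close> of \<open>R\<close> lifts to \<open>R\<close> only after passing to a cover; the properties of \<open>S\<close> are
  checked on covers and descend.\<close>

lemma posetal_reflection:
  assumes R: "is_preorder C R"
  obtains E S q where "E \<in> Eq_objs C" "base E = base R" "\<And>x y. holds C E x y \<longleftrightarrow> holds C R x y \<and> holds C R y x"
    "S \<in> ParOrd_objs C" "is_regular_epi C q" "Dom C q = base R" "Cod C q = base S"
    "\<And>x y. holds C R x y \<Longrightarrow> holds C S (q \<cdot> x) (q \<cdot> y)"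
    "\<And>x y. x \<in> Ar C \<Longrightarrow> y \<in> Ar C \<Longrightarrow> Cod C x = base R \<Longrightarrow> Cod C y = base R \<Longrightarrow> Dom C y = Dom C x \<Longrightarrow>
      q \<cdot> x = q \<cdot> y \<Longrightarrow> holds C E x y"
    "\<And>f. f \<in> Ar C \<Longrightarrow> Dom C f = base R \<Longrightarrow> \<forall>x y. holds C E x y \<longrightarrow> f \<cdot> x = f \<cdot> y \<Longrightarrow>
      \<exists>w \<in> Ar C. Dom C w = base S \<and> Cod C w = Cod C f \<and> w \<cdot> q = f"
    "\<And>x y. holds C S x y \<Longrightarrow> \<exists>p a b. is_regular_epi C p \<and> p \<in> Ar C \<and> Cod C p = Dom C x \<and> holds C R a b \<and> x \<cdot> p = q \<cdot> a \<and> y \<cdot> p = q \<cdot> b"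
proof -
  note rel = preorderD(1)[OF R]
  note cv = rel_conv_relation[OF rel]
  note [simp] = relD[OF rel]
  obtain E where E: "is_relation C E" "base E = base R" "\<And>x y. holds C E x y \<longleftrightarrow> holds C R x y \<and> holds C (rel_conv R) x y"
    by (rule rel_inter[OF rel cv(1,3)]) (rule that, assumption+)
  have Eh: "holds C E x y \<longleftrightarrow> holds C R x y \<and> holds C R y x" for x y using E(3) cv(2) by blast
  note [simp] = relD[OF E(1)] E(2)
  have EP: "is_preorder C E" unfolding preorder_iff
  proof (intro conjI ballI impI allI)
    show "is_relation C E" by (rule E(1))
    show "holds C E x x" if "x \<in> Ar C" "Cod C x = base E" for x
      unfolding Eh using preorderD(2)[OF R, of x] that by simp
    show "holds C E x z" if "holds C E x y" "holds C E y z" for x y z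
      using that preorderD(3)[OF R] unfolding Eh by blast
  qed
  have EE: "E \<in> Eq_objs C" using EP Eh by (simp add: Eq_iff)
  have "\<forall>R \<in> Eq_objs C. \<exists>f. is_pullback C (pr1 R) (pr2 R) f f"
    using exact unfolding is_exact_category_def by (elim conjE) assumption
  \<comment> \<open>Exactness: the symmetric part \<open>E\<close> of the preorder is the kernel
    pair of some \<open>f\<close>, and hence has a coequaliser.\<close>
  then obtain f where f: "is_pullback C (pr1 E) (pr2 E) f f" using EE by blast
  note fD = pullbackD[OF f]
  obtain q where q: "is_coequalizer C q (pr1 E) (pr2 E)" using kernel_pair_coequalizer[OF f] .
  note qD = coequalizerD[OF q]
  have rq: "is_regular_epi C q" using q unfolding is_regular_epi_def by blast
  have qA [simp]: "q \<in> Ar C" "Dom C q = base R" using qD(5,6) by simp_all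
  have qE: "q \<cdot> x = q \<cdot> y" if h: "holds C E x y" for x y
  proof -
    obtain t where t: "t \<in> Ar C" "Cod C t = Dom C (pr1 E)" "pr1 E \<cdot> t = x" "pr2 E \<cdot> t = y" using h by (rule holdsE)
    show ?thesis unfolding t(3,4)[symmetric] by (rule comp_square[OF qD(7)]) (use t in simp_all)
  qed
  \<comment> \<open>\<open>E\<close> is also the kernel pair of its coequaliser \<open>q\<close>:
    since \<open>f\<close> factors through \<open>q\<close>, elements identified by \<open>q\<close>
    are identified by \<open>f\<close> and so related by \<open>E\<close>.\<close>
  have ker: "holds C E x y" if xy: "x \<in> Ar C" "y \<in> Ar C" "Cod C x = base R" "Cod C y = base R" "Dom C y = Dom C x" "q \<cdot> x = q \<cdot> y" for x y
  proof -
    obtain w where w: "w \<in> Ar C" "Dom C w = Cod C q" "Cod C w = Cod C f" "w \<cdot> q = f"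
      by (rule coequalizerE[OF q, of f]) (use fD in simp_all)
    have "f \<cdot> x = w \<cdot> (q \<cdot> x)" using xy w(1-3) comp_tri[OF w(4), of x] by simp
    also have "\<dots> = w \<cdot> (q \<cdot> y)" by (simp only: xy(6))
    also have "\<dots> = f \<cdot> y" using xy w(1-3) comp_tri[OF w(4), of y] by simp
    finally obtain z where "z \<in> Ar C" "Cod C z = Dom C (pr1 E)" "pr1 E \<cdot> z = x" "pr2 E \<cdot> z = y"
      by - (rule pullbackE[OF f, of x y]; use xy fD in simp)
    then show ?thesis by (rule holdsI)
  qed
  have desc: "\<exists>w \<in> Ar C. Dom C w = Cod C q \<and> Cod C w = Cod C f \<and> w \<cdot> q = f"
    if fR: "f \<in> Ar C" "Dom C f = base R" "\<forall>x y. holds C E x y \<longrightarrow> f \<cdot> x = f \<cdot> y" for f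
  proof -
    have "f \<cdot> pr1 E = f \<cdot> pr2 E" using fR(3) holds_pr[OF E(1)] by blast
    then obtain w where "w \<in> Ar C" "Dom C w = Cod C q" "Cod C w = Cod C f" "w \<cdot> q = f"
      by - (rule coequalizerE[OF q, of f]; use fR in simp)
    then show ?thesis by blast
  qed
  obtain S e where S: "is_relation C S" "base S = Cod C q" and e: "is_regular_epi C e" "Dom C e = Dom C (q \<cdot> pr1 R)" "Cod C e = Dom C (pr1 S)"
    and Se: "pr1 S \<cdot> e = q \<cdot> pr1 R" "pr2 S \<cdot> e = q \<cdot> pr2 R"
    by (rule image_ex[of "q \<cdot> pr1 R" "Cod C q" "q \<cdot> pr2 R"]) simp_all
  note [simp] = relD[OF S(1)] S(2) regular_epi_arr[OF e(1)] e(3)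
  have de [simp]: "Dom C e = Dom C (pr1 R)" using e(2) by simp
  have RS: "holds C S (q \<cdot> x) (q \<cdot> y)" if h: "holds C R x y" for x y
  proof -
    have "holds C S (q \<cdot> pr1 R) (q \<cdot> pr2 R)" by (rule holdsI[of e]) (simp_all add: Se)
    from holds_imp[OF rel h S(1) _ _ this] show ?thesis by simp
  qed
  have SR: "\<exists>p a b. is_regular_epi C p \<and> p \<in> Ar C \<and> Cod C p = Dom C x \<and> holds C R a b \<and> x \<cdot> p = q \<cdot> a \<and> y \<cdot> p = q \<cdot> b"
    if h: "holds C S x y" for x y
  proof -
    obtain t where t: "t \<in> Ar C" "Cod C t = Dom C (pr1 S)" "pr1 S \<cdot> t = x" "pr2 S \<cdot> t = y" using h by (rule holdsE)
    obtain p a where p: "is_regular_epi C p" "p \<in> Ar C" "Cod C p = Dom C t" "a \<in> Ar C" "Dom C a = Dom C p" "Cod C a = Dom C e" "e \<cdot> a = t \<cdot> p"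
      by (rule cover[OF e(1), of t]) (use t in simp_all)
    have dx: "Dom C x = Dom C t" unfolding t(3)[symmetric] using t(1,2) by simp
    have "x \<cdot> p = pr1 S \<cdot> (e \<cdot> a)" "y \<cdot> p = pr2 S \<cdot> (e \<cdot> a)"
      unfolding p(7) t(3,4)[symmetric] using t(1,2) p(2,3) by simp_all
    then have "x \<cdot> p = q \<cdot> (pr1 R \<cdot> a)" "y \<cdot> p = q \<cdot> (pr2 R \<cdot> a)"
      using p(4,6) by (simp_all add: comp_square[OF Se(1)] comp_square[OF Se(2)])
    moreover have "holds C R (pr1 R \<cdot> a) (pr2 R \<cdot> a)" by (rule holdsI[of a]) (use p in simp_all)
    ultimately show ?thesis using p(1-3) dx by metis
  qed
  have SP: "is_preorder C S" unfolding preorder_iff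
  proof (intro conjI ballI impI allI)
    show "is_relation C S" by (rule S(1))
    fix x assume x: "x \<in> Ar C" "Cod C x = base S"
    obtain p a where p: "is_regular_epi C p" "p \<in> Ar C" "Cod C p = Dom C x" "a \<in> Ar C" "Dom C a = Dom C p" "Cod C a = Dom C q" "q \<cdot> a = x \<cdot> p"
      by (rule cover[OF rq, of x]) (use x in simp_all)
    have "holds C S (q \<cdot> a) (q \<cdot> a)" by (rule RS, rule preorderD(2)[OF R]) (use p in simp_all)
    then have "holds C S (x \<cdot> p) (x \<cdot> p)" by (simp only: p(7))
    then show "holds C S x x" by - (rule holds_descend[OF S(1) p(1)]; use x p in simp)
  next
    fix x y z assume xy: "holds C S x y" and yz: "holds C S y z"
    note d = holdsD[OF S(1) xy] and d' = holdsD[OF S(1) yz]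
    obtain p a b where p: "is_regular_epi C p" "p \<in> Ar C" "Cod C p = Dom C x" "holds C R a b" "x \<cdot> p = q \<cdot> a" "y \<cdot> p = q \<cdot> b"
      using SR[OF xy] by blast
    note ab = holdsD[OF rel p(4)]
    have pa: "Dom C p = Dom C a" using comp_arr(2)[of p x] comp_arr(2)[of a q] p(2,3,5) d ab by simp
    have "holds C S (y \<cdot> p) (z \<cdot> p)" by (rule holds_comp[OF S(1) yz p(2)]) (use p(3) d in simp)
    then obtain r a' b' where r: "is_regular_epi C r" "r \<in> Ar C" "Cod C r = Dom C (y \<cdot> p)" "holds C R a' b'" "(y \<cdot> p) \<cdot> r = q \<cdot> a'" "(z \<cdot> p) \<cdot> r = q \<cdot> b'"
      using SR by blast
    note ab' = holdsD[OF rel r(4)]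
    have rc: "Cod C r = Dom C p" using r(3) p(2,3) d by simp
    have rd: "Dom C r = Dom C a'" using comp_arr(2)[of r "y \<cdot> p"] comp_arr(2)[of a' q] r(2,3,5) p(2,3) d ab' by simp
    \<comment> \<open>The two lifts of the middle element \<open>y\<close> need not be equal, only
      their images under \<open>q\<close> are. By \<open>ker\<close> they are related by
      \<open>E\<close>, hence by \<open>R\<close>, and this closes the chain upstairs.\<close>
    have "q \<cdot> (b \<cdot> r) = q \<cdot> a'" unfolding r(5)[symmetric] p(6) using ab r(2) rc pa by simp
    then have "holds C E (b \<cdot> r) a'" by - (rule ker; use ab ab' r(2) rc pa rd in simp)
    then have "holds C R (b \<cdot> r) a'" using Eh by blast
    moreover have "holds C R (a \<cdot> r) (b \<cdot> r)" by (rule holds_comp[OF rel p(4) r(2)]) (use rc pa in simp)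
    ultimately have "holds C R (a \<cdot> r) b'" using preorderD(3)[OF R] r(4) by blast
    then have "holds C S (q \<cdot> (a \<cdot> r)) (q \<cdot> b')" by (rule RS)
    moreover have "q \<cdot> (a \<cdot> r) = (x \<cdot> p) \<cdot> r" unfolding p(5) using ab r(2) rc pa by simp
    ultimately have "holds C S ((x \<cdot> p) \<cdot> r) ((z \<cdot> p) \<cdot> r)" by (simp only: r(6))
    then have "holds C S (x \<cdot> p) (z \<cdot> p)" by - (rule holds_descend[OF S(1) r(1)]; use d d' p(2,3) rc in simp)
    then show "holds C S x z" by - (rule holds_descend[OF S(1) p(1)]; use d d' p(2,3) in simp)
  qed
  have SA: "x = y" if xy: "holds C S x y" and yx: "holds C S y x" for x y
  proof -
    note d = holdsD[OF S(1) xy]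
    obtain p a b where p: "is_regular_epi C p" "p \<in> Ar C" "Cod C p = Dom C x" "holds C R a b" "x \<cdot> p = q \<cdot> a" "y \<cdot> p = q \<cdot> b"
      using SR[OF xy] by blast
    note ab = holdsD[OF rel p(4)]
    have pa: "Dom C p = Dom C a" using comp_arr(2)[of p x] comp_arr(2)[of a q] p(2,3,5) d ab by simp
    have "holds C S (y \<cdot> p) (x \<cdot> p)" by (rule holds_comp[OF S(1) yx p(2)]) (use p(3) d in simp)
    then obtain r c c' where r: "is_regular_epi C r" "r \<in> Ar C" "Cod C r = Dom C (y \<cdot> p)" "holds C R c c'" "(y \<cdot> p) \<cdot> r = q \<cdot> c" "(x \<cdot> p) \<cdot> r = q \<cdot> c'"
      using SR by blast
    note cc = holdsD[OF rel r(4)]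
    have rc: "Cod C r = Dom C p" using r(3) p(2,3) d by simp
    have rd: "Dom C r = Dom C c" using comp_arr(2)[of r "y \<cdot> p"] comp_arr(2)[of c q] r(2,3,5) p(2,3) d cc by simp
    \<comment> \<open>Again the lifts match only up to \<open>E\<close>, at both ends. This suffices
      to reverse the relation upstairs, so that \<open>a \<cdot> r\<close> and
      \<open>b \<cdot> r\<close> are related both ways and identified by \<open>q\<close>.\<close>
    have q1: "q \<cdot> (b \<cdot> r) = q \<cdot> c" unfolding r(5)[symmetric] p(6) using ab r(2) rc pa by simp
    have q2: "q \<cdot> c' = q \<cdot> (a \<cdot> r)" unfolding r(6)[symmetric] p(5) using ab r(2) rc pa by simp
    have "holds C E (b \<cdot> r) c" by (rule ker[OF _ _ _ _ _ q1]) (use ab cc r(2) rc pa rd in simp_all)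
    moreover have "holds C E c' (a \<cdot> r)" by (rule ker[OF _ _ _ _ _ q2]) (use ab cc r(2) rc pa rd in simp_all)
    ultimately have "holds C R (b \<cdot> r) (a \<cdot> r)" using Eh preorderD(3)[OF R] r(4) by blast
    moreover have "holds C R (a \<cdot> r) (b \<cdot> r)" by (rule holds_comp[OF rel p(4) r(2)]) (use rc pa in simp)
    ultimately have "q \<cdot> (a \<cdot> r) = q \<cdot> (b \<cdot> r)" using Eh qE by blast
    then have "(x \<cdot> p) \<cdot> r = (y \<cdot> p) \<cdot> r" unfolding p(5,6) using ab r(2) rc pa by simp
    then have "x \<cdot> p = y \<cdot> p" by - (rule regular_epi_epi[OF r(1)]; use d p(2,3) rc in simp)
    then show "x = y" by - (rule regular_epi_epi[OF p(1)]; use d p(2,3) in simp)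
  qed
  have SO: "S \<in> ParOrd_objs C" unfolding ParOrd_iff using SP SA by blast
  show thesis
    by (rule that[OF EE E(2) Eh SO rq qA(2) S(2)[symmetric] RS ker _ SR]) (use desc in \<open>simp_all only: S(2)\<close>)
qed

text \<open>The kernel property rests on \<open>E\<close> being the kernel pair of \<open>q\<close>:
  an arrow that becomes trivial after \<open>q\<close> sends related elements to pairs of
  \<open>E\<close>. The cokernel property rests on \<open>q\<close> being the coequaliser of
  \<open>E\<close>, along which an arrow that is trivial on \<open>E\<close> descends.\<close>

lemma PO_canonical_ex:
  assumes R: "is_preorder C R"
  shows "\<exists>K P. canonical_seq PO (Eq_objs C) (ParOrd_objs C) R K P"
proof -
  note rel = preorderD(1)[OF R]
  obtain E S q where E: "E \<in> Eq_objs C" "base E = base R" and Eh: "\<And>x y. holds C E x y \<longleftrightarrow> holds C R x y \<and> holds C R y x"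
    and S: "S \<in> ParOrd_objs C" and rq: "is_regular_epi C q" and qD: "Dom C q = base R" "Cod C q = base S"
    and RS: "\<And>x y. holds C R x y \<Longrightarrow> holds C S (q \<cdot> x) (q \<cdot> y)"
    and ker: "\<And>x y. x \<in> Ar C \<Longrightarrow> y \<in> Ar C \<Longrightarrow> Cod C x = base R \<Longrightarrow> Cod C y = base R \<Longrightarrow> Dom C y = Dom C x \<Longrightarrow>
      q \<cdot> x = q \<cdot> y \<Longrightarrow> holds C E x y"
    and desc: "\<And>f. f \<in> Ar C \<Longrightarrow> Dom C f = base R \<Longrightarrow> \<forall>x y. holds C E x y \<longrightarrow> f \<cdot> x = f \<cdot> y \<Longrightarrow>
      \<exists>w \<in> Ar C. Dom C w = base S \<and> Cod C w = Cod C f \<and> w \<cdot> q = f"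
    and SR: "\<And>x y. holds C S x y \<Longrightarrow> \<exists>p a b. is_regular_epi C p \<and> p \<in> Ar C \<and> Cod C p = Dom C x \<and> holds C R a b \<and> x \<cdot> p = q \<cdot> a \<and> y \<cdot> p = q \<cdot> b"
    by (rule posetal_reflection[OF R]) (rule that, assumption+)
  have EP: "is_preorder C E" and SP: "is_preorder C S" using E S by (simp_all add: Eq_iff ParOrd_iff)
  note Erel = preorderD(1)[OF EP] and Srel = preorderD(1)[OF SP]
  have SA: "holds C S x y \<Longrightarrow> holds C S y x \<Longrightarrow> x = y" for x y using S by (simp add: ParOrd_iff)
  note qA [simp] = regular_epi_arr[OF rq]
  have bo: "base R \<in> Ob C" by (rule base_Ob[OF R])
  let ?K = "(E, Ident C (base R), R)" and ?P = "(R, q, S)"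
  have K: "?K \<in> Ar PO"
  proof (rule PO_ArI[OF EP R])
    fix x y assume h: "holds C E x y"
    then have "holds C R x y" using Eh by blast
    with holdsD[OF rel this] show "holds C R (Ident C (base R) \<cdot> x) (Ident C (base R) \<cdot> y)" by simp
  qed (use bo E in simp_all)
  have P: "?P \<in> Ar PO" by (rule PO_ArI[OF R SP qA qD RS])
  have PK: "Comp PO ?P ?K = (E, q, S)" using qD by (simp add: PO_simps)
  have qE: "q \<cdot> x = q \<cdot> y" if "holds C E x y" for x y using RS SA Eh that by blast
  have cK: "Cod PO ?K = Dom PO ?P" by (simp add: PO_simps)
  have PKA: "(E, q, S) \<in> Ar PO" using PO.comp_arr(1)[OF K P cK] unfolding PK .
  have t: "is_trivial PO (Eq_objs C \<inter> ParOrd_objs C) (Comp PO ?P ?K)"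
    unfolding PK PO_trivial_iff[OF PKA] using qE by simp
  have "is_Z_kernel PO (Eq_objs C \<inter> ParOrd_objs C) ?K ?P"
  proof (rule PO.Z_kernelI[OF P _ cK t])
    show "is_mono PO ?K" unfolding PO_mono_iff[OF K] using iso_mono[OF iso_ident[OF bo]] by simp
    fix U assume U: "U \<in> Ar PO" "Cod PO U = Dom PO ?P" "is_trivial PO (Eq_objs C \<inter> ParOrd_objs C) (Comp PO ?P U)"
    note u = PO_ArD[OF U(1)]
    have uR: "snd (snd U) = R" using U(2) by (simp add: PO_simps)
    have PU: "Comp PO ?P U \<in> Ar PO" by (rule PO.comp_arr(1)[OF U(1) P U(2)])
    have W: "(fst U, und U, E) \<in> Ar PO"
    proof (rule PO_ArI[OF u(1) EP])
      fix x y assume h: "holds C (fst U) x y"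
      note d = holdsD[OF u(3) h]
      have "(q \<cdot> und U) \<cdot> x = (q \<cdot> und U) \<cdot> y" using U(3) h unfolding PO_trivial_iff[OF PU] by (simp add: PO_simps)
      then show "holds C E (und U \<cdot> x) (und U \<cdot> y)"
        by - (rule ker; use d u(5-7) uR qD in simp)
    qed (use u(5-7) uR E in simp_all)
    show "\<exists>W \<in> Ar PO. Dom PO W = Dom PO U \<and> Cod PO W = Dom PO ?K \<and> Comp PO ?K W = U"
      using u(5-7) uR by (intro bexI[OF _ W]) (auto simp: PO_simps intro!: PO_eqI)
  qed
  moreover have "is_Z_cokernel PO (Eq_objs C \<inter> ParOrd_objs C) ?P ?K"
  proof (rule PO.Z_cokernelI[OF K P _ t])
    show "Dom PO ?P = Cod PO ?K" by (simp add: PO_simps)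
    fix U assume U: "U \<in> Ar PO" "Dom PO U = Cod PO ?K" "is_trivial PO (Eq_objs C \<inter> ParOrd_objs C) (Comp PO U ?K)"
    note u = PO_ArD[OF U(1)]
    have uR: "fst U = R" using U(2) by (simp add: PO_simps)
    have UK: "Comp PO U ?K \<in> Ar PO" by (rule PO.comp_arr(1)[OF K U(1)]) (use U(2) in simp)
    have UKe: "fst (Comp PO U ?K) = E" "und (Comp PO U ?K) = und U" using u(5-7) uR by (simp_all add: PO_simps)
    have uE: "\<forall>x y. holds C E x y \<longrightarrow> und U \<cdot> x = und U \<cdot> y"
      using U(3) unfolding PO_trivial_iff[OF UK] UKe by blast
    obtain w where w: "w \<in> Ar C" "Dom C w = base S" "Cod C w = Cod C (und U)" "w \<cdot> q = und U"
      using desc[OF u(5) _ uE] u(6) uR by auto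
    have W: "(S, w, snd (snd U)) \<in> Ar PO"
    proof (rule PO_ArI[OF SP u(2)])
      fix x y assume h: "holds C S x y"
      note d = holdsD[OF Srel h]
      \<comment> \<open>Monotonicity of the descended arrow: a related pair of the quotient lifts to
        \<open>R\<close> on a cover, \<open>U\<close> is monotone there, and the conclusion descends
        from the cover.\<close>
      obtain p a b where p: "is_regular_epi C p" "p \<in> Ar C" "Cod C p = Dom C x" "holds C R a b" "x \<cdot> p = q \<cdot> a" "y \<cdot> p = q \<cdot> b"
        using SR[OF h] by blast
      note ab = holdsD[OF rel p(4)]
      have "holds C (snd (snd U)) (und U \<cdot> a) (und U \<cdot> b)" using u(8) p(4) uR by simp
      moreover have "und U \<cdot> a = w \<cdot> (x \<cdot> p)" "und U \<cdot> b = w \<cdot> (y \<cdot> p)"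
        unfolding p(5,6) using ab w(1-3) qD by (simp_all add: comp_tri[OF w(4)])
      ultimately have "holds C (snd (snd U)) ((w \<cdot> x) \<cdot> p) ((w \<cdot> y) \<cdot> p)" using d w(1-3) p(2,3) by simp
      then show "holds C (snd (snd U)) (w \<cdot> x) (w \<cdot> y)"
        by - (rule holds_descend[OF u(4) p(1)]; use d w(1-3) p(2,3) u(7) in simp)
    qed (use w u(7) in simp_all)
    show "\<exists>W \<in> Ar PO. Dom PO W = Cod PO ?P \<and> Cod PO W = Cod PO U \<and> Comp PO W ?P = U"
      using w(4) uR by (intro bexI[OF _ W]) (auto simp: PO_simps intro!: PO_eqI)
  next
    fix U V assume UV: "U \<in> Ar PO" "V \<in> Ar PO" "Dom PO U = Cod PO ?P" "Dom PO V = Cod PO ?P" "Cod PO U = Cod PO V" "Comp PO U ?P = Comp PO V ?P"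
    have "und U = und V"
      by (rule regular_epi_epi[OF rq]) (use UV(3-6) PO_ArD(5-7)[OF UV(1)] PO_ArD(5-7)[OF UV(2)] qD in \<open>simp_all add: PO_simps\<close>)
    then show "U = V" using UV(3-5) by (intro PO_eqI) (simp_all add: PO_simps)
  qed
  ultimately have "canonical_seq PO (Eq_objs C) (ParOrd_objs C) R ?K ?P"
    using E(1) S by (simp add: canonical_seq_def short_Z_exact_def PO_simps)
  then show ?thesis by blast
qed

text \<open>The codomain of an isomorphism is a retract of its domain.\<close>

lemma PO_full_replete: "full_replete PO (Eq_objs C)" "full_replete PO (ParOrd_objs C)"
proof -
  have "(Dom PO F \<in> Eq_objs C \<longrightarrow> Cod PO F \<in> Eq_objs C) \<and> (Dom PO F \<in> ParOrd_objs C \<longrightarrow> Cod PO F \<in> ParOrd_objs C)"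
    if F: "is_iso PO F" for F
  proof -
    obtain G where G: "F \<in> Ar PO" "G \<in> Ar PO" "Dom PO G = Cod PO F" "Cod PO G = Dom PO F" "Comp PO F G = Ident PO (Cod PO F)"
      by (rule PO.isoE[OF F])
    show ?thesis using PO_retract[OF G(1,2,4)] G(3,5) by simp
  qed
  moreover have "Eq_objs C \<subseteq> Ob PO" "ParOrd_objs C \<subseteq> Ob PO" by (auto simp: Eq_iff ParOrd_iff PO_simps)
  ultimately show "full_replete PO (Eq_objs C)" "full_replete PO (ParOrd_objs C)"
    unfolding full_replete_def by blast+
qed

lemma PO_pretorsion: "pretorsion_theory PO (Eq_objs C) (ParOrd_objs C)"
  unfolding pretorsion_theory_def
proof (intro conjI ballI)
  show "category PO" by (rule PO_category)
  show "full_replete PO (Eq_objs C)" "full_replete PO (ParOrd_objs C)" by (rule PO_full_replete)+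
  show "\<exists>k c. canonical_seq PO (Eq_objs C) (ParOrd_objs C) A k c" if "A \<in> Ob PO" for A
    using PO_canonical_ex that by (simp add: PO_simps)
  fix T F f assume T: "T \<in> Eq_objs C" and F: "F \<in> ParOrd_objs C" and f: "f \<in> hom PO T F"
  then have fA: "f \<in> Ar PO" and e: "fst f = T" "snd (snd f) = F" by (simp_all add: PO_simps)
  note fD = PO_ArD[OF fA]
  have "und f \<cdot> x = und f \<cdot> y" if xy: "holds C (fst f) x y" for x y
  proof -
    have yx: "holds C (fst f) y x" using T xy e by (simp add: Eq_iff)
    show ?thesis using F fD(8)[OF xy] fD(8)[OF yx] e by (simp add: ParOrd_iff)
  qed
  then show "is_trivial PO (Eq_objs C \<inter> ParOrd_objs C) f" unfolding PO_trivial_iff[OF fA] by blast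
qed

sublocale P: pretor_cat PO "Eq_objs C" "ParOrd_objs C"
proof -
  interpret T: triv_cat PO "Eq_objs C \<inter> ParOrd_objs C" by (rule PO_triv_cat)
  show "pretor_cat PO (Eq_objs C) (ParOrd_objs C)"
  proof
    show "pretorsion_theory PO (Eq_objs C) (ParOrd_objs C)" by (rule PO_pretorsion)
    fix i j assume "is_coproduct PO i j"
    then show "Dom PO i \<in> Eq_objs C \<Longrightarrow> Dom PO j \<in> Eq_objs C \<Longrightarrow> Cod PO i \<in> Eq_objs C"
      "Dom PO i \<in> ParOrd_objs C \<Longrightarrow> Dom PO j \<in> ParOrd_objs C \<Longrightarrow> Cod PO i \<in> ParOrd_objs C"
      using PO_sym_coproduct PO_antisym_coproduct by (simp_all add: PO_simps)
  next
    fix a assume a: "is_complemented PO a"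
    show "Cod PO a \<in> Eq_objs C \<Longrightarrow> Dom PO a \<in> Eq_objs C" "Cod PO a \<in> ParOrd_objs C \<Longrightarrow> Dom PO a \<in> ParOrd_objs C"
      using PO_complemented[OF a] by blast+
  next
    fix r s assume "r \<in> Ar PO" "s \<in> Ar PO" "Cod PO s = Dom PO r" "Comp PO r s = Ident PO (Dom PO s)"
    note ret = PO_retract[OF this]
    show "Dom PO r \<in> Eq_objs C \<Longrightarrow> Dom PO s \<in> Eq_objs C" "Dom PO r \<in> ParOrd_objs C \<Longrightarrow> Dom PO s \<in> ParOrd_objs C"
      using ret by blast+
  qed
qed

end

lemma pretopos_cat:
  assumes "pretopos C"
  shows "pretopos_cat C"
proof -
  have e: "is_exact_category C" and x: "is_extensive C" using assms by (simp_all add: pretopos_def)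
  have r: "category C" "has_finite_limits C"
    using e by (simp_all only: is_exact_category_def is_regular_category_def)
  interpret category C by (rule r)
  note T = conjunct1[OF r(2)[unfolded has_finite_limits_def]] and p = conjunct2[OF r(2)[unfolded has_finite_limits_def]]
  show ?thesis by unfold_locales (use e x T p in blast)+
qed

section \<open>The universal property of the abstract stable category\<close>

context pretor_cat
begin

definition emb_functor :: "('o, 'm, 'o, ('m \<times> 'm) set set) funct" where
  "emb_functor = \<lparr>omap = (\<lambda>A. A), amap = (\<lambda>f. emb f)\<rparr>"

lemma emb_functor: "is_functor C St emb_functor"
  unfolding is_functor_def emb_functor_def
  using St_category category_axioms emb_comp by (simp add: St_Ident)

lemma emb_coproducts: "preserves_finite_coproducts C St emb_functor"
  unfolding preserves_finite_coproducts_def emb_functor_def using emb_initial emb_coproduct by simp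

lemma emb_torsion: "torsion_theory_functor C \<T> \<F> St \<T> \<F> emb_functor"
  unfolding torsion_theory_functor_def
  using emb_functor emb_canonical by (auto simp: St_zero_objects emb_functor_def canonical_seq_def)

lemma stable_universal:
  fixes X :: "('x, 'y) cat"
  assumes "torsion_theory X \<T>' \<F>'" "preserves_finite_coproducts C X G" "torsion_theory_functor C \<T> \<F> X \<T>' \<F>' G"
  shows "\<exists>H. is_functor St X H \<and> functor_eq C (funct_comp H emb_functor) G \<and>
    (\<forall>H'. is_functor St X H' \<and> functor_eq C (funct_comp H' emb_functor) G \<longrightarrow> functor_eq St H' H) \<and>
    preserves_finite_coproducts St X H \<and> torsion_theory_functor St \<T> \<F> X \<T>' \<F>' H"
proof -
  interpret U: torsion_functor C \<T> \<F> X \<T>' \<F>' G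
    by unfold_locales (rule assms)+
  show ?thesis
  proof (intro exI[of _ U.induced_functor] conjI allI impI)
    show "is_functor St X U.induced_functor" by (rule U.induced_functor)
    show "functor_eq C (funct_comp U.induced_functor emb_functor) G"
      unfolding functor_eq_def funct_comp_def using U.induced_emb by (simp add: emb_functor_def U.induced_functor_def)
    show "preserves_finite_coproducts St X U.induced_functor" by (rule U.induced_coproducts)
    show "torsion_theory_functor St \<T> \<F> X \<T>' \<F>' U.induced_functor" by (rule U.induced_torsion)
    fix H' assume "is_functor St X H' \<and> functor_eq C (funct_comp H' emb_functor) G"
    then have H: "is_functor St X H'" "functor_eq C (funct_comp H' emb_functor) G" by simp_all
    then have e: "amap H' (emb f) = amap G f" if "f \<in> Ar C" for f
      using that by (simp add: functor_eq_def funct_comp_def emb_functor_def)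
    have o: "omap H' A = omap G A" if "A \<in> Ob C" for A
      using H(2) that by (simp add: functor_eq_def funct_comp_def emb_functor_def)
    show "functor_eq St H' U.induced_functor"
      unfolding functor_eq_def using U.induced_unique[OF H(1) e o] o by (simp add: U.induced_functor_def)
  qed
qed

end

section \<open>Specialisation to internal preorders in a pretopos\<close>

lemma Stab_eq: "Stab C = stable_cat (PreOrd C) (Eq_objs C \<inter> ParOrd_objs C)"
  by (simp add: Stab_def stable_cat_def PaPreOrd_def stab_cong_def stable_cong_def)

lemma stab_class_eq: "stab_class C a f = stable_class (PreOrd C) (Eq_objs C \<inter> ParOrd_objs C) a f"
  by (simp add: stab_class_def stable_class_def PaPreOrd_def stab_cong_def stable_cong_def)

theorem theorem2p3:
  fixes C :: "('o, 'm) cat"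
  assumes "pretopos C"
  shows
    "pretorsion_theory (PreOrd C) (Eq_objs C) (ParOrd_objs C) \<and>
     torsion_theory (Stab C) (Eq_objs C) (ParOrd_objs C) \<and>
     has_finite_coproducts (Stab C) \<and>
     preserves_finite_coproducts (PreOrd C) (Stab C) (stab_functor C) \<and>
     torsion_theory_functor (PreOrd C) (Eq_objs C) (ParOrd_objs C)
       (Stab C) (Eq_objs C) (ParOrd_objs C) (stab_functor C) \<and>
     (\<forall>(X :: ('x, 'y) cat) \<T> \<F> G.
        category X \<and> pointed X \<and> has_finite_coproducts X \<and> torsion_theory X \<T> \<F> \<and>
        preserves_finite_coproducts (PreOrd C) X G \<and>
        torsion_theory_functor (PreOrd C) (Eq_objs C) (ParOrd_objs C) X \<T> \<F> G \<longrightarrow>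
        (\<exists>H. is_functor (Stab C) X H \<and>
             functor_eq (PreOrd C) (funct_comp H (stab_functor C)) G \<and>
             (\<forall>H'. is_functor (Stab C) X H' \<and>
                   functor_eq (PreOrd C) (funct_comp H' (stab_functor C)) G \<longrightarrow>
                   functor_eq (Stab C) H' H) \<and>
             preserves_finite_coproducts (Stab C) X H \<and>
             torsion_theory_functor (Stab C) (Eq_objs C) (ParOrd_objs C) X \<T> \<F> H))"
proof -
  interpret pretopos_cat C by (rule pretopos_cat[OF assms])
  have F: "stab_functor C = P.emb_functor"
    unfolding stab_functor_def P.emb_functor_def stab_class_eq ..
  show ?thesis unfolding Stab_eq F
    by (intro conjI allI impI PO_pretorsion P.St_torsion P.St_coproducts P.emb_coproducts P.emb_torsion, elim conjE)
      (rule P.stable_universal)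
qed

end
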